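(* Let $K(u,v)$ be $h/p$ homogeneous and either $0$-degenerate or $m$-degenerate (see context). Let $\boldsymbol\tau\in C([0,T];H^1(\mathbb T^1;\mathbb R^3))$ be a mild solution of $$\boldsymbol\tau_t=\boldsymbol\tau_{xx}+\mathbf F_{\gamma_{\boldsymbol\tau}}+\lambda_{\boldsymbol\tau}+\mu_{\boldsymbol\tau}\boldsymbol\tau,\qquad\boldsymbol\tau(0)=\boldsymbol\tau_0\in H^1(\mathbb T^1),\tag{$*$}$$ where $\boldsymbol\tau(t)$ has mean zero and unit speed. Suppose that each $\gamma_{\boldsymbol\tau(t)}$ is a bi-Lipschitz embedding and that $$A_*:=\max_{[0,T]}\|A_{\boldsymbol\tau(t)}^{-1}\|_{\mathrm{op}},\qquad\delta_*:=\max_{[0,T]}\delta_\infty(\gamma_{\boldsymbol\tau(t)}),\qquad H_*:=\max_{[0,T]}\|\boldsymbol\tau(t)\|_{H^1(\mathbb T^1)}$$ are finite. Then $\boldsymbol\tau\in C^1((0,T];H^1(\mathbb T^1))\cap C((0,T];H^3(\mathbb T^1))$, and for each $0<t\le T$ the differential equation $( * )$ holds in the classical sense. Moreover, for any $\epsilon>0$ the a-priori bounds $$\|\boldsymbol\tau(t)\|_{H^3(\mathbb T^1)}\le C(\epsilon,A_*,\delta_*,H_* ),\qquad\sup_{k\in\mathbb Z}|k|^4|\hat{\boldsymbol\tau}_k(t)|\le C(\epsilon,A_*,\delta_*,H_* )$$ hold for all $t\in[\epsilon,T]$.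
   Context: $\mathbb T^1$ is $[-\pi,\pi]$ with endpoints identified; $\vartheta(z)=\min\{|z|,2\pi-|z|\}$ on $[-\pi,\pi]$, extended $2\pi$-periodically. $\hat\gamma_k=\frac1{2\pi}\int_{\mathbb T^1}\gamma e^{-ikx}dx$, $\|\gamma\|_{L^2}^2=\sum_k|\hat\gamma_k|^2$, $\|\gamma\|_{\dot H^s}^2=\sum_k|k|^{2s}|\hat\gamma_k|^2$, $\|\gamma\|_{H^s}^2=|\hat\gamma_0|^2+\|\gamma\|_{\dot H^s}^2$. Unit speed: $|\boldsymbol\tau|\equiv1$ (for curves $|\gamma'|\equiv1$). The curve induced by a mean zero $\boldsymbol\tau$ is $\gamma_{\boldsymbol\tau}(x)=\frac1{2\pi}\int_{\mathbb T^1}(z-\pi)\boldsymbol\tau(z)dz+\int_{-\pi}^x\boldsymbol\tau(z)dz$. A unit speed $\gamma$ is a bi-Lipschitz embedding if its distortion $\delta_\infty(\gamma)=\sup_{\vartheta(x-y)>0}\vartheta(x-y)/|\gamma(x)-\gamma(y)|$ is finite. $K$ is $h/p$ homogeneous if there are $h\in C^1([1,\infty))$ and $p\ge0$ with $K(v/\alpha,v)=h(\alpha)v^{-p}$ for all $v>0$, $\alpha\ge1$. Put $g(\alpha)=-\alpha^2h'(\alpha)$. $0$-degenerate: $g\in C^1([1,\infty))$ and $p<\frac12$. $m$-degenerate: for some non-negative integer $m>4p-2$, $g\in C^{m+1}([1,\infty))$ and $g(1)=g'(1)=\dots=g^{(m)}(1)=0$. $f_\gamma(x)=\mathrm{p.v.}\int_{\mathbb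 T^1}K_u(|\gamma(x)-\gamma(y)|^2,\vartheta^2(x-y))(\gamma(x)-\gamma(y))\,dy$ ($K_u$ = derivative in the first argument; p.v. = $L^2$ limit as $\epsilon\downarrow 0$ of integrals over $\{\vartheta(x-y)\ge\epsilon\}$) and $\mathbf F_\gamma(x)=\frac1{2\pi}\int_{\mathbb T^1}(z-\pi)f_\gamma(z)dz+\int_{-\pi}^xf_\gamma(z)dz$. Lagrange multipliers: $$A_{\boldsymbol\tau}\lambda_{\boldsymbol\tau}=\frac1{2\pi}\int_{\mathbb T^1}\frac{\langle\mathbf F_{\gamma_{\boldsymbol\tau}},\boldsymbol\tau\rangle-|\boldsymbol\tau_x|^2}{|\boldsymbol\tau|^2}\boldsymbol\tau\,dx,\quad A_{\boldsymbol\tau}=\mathrm{Id}-\frac1{2\pi}\int_{\mathbb T^1}\frac{\boldsymbol\tau\otimes\boldsymbol\tau}{|\boldsymbol\tau|^2}dx,\quad\mu_{\boldsymbol\tau}=\frac{|\boldsymbol\tau_x|^2-\langle\mathbf F_{\gamma_{\boldsymbol\tau}}+\lambda_{\boldsymbol\tau},\boldsymbol\tau\rangle}{|\boldsymbol\tau|^2}.$$ $\boldsymbol\tau\in C([0,T];H^1)$ is a mild solution if $\boldsymbol\tau(t)=S(t)[\boldsymbol\tau_0]+\int_0^tS(t-s)[\mathbf F_{\gamma_{\boldsymbol\tau}}+\lambda_{\boldsymbol\tau}+\mu_{\boldsymbol\tau}\boldsymbol\tau](s)\,ds$ for all $t\in[0,T]$, with $S(t)$ the heat semigroup on $\mathbb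 T^1$. Constants $C(\cdot)$ may also depend on the kernel $K$. *)

theory Defs
  imports "HOL-Analysis.Analysis"
begin

(* Functions on the circle [-pi,pi] (endpoints identified) are 2 pi periodic functions on the
   real line.  Integrals over the circle are Lebesgue integrals over {-pi..pi}. *)

definition vartheta :: "real \<Rightarrow> real" where
  "vartheta z = (let w = z - 2 * pi * of_int \<lfloor>(z + pi) / (2 * pi)\<rfloor>
                 in min \<bar>w\<bar> (2 * pi - \<bar>w\<bar>))"

definition fourier :: "(real \<Rightarrow> real^3) \<Rightarrow> int \<Rightarrow> complex^3" where
  "fourier f k =
     (\<chi> j. (1 / (2 * pi)) *\<^sub>R (LBINT x:{-pi..pi}. complex_of_real (f x $ j) * cis (- (of_int k * x))))"

definition L2_circle :: "(real \<Rightarrow> real^3) \<Rightarrow> bool" where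
  "L2_circle f \<longleftrightarrow> (\<forall>x. f (x + 2 * pi) = f x) \<and>
     set_borel_measurable lborel {-pi..pi} f \<and>
     set_integrable lborel {-pi..pi} (\<lambda>x. (norm (f x))\<^sup>2)"

definition L2_norm :: "(real \<Rightarrow> real^3) \<Rightarrow> real" where
  "L2_norm f = sqrt (\<Sum>\<^sub>\<infinity>k. (norm (fourier f k))\<^sup>2)"

definition Hdot_norm :: "real \<Rightarrow> (real \<Rightarrow> real^3) \<Rightarrow> real" where
  "Hdot_norm s f = sqrt (\<Sum>\<^sub>\<infinity>k. real_of_int \<bar>k\<bar> powr (2 * s) * (norm (fourier f k))\<^sup>2)"

definition H_norm :: "real \<Rightarrow> (real \<Rightarrow> real^3) \<Rightarrow> real" where
  "H_norm s f = sqrt ((norm (fourier f 0))\<^sup>2 + (Hdot_norm s f)\<^sup>2)"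

(* Used for s \<ge> 1 only, where every class has a unique continuous representative:
   an element of H^s is identified with that representative. *)
definition H_space :: "real \<Rightarrow> (real \<Rightarrow> real^3) set" where
  "H_space s = {f. continuous_on UNIV f \<and> L2_circle f \<and>
     (\<lambda>k. real_of_int \<bar>k\<bar> powr (2 * s) * (norm (fourier f k))\<^sup>2) summable_on UNIV}"

definition C_into_H :: "real \<Rightarrow> real set \<Rightarrow> (real \<Rightarrow> real \<Rightarrow> real^3) \<Rightarrow> bool" where
  "C_into_H s I \<tau> \<longleftrightarrow> (\<forall>t\<in>I. \<tau> t \<in> H_space s \<and>
     ((\<lambda>r. H_norm s (\<lambda>x. \<tau> r x - \<tau> t x)) \<longlongrightarrow> 0) (at t within I))"

definition C1_into_H :: "real \<Rightarrow> real set \<Rightarrow> (real \<Rightarrow> real \<Rightarrow> real^3) \<Rightarrow> bool" where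
  "C1_into_H s I \<tau> \<longleftrightarrow> C_into_H s I \<tau> \<and>
     (\<exists>\<tau>'. C_into_H s I \<tau>' \<and>
       (\<forall>t\<in>I. ((\<lambda>r. H_norm s (\<lambda>x. (1 / (r - t)) *\<^sub>R (\<tau> r x - \<tau> t x) - \<tau>' t x)) \<longlongrightarrow> 0)
                (at t within I)))"

(* Derivative in L^2 of a periodic distribution, determined up to null sets. *)
definition weak_deriv :: "(real \<Rightarrow> real^3) \<Rightarrow> real \<Rightarrow> real^3" where
  "weak_deriv f = (SOME g. L2_circle g \<and> (\<forall>k. fourier g k = (\<i> * of_int k) *s fourier f k))"

definition mean_zero :: "(real \<Rightarrow> real^3) \<Rightarrow> bool" where
  "mean_zero f \<longleftrightarrow> (LBINT x:{-pi..pi}. f x) = 0"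

definition unit_speed :: "(real \<Rightarrow> real^3) \<Rightarrow> bool" where
  "unit_speed \<tau> \<longleftrightarrow> (\<forall>x. norm (\<tau> x) = 1)"

(* The mean zero primitive of a mean zero function; it gives both the curve induced by a tangent
   field and the nonlocal forcing. *)
definition primitive :: "(real \<Rightarrow> real^3) \<Rightarrow> real \<Rightarrow> real^3" where
  "primitive f x = (1 / (2 * pi)) *\<^sub>R (LBINT z:{-pi..pi}. (z - pi) *\<^sub>R f z) + (LBINT z=-pi..x. f z)"

abbreviation curve :: "(real \<Rightarrow> real^3) \<Rightarrow> real \<Rightarrow> real^3" where
  "curve \<tau> \<equiv> primitive \<tau>"

(* Division in ereal: the quotient is \<infinity> when the two curve points coincide. *)
definition distortion :: "(real \<Rightarrow> real^3) \<Rightarrow> ereal" where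
  "distortion \<gamma> = (SUP (x, y)\<in>{(x, y). vartheta (x - y) > 0}.
     ereal (vartheta (x - y)) / ereal (norm (\<gamma> x - \<gamma> y)))"

definition bilipschitz_embedding :: "(real \<Rightarrow> real^3) \<Rightarrow> bool" where
  "bilipschitz_embedding \<gamma> \<longleftrightarrow> distortion \<gamma> < \<infinity>"

definition deriv_on :: "real set \<Rightarrow> (real \<Rightarrow> real) \<Rightarrow> real \<Rightarrow> real" where
  "deriv_on S f x = vector_derivative f (at x within S)"

definition Ck_on :: "nat \<Rightarrow> real set \<Rightarrow> (real \<Rightarrow> real) \<Rightarrow> bool" where
  "Ck_on n S f \<longleftrightarrow>
     (\<forall>i<n. \<forall>x\<in>S. ((deriv_on S ^^ i) f) differentiable (at x within S)) \<and>
     continuous_on S ((deriv_on S ^^ n) f)"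

definition homogeneous :: "(real \<Rightarrow> real \<Rightarrow> real) \<Rightarrow> (real \<Rightarrow> real) \<Rightarrow> real \<Rightarrow> bool" where
  "homogeneous K h p \<longleftrightarrow> Ck_on 1 {1..} h \<and> p \<ge> 0 \<and>
     (\<forall>v>0. \<forall>\<alpha>\<ge>1. K (v / \<alpha>) v = h \<alpha> * v powr (- p))"

definition g_of :: "(real \<Rightarrow> real) \<Rightarrow> real \<Rightarrow> real" where
  "g_of h \<alpha> = - (\<alpha>\<^sup>2 * deriv_on {1..} h \<alpha>)"

definition zero_degenerate :: "(real \<Rightarrow> real) \<Rightarrow> real \<Rightarrow> bool" where
  "zero_degenerate h p \<longleftrightarrow> Ck_on 1 {1..} (g_of h) \<and> p < 1 / 2"

definition m_degenerate :: "nat \<Rightarrow> (real \<Rightarrow> real) \<Rightarrow> real \<Rightarrow> bool" where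
  "m_degenerate m h p \<longleftrightarrow> real m > 4 * p - 2 \<and> Ck_on (m + 1) {1..} (g_of h) \<and>
     (\<forall>i\<le>m. (deriv_on {1..} ^^ i) (g_of h) 1 = 0)"

(* Homogeneity prescribes K (u, v) for 0 < u \<le> v only, hence the left derivative at u = v. *)
definition K_u :: "(real \<Rightarrow> real \<Rightarrow> real) \<Rightarrow> real \<Rightarrow> real \<Rightarrow> real" where
  "K_u K u v = deriv_on {0<..v} (\<lambda>w. K w v) u"

definition force_trunc ::
  "(real \<Rightarrow> real \<Rightarrow> real) \<Rightarrow> (real \<Rightarrow> real^3) \<Rightarrow> real \<Rightarrow> real \<Rightarrow> real^3" where
  "force_trunc K \<gamma> \<epsilon> x = (LBINT y:{y\<in>{-pi..pi}. vartheta (x - y) \<ge> \<epsilon>}.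
     K_u K ((norm (\<gamma> x - \<gamma> y))\<^sup>2) ((vartheta (x - y))\<^sup>2) *\<^sub>R (\<gamma> x - \<gamma> y))"

(* Principal value: a limit in L^2, determined up to null sets. *)
definition force ::
  "(real \<Rightarrow> real \<Rightarrow> real) \<Rightarrow> (real \<Rightarrow> real^3) \<Rightarrow> real \<Rightarrow> real^3" where
  "force K \<gamma> = (SOME f. L2_circle f \<and>
     (\<forall>\<^sub>F \<epsilon> in at_right 0. L2_circle (force_trunc K \<gamma> \<epsilon>)) \<and>
     ((\<lambda>\<epsilon>. L2_norm (\<lambda>x. force_trunc K \<gamma> \<epsilon> x - f x)) \<longlongrightarrow> 0) (at_right 0))"

definition bigF ::
  "(real \<Rightarrow> real \<Rightarrow> real) \<Rightarrow> (real \<Rightarrow> real^3) \<Rightarrow> real \<Rightarrow> real^3" where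
  "bigF K \<gamma> = primitive (force K \<gamma>)"

definition A_mat :: "(real \<Rightarrow> real^3) \<Rightarrow> real^3^3" where
  "A_mat \<tau> = mat 1 -
     (\<chi> i j. (1 / (2 * pi)) * (LBINT x:{-pi..pi}. (\<tau> x $ i * \<tau> x $ j) / (norm (\<tau> x))\<^sup>2))"

definition inv_opnorm :: "real^3^3 \<Rightarrow> ereal" where
  "inv_opnorm A = (if invertible A then ereal (onorm ((*v) (matrix_inv A))) else \<infinity>)"

(* In the multipliers the argument d is the derivative of the tangent field: a representative of the
   weak derivative in the mild formulation, the pointwise derivative in the classical one. *)
definition lambda_mult ::
  "(real \<Rightarrow> real \<Rightarrow> real) \<Rightarrow> (real \<Rightarrow> real^3) \<Rightarrow> (real \<Rightarrow> real^3) \<Rightarrow> real^3" where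
  "lambda_mult K \<tau> d = matrix_inv (A_mat \<tau>) *v
     ((1 / (2 * pi)) *\<^sub>R (LBINT x:{-pi..pi}.
        ((bigF K (curve \<tau>) x \<bullet> \<tau> x - (norm (d x))\<^sup>2) / (norm (\<tau> x))\<^sup>2) *\<^sub>R \<tau> x))"

definition mu_mult ::
  "(real \<Rightarrow> real \<Rightarrow> real) \<Rightarrow> (real \<Rightarrow> real^3) \<Rightarrow> (real \<Rightarrow> real^3) \<Rightarrow> real \<Rightarrow> real" where
  "mu_mult K \<tau> d x =
     ((norm (d x))\<^sup>2 - (bigF K (curve \<tau>) x + lambda_mult K \<tau> d) \<bullet> \<tau> x) / (norm (\<tau> x))\<^sup>2"

definition nonlinearity ::
  "(real \<Rightarrow> real \<Rightarrow> real) \<Rightarrow> (real \<Rightarrow> real^3) \<Rightarrow> (real \<Rightarrow> real^3) \<Rightarrow> real \<Rightarrow> real^3" where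
  "nonlinearity K \<tau> d x = bigF K (curve \<tau>) x + lambda_mult K \<tau> d + mu_mult K \<tau> d x *\<^sub>R \<tau> x"

definition heat :: "real \<Rightarrow> (real \<Rightarrow> real^3) \<Rightarrow> real \<Rightarrow> real^3" where
  "heat t f x = (if t = 0 then f x else
     (\<chi> j. Re (\<Sum>\<^sub>\<infinity>k::int. exp (- (of_int k)\<^sup>2 * t) *\<^sub>R (fourier f k $ j * cis (of_int k * x)))))"

(* The Duhamel integral takes values in H^1, where point evaluation is continuous; it is therefore
   written pointwise in x. *)
definition mild_solution ::
  "(real \<Rightarrow> real \<Rightarrow> real) \<Rightarrow> real \<Rightarrow> (real \<Rightarrow> real^3) \<Rightarrow> (real \<Rightarrow> real \<Rightarrow> real^3) \<Rightarrow> bool" where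
  "mild_solution K T \<tau>\<^sub>0 \<tau> \<longleftrightarrow> \<tau>\<^sub>0 \<in> H_space 1 \<and> \<tau> 0 = \<tau>\<^sub>0 \<and> C_into_H 1 {0..T} \<tau> \<and>
     (\<forall>t\<in>{0..T}. \<forall>x.
        set_integrable lborel {0..t} (\<lambda>s. heat (t - s) (nonlinearity K (\<tau> s) (weak_deriv (\<tau> s))) x) \<and>
        \<tau> t x = heat t \<tau>\<^sub>0 x
          + (LBINT s:{0..t}. heat (t - s) (nonlinearity K (\<tau> s) (weak_deriv (\<tau> s))) x))"

definition classical_at ::
  "(real \<Rightarrow> real \<Rightarrow> real) \<Rightarrow> real \<Rightarrow> (real \<Rightarrow> real \<Rightarrow> real^3) \<Rightarrow> real \<Rightarrow> bool" where
  "classical_at K T \<tau> t \<longleftrightarrow> (\<exists>\<tau>\<^sub>x \<tau>\<^sub>x\<^sub>x. continuous_on UNIV \<tau>\<^sub>x\<^sub>x \<and> (\<forall>x.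
     (\<tau> t has_vector_derivative \<tau>\<^sub>x x) (at x) \<and>
     (\<tau>\<^sub>x has_vector_derivative \<tau>\<^sub>x\<^sub>x x) (at x) \<and>
     ((\<lambda>s. \<tau> s x) has_vector_derivative \<tau>\<^sub>x\<^sub>x x + nonlinearity K (\<tau> t) \<tau>\<^sub>x x) (at t within {0<..T})))"

definition A_star :: "real \<Rightarrow> (real \<Rightarrow> real \<Rightarrow> real^3) \<Rightarrow> ereal" where
  "A_star T \<tau> = (SUP t\<in>{0..T}. inv_opnorm (A_mat (\<tau> t)))"

definition delta_star :: "real \<Rightarrow> (real \<Rightarrow> real \<Rightarrow> real^3) \<Rightarrow> ereal" where
  "delta_star T \<tau> = (SUP t\<in>{0..T}. distortion (curve (\<tau> t)))"

definition H_star :: "real \<Rightarrow> (real \<Rightarrow> real \<Rightarrow> real^3) \<Rightarrow> ereal" where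
  "H_star T \<tau> = (SUP t\<in>{0..T}. ereal (H_norm 1 (\<tau> t)))"

end

theory Submission
  imports Defs "HOL-Library.Nat_Bijection"
begin

text \<open>The proof is a bootstrap for Fourier coefficients.  Let \<open>y\<^sub>k(t)\<close> be a coefficient of the tangent
  field and \<open>n\<^sub>k(t)\<close> the corresponding coefficient of the nonlinearity \<open>F + \<lambda> + \<mu> \<tau>\<close>.  The heat semigroup
  is diagonal, so a mild solution satisfies \<open>y\<^sub>k' = - k\<^sup>2 y\<^sub>k + n\<^sub>k\<close> for each \<open>k\<close> (\<open>Duhamel\<close>,
  \<open>y_has_derivative\<close>), and a bound \<open>\<bar>n\<^sub>k\<bar> \<le> C \<bar>k\<bar> powr -\<sigma>\<close> on a time interval gives
  \<open>\<bar>y\<^sub>k\<bar> \<le> C' \<bar>k\<bar> powr -(\<sigma> + 2)\<close> as soon as a short time has passed (\<open>parabolic_gain\<close>).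

  The force is tame in this picture.  By homogeneity \<open>K\<^sub>u\<close> equals \<open>g(\<alpha>) \<bar>z\<bar> powr (-2p-2)\<close> at two points at
  distance \<open>\<bar>z\<bar>\<close> along the curve, where \<open>\<alpha> \<ge> 1\<close> is the squared ratio of \<open>\<bar>z\<bar>\<close> and the chord.  The
  constant part \<open>g(1)\<close>, present only if \<open>p < 1/2\<close>, acts on the curve as a Fourier multiplier of size
  \<open>O(k\<^sup>2)\<close>, and thus contributes a bounded multiplier of \<open>\<tau>\<close> to \<open>F\<close>.  For the rest, \<open>\<alpha> - 1\<close> is
  \<open>O(\<bar>z\<bar>)\<close> for unit speed curves with tangents in \<open>H\<^sup>1\<close>, because such tangents are Hoelder continuous
  of order \<open>1/2\<close>; the kernel is then \<open>O(\<bar>z\<bar> powr (m - 2p))\<close>, which is integrable because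
  \<open>m > 2p - 1\<close> follows from \<open>m > 4p - 2\<close> and \<open>m \<ge> 0\<close>.  So the principal value exists
  (\<open>force_fourier\<close>).  If \<open>\<tau>\<close> is even Lipschitz, this remainder is Lipschitz too (\<open>NL_Lipschitz\<close>), and
  \<open>F\<close> has coefficients \<open>O(\<bar>k\<bar> powr -2)\<close> as long as those of \<open>\<tau>\<close> decay that fast.

  For unit tangents the nonlinearity is \<open>F + \<lambda> - (\<langle>F + \<lambda>, \<tau>\<rangle> - \<bar>\<tau>\<^sub>x\<bar>\<^sup>2) \<tau>\<close>.  Its worst term is quadratic
  in \<open>\<tau>\<^sub>x\<close>: in \<open>H\<^sup>1\<close> it is merely integrable, so at first \<open>n\<^sub>k\<close> is just bounded, which gives
  \<open>y\<^sub>k = O(\<bar>k\<bar> powr -2)\<close>.  From then on products are estimated by convolving decaying sequences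
  (\<open>convolution_weights\<close>, \<open>decay_step\<close>), and the exponents of \<open>y\<^sub>k\<close> improve to \<open>-5/2\<close>, where \<open>\<tau>\<close> becomes
  Lipschitz, then to \<open>-7/2\<close> and to \<open>-4\<close> (\<open>bootstrap\<close>).  All constants are functions of the kernel, the
  waiting time and the three quantities \<open>A\<close>, \<open>\<delta>\<close>, \<open>H\<close>, which is the a-priori bound.

  Regularity follows from the decay.  The coefficients \<open>n\<^sub>k\<close> are continuous in time because the nonlinearity is
  continuous in \<open>H\<^sup>1\<close> coefficient by coefficient (\<open>nonlinearity_coeff_tendsto\<close>).  Hence each \<open>y\<^sub>k\<close> is
  continuously differentiable, and the summable bounds \<open>O(\<bar>k\<bar> powr -4)\<close> for \<open>y\<^sub>k\<close> and \<open>O(\<bar>k\<bar> powr -2)\<close> for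
  \<open>y\<^sub>k'\<close> and \<open>n\<^sub>k\<close> allow limits to be taken inside the Fourier series, in \<open>H\<^sup>3\<close>, in \<open>H\<^sup>1\<close> and
  pointwise.\<close>

section \<open>The circle as a measure space\<close>

text \<open>All integrals over the circle are Lebesgue integrals, so the short names are kept for their rules.\<close>

hide_fact (open)
  Henstock_Kurzweil_Integration.integrable_add
  Henstock_Kurzweil_Integration.integrable_bound
  Henstock_Kurzweil_Integration.integrable_cong
  Henstock_Kurzweil_Integration.integrable_diff
  Henstock_Kurzweil_Integration.integrable_sum
  Henstock_Kurzweil_Integration.integral_add
  Henstock_Kurzweil_Integration.integral_cnj
  Henstock_Kurzweil_Integration.integral_cong
  Henstock_Kurzweil_Integration.integral_diff
  Henstock_Kurzweil_Integration.integral_nonneg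
  Henstock_Kurzweil_Integration.integral_sum

definition circ :: "real measure" where
  "circ = restrict_space lborel {-pi..pi}"

lemma space_circ [simp]: "space circ = {-pi..pi}"
  by (simp add: circ_def space_restrict_space)

lemma measurable_circI [measurable (raw)]:
  "f \<in> borel_measurable borel \<Longrightarrow> f \<in> borel_measurable circ"
  unfolding circ_def by (intro measurable_restrict_space1) simp

lemma measurable_circ_ident: "(\<lambda>x. x) \<in> measurable circ borel"
  by (rule measurable_circI) simp

lemma set_integral_circ:
  fixes f :: "real \<Rightarrow> 'b::{banach, second_countable_topology}"
  shows "(LBINT x:{-pi..pi}. f x) = integral\<^sup>L circ f"
  unfolding circ_def set_lebesgue_integral_def by (subst integral_restrict_space) auto

lemma set_integrable_circ:
  fixes f :: "real \<Rightarrow> 'b::{banach, second_countable_topology}"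
  shows "set_integrable lborel {-pi..pi} f \<longleftrightarrow> integrable circ f"
  unfolding circ_def set_integrable_def by (subst integrable_restrict_space) auto

lemma set_measurable_circ:
  fixes f :: "real \<Rightarrow> 'b::real_normed_vector"
  shows "set_borel_measurable lborel {-pi..pi} f \<longleftrightarrow> f \<in> borel_measurable circ"
  unfolding circ_def set_borel_measurable_def
  by (subst borel_measurable_restrict_space_iff) (auto simp: borel_measurable_scaleR)

lemma AE_circ: "(AE x in circ. P x) \<longleftrightarrow> (AE x in lborel. x \<in> {-pi..pi} \<longrightarrow> P x)"
  unfolding circ_def by (rule AE_restrict_space_iff) simp

lemma emeasure_circ: "emeasure circ {-pi..pi} = ennreal (2 * pi)"
  unfolding circ_def by (subst emeasure_restrict_space) auto

interpretation circ: finite_measure circ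
  by (rule finite_measureI) (simp add: emeasure_circ)

lemma measure_circ: "measure circ {-pi..pi} = 2 * pi"
  using emeasure_circ by (simp add: measure_def)

lemma integrable_circ_bounded:
  fixes f :: "real \<Rightarrow> 'b::{banach, second_countable_topology}"
  assumes "f \<in> borel_measurable circ" "\<And>x. x \<in> {-pi..pi} \<Longrightarrow> norm (f x) \<le> B"
  shows "integrable circ f"
  using assms by (intro circ.integrable_const_bound[of _ B]) auto

lemma integrable_circ_continuous:
  fixes f :: "real \<Rightarrow> 'b::{banach, second_countable_topology}"
  assumes "continuous_on {-pi..pi} f"
  shows "integrable circ f"
  using borel_integrable_compact[of "{-pi..pi}" f] assms
  by (simp add: set_integrable_circ[symmetric] set_integrable_def indicator_scaleR_eq_if cong: if_cong)

text \<open>Integrability of the product is part of the Cauchy--Schwarz inequality here: a function that is not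
  integrable has integral \<open>0\<close>, so the inequality alone would be empty for it.\<close>

lemma integral_Cauchy_Schwarz:
  fixes f g :: "'a \<Rightarrow> real"
  assumes [measurable]: "f \<in> borel_measurable M" "g \<in> borel_measurable M"
    and f: "integrable M (\<lambda>x. (f x)\<^sup>2)" and g: "integrable M (\<lambda>x. (g x)\<^sup>2)"
  shows "integrable M (\<lambda>x. f x * g x)"
    and "(\<integral>x. \<bar>f x * g x\<bar> \<partial>M) \<le> sqrt (\<integral>x. (f x)\<^sup>2 \<partial>M) * sqrt (\<integral>x. (g x)\<^sup>2 \<partial>M)"
proof -
  have "\<bar>f x * g x\<bar> \<le> (f x)\<^sup>2 + (g x)\<^sup>2" for x
  proof -
    have "2 * (\<bar>f x\<bar> * \<bar>g x\<bar>) \<le> (f x)\<^sup>2 + (g x)\<^sup>2"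
      using sum_squares_bound[of "\<bar>f x\<bar>" "\<bar>g x\<bar>"] by (simp add: mult.assoc)
    then show ?thesis
      by (simp add: abs_mult) (smt (verit) zero_le_power2 mult_nonneg_nonneg abs_ge_zero)
  qed
  then show int: "integrable M (\<lambda>x. f x * g x)"
    by (intro integrable_bound[OF integrable_add[OF f g]]) auto
  let ?I = "\<integral>x. \<bar>f x * g x\<bar> \<partial>M"
  have "(\<integral>\<^sup>+x. ennreal \<bar>f x\<bar> * ennreal \<bar>g x\<bar> \<partial>M)\<^sup>2
      \<le> (\<integral>\<^sup>+x. (ennreal \<bar>f x\<bar>)\<^sup>2 \<partial>M) * (\<integral>\<^sup>+x. (ennreal \<bar>g x\<bar>)\<^sup>2 \<partial>M)"
    by (intro Cauchy_Schwarz_nn_integral) auto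
  also have "(\<integral>\<^sup>+x. ennreal \<bar>f x\<bar> * ennreal \<bar>g x\<bar> \<partial>M) = ennreal ?I"
    by (subst nn_integral_eq_integral[symmetric])
       (use integrable_abs[OF int] in \<open>auto simp: ennreal_mult'[symmetric] abs_mult\<close>)
  also have "(\<integral>\<^sup>+x. (ennreal \<bar>f x\<bar>)\<^sup>2 \<partial>M) = ennreal (\<integral>x. (f x)\<^sup>2 \<partial>M)"
    by (subst nn_integral_eq_integral[symmetric]) (use f in \<open>auto simp: ennreal_power\<close>)
  also have "(\<integral>\<^sup>+x. (ennreal \<bar>g x\<bar>)\<^sup>2 \<partial>M) = ennreal (\<integral>x. (g x)\<^sup>2 \<partial>M)"
    by (subst nn_integral_eq_integral[symmetric]) (use g in \<open>auto simp: ennreal_power\<close>)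
  finally have "?I\<^sup>2 \<le> (\<integral>x. (f x)\<^sup>2 \<partial>M) * (\<integral>x. (g x)\<^sup>2 \<partial>M)"
    by (simp add: ennreal_power ennreal_mult'[symmetric])
  then have "sqrt (?I\<^sup>2) \<le> sqrt ((\<integral>x. (f x)\<^sup>2 \<partial>M) * (\<integral>x. (g x)\<^sup>2 \<partial>M))"
    by (rule real_sqrt_le_mono)
  then show "?I \<le> sqrt (\<integral>x. (f x)\<^sup>2 \<partial>M) * sqrt (\<integral>x. (g x)\<^sup>2 \<partial>M)"
    by (simp add: real_sqrt_mult)
qed

section \<open>Scalar Fourier coefficients\<close>

definition fc :: "(real \<Rightarrow> complex) \<Rightarrow> int \<Rightarrow> complex" where
  "fc u k = (1 / (2 * pi)) *\<^sub>R (\<integral>x. u x * cis (- (of_int k * x)) \<partial>circ)"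

lemma measurable_cis [measurable]: "(\<lambda>x. cis (a * x)) \<in> borel_measurable circ"
  by (intro measurable_circI borel_measurable_continuous_onI continuous_intros)

lemma measurable_cis' [measurable]: "(\<lambda>x. cis (- (a * x))) \<in> borel_measurable circ"
  by (intro measurable_circI borel_measurable_continuous_onI continuous_intros)

lemma integrable_mult_cis:
  assumes "integrable circ u"
  shows "integrable circ (\<lambda>x. u x * cis (a * x))"
  by (rule integrable_bound[OF assms])
     (use assms in \<open>auto simp: norm_mult intro!: borel_measurable_times\<close>)

lemma integrable_mult_cis':
  assumes "integrable circ u"
  shows "integrable circ (\<lambda>x. u x * cis (- (a * x)))"
  using integrable_mult_cis[OF assms, of "-a"] by simp

lemma fc_add: "integrable circ u \<Longrightarrow> integrable circ v \<Longrightarrow> fc (\<lambda>x. u x + v x) k = fc u k + fc v k"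
  unfolding fc_def
  by (simp add: distrib_right integrable_mult_cis' integral_add scaleR_add_right)

lemma fc_diff: "integrable circ u \<Longrightarrow> integrable circ v \<Longrightarrow> fc (\<lambda>x. u x - v x) k = fc u k - fc v k"
  unfolding fc_def
  by (simp add: left_diff_distrib integrable_mult_cis' integral_diff scaleR_diff_right)

lemma fc_mult_left: "fc (\<lambda>x. c * u x) k = c * fc u k"
  unfolding fc_def by (simp add: mult.assoc)

lemma fc_sum: "(\<And>i. i \<in> I \<Longrightarrow> integrable circ (u i)) \<Longrightarrow> fc (\<lambda>x. \<Sum>i\<in>I. u i x) k = (\<Sum>i\<in>I. fc (u i) k)"
  unfolding fc_def
  by (simp add: sum_distrib_right integrable_mult_cis' integral_sum scaleR_right.sum)

lemma fc_mult_cis: "fc (\<lambda>x. u x * cis (of_int j * x)) k = fc u (k - j)"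
  unfolding fc_def
  by (intro arg_cong[where f="\<lambda>z. _ *\<^sub>R z"] integral_cong)
     (auto simp: mult.assoc cis_mult algebra_simps)

lemma fc_cnj: "fc (\<lambda>x. cnj (u x)) k = cnj (fc u (- k))"
proof -
  have "(\<integral>x. cnj (u x * cis (of_int k * x)) \<partial>circ) = cnj (\<integral>x. u x * cis (of_int k * x) \<partial>circ)"
    by (rule integral_cnj)
  then show ?thesis
    unfolding fc_def by (simp add: cis_cnj)
qed

lemma fc_cong_AE:
  assumes "u \<in> borel_measurable circ" "v \<in> borel_measurable circ" "AE x in circ. u x = v x"
  shows "fc u k = fc v k"
  unfolding fc_def
  by (intro arg_cong[where f="\<lambda>z. _ *\<^sub>R z"] integral_cong_AE) (use assms in auto)

lemma fc_cong: "(\<And>x. x \<in> {-pi..pi} \<Longrightarrow> u x = v x) \<Longrightarrow> fc u k = fc v k"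
  unfolding fc_def
  by (intro arg_cong[where f="\<lambda>z. _ *\<^sub>R z"] integral_cong) auto

lemma norm_fc_le:
  assumes "integrable circ u"
  shows "norm (fc u k) \<le> (1 / (2 * pi)) * (\<integral>x. norm (u x) \<partial>circ)"
proof -
  have "norm (\<integral>x. u x * cis (- (of_int k * x)) \<partial>circ) \<le> (\<integral>x. norm (u x * cis (- (of_int k * x))) \<partial>circ)"
    by (rule integral_norm_bound)
  then show ?thesis
    unfolding fc_def by (simp add: norm_mult field_simps)
qed

lemma integral_cis:
  "(\<integral>x. cis (of_int k * x) \<partial>circ) = (if k = 0 then of_real (2 * pi) else 0)"
proof (cases "k = 0")
  case True
  then show ?thesis by (simp add: measure_circ scaleR_conv_of_real)
next
  case False
  have "((\<lambda>x. cis (of_int k * x) / (\<i> * of_int k)) has_vector_derivative cis (of_int k * x)) (at x within S)"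
    for x :: real and S
  proof -
    have "((\<lambda>z. exp (\<i> * of_int k * z) / (\<i> * of_int k)) has_field_derivative exp (\<i> * of_int k * of_real x))
        (at (of_real x))"
      using False by (auto intro!: derivative_eq_intros)
    from has_vector_derivative_real_field[OF this] show ?thesis
      by (simp add: cis_conv_exp mult.assoc)
  qed
  then have "(LBINT x=-pi..pi. cis (of_int k * x)) = cis (of_int k * pi) / (\<i> * of_int k) - cis (of_int k * (-pi)) / (\<i> * of_int k)"
    by (intro interval_integral_FTC_finite) (auto intro!: continuous_intros simp: min_def max_def)
  also have "cis (of_int k * (-pi)) = cis (of_int k * pi)"
  proof -
    have "cis (of_int k * pi) = cis (of_int k * (-pi)) * cis (2 * pi * of_int k)"
      by (simp add: cis_mult algebra_simps)
    then show ?thesis by (simp add: cis_multiple_2pi)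
  qed
  finally have "(LBINT x:{-pi..pi}. cis (of_int k * x)) = 0"
    by (subst (asm) interval_integral_Icc) auto
  with False show ?thesis by (simp add: set_integral_circ)
qed

lemma fc_cis: "fc (\<lambda>x. cis (of_int j * x)) k = (if j = k then 1 else 0)"
proof -
  have "fc (\<lambda>x. cis (of_int j * x)) k = (1 / (2 * pi)) *\<^sub>R (\<integral>x. cis (of_int (j - k) * x) \<partial>circ)"
    unfolding fc_def
    by (intro arg_cong[where f="\<lambda>z. _ *\<^sub>R z"] integral_cong)
       (auto simp: cis_mult algebra_simps)
  then show ?thesis by (simp only: integral_cis) (simp add: scaleR_conv_of_real)
qed

section \<open>Uniqueness of Fourier coefficients\<close>

text \<open>On the unit circle the coordinate functions, and so all real polynomial functions, are combinations
  of \<open>cis x\<close> and \<open>cis (- x)\<close>.\<close>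

lemma real_linear_on_cis:
  fixes f :: "complex \<Rightarrow> real"
  assumes "bounded_linear f"
  shows "complex_of_real (f (cis x)) =
     ((of_real (f 1) - \<i> * of_real (f \<i>)) / 2) * cis x + ((of_real (f 1) + \<i> * of_real (f \<i>)) / 2) * cis (- x)"
proof -
  interpret bounded_linear f by fact
  have "cis x = cos x *\<^sub>R 1 + sin x *\<^sub>R \<i>"
    by (simp add: complex_eq_iff)
  then have "f (cis x) = cos x * f 1 + sin x * f \<i>"
    by (simp only: add scaleR) simp
  then show ?thesis
    by (simp add: complex_eq_iff field_simps)
qed

lemma integrable_mult_continuous:
  fixes u w :: "real \<Rightarrow> complex"
  assumes "integrable circ u" "continuous_on UNIV w"
  shows "integrable circ (\<lambda>x. u x * w x)"
proof -
  have "compact (w ` {-pi..pi})"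
    using assms(2) continuous_on_subset by (intro compact_continuous_image) auto
  then obtain B where B: "\<And>x. x \<in> {-pi..pi} \<Longrightarrow> norm (w x) \<le> B"
    using compact_imp_bounded bounded_iff by (metis imageI)
  have [measurable]: "w \<in> borel_measurable circ"
    using assms(2) by (intro measurable_circI borel_measurable_continuous_onI)
  have [measurable]: "u \<in> borel_measurable circ"
    using assms(1) by simp
  show ?thesis
  proof (rule integrable_bound[of _ "\<lambda>x. B * norm (u x)"])
    show "AE x in circ. norm (u x * w x) \<le> norm (B * norm (u x))"
    proof (rule AE_I2)
      fix x assume "x \<in> space circ"
      then have "norm (w x) \<le> \<bar>B\<bar>" using B[of x] by auto
      from mult_right_mono[OF this, of "norm (u x)"]
      show "norm (u x * w x) \<le> norm (B * norm (u x))" by (simp add: norm_mult abs_mult mult.commute)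
    qed
  qed (use assms(1) in auto)
qed

lemma continuous_on_polynomial_cis:
  assumes "real_polynomial_function h"
  shows "continuous_on UNIV (\<lambda>x. complex_of_real (h (cis x)))"
proof -
  have "continuous_on UNIV h"
    by (intro continuous_at_imp_continuous_on ballI continuous_real_polymonial_function[OF assms])
  then show ?thesis
    by (rule continuous_on_of_real[OF continuous_on_compose2[OF _ continuous_on_cis[OF continuous_on_id]]]) auto
qed

text \<open>Multiplication by a trigonometric polynomial permutes and combines Fourier coefficients, so the
  functions that keep all coefficients equal to zero form an algebra; this avoids writing the
  restriction of a polynomial to the unit circle as an explicit trigonometric sum.\<close>

lemma fc_zero_mult_polynomial:
  assumes "real_polynomial_function q" "integrable circ u" "\<And>k. fc u k = 0"
  shows "fc (\<lambda>x. u x * of_real (q (cis x))) k = 0"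
  using assms
proof (induction q arbitrary: u k)
  case (linear f)
  let ?a = "(of_real (f 1) - \<i> * of_real (f \<i>)) / 2" and ?b = "(of_real (f 1) + \<i> * of_real (f \<i>)) / 2"
  have eq: "(\<lambda>x. u x * of_real (f (cis x))) = (\<lambda>x. ?a * (u x * cis (of_int 1 * x)) + ?b * (u x * cis (of_int (-1) * x)))"
    by (rule ext) (simp only: real_linear_on_cis[OF linear(1)], simp add: algebra_simps)
  have "fc (\<lambda>x. u x * of_real (f (cis x))) k =
      fc (\<lambda>x. ?a * (u x * cis (of_int 1 * x))) k + fc (\<lambda>x. ?b * (u x * cis (of_int (-1) * x))) k"
    unfolding eq by (intro fc_add integrable_mult_right integrable_mult_cis linear)
  also have "\<dots> = ?a * fc u (k - 1) + ?b * fc u (k - (-1))"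
    by (simp only: fc_mult_left fc_mult_cis)
  finally show ?case using linear by simp
next
  case (const c)
  then show ?case using fc_mult_left[of "of_real c" u k] by (simp add: mult.commute)
next
  case (add f g)
  note c = continuous_on_polynomial_cis
  show ?case
    using add integrable_mult_continuous[OF add.prems(1) c[OF add.hyps(1)]]
      integrable_mult_continuous[OF add.prems(1) c[OF add.hyps(2)]]
    by (simp add: distrib_left fc_add)
next
  case (mult f g)
  note c = continuous_on_polynomial_cis
  show ?case
    using mult.IH(2)[of "\<lambda>x. u x * of_real (f (cis x))" k] mult.IH(1)[of u] mult.prems
      integrable_mult_continuous[OF mult.prems(1) c[OF mult.hyps(1)]]
    by (simp add: mult.assoc)
qed

lemma fc_0: "fc u 0 = (1 / (2 * pi)) *\<^sub>R (\<integral>x. u x \<partial>circ)"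
  by (simp add: fc_def)

text \<open>By Stone--Weierstrass it suffices to test against polynomials in the two coordinates.\<close>

lemma integral_mult_circle_zero:
  assumes u: "integrable circ u" "\<And>k. fc u k = 0" and \<phi>: "continuous_on (sphere 0 1) (\<phi> :: complex \<Rightarrow> real)"
  shows "(\<integral>x. u x * of_real (\<phi> (cis x)) \<partial>circ) = 0"
proof -
  have cphi: "continuous_on UNIV (\<lambda>x. complex_of_real (\<phi> (cis x)))"
    by (rule continuous_on_of_real[OF continuous_on_compose2[OF \<phi> continuous_on_cis[OF continuous_on_id]]]) auto
  have "norm (\<integral>x. u x * of_real (\<phi> (cis x)) \<partial>circ) \<le> e * (\<integral>x. norm (u x) \<partial>circ)" if e: "e > 0" for e
  proof -
    obtain q where q: "real_polynomial_function q" "\<And>z. z \<in> sphere 0 1 \<Longrightarrow> \<bar>\<phi> z - q z\<bar> < e"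
      using Stone_Weierstrass_real_polynomial_function[OF compact_sphere \<phi> e] by blast
    note cq = continuous_on_polynomial_cis[OF q(1)]
    have "(\<integral>x. u x * of_real (q (cis x)) \<partial>circ) = 0"
      using fc_zero_mult_polynomial[OF q(1) u, of 0] by (simp add: fc_0)
    then have "(\<integral>x. u x * of_real (\<phi> (cis x)) \<partial>circ) =
        (\<integral>x. u x * of_real (\<phi> (cis x)) - u x * of_real (q (cis x)) \<partial>circ)"
      using integrable_mult_continuous[OF u(1) cphi] integrable_mult_continuous[OF u(1) cq] by simp
    also have "norm \<dots> \<le> (\<integral>x. e * norm (u x) \<partial>circ)"
    proof (rule order_trans[OF integral_norm_bound integral_mono])
      show "integrable circ (\<lambda>x. norm (u x * of_real (\<phi> (cis x)) - u x * of_real (q (cis x))))"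
        using integrable_mult_continuous[OF u(1) cphi] integrable_mult_continuous[OF u(1) cq] by simp
      show "norm (u x * of_real (\<phi> (cis x)) - u x * of_real (q (cis x))) \<le> e * norm (u x)" for x
        using q(2)[of "cis x"]
        by (simp add: norm_mult of_real_diff[symmetric] right_diff_distrib[symmetric] mult.commute[of e]
            mult_left_mono del: of_real_diff)
    qed (use u in auto)
    finally show ?thesis by simp
  qed
  note b = this
  show ?thesis
  proof (cases "(\<integral>x. norm (u x) \<partial>circ) = 0")
    case True
    then show ?thesis using b[of 1] by simp
  next
    case False
    then have I: "(\<integral>x. norm (u x) \<partial>circ) > 0"
      by (metis integral_nonneg norm_ge_zero order_le_less)
    have "norm (\<integral>x. u x * of_real (\<phi> (cis x)) \<partial>circ) \<le> 0 + e" if "e > 0" for e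
      using b[of "e / (\<integral>x. norm (u x) \<partial>circ)"] I that by simp
    then have "norm (\<integral>x. u x * of_real (\<phi> (cis x)) \<partial>circ) \<le> 0" by (rule field_le_epsilon)
    then show ?thesis by simp
  qed
qed

lemma tendsto_tent_indicator:
  assumes "closed K" "K \<noteq> {}"
  shows "(\<lambda>n. max 0 (1 - real n * infdist z K)) \<longlonglongrightarrow> indicator K z"
proof (cases "z \<in> K")
  case True
  then show ?thesis by simp
next
  case False
  then have pos: "infdist z K > 0"
    using assms by (simp add: infdist_pos_not_in_closed)
  have "eventually (\<lambda>n. real n * infdist z K \<ge> 1) sequentially"
  proof -
    obtain N where "1 \<le> real N * infdist z K"
      using reals_Archimedean3[OF pos] less_imp_le by metis
    moreover have "real N * infdist z K \<le> real n * infdist z K" if "N \<le> n" for n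
      using that infdist_nonneg[of z K] by (intro mult_right_mono) auto
    ultimately show ?thesis
      unfolding eventually_sequentially by (meson order_trans)
  qed
  then have "eventually (\<lambda>n. max 0 (1 - real n * infdist z K) = indicator K z) sequentially"
    by eventually_elim (use False in auto)
  then show ?thesis by (rule tendsto_eventually)
qed

lemma cis_inj: "cis x = cis c \<Longrightarrow> x \<in> {-pi<..<pi} \<Longrightarrow> c \<in> {-pi..pi} \<Longrightarrow> x = c"
proof -
  assume "cis x = cis c" and x: "x \<in> {-pi<..<pi}" and c: "c \<in> {-pi..pi}"
  then have "cis (x - c) = 1" by (simp add: cis_divide[symmetric])
  then have "cos (x - c) = 1" by (metis cis.simps(1) one_complex.simps(1))
  then obtain n :: int where n: "x - c = of_int n * 2 * pi" using cos_one_2pi_int by blast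
  have "\<bar>x - c\<bar> < 2 * pi" using x c by auto
  then have "\<bar>of_int n\<bar> * (2 * pi) < 1 * (2 * pi)" using n by (simp add: abs_mult mult.assoc)
  then have "n = 0" by (simp add: mult_less_cancel_right)
  then show "x = c" using n by simp
qed

text \<open>The indicator of a closed set is the decreasing limit of tents, which are continuous on the circle.\<close>

lemma integral_closed_zero:
  assumes u: "integrable circ u" "\<And>k. fc u k = 0" and C: "closed C"
  shows "(\<integral>x. indicator C x *\<^sub>R u x \<partial>circ) = 0"
proof (cases "C \<inter> {-pi..pi} = {}")
  case True
  then have "(\<integral>x. indicator C x *\<^sub>R u x \<partial>circ) = (\<integral>x. 0 \<partial>circ)"
    by (intro integral_cong) (auto simp: indicator_def)
  then show ?thesis by simp
next
  case False
  define K where "K = cis ` (C \<inter> {-pi..pi})"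
  let ?t = "\<lambda>n x. max 0 (1 - real n * infdist (cis x) K)"
  have "compact K"
    unfolding K_def using C by (intro compact_continuous_image continuous_intros) (auto simp: closed_Int_compact)
  then have K: "closed K" "K \<noteq> {}"
    using compact_imp_closed False by (auto simp: K_def)
  have cont: "continuous_on UNIV (\<lambda>x. complex_of_real (?t n x))" for n
    by (intro continuous_intros)
  have [measurable]: "u \<in> borel_measurable circ" using u by simp
  have [measurable]: "C \<in> sets borel" using C by simp
  have [measurable]: "(\<lambda>x. complex_of_real (?t n x)) \<in> borel_measurable circ" for n
    by (intro measurable_circI borel_measurable_continuous_onI cont)
  have [measurable]: "(\<lambda>x. indicat_real C x) \<in> borel_measurable circ"
    by (intro measurable_circI) measurable
  have "(\<lambda>n. \<integral>x. u x * of_real (?t n x) \<partial>circ)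
      \<longlonglongrightarrow> (\<integral>x. indicator C x *\<^sub>R u x \<partial>circ)"
  proof (rule integral_dominated_convergence[where w="\<lambda>x. norm (u x)"])
    \<comment> \<open>The endpoints have the same image under \<open>cis\<close>; off this null set the two indicators agree.\<close>
    show "AE x in circ. (\<lambda>n. u x * of_real (?t n x)) \<longlonglongrightarrow> indicator C x *\<^sub>R u x"
    proof -
      have "AE x in circ. x \<noteq> pi \<and> x \<noteq> -pi"
        unfolding AE_circ using AE_lborel_singleton[of pi] AE_lborel_singleton[of "-pi"] by eventually_elim auto
      moreover have "AE x in circ. x \<in> {-pi..pi}" by (simp add: AE_circ)
      ultimately show ?thesis
      proof eventually_elim
        case (elim x)
        have "indicat_real K (cis x) = indicator C x"
          using elim cis_inj[of x] by (auto simp: K_def indicator_def)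
        then have "(\<lambda>n. ?t n x) \<longlonglongrightarrow> indicator C x"
          using tendsto_tent_indicator[OF K, of "cis x"] by simp
        then have "(\<lambda>n. u x * of_real (?t n x)) \<longlonglongrightarrow> u x * of_real (indicator C x)"
          by (intro tendsto_intros)
        then show ?case by (simp add: scaleR_conv_of_real mult.commute)
      qed
    qed
    show "AE x in circ. norm (u x * complex_of_real (?t n x)) \<le> norm (u x)" for n
    proof (intro AE_I2)
      fix x
      have "\<bar>?t n x\<bar> \<le> 1"
        using infdist_nonneg[of "cis x" K] by (auto simp: max_def)
      from mult_left_mono[OF this, of "norm (u x)"]
      show "norm (u x * complex_of_real (?t n x)) \<le> norm (u x)"
        by (simp only: norm_mult norm_of_real) simp
    qed
  qed (use u in auto)
  moreover have "(\<integral>x. u x * of_real (?t n x) \<partial>circ) = 0" for n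
    by (rule integral_mult_circle_zero[OF u, of "\<lambda>z. max 0 (1 - real n * infdist z K)"]) (intro continuous_intros)
  ultimately show ?thesis by (simp add: LIMSEQ_const_iff)
qed

text \<open>Closed sets form an intersection stable generator of the Borel sets, so \<open>u\<close> has integral zero over
  every Borel set.\<close>

theorem fc_zero_imp_AE_zero:
  assumes u: "integrable circ u" "\<And>k. fc u k = 0"
  shows "AE x in circ. u x = 0"
proof (rule circ.density_zero[OF u(1)])
  have [measurable]: "u \<in> borel_measurable circ" using u by simp
  have mind: "(\<lambda>x. indicat_real A x) \<in> borel_measurable circ" if "A \<in> sets borel" for A
    using that by (intro measurable_circI borel_measurable_indicator) auto
  have int: "integrable circ (\<lambda>x. indicator A x *\<^sub>R u x)" if "A \<in> sets borel" for A
    using mind[OF that] by (intro integrable_bound[OF u(1)]) (auto simp: indicator_def)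
  have zero: "(\<integral>x. indicator A x *\<^sub>R u x \<partial>circ) = 0" if A: "A \<in> sets borel" for A
  proof -
    have "Int_stable (Collect closed :: real set set)" "(Collect closed :: real set set) \<subseteq> Pow UNIV"
      by (auto simp: Int_stable_def)
    moreover have "A \<in> sigma_sets UNIV (Collect closed)"
      using A by (simp add: borel_eq_closed)
    ultimately show ?thesis
    proof (induction rule: sigma_sets_induct_disjoint)
      case (basic A)
      then show ?case using integral_closed_zero[OF u] by simp
    next
      case (compl A)
      have Ab: "A \<in> sets borel" using compl by (simp add: borel_eq_closed)
      have "(\<integral>x. indicator (UNIV - A) x *\<^sub>R u x \<partial>circ) = (\<integral>x. u x - indicator A x *\<^sub>R u x \<partial>circ)"
        by (intro integral_cong) (auto simp: indicator_def)
      also have "\<dots> = 0"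
        using compl.IH int[OF Ab] u integral_closed_zero[OF u, of UNIV] by simp
      finally show ?case .
    next
      case (union A)
      have Ab: "A i \<in> sets borel" for i using union(2) by (auto simp: borel_eq_closed)
      have "(\<lambda>n. \<integral>x. indicator (\<Union>i<n. A i) x *\<^sub>R u x \<partial>circ) \<longlonglongrightarrow> (\<integral>x. indicator (\<Union>i. A i) x *\<^sub>R u x \<partial>circ)"
      proof (rule integral_dominated_convergence[where w="\<lambda>x. norm (u x)"])
        show "AE x in circ. (\<lambda>n. indicator (\<Union>i<n. A i) x *\<^sub>R u x) \<longlonglongrightarrow> indicator (\<Union>i. A i) x *\<^sub>R u x"
          by (intro AE_I2 tendsto_scaleR LIMSEQ_indicator_UN tendsto_const)
        show "(\<lambda>x. indicat_real (\<Union>i. A i) x *\<^sub>R u x) \<in> borel_measurable circ"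
          using int[of "\<Union>i. A i"] Ab by auto
        show "(\<lambda>x. indicat_real (\<Union>i<n. A i) x *\<^sub>R u x) \<in> borel_measurable circ" for n
          using int[of "\<Union>i<n. A i"] Ab by auto
      qed (use u in \<open>auto simp: indicator_def\<close>)
      moreover have "(\<integral>x. indicator (\<Union>i<n. A i) x *\<^sub>R u x \<partial>circ) = 0" for n
      proof -
        have "(\<integral>x. indicator (\<Union>i<n. A i) x *\<^sub>R u x \<partial>circ) = (\<integral>x. (\<Sum>i<n. indicator (A i) x *\<^sub>R u x) \<partial>circ)"
        proof (intro integral_cong refl)
          fix x
          have "disjoint_family_on A {..<n}" using union(1) by (auto simp: disjoint_family_on_def)
          then have "indicat_real (\<Union>i<n. A i) x = (\<Sum>i<n. indicator (A i) x)"
            by (subst indicator_UN_disjoint) auto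
          then show "indicat_real (\<Union>i<n. A i) x *\<^sub>R u x = (\<Sum>i<n. indicator (A i) x *\<^sub>R u x)"
            by (simp add: scaleR_sum_left)
        qed
        also have "\<dots> = 0" using int Ab union(3) by (subst integral_sum) auto
        finally show ?thesis .
      qed
      ultimately show ?case by (simp add: LIMSEQ_const_iff)
    qed auto
  qed
  fix A assume "A \<in> sets circ"
  then have "A \<in> sets borel"
    by (auto simp: circ_def sets_restrict_space_iff)
  then show "set_lebesgue_integral circ A u = 0"
    using zero by (simp add: set_lebesgue_integral_def)
qed

corollary fc_eq_imp_AE_eq:
  assumes "integrable circ u" "integrable circ v" "\<And>k. fc u k = fc v k"
  shows "AE x in circ. u x = v x"
  using fc_zero_imp_AE_zero[of "\<lambda>x. u x - v x"] assms by (simp add: fc_diff)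

lemma AE_eq_imp_eq_continuous:
  fixes u v :: "real \<Rightarrow> 'b::real_normed_vector"
  assumes ae: "AE x in circ. u x = v x" and "continuous_on {-pi..pi} u" "continuous_on {-pi..pi} v"
    and x: "x \<in> {-pi..pi}"
  shows "u x = v x"
proof (rule ccontr)
  assume ne: "u x \<noteq> v x"
  define f where "f = (\<lambda>x. norm (u x - v x))"
  have f: "continuous_on {-pi..pi} f" unfolding f_def by (intro continuous_intros assms)
  have "f x > 0" using ne by (simp add: f_def)
  then obtain d where d: "d > 0" "\<And>y. y \<in> {-pi..pi} \<Longrightarrow> dist y x < d \<Longrightarrow> dist (f y) (f x) < f x"
    using f x unfolding continuous_on_iff by metis
  define a b where "a = max (-pi) (x - d)" and "b = min pi (x + d)"
  have "a < b" using x d(1) pi_gt_zero unfolding a_def b_def by (auto simp: max_def min_def)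
  have "AE y in lborel. y \<in> {-pi..pi} \<longrightarrow> u y = v y" using ae by (simp add: AE_circ)
  then have "AE y in lborel. y \<notin> {a<..<b}"
  proof eventually_elim
    case (elim y)
    show ?case
    proof
      assume "y \<in> {a<..<b}"
      then have "y \<in> {-pi..pi}" "dist y x < d" by (auto simp: a_def b_def dist_real_def)
      then show False using d(2)[of y] elim \<open>f x > 0\<close> by (auto simp: f_def dist_real_def)
    qed
  qed
  then have "emeasure lborel {a<..<b} = 0"
    by (subst (asm) AE_iff_measurable[where N="{a<..<b}"]) auto
  then show False using \<open>a < b\<close> by simp
qed

section \<open>Square integrable functions\<close>

definition circ_L2 :: "(real \<Rightarrow> complex) \<Rightarrow> bool" where
  "circ_L2 u \<longleftrightarrow> u \<in> borel_measurable circ \<and> integrable circ (\<lambda>x. (norm (u x))\<^sup>2)"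

text \<open>The \<open>L\<^sup>2\<close> norm with respect to \<open>dx\<close>, not \<open>dx / (2 * pi)\<close>; hence the factors \<open>2 * pi\<close> in the
  identities of Bessel and Parseval.\<close>

definition n2 :: "(real \<Rightarrow> complex) \<Rightarrow> real" where
  "n2 u = sqrt (\<integral>x. (norm (u x))\<^sup>2 \<partial>circ)"

lemma n2_nonneg [simp]: "n2 u \<ge> 0"
  by (simp add: n2_def)

lemma n2_square: "(n2 u)\<^sup>2 = (\<integral>x. (norm (u x))\<^sup>2 \<partial>circ)"
  by (simp add: n2_def)

lemma circ_L2_measurable [measurable_dest]: "circ_L2 u \<Longrightarrow> u \<in> borel_measurable circ"
  by (simp add: circ_L2_def)

lemma circ_L2_mult:
  assumes "circ_L2 u" "circ_L2 v"
  shows "integrable circ (\<lambda>x. u x * v x)"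
    and "(\<integral>x. norm (u x * v x) \<partial>circ) \<le> n2 u * n2 v"
proof -
  have [measurable]: "u \<in> borel_measurable circ" "v \<in> borel_measurable circ"
    using assms by (auto simp: circ_L2_def)
  have "integrable circ (\<lambda>x. norm (u x) * norm (v x))"
    by (rule integral_Cauchy_Schwarz) (use assms in \<open>auto simp: circ_L2_def\<close>)
  then show "integrable circ (\<lambda>x. u x * v x)"
    by (rule integrable_bound) (auto simp: norm_mult)
  have "(\<integral>x. \<bar>norm (u x) * norm (v x)\<bar> \<partial>circ) \<le> n2 u * n2 v"
    unfolding n2_def by (rule integral_Cauchy_Schwarz) (use assms in \<open>auto simp: circ_L2_def\<close>)
  then show "(\<integral>x. norm (u x * v x) \<partial>circ) \<le> n2 u * n2 v"
    by (simp add: norm_mult)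
qed

lemma circ_L2_bounded:
  assumes "u \<in> borel_measurable circ" "\<And>x. x \<in> {-pi..pi} \<Longrightarrow> norm (u x) \<le> B"
  shows "circ_L2 u"
  unfolding circ_L2_def
proof (intro conjI integrable_circ_bounded[where B="B\<^sup>2"])
  fix x :: real assume "x \<in> {-pi..pi}"
  then show "norm ((norm (u x))\<^sup>2) \<le> B\<^sup>2"
    using assms(2)[of x] by (simp add: power_mono)
qed (use assms(1) in auto)

lemma circ_L2_continuous:
  assumes "continuous_on UNIV u" shows "circ_L2 u"
proof -
  have "compact (u ` {-pi..pi})"
    using assms continuous_on_subset by (intro compact_continuous_image) auto
  then obtain B where "\<And>x. x \<in> {-pi..pi} \<Longrightarrow> norm (u x) \<le> B"
    using compact_imp_bounded bounded_iff by (metis imageI)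
  then show ?thesis
    using assms by (intro circ_L2_bounded) (auto intro: measurable_circI borel_measurable_continuous_onI)
qed

lemma circ_L2_imp_integrable:
  assumes "circ_L2 u" shows "integrable circ u"
  using circ_L2_mult(1)[OF assms circ_L2_continuous[of "\<lambda>_. 1"]] by simp

lemma integral_norm_le_n2:
  assumes "circ_L2 u"
  shows "(\<integral>x. norm (u x) \<partial>circ) \<le> sqrt (2 * pi) * n2 u"
  using circ_L2_mult(2)[OF assms circ_L2_continuous[of "\<lambda>_. 1"]]
  by (simp add: n2_def measure_circ mult.commute)

lemma circ_L2_add:
  assumes "circ_L2 u" "circ_L2 v" shows "circ_L2 (\<lambda>x. u x + v x)"
  unfolding circ_L2_def
proof
  have [measurable]: "u \<in> borel_measurable circ" "v \<in> borel_measurable circ"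
    using assms by (auto simp: circ_L2_def)
  show "(\<lambda>x. u x + v x) \<in> borel_measurable circ" by measurable
  have b: "(norm (a + b))\<^sup>2 \<le> 2 * (norm a)\<^sup>2 + 2 * (norm b)\<^sup>2" for a b :: complex
  proof -
    have "(norm (a + b))\<^sup>2 \<le> (norm a + norm b)\<^sup>2" by (intro power_mono norm_triangle_ineq) auto
    also have "\<dots> \<le> 2 * (norm a)\<^sup>2 + 2 * (norm b)\<^sup>2"
      using sum_squares_bound[of "norm a" "norm b"] by (simp add: power2_sum)
    finally show ?thesis .
  qed
  have i: "integrable circ (\<lambda>x. 2 * (norm (u x))\<^sup>2 + 2 * (norm (v x))\<^sup>2)"
    using assms by (auto simp: circ_L2_def)
  show "integrable circ (\<lambda>x. (norm (u x + v x))\<^sup>2)"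
    by (rule integrable_bound[OF i]) (use b in auto)
qed

lemma circ_L2_cmult: "circ_L2 u \<Longrightarrow> circ_L2 (\<lambda>x. c * u x)"
  by (auto simp: circ_L2_def norm_mult power_mult_distrib)

lemma circ_L2_uminus: "circ_L2 u \<Longrightarrow> circ_L2 (\<lambda>x. - u x)"
  using circ_L2_cmult[of u "-1"] by simp

lemma circ_L2_diff: "circ_L2 u \<Longrightarrow> circ_L2 v \<Longrightarrow> circ_L2 (\<lambda>x. u x - v x)"
  using circ_L2_add[of u "\<lambda>x. - v x"] circ_L2_uminus[of v] by simp

lemma measurable_cnj [measurable (raw)]:
  "u \<in> borel_measurable M \<Longrightarrow> (\<lambda>x. cnj (u x)) \<in> borel_measurable M"
  by (rule measurable_compose[of u M borel cnj])
     (auto intro!: borel_measurable_continuous_onI continuous_intros)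

lemma circ_L2_cnj: "circ_L2 u \<Longrightarrow> circ_L2 (\<lambda>x. cnj (u x))"
  by (auto simp: circ_L2_def measurable_cnj)

subsection \<open>Partial sums\<close>

text \<open>The frequencies are enumerated by \<^const>\<open>int_decode\<close>, so that series over the integers become
  ordinary series.\<close>

definition psum :: "(int \<Rightarrow> complex) \<Rightarrow> nat set \<Rightarrow> real \<Rightarrow> complex" where
  "psum c I x = (\<Sum>i\<in>I. c (int_decode i) * cis (of_int (int_decode i) * x))"

lemma continuous_psum: "continuous_on S (psum c I)"
  unfolding psum_def by (intro continuous_intros)

lemma circ_L2_psum: "circ_L2 (psum c I)"
  by (intro circ_L2_continuous continuous_psum)

lemma integral_psum_cnj_mult:
  assumes "integrable circ u" "finite I"
  shows "(\<integral>x. u x * cnj (psum c I x) \<partial>circ) = 2 * pi * (\<Sum>i\<in>I. fc u (int_decode i) * cnj (c (int_decode i)))"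
proof -
  have "(\<integral>x. u x * cnj (psum c I x) \<partial>circ) =
      (\<integral>x. (\<Sum>i\<in>I. cnj (c (int_decode i)) * (u x * cis (- (of_int (int_decode i) * x)))) \<partial>circ)"
    unfolding psum_def
    by (intro integral_cong) (auto simp: sum_distrib_left cis_cnj algebra_simps)
  also have "\<dots> = (\<Sum>i\<in>I. cnj (c (int_decode i)) * (\<integral>x. u x * cis (- (of_int (int_decode i) * x)) \<partial>circ))"
    using assms by (subst integral_sum) (auto intro!: integrable_mult_right integrable_mult_cis')
  also have "\<dots> = (\<Sum>i\<in>I. cnj (c (int_decode i)) * (2 * pi * fc u (int_decode i)))"
    by (simp add: fc_def scaleR_conv_of_real)
  finally show ?thesis by (simp add: sum_distrib_left mult_ac)
qed

lemma fc_psum: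
  assumes "finite I"
  shows "fc (psum c I) k = (if int_encode k \<in> I then c k else 0)"
proof -
  have "fc (psum c I) k = (\<Sum>i\<in>I. c (int_decode i) * fc (\<lambda>x. cis (of_int (int_decode i) * x)) k)"
    unfolding psum_def
    by (subst fc_sum) (auto simp: fc_mult_left intro!: integrable_mult_right integrable_circ_continuous continuous_intros)
  also have "\<dots> = (\<Sum>i\<in>I. if i = int_encode k then c k else 0)"
    by (intro sum.cong) (auto simp: fc_cis)
  finally show ?thesis using assms by simp
qed

lemma n2_psum:
  assumes "finite I"
  shows "(n2 (psum c I))\<^sup>2 = 2 * pi * (\<Sum>i\<in>I. (norm (c (int_decode i)))\<^sup>2)"
proof -
  have "complex_of_real ((n2 (psum c I))\<^sup>2) = (\<integral>x. psum c I x * cnj (psum c I x) \<partial>circ)"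
    unfolding n2_square by (simp add: complex_norm_square del: of_real_power integral_complex_of_real flip: integral_complex_of_real)
  also have "\<dots> = 2 * pi * (\<Sum>i\<in>I. fc (psum c I) (int_decode i) * cnj (c (int_decode i)))"
    using assms circ_L2_psum circ_L2_imp_integrable by (intro integral_psum_cnj_mult) blast+
  also have "\<dots> = complex_of_real (2 * pi * (\<Sum>i\<in>I. (norm (c (int_decode i)))\<^sup>2))"
    using assms by (simp add: fc_psum complex_norm_square[symmetric])
  finally show ?thesis by (simp only: of_real_eq_iff)
qed

lemma n2_diff_psum:
  assumes u: "circ_L2 u" and "finite I"
  shows "(n2 (\<lambda>x. u x - psum (fc u) I x))\<^sup>2 = (n2 u)\<^sup>2 - 2 * pi * (\<Sum>i\<in>I. (norm (fc u (int_decode i)))\<^sup>2)"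
proof -
  let ?S = "psum (fc u) I"
  let ?J = "\<integral>x. u x * cnj (?S x) \<partial>circ"
  have J: "?J = complex_of_real (2 * pi * (\<Sum>i\<in>I. (norm (fc u (int_decode i)))\<^sup>2))"
    using assms circ_L2_imp_integrable by (subst integral_psum_cnj_mult) (auto simp: complex_norm_square[symmetric])
  have i1: "integrable circ (\<lambda>x. u x * cnj (?S x))"
    by (intro circ_L2_mult u circ_L2_cnj circ_L2_psum)
  have eq: "(norm (a - b))\<^sup>2 = (norm a)\<^sup>2 + (norm b)\<^sup>2 - 2 * Re (a * cnj b)" for a b :: complex
    by (simp add: cmod_power2 power2_diff)
  have "(n2 (\<lambda>x. u x - ?S x))\<^sup>2 = (\<integral>x. (norm (u x))\<^sup>2 + (norm (?S x))\<^sup>2 - 2 * Re (u x * cnj (?S x)) \<partial>circ)"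
    unfolding n2_square by (simp only: eq)
  also have "\<dots> = (n2 u)\<^sup>2 + (n2 ?S)\<^sup>2 - 2 * (\<integral>x. Re (u x * cnj (?S x)) \<partial>circ)"
  proof -
    have a: "integrable circ (\<lambda>x. (norm (u x))\<^sup>2)" "integrable circ (\<lambda>x. (norm (?S x))\<^sup>2)"
      using u circ_L2_psum[of "fc u" I] by (auto simp: circ_L2_def)
    have r: "integrable circ (\<lambda>x. 2 * Re (u x * cnj (?S x)))"
      by (intro integrable_mult_right integrable_Re i1)
    show ?thesis
      unfolding n2_square integral_diff[OF integrable_add[OF a] r]
        integral_add[OF a] by (simp only: integral_mult_right_zero)
  qed
  also have "(\<integral>x. Re (u x * cnj (?S x)) \<partial>circ) = Re ?J"
    by (rule integral_Re[OF i1])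
  also have "\<dots> = 2 * pi * (\<Sum>i\<in>I. (norm (fc u (int_decode i)))\<^sup>2)"
    unfolding J by simp
  also have "(n2 ?S)\<^sup>2 = 2 * pi * (\<Sum>i\<in>I. (norm (fc u (int_decode i)))\<^sup>2)"
    by (rule n2_psum) fact
  finally show ?thesis by simp
qed

lemma summable_int_decode:
  fixes f :: "int \<Rightarrow> real"
  assumes "\<And>k. f k \<ge> 0"
  shows "f summable_on UNIV \<longleftrightarrow> summable (\<lambda>i. f (int_decode i))"
  using summable_on_reindex_bij_betw[OF bij_int_decode, of f] assms
  by (simp add: summable_on_UNIV_nonneg_real_iff)

lemma sums_int_decode:
  fixes f :: "int \<Rightarrow> 'a::banach"
  assumes "(\<lambda>k. norm (f k)) summable_on UNIV"
  shows "(\<lambda>i. f (int_decode i)) sums infsum f UNIV"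
proof -
  have "(f has_sum infsum f UNIV) UNIV"
    using abs_summable_summable[OF assms] by simp
  then have "((\<lambda>i. f (int_decode i)) has_sum infsum f UNIV) UNIV"
    using has_sum_reindex_bij_betw[OF bij_int_decode, of f] by simp
  then show ?thesis by (rule has_sum_imp_sums)
qed

lemma Bessel:
  assumes u: "circ_L2 u"
  shows "(\<lambda>k. (norm (fc u k))\<^sup>2) summable_on UNIV"
    and "2 * pi * (\<Sum>\<^sub>\<infinity>k. (norm (fc u k))\<^sup>2) \<le> (n2 u)\<^sup>2"
proof -
  have le: "(\<Sum>i\<in>I. (norm (fc u (int_decode i)))\<^sup>2) \<le> (n2 u)\<^sup>2 / (2 * pi)" if "finite I" for I
  proof -
    have "2 * pi * (\<Sum>i\<in>I. (norm (fc u (int_decode i)))\<^sup>2) \<le> (n2 u)\<^sup>2"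
      using n2_diff_psum[OF u that] zero_le_power2[of "n2 (\<lambda>x. u x - psum (fc u) I x)"] by linarith
    then show ?thesis by (simp add: field_simps)
  qed
  have s: "summable (\<lambda>i. (norm (fc u (int_decode i)))\<^sup>2)"
    using le by (intro bounded_imp_summable[of _ "(n2 u)\<^sup>2 / (2 * pi)"]) auto
  then show sum: "(\<lambda>k. (norm (fc u k))\<^sup>2) summable_on UNIV"
    by (subst summable_int_decode) auto
  have "(\<Sum>\<^sub>\<infinity>k. (norm (fc u k))\<^sup>2) = (\<Sum>i. (norm (fc u (int_decode i)))\<^sup>2)"
    using sums_int_decode[of "\<lambda>k. (norm (fc u k))\<^sup>2"] sum sums_unique by force
  also have "\<dots> \<le> (n2 u)\<^sup>2 / (2 * pi)"
    by (intro suminf_le_const s le) auto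
  finally show "2 * pi * (\<Sum>\<^sub>\<infinity>k. (norm (fc u k))\<^sup>2) \<le> (n2 u)\<^sup>2"
    by (simp add: field_simps)
qed

text \<open>Along a subsequence whose tails decrease geometrically the partial sums converge absolutely
  almost everywhere; Fatou's lemma then bounds the distance of the limit from every partial sum.\<close>

theorem Riesz_Fischer:
  assumes c: "(\<lambda>k. (norm (c k))\<^sup>2) summable_on UNIV"
  obtains u where "circ_L2 u" "\<And>k. fc u k = c k" "(\<lambda>n. n2 (\<lambda>x. u x - psum c {..<n} x)) \<longlonglongrightarrow> 0"
proof -
  let ?a = "\<lambda>i. (norm (c (int_decode i)))\<^sup>2"
  have sa: "summable ?a" using c by (subst (asm) summable_int_decode) auto
  define T where "T n = (\<Sum>i. ?a (i + n))" for n
  have T0: "T \<longlonglongrightarrow> 0"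
    unfolding T_def using suminf_exist_split2[OF sa] .
  have Tle: "(\<Sum>i\<in>{m..<n}. ?a i) \<le> T m" for m n
  proof -
    have "(\<Sum>i\<in>{m..<n}. ?a i) = (\<Sum>i<n-m. ?a (i + m))"
    proof (cases "m \<le> n")
      case True
      then show ?thesis
        using sum.shift_bounds_nat_ivl[of ?a 0 m "n - m"] by (simp add: atLeast0LessThan)
    qed simp
    also have "\<dots> \<le> T m"
      unfolding T_def by (intro sum_le_suminf summable_ignore_initial_segment[OF sa]) auto
    finally show ?thesis .
  qed
  have "\<exists>n. \<forall>m\<ge>n. T m \<le> (1/4)^j" for j
    using order_tendstoD(2)[OF T0, of "(1/4)^j"] by (auto simp: eventually_sequentially intro: less_imp_le)
  then obtain N0 where N0: "\<And>j m. m \<ge> N0 j \<Longrightarrow> T m \<le> (1/4)^j" by metis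
  \<comment> \<open>Increments along \<open>N\<close> have \<open>L\<^sup>2\<close> norm \<open>O((1/2)^j)\<close>; the summand \<open>j\<close> makes \<open>N\<close> tend to infinity.\<close>
  define N where "N j = j + (\<Sum>i\<le>j. N0 i)" for j
  have Nmono: "N j \<le> N (Suc j)" for j by (simp add: N_def)
  have Nge: "j \<le> N j" for j by (simp add: N_def)
  have NT: "T (N j) \<le> (1/4)^j" for j
    by (rule N0) (auto simp: N_def intro!: trans_le_add2 member_le_sum)
  define S where "S n = psum c {..<n}" for n
  have SL [simp]: "circ_L2 (S n)" for n by (simp add: S_def circ_L2_psum)
  have Sm [measurable]: "S n \<in> borel_measurable circ" for n using SL[of n] by (simp add: circ_L2_def)
  have Sdiff: "S n x - S m x = psum c {m..<n} x" if "m \<le> n" for m n x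
    unfolding S_def psum_def using that
    by (subst lessThan_minus_lessThan[symmetric], subst sum_diff) auto
  have nS: "(n2 (\<lambda>x. S n x - S m x))\<^sup>2 \<le> 2 * pi * T m" if "m \<le> n" for m n
  proof -
    have "(n2 (\<lambda>x. S n x - S m x))\<^sup>2 = (n2 (psum c {m..<n}))\<^sup>2" by (simp only: Sdiff[OF that])
    also have "\<dots> = 2 * pi * (\<Sum>i\<in>{m..<n}. ?a i)" by (simp add: n2_psum)
    also have "\<dots> \<le> 2 * pi * T m" by (intro mult_left_mono Tle) auto
    finally show ?thesis .
  qed
  let ?d = "\<lambda>j x. S (N (Suc j)) x - S (N j) x"
  have dn: "n2 (?d j) \<le> sqrt (2 * pi) * (1/2)^j" for j
  proof -
    have "(n2 (?d j))\<^sup>2 \<le> 2 * pi * (1/4)^j"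
      by (rule order_trans[OF nS[OF Nmono] mult_left_mono[OF NT]]) simp
    also have "(1/4::real)^j = (1/2 * (1/2))^j" by simp
    also have "\<dots> = ((1/2)^j)\<^sup>2" by (simp only: power_mult_distrib power2_eq_square)
    also have "2 * pi * ((1/2)^j)\<^sup>2 = (sqrt (2 * pi) * (1/2)^j)\<^sup>2"
      by (simp only: power_mult_distrib) simp
    finally show ?thesis by (rule power2_le_imp_le) auto
  qed
  have di: "(\<integral>x. norm (?d j x) \<partial>circ) \<le> 2 * pi * (1/2)^j" for j
  proof -
    have "(\<integral>x. norm (?d j x) \<partial>circ) \<le> sqrt (2 * pi) * n2 (?d j)"
      by (intro integral_norm_le_n2 circ_L2_diff SL)
    also have "\<dots> \<le> sqrt (2 * pi) * (sqrt (2 * pi) * (1/2)^j)"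
      by (intro mult_left_mono dn) auto
    finally show ?thesis by (simp add: mult.assoc[symmetric])
  qed
  have dint: "integrable circ (?d j)" for j
    by (intro circ_L2_imp_integrable circ_L2_diff SL)
  have "(\<integral>\<^sup>+x. (\<Sum>j. ennreal (norm (?d j x))) \<partial>circ) = (\<Sum>j. \<integral>\<^sup>+x. ennreal (norm (?d j x)) \<partial>circ)"
    by (rule nn_integral_suminf) measurable
  also have "\<dots> = (\<Sum>j. ennreal (\<integral>x. norm (?d j x) \<partial>circ))"
    using dint by (intro suminf_cong nn_integral_eq_integral) auto
  also have "\<dots> \<le> (\<Sum>j. ennreal (2 * pi * (1/2)^j))"
    by (intro suminf_le ennreal_leI di) auto
  also have "\<dots> = ennreal (\<Sum>j. 2 * pi * (1/2)^j)"
    by (intro suminf_ennreal2) (auto intro!: summable_mult summable_geometric)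
  also have "\<dots> < \<infinity>" by simp
  finally have "AE x in circ. (\<Sum>j. ennreal (norm (?d j x))) \<noteq> \<infinity>"
    by (intro nn_integral_PInf_AE) auto
  then have ae: "AE x in circ. summable (\<lambda>j. ?d j x)"
  proof eventually_elim
    case (elim x)
    then have "summable (\<lambda>j. norm (?d j x))"
      by (intro summable_suminf_not_top) auto
    then show ?case by (rule summable_norm_cancel)
  qed
  define u where "u x = S (N 0) x + (\<Sum>j. ?d j x)" for x
  have um [measurable]: "u \<in> borel_measurable circ"
    unfolding u_def by measurable
  have lim: "AE x in circ. (\<lambda>j. S (N j) x) \<longlonglongrightarrow> u x"
    using ae
  proof eventually_elim
    case (elim x)
    then have "(\<lambda>n. S (N 0) x + (\<Sum>j<n. ?d j x)) \<longlonglongrightarrow> u x"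
      unfolding u_def by (intro tendsto_intros summable_LIMSEQ)
    moreover have "(\<Sum>j<n. ?d j x) = S (N n) x - S (N 0) x" for n
      by (rule sum_lessThan_telescope)
    ultimately show ?case by simp
  qed
  have fatou: "(\<integral>\<^sup>+x. ennreal ((norm (u x - S n x))\<^sup>2) \<partial>circ) \<le> ennreal (2 * pi * T n)" for n
  proof -
    let ?I = "\<lambda>j. \<integral>\<^sup>+x. ennreal ((norm (S (N j) x - S n x))\<^sup>2) \<partial>circ"
    have "(\<integral>\<^sup>+x. ennreal ((norm (u x - S n x))\<^sup>2) \<partial>circ)
        = (\<integral>\<^sup>+x. liminf (\<lambda>j. ennreal ((norm (S (N j) x - S n x))\<^sup>2)) \<partial>circ)"
    proof (rule nn_integral_cong_AE)
      show "AE x in circ. ennreal ((norm (u x - S n x))\<^sup>2) = liminf (\<lambda>j. ennreal ((norm (S (N j) x - S n x))\<^sup>2))"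
        using lim
      proof eventually_elim
        case (elim x)
        then have "(\<lambda>j. ennreal ((norm (S (N j) x - S n x))\<^sup>2)) \<longlonglongrightarrow> ennreal ((norm (u x - S n x))\<^sup>2)"
          by (intro tendsto_ennrealI tendsto_intros)
        then show ?case using lim_imp_Liminf[OF trivial_limit_sequentially] by metis
      qed
    qed
    also have "\<dots> \<le> liminf (?I)"
      by (rule nn_integral_liminf) measurable
    also have "\<dots> \<le> ennreal (2 * pi * T n)"
    proof (rule Liminf_le)
      have "?I j \<le> ennreal (2 * pi * T n)" if "j \<ge> n" for j
      proof -
        have "?I j = ennreal ((n2 (\<lambda>x. S (N j) x - S n x))\<^sup>2)"
          unfolding n2_square using circ_L2_diff[OF SL SL, of "N j" n]
          by (intro nn_integral_eq_integral) (auto simp: circ_L2_def)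
        also have "\<dots> \<le> ennreal (2 * pi * T n)"
          using nS[of n "N j"] Nge[of j] that by (intro ennreal_leI) auto
        finally show ?thesis .
      qed
      then show "\<forall>\<^sub>F j in sequentially. ?I j \<le> ennreal (2 * pi * T n)"
        by (auto simp: eventually_sequentially)
    qed simp
    finally show ?thesis .
  qed
  have L2d: "circ_L2 (\<lambda>x. u x - S n x)" for n
    unfolding circ_L2_def
  proof
    show "integrable circ (\<lambda>x. (cmod (u x - S n x))\<^sup>2)"
      using fatou[of n] by (intro integrableI_bounded) (auto simp: le_less_trans)
  qed measurable
  have nd: "(n2 (\<lambda>x. u x - S n x))\<^sup>2 \<le> 2 * pi * T n" for n
  proof -
    have "T n \<ge> 0" using Tle[of n n] by simp
    moreover have "ennreal ((n2 (\<lambda>x. u x - S n x))\<^sup>2) \<le> ennreal (2 * pi * T n)"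
      unfolding n2_square using fatou[of n] L2d[of n]
      by (subst nn_integral_eq_integral[symmetric]) (auto simp: circ_L2_def)
    ultimately show ?thesis by (subst (asm) ennreal_le_iff) auto
  qed
  have uL: "circ_L2 u"
    using circ_L2_add[OF L2d[of 0] SL[of 0]] by simp
  have to0: "(\<lambda>n. n2 (\<lambda>x. u x - S n x)) \<longlonglongrightarrow> 0"
  proof (rule tendsto_sandwich[of "\<lambda>_. 0" _ _ "\<lambda>n. sqrt (2 * pi * T n)"])
    show "\<forall>\<^sub>F n in sequentially. n2 (\<lambda>x. u x - S n x) \<le> sqrt (2 * pi * T n)"
      using nd by (intro always_eventually allI real_le_rsqrt)
    show "(\<lambda>n. sqrt (2 * pi * T n)) \<longlonglongrightarrow> 0"
      using tendsto_real_sqrt[OF tendsto_mult_left[OF T0, of "2 * pi"]] by simp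
  qed auto
  have "fc u k = c k" for k
  proof -
    have "(\<lambda>n. fc u k - fc (S n) k) \<longlonglongrightarrow> 0"
    proof (rule Lim_null_comparison)
      show "(\<lambda>n. (1 / (2 * pi)) * (sqrt (2 * pi) * n2 (\<lambda>x. u x - S n x))) \<longlonglongrightarrow> 0"
        using to0 by (intro tendsto_mult_right_zero)
      have "norm (fc u k - fc (S n) k) \<le> (1 / (2 * pi)) * (sqrt (2 * pi) * n2 (\<lambda>x. u x - S n x))" for n
      proof -
        have "fc u k - fc (S n) k = fc (\<lambda>x. u x - S n x) k"
          using uL SL circ_L2_imp_integrable by (subst fc_diff) auto
        also have "norm \<dots> \<le> (1 / (2 * pi)) * (\<integral>x. norm (u x - S n x) \<partial>circ)"
          by (intro norm_fc_le circ_L2_imp_integrable L2d)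
        also have "\<dots> \<le> (1 / (2 * pi)) * (sqrt (2 * pi) * n2 (\<lambda>x. u x - S n x))"
          by (intro mult_left_mono integral_norm_le_n2 L2d) auto
        finally show ?thesis .
      qed
      then show "\<forall>\<^sub>F n in sequentially. norm (fc u k - fc (S n) k) \<le> (1 / (2 * pi)) * (sqrt (2 * pi) * n2 (\<lambda>x. u x - S n x))"
        by simp
    qed
    moreover have "\<forall>\<^sub>F n in sequentially. fc u k - fc (S n) k = fc u k - c k"
      using eventually_gt_at_top[of "int_encode k"]
      by eventually_elim (simp add: S_def fc_psum)
    ultimately have "(\<lambda>n::nat. fc u k - c k) \<longlonglongrightarrow> 0"
      by (rule Lim_transform_eventually)
    then show ?thesis by (simp add: LIMSEQ_const_iff)
  qed
  with uL to0 show ?thesis using that unfolding S_def by blast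
qed

lemma n2_cong_AE:
  assumes "u \<in> borel_measurable circ" "v \<in> borel_measurable circ" "AE x in circ. u x = v x"
  shows "n2 u = n2 v"
  unfolding n2_def by (intro arg_cong[where f=sqrt] integral_cong_AE) (use assms in auto)

text \<open>The limit provided by Riesz--Fischer has the coefficients of \<open>u\<close>, so it equals \<open>u\<close> almost everywhere.\<close>

lemma n2_psum_tendsto:
  assumes u: "circ_L2 u"
  shows "(\<lambda>n. n2 (\<lambda>x. u x - psum (fc u) {..<n} x)) \<longlonglongrightarrow> 0"
proof -
  obtain v where v: "circ_L2 v" "\<And>k. fc v k = fc u k" "(\<lambda>n. n2 (\<lambda>x. v x - psum (fc u) {..<n} x)) \<longlonglongrightarrow> 0"
    using Riesz_Fischer[OF Bessel(1)[OF u]] by metis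
  have ae: "AE x in circ. u x = v x"
    using u v circ_L2_imp_integrable by (intro fc_eq_imp_AE_eq) auto
  have [measurable]: "u \<in> borel_measurable circ" "v \<in> borel_measurable circ" "psum c I \<in> borel_measurable circ" for c I
    using u v circ_L2_psum[of c I] by (auto simp: circ_L2_def)
  have "n2 (\<lambda>x. v x - psum (fc u) {..<n} x) = n2 (\<lambda>x. u x - psum (fc u) {..<n} x)" for n
    by (rule n2_cong_AE) (use ae in auto)
  with v(3) show ?thesis by simp
qed

theorem Parseval:
  assumes u: "circ_L2 u"
  shows "2 * pi * (\<Sum>\<^sub>\<infinity>k. (norm (fc u k))\<^sup>2) = (n2 u)\<^sup>2"
proof -
  have "(\<lambda>n. (n2 (\<lambda>x. u x - psum (fc u) {..<n} x))\<^sup>2) \<longlonglongrightarrow> 0"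
    using tendsto_power[OF n2_psum_tendsto[OF u], of 2] by simp
  then have "(\<lambda>n. (n2 u)\<^sup>2 - 2 * pi * (\<Sum>i<n. (norm (fc u (int_decode i)))\<^sup>2)) \<longlonglongrightarrow> 0"
    by (simp add: n2_diff_psum[OF u])
  moreover have "(\<lambda>n. (n2 u)\<^sup>2 - 2 * pi * (\<Sum>i<n. (norm (fc u (int_decode i)))\<^sup>2))
      \<longlonglongrightarrow> (n2 u)\<^sup>2 - 2 * pi * (\<Sum>\<^sub>\<infinity>k. (norm (fc u k))\<^sup>2)"
    using sums_int_decode[of "\<lambda>k. (norm (fc u k))\<^sup>2"] Bessel(1)[OF u]
    by (intro tendsto_intros) (simp add: sums_def)
  ultimately show ?thesis using LIMSEQ_unique by force
qed

section \<open>Sums over the integers\<close>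

text \<open>Dominated convergence for sums over the frequencies; every limit in time or in the truncation
  parameter is taken through it.\<close>

lemma infsum_tendsto_dominated:
  fixes f :: "'b \<Rightarrow> int \<Rightarrow> 'a::{real_normed_algebra, banach}"
  assumes lim: "\<And>k. ((\<lambda>r. f r k) \<longlongrightarrow> g k) F"
    and bd: "\<forall>\<^sub>F r in F. \<forall>k. norm (f r k) \<le> M k"
    and M: "M summable_on UNIV"
  shows "((\<lambda>r. \<Sum>\<^sub>\<infinity>k. f r k) \<longlongrightarrow> (\<Sum>\<^sub>\<infinity>k. g k)) F"
proof (cases "F = bot")
  case False
  have gM: "norm (g k) \<le> M k" for k
    by (rule tendsto_upperbound[OF tendsto_norm[OF lim] _ False]) (use bd in eventually_elim, auto)
  then have M0: "M k \<ge> 0" for k using norm_ge_zero order_trans by blast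
  have sM: "summable (\<lambda>i. M (int_decode i))"
    using M M0 by (subst (asm) summable_int_decode) auto
  have abs: "(\<lambda>k. norm (h k)) summable_on UNIV" if "\<And>k. norm (h k) \<le> M k" for h :: "int \<Rightarrow> 'a"
    by (rule summable_on_comparison_test[OF M]) (use that in auto)
  have "((\<lambda>r. \<Sum>i. f r (int_decode i)) \<longlongrightarrow> (\<Sum>i. g (int_decode i))) F"
  proof -
    have "\<forall>\<^sub>F (i, r) in at_top \<times>\<^sub>F F. norm (f r (int_decode i)) \<le> M (int_decode i)"
      unfolding case_prod_unfold
      using eventually_compose_filterlim[OF bd filterlim_snd[of F at_top]] by eventually_elim auto
    from tannerys_theorem[of "\<lambda>i r. f r (int_decode i)", OF lim this sM False] show ?thesis by blast
  qed
  moreover have "(\<Sum>i. g (int_decode i)) = (\<Sum>\<^sub>\<infinity>k. g k)"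
    using sums_int_decode[OF abs[OF gM]] by (rule sums_unique[symmetric])
  moreover have "\<forall>\<^sub>F r in F. (\<Sum>i. f r (int_decode i)) = (\<Sum>\<^sub>\<infinity>k. f r k)"
    using bd by eventually_elim (rule sums_unique[symmetric, OF sums_int_decode[OF abs]], blast)
  ultimately show ?thesis
    by (simp add: tendsto_cong)
qed simp

lemma infsum_Cauchy_Schwarz:
  fixes f g :: "'i \<Rightarrow> real"
  assumes f: "(\<lambda>k. (f k)\<^sup>2) summable_on A" and g: "(\<lambda>k. (g k)\<^sup>2) summable_on A"
  shows "(\<lambda>k. \<bar>f k * g k\<bar>) summable_on A"
    and "(\<Sum>\<^sub>\<infinity>k\<in>A. \<bar>f k * g k\<bar>) \<le> sqrt (\<Sum>\<^sub>\<infinity>k\<in>A. (f k)\<^sup>2) * sqrt (\<Sum>\<^sub>\<infinity>k\<in>A. (g k)\<^sup>2)"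
proof -
  have le: "(\<Sum>k\<in>B. \<bar>f k * g k\<bar>) \<le> sqrt (\<Sum>\<^sub>\<infinity>k\<in>A. (f k)\<^sup>2) * sqrt (\<Sum>\<^sub>\<infinity>k\<in>A. (g k)\<^sup>2)"
    if "finite B" "B \<subseteq> A" for B
  proof -
    have "(\<Sum>k\<in>B. \<bar>f k\<bar> * \<bar>g k\<bar>) \<le> L2_set f B * L2_set g B"
      by (rule L2_set_mult_ineq)
    also have "\<dots> \<le> sqrt (\<Sum>\<^sub>\<infinity>k\<in>A. (f k)\<^sup>2) * sqrt (\<Sum>\<^sub>\<infinity>k\<in>A. (g k)\<^sup>2)"
      unfolding L2_set_def using that f g
      by (intro mult_mono real_sqrt_le_mono finite_sum_le_infsum) (auto simp: infsum_nonneg sum_nonneg)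
    finally show ?thesis by (simp add: abs_mult)
  qed
  show s: "(\<lambda>k. \<bar>f k * g k\<bar>) summable_on A"
    by (rule nonneg_bounded_partial_sums_imp_summable_on[of _ _ "sqrt (\<Sum>\<^sub>\<infinity>k\<in>A. (f k)\<^sup>2) * sqrt (\<Sum>\<^sub>\<infinity>k\<in>A. (g k)\<^sup>2)"])
       (auto intro!: eventually_finite_subsets_at_top_weakI le)
  show "(\<Sum>\<^sub>\<infinity>k\<in>A. \<bar>f k * g k\<bar>) \<le> sqrt (\<Sum>\<^sub>\<infinity>k\<in>A. (f k)\<^sup>2) * sqrt (\<Sum>\<^sub>\<infinity>k\<in>A. (g k)\<^sup>2)"
    by (rule infsum_le_finite_sums[OF s le])
qed

text \<open>The shift by \<open>1\<close> lets the mean value take part in all estimates by powers of the frequency.\<close>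

definition wt :: "int \<Rightarrow> real" where
  "wt k = 1 + real_of_int \<bar>k\<bar>"

lemma wt_ge_1: "wt k \<ge> 1" and wt_pos: "wt k > 0" and wt_nz: "wt k \<noteq> 0"
  by (auto simp: wt_def add_nonneg_eq_0_iff)

lemma wt_uminus [simp]: "wt (- k) = wt k"
  by (simp add: wt_def)

lemma wt_triangle: "wt k \<le> wt j + wt (k - j)"
  by (simp add: wt_def)

lemma wt_le_abs: "k \<noteq> 0 \<Longrightarrow> wt k \<le> 2 * real_of_int \<bar>k\<bar>"
  unfolding wt_def by linarith

lemma abs_le_wt: "real_of_int \<bar>k\<bar> \<le> wt k"
  by (simp add: wt_def)

lemma summable_wt:
  assumes "s > 1"
  shows "(\<lambda>k. wt k powr (- s)) summable_on UNIV"
proof -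
  have "summable (\<lambda>n. real (Suc n) powr (- s))"
    using assms by (subst summable_Suc_iff) (simp add: summable_real_powr_iff)
  then have n: "(\<lambda>n. wt (int n) powr (- s)) summable_on UNIV"
    by (intro norm_summable_imp_summable_on) (simp add: wt_def add.commute)
  have "((\<lambda>k. wt k powr (- s)) summable_on range int)"
    by (subst summable_on_reindex) (use n in \<open>auto simp: o_def\<close>)
  moreover have "((\<lambda>k. wt k powr (- s)) summable_on range (\<lambda>n. - int n))"
    by (subst summable_on_reindex) (use n in \<open>auto simp: o_def inj_def\<close>)
  ultimately have "(\<lambda>k. wt k powr (- s)) summable_on (range int \<union> range (\<lambda>n. - int n))"
    by (rule summable_on_union)
  moreover have "range int \<union> range (\<lambda>n. - int n) = UNIV"
    by (auto simp: image_iff) (metis int_cases2)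
  ultimately show ?thesis by simp
qed

lemma powr_split_le:
  fixes x y u v :: real
  assumes "x > 0" "y > 0" "u \<ge> 0" "v \<ge> 0"
  shows "x powr (-u) * y powr (-v) \<le> x powr (-(u+v)) + y powr (-(u+v))"
proof (cases "x \<le> y")
  case True
  have "y powr (-v) \<le> x powr (-v)"
    using True assms by (intro powr_mono2') auto
  then have "x powr (-u) * y powr (-v) \<le> x powr (-u) * x powr (-v)"
    by (intro mult_left_mono) auto
  also have "\<dots> = x powr (-(u+v))" by (simp add: powr_add[symmetric])
  finally show ?thesis by (smt (verit) powr_ge_zero)
next
  case False
  have "x powr (-u) \<le> y powr (-u)"
    using False assms by (intro powr_mono2') auto
  then have "x powr (-u) * y powr (-v) \<le> y powr (-u) * y powr (-v)"
    by (intro mult_right_mono) auto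
  also have "\<dots> = y powr (-(u+v))" by (simp add: powr_add[symmetric])
  finally show ?thesis by (smt (verit) powr_ge_zero)
qed

text \<open>The larger of the two frequencies \<open>j\<close> and \<open>k - j\<close> is at least \<open>\<bar>k\<bar> / 2\<close>; it pays for the decay in
  \<open>k\<close> and the remaining decay makes the sum converge.\<close>

lemma convolution_weights:
  assumes "0 \<le> \<sigma>" "\<sigma> \<le> a" "\<sigma> \<le> b" "a + b - \<sigma> > 1"
  obtains C where "C \<ge> 0"
    "\<And>k. (\<lambda>j. wt j powr (-a) * wt (k - j) powr (-b)) summable_on UNIV"
    "\<And>k. (\<Sum>\<^sub>\<infinity>j. wt j powr (-a) * wt (k - j) powr (-b)) \<le> C * wt k powr (-\<sigma>)"
proof -
  define s where "s = a + b - \<sigma>"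
  define W where "W = (\<Sum>\<^sub>\<infinity>k. wt k powr (- s))"
  have sW: "(\<lambda>j. wt j powr (- s)) summable_on UNIV"
    using assms by (intro summable_wt) (simp add: s_def)
  have bij: "bij_betw (\<lambda>j. k - j) UNIV (UNIV :: int set)" for k
    by (rule bij_betwI[where g="\<lambda>j. k - j"]) auto
  have sW': "(\<lambda>j. wt (k - j) powr (- s)) summable_on UNIV" for k
    using summable_on_reindex_bij_betw[OF bij, of "\<lambda>j. wt j powr (-s)" k] sW by simp
  have W': "(\<Sum>\<^sub>\<infinity>j. wt (k - j) powr (- s)) = W" for k
    unfolding W_def by (rule infsum_reindex_bij_betw[OF bij])
  let ?B = "2 powr (1 + \<sigma>)"
  have le: "wt j powr (-a) * wt (k - j) powr (-b) \<le>
      (?B * wt k powr (-\<sigma>)) * (wt j powr (-s) + wt (k - j) powr (-s))" for j k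
  proof -
    have "wt k powr \<sigma> \<le> 2 powr \<sigma> * (wt j powr \<sigma> + wt (k - j) powr \<sigma>)"
    proof -
      have "wt k \<le> 2 * max (wt j) (wt (k - j))" using wt_triangle[of k j] by auto
      then have "wt k powr \<sigma> \<le> (2 * max (wt j) (wt (k - j))) powr \<sigma>"
        using assms wt_pos[of k] by (intro powr_mono2) auto
      also have "\<dots> = 2 powr \<sigma> * max (wt j) (wt (k - j)) powr \<sigma>"
        using wt_pos[of j] wt_pos[of "k - j"] by (intro powr_mult)
      also have "\<dots> \<le> 2 powr \<sigma> * (wt j powr \<sigma> + wt (k - j) powr \<sigma>)"
        by (intro mult_left_mono) (auto simp: max_def)
      finally show ?thesis .
    qed
    then have "wt j powr (-a) * wt (k - j) powr (-b) * wt k powr \<sigma>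
        \<le> wt j powr (-a) * wt (k - j) powr (-b) * (2 powr \<sigma> * (wt j powr \<sigma> + wt (k - j) powr \<sigma>))"
      by (intro mult_left_mono) auto
    also have "\<dots> = 2 powr \<sigma> * (wt j powr (-(a-\<sigma>)) * wt (k - j) powr (-b) + wt j powr (-a) * wt (k - j) powr (-(b-\<sigma>)))"
    proof -
      have "wt j powr (-(a-\<sigma>)) = wt j powr (-a) * wt j powr \<sigma>"
           "wt (k-j) powr (-(b-\<sigma>)) = wt (k-j) powr (-b) * wt (k-j) powr \<sigma>"
        by (simp_all add: powr_add[symmetric])
      then show ?thesis by (simp add: algebra_simps)
    qed
    also have "\<dots> \<le> 2 powr \<sigma> * ((wt j powr (-s) + wt (k - j) powr (-s)) + (wt j powr (-s) + wt (k - j) powr (-s)))"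
    proof -
      have "wt j powr (-(a-\<sigma>)) * wt (k - j) powr (-b) \<le> wt j powr (-s) + wt (k - j) powr (-s)"
        using powr_split_le[OF wt_pos wt_pos, of "a - \<sigma>" b j "k - j"] assms by (simp add: s_def algebra_simps)
      moreover have "wt j powr (-a) * wt (k - j) powr (-(b-\<sigma>)) \<le> wt j powr (-s) + wt (k - j) powr (-s)"
        using powr_split_le[OF wt_pos wt_pos, of a "b - \<sigma>" j "k - j"] assms by (simp add: s_def algebra_simps)
      ultimately show ?thesis by (intro mult_left_mono add_mono) auto
    qed
    also have "\<dots> = ?B * (wt j powr (-s) + wt (k - j) powr (-s))"
      by (simp add: powr_add algebra_simps)
    finally have "wt j powr (-a) * wt (k - j) powr (-b) * wt k powr \<sigma> \<le> ?B * (wt j powr (-s) + wt (k - j) powr (-s))" .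
    then show ?thesis
      using wt_pos[of k] by (simp add: powr_minus field_simps)
  qed
  have dom: "(\<lambda>j. (?B * wt k powr (-\<sigma>)) * (wt j powr (-s) + wt (k - j) powr (-s))) summable_on UNIV" for k
    by (intro summable_on_cmult_right summable_on_add sW sW')
  have sum: "(\<lambda>j. wt j powr (-a) * wt (k - j) powr (-b)) summable_on UNIV" for k
    by (rule summable_on_comparison_test[OF dom[of k]]) (use le in auto)
  have "(\<Sum>\<^sub>\<infinity>j. wt j powr (-a) * wt (k - j) powr (-b)) \<le> (?B * 2 * W) * wt k powr (-\<sigma>)" for k
  proof -
    have "(\<Sum>\<^sub>\<infinity>j. wt j powr (-a) * wt (k - j) powr (-b)) \<le> (\<Sum>\<^sub>\<infinity>j. (?B * wt k powr (-\<sigma>)) * (wt j powr (-s) + wt (k - j) powr (-s)))"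
      by (intro infsum_mono sum dom le)
    also have "\<dots> = (?B * wt k powr (-\<sigma>)) * (W + W)"
      by (simp add: infsum_cmult_right' infsum_add[OF sW sW'] W' W_def[symmetric])
    finally show ?thesis by (simp add: algebra_simps)
  qed
  moreover have "?B * 2 * W \<ge> 0" unfolding W_def by (auto intro!: mult_nonneg_nonneg infsum_nonneg)
  ultimately show ?thesis using sum that by blast
qed

section \<open>Absolutely convergent Fourier series and products\<close>

definition fser :: "(int \<Rightarrow> complex) \<Rightarrow> real \<Rightarrow> complex" where
  "fser c x = (\<Sum>\<^sub>\<infinity>k. c k * cis (of_int k * x))"

lemma abs_summable_fser: "(\<lambda>k. norm (c k)) summable_on UNIV \<Longrightarrow> (\<lambda>k. norm (c k * cis (of_int k * x))) summable_on UNIV"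
  by (simp add: norm_mult)

lemma norm_fser_diff_psum:
  assumes c: "(\<lambda>k. norm (c k)) summable_on UNIV"
  shows "norm (fser c x - psum c {..<n} x) \<le> (\<Sum>i. norm (c (int_decode (i + n))))"
proof -
  have s: "summable (\<lambda>i. norm (c (int_decode i)))"
    using c by (subst (asm) summable_int_decode) auto
  have s1: "(\<lambda>i. c (int_decode i) * cis (of_int (int_decode i) * x)) sums fser c x"
    unfolding fser_def by (rule sums_int_decode[OF abs_summable_fser[OF c]])
  from sums_split_initial_segment[OF this, of n]
  have "fser c x - psum c {..<n} x = (\<Sum>i. c (int_decode (i + n)) * cis (of_int (int_decode (i + n)) * x))"
    unfolding psum_def by (rule sums_unique)
  also have "norm \<dots> \<le> (\<Sum>i. norm (c (int_decode (i + n)) * cis (of_int (int_decode (i + n)) * x)))"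
    using summable_ignore_initial_segment[OF s, of n] by (intro summable_norm) (simp add: norm_mult)
  finally show ?thesis by (simp add: norm_mult)
qed

lemma tail_tendsto_0:
  assumes c: "(\<lambda>k. norm (c k)) summable_on UNIV"
  shows "(\<lambda>n. \<Sum>i. norm (c (int_decode (i + n)))) \<longlonglongrightarrow> 0"
  using suminf_exist_split2[of "\<lambda>i. norm (c (int_decode i))"] c by (subst (asm) summable_int_decode) auto

lemma continuous_fser:
  assumes c: "(\<lambda>k. norm (c k)) summable_on UNIV"
  shows "continuous_on UNIV (fser c)"
proof (rule uniform_limit_theorem)
  show "\<forall>\<^sub>F n in sequentially. continuous_on UNIV (psum c {..<n})"
    by (simp add: continuous_psum)
  show "uniform_limit UNIV (\<lambda>n. psum c {..<n}) (fser c) sequentially"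
  proof (rule uniform_limitI)
    fix e :: real assume "e > 0"
    then have "\<forall>\<^sub>F n in sequentially. (\<Sum>i. norm (c (int_decode (i + n)))) < e"
      using order_tendstoD(2)[OF tail_tendsto_0[OF c]] by blast
    then show "\<forall>\<^sub>F n in sequentially. \<forall>x\<in>UNIV. dist (psum c {..<n} x) (fser c x) < e"
      by eventually_elim
        (simp only: dist_norm norm_minus_commute, use le_less_trans[OF norm_fser_diff_psum[OF c]] in blast)
  qed
qed simp

lemma fser_periodic: "fser c (x + 2 * pi) = fser c x"
  unfolding fser_def
proof (rule infsum_cong)
  fix k :: int
  have "cis (of_int k * (x + 2 * pi)) = cis (of_int k * x) * cis (2 * pi * of_int k)"
    by (simp add: cis_mult algebra_simps)
  then show "c k * cis (of_int k * (x + 2 * pi)) = c k * cis (of_int k * x)"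
    by (simp add: cis_multiple_2pi)
qed

lemma norm_fser_le: "(\<lambda>k. norm (c k)) summable_on UNIV \<Longrightarrow> norm (fser c x) \<le> (\<Sum>\<^sub>\<infinity>k. norm (c k))"
  unfolding fser_def using norm_infsum_bound[OF abs_summable_fser[of c x]] by (simp add: norm_mult)

lemma fc_mult_psum:
  assumes "integrable circ u" "finite I"
  shows "fc (\<lambda>x. psum c I x * u x) k = (\<Sum>i\<in>I. c (int_decode i) * fc u (k - int_decode i))"
proof -
  have "fc (\<lambda>x. psum c I x * u x) k = fc (\<lambda>x. \<Sum>i\<in>I. c (int_decode i) * (u x * cis (of_int (int_decode i) * x))) k"
    by (rule fc_cong) (simp only: psum_def sum_distrib_right, simp add: mult_ac)
  also have "\<dots> = (\<Sum>i\<in>I. c (int_decode i) * fc u (k - int_decode i))"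
    using assms by (subst fc_sum) (auto simp: fc_mult_left fc_mult_cis intro!: integrable_mult_right integrable_mult_cis)
  finally show ?thesis .
qed

text \<open>A product with an absolutely convergent series only needs the other factor to be integrable.\<close>

lemma fc_mult_fser:
  assumes u: "integrable circ u" and c: "(\<lambda>k. norm (c k)) summable_on UNIV"
  shows "integrable circ (\<lambda>x. fser c x * u x)"
    and "(\<lambda>j. norm (c j * fc u (k - j))) summable_on UNIV"
    and "fc (\<lambda>x. fser c x * u x) k = (\<Sum>\<^sub>\<infinity>j. c j * fc u (k - j))"
proof -
  show i: "integrable circ (\<lambda>x. fser c x * u x)"
    using integrable_mult_continuous[OF u continuous_fser[OF c]] by (simp add: mult.commute)
  have ip: "integrable circ (\<lambda>x. psum c I x * u x)" for I
    using integrable_mult_continuous[OF u continuous_psum[of _ c I]] by (simp add: mult.commute)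
  let ?U = "\<integral>x. norm (u x) \<partial>circ"
  show s: "(\<lambda>j. norm (c j * fc u (k - j))) summable_on UNIV"
  proof (rule summable_on_comparison_test)
    show "(\<lambda>j. norm (c j) * ((1 / (2 * pi)) * ?U)) summable_on UNIV"
      by (intro summable_on_cmult_left c)
    show "norm (c j * fc u (k - j)) \<le> norm (c j) * ((1 / (2 * pi)) * ?U)" for j
      unfolding norm_mult by (intro mult_left_mono norm_fc_le u) simp
  qed simp
  have "(\<lambda>n. fc (\<lambda>x. psum c {..<n} x * u x) k) \<longlonglongrightarrow> fc (\<lambda>x. fser c x * u x) k"
  proof (rule LIM_zero_cancel[OF Lim_null_comparison])
    show "(\<lambda>n. (1 / (2 * pi)) * ((\<Sum>i. norm (c (int_decode (i + n)))) * ?U)) \<longlonglongrightarrow> 0"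
      by (intro tendsto_mult_right_zero tendsto_mult_left_zero tail_tendsto_0 c)
    have "norm (fc (\<lambda>x. psum c {..<n} x * u x) k - fc (\<lambda>x. fser c x * u x) k)
        \<le> (1 / (2 * pi)) * ((\<Sum>i. norm (c (int_decode (i + n)))) * ?U)" for n
    proof -
      have "norm (fc (\<lambda>x. psum c {..<n} x * u x) k - fc (\<lambda>x. fser c x * u x) k)
          = norm (fc (\<lambda>x. psum c {..<n} x * u x - fser c x * u x) k)"
        using i ip by (subst fc_diff) auto
      also have "\<dots> \<le> (1 / (2 * pi)) * (\<integral>x. norm (psum c {..<n} x * u x - fser c x * u x) \<partial>circ)"
        by (intro norm_fc_le integrable_diff i ip)
      also have "\<dots> \<le> (1 / (2 * pi)) * (\<integral>x. (\<Sum>i. norm (c (int_decode (i + n)))) * norm (u x) \<partial>circ)"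
      proof (intro mult_left_mono integral_mono)
        fix x
        have "norm (psum c {..<n} x * u x - fser c x * u x) = norm (fser c x - psum c {..<n} x) * norm (u x)"
          by (simp add: left_diff_distrib[symmetric] norm_mult norm_minus_commute)
        also have "\<dots> \<le> (\<Sum>i. norm (c (int_decode (i + n)))) * norm (u x)"
          by (intro mult_right_mono norm_fser_diff_psum c) auto
        finally show "norm (psum c {..<n} x * u x - fser c x * u x) \<le> (\<Sum>i. norm (c (int_decode (i + n)))) * norm (u x)" .
      qed (use i ip u in auto)
      finally show ?thesis by simp
    qed
    then show "\<forall>\<^sub>F n in sequentially. norm (fc (\<lambda>x. psum c {..<n} x * u x) k - fc (\<lambda>x. fser c x * u x) k)
        \<le> (1 / (2 * pi)) * ((\<Sum>i. norm (c (int_decode (i + n)))) * ?U)" by simp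
  qed
  moreover have "(\<lambda>n. fc (\<lambda>x. psum c {..<n} x * u x) k) \<longlonglongrightarrow> (\<Sum>\<^sub>\<infinity>j. c j * fc u (k - j))"
    using sums_int_decode[OF s] by (simp add: fc_mult_psum[OF u] sums_def)
  ultimately show "fc (\<lambda>x. fser c x * u x) k = (\<Sum>\<^sub>\<infinity>j. c j * fc u (k - j))"
    by (rule LIMSEQ_unique)
qed

lemma fc_fser:
  assumes c: "(\<lambda>k. norm (c k)) summable_on UNIV"
  shows "fc (fser c) k = c k"
proof -
  have 1: "fc (\<lambda>_. 1) j = (if j = 0 then 1 else 0)" for j
    using fc_cis[of 0 j] by auto
  have "fc (fser c) k = (\<Sum>\<^sub>\<infinity>j. c j * fc (\<lambda>_. 1) (k - j))"
    using fc_mult_fser(3)[OF _ c, of "\<lambda>_. 1" k] by simp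
  also have "\<dots> = (\<Sum>\<^sub>\<infinity>j\<in>{k}. c j * fc (\<lambda>_. 1) (k - j))"
    by (rule infsum_cong_neutral) (auto simp: 1)
  finally show ?thesis by (simp add: 1)
qed

text \<open>The partial sums of \<open>u\<close> converge in \<open>L\<^sup>2\<close>, so their products with \<open>v\<close> converge in \<open>L\<^sup>1\<close>.\<close>

lemma fc_mult_L2:
  assumes u: "circ_L2 u" and v: "circ_L2 v"
  shows "(\<lambda>j. norm (fc u j * fc v (k - j))) summable_on UNIV"
    and "fc (\<lambda>x. u x * v x) k = (\<Sum>\<^sub>\<infinity>j. fc u j * fc v (k - j))"
proof -
  let ?s = "\<lambda>n. psum (fc u) {..<n}"
  have bij: "bij_betw (\<lambda>j. k - j) UNIV (UNIV :: int set)"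
    by (rule bij_betwI[where g="\<lambda>j. k - j"]) auto
  have "(\<lambda>j. (norm (fc v (k - j)))\<^sup>2) summable_on UNIV"
    using summable_on_reindex_bij_betw[OF bij, of "\<lambda>j. (norm (fc v j))\<^sup>2"] Bessel(1)[OF v] by simp
  from infsum_Cauchy_Schwarz(1)[OF Bessel(1)[OF u] this]
  show s: "(\<lambda>j. norm (fc u j * fc v (k - j))) summable_on UNIV"
    by (simp add: norm_mult abs_mult)
  have i: "integrable circ (\<lambda>x. u x * v x)" by (intro circ_L2_mult u v)
  have ip: "integrable circ (\<lambda>x. psum (fc u) I x * v x)" for I by (intro circ_L2_mult circ_L2_psum v)
  have "(\<lambda>n. fc (\<lambda>x. ?s n x * v x) k) \<longlonglongrightarrow> fc (\<lambda>x. u x * v x) k"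
  proof (rule LIM_zero_cancel[OF Lim_null_comparison])
    show "(\<lambda>n. (1 / (2 * pi)) * (n2 (\<lambda>x. u x - ?s n x) * n2 v)) \<longlonglongrightarrow> 0"
      by (intro tendsto_mult_right_zero tendsto_mult_left_zero n2_psum_tendsto u)
    have "norm (fc (\<lambda>x. ?s n x * v x) k - fc (\<lambda>x. u x * v x) k)
        \<le> (1 / (2 * pi)) * (n2 (\<lambda>x. u x - ?s n x) * n2 v)" for n
    proof -
      have "norm (fc (\<lambda>x. ?s n x * v x) k - fc (\<lambda>x. u x * v x) k)
          = norm (fc (\<lambda>x. u x * v x - ?s n x * v x) k)"
        using i ip by (subst fc_diff) (auto simp: norm_minus_commute)
      also have "\<dots> \<le> (1 / (2 * pi)) * (\<integral>x. norm (u x * v x - ?s n x * v x) \<partial>circ)"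
        by (intro norm_fc_le integrable_diff i ip)
      also have "\<dots> \<le> (1 / (2 * pi)) * (n2 (\<lambda>x. u x - ?s n x) * n2 v)"
        using circ_L2_mult(2)[OF circ_L2_diff[OF u circ_L2_psum] v, of "fc u" "{..<n}"]
        by (intro mult_left_mono) (auto simp: left_diff_distrib)
      finally show ?thesis .
    qed
    then show "\<forall>\<^sub>F n in sequentially. norm (fc (\<lambda>x. ?s n x * v x) k - fc (\<lambda>x. u x * v x) k)
        \<le> (1 / (2 * pi)) * (n2 (\<lambda>x. u x - ?s n x) * n2 v)" by simp
  qed
  moreover have "(\<lambda>n. fc (\<lambda>x. ?s n x * v x) k) \<longlonglongrightarrow> (\<Sum>\<^sub>\<infinity>j. fc u j * fc v (k - j))"
    using sums_int_decode[OF s] circ_L2_imp_integrable[OF v] by (simp add: fc_mult_psum sums_def)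
  ultimately show "fc (\<lambda>x. u x * v x) k = (\<Sum>\<^sub>\<infinity>j. fc u j * fc v (k - j))"
    by (rule LIMSEQ_unique)
qed

subsection \<open>Periodicity\<close>

definition per2pi :: "(real \<Rightarrow> 'a) \<Rightarrow> bool" where
  "per2pi f \<longleftrightarrow> (\<forall>x. f (x + 2 * pi) = f x)"

lemma per2pi_int:
  assumes "per2pi f" shows "f (x + 2 * pi * of_int n) = f x"
proof -
  have nat: "f (x + 2 * pi * real n) = f x" for x n
  proof (induction n)
    case (Suc n)
    have "f (x + 2 * pi * real (Suc n)) = f ((x + 2 * pi * real n) + 2 * pi)" by (simp add: algebra_simps)
    then show ?case using Suc assms by (simp add: per2pi_def)
  qed simp
  show ?thesis
  proof (cases "n \<ge> 0")
    case True
    then show ?thesis using nat[of x "nat n"] by simp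
  next
    case False
    then show ?thesis using nat[of "x + 2 * pi * of_int n" "nat (- n)"] by (simp add: algebra_simps)
  qed
qed

text \<open>The representative in \<open>[-\<pi>, \<pi>)\<close>; the distance \<^const>\<open>vartheta\<close> is defined through it.\<close>

definition reduce :: "real \<Rightarrow> real" where
  "reduce x = x - 2 * pi * of_int \<lfloor>(x + pi) / (2 * pi)\<rfloor>"

lemma reduce_bounds: "-pi \<le> reduce x" "reduce x < pi"
proof -
  let ?n = "\<lfloor>(x + pi) / (2 * pi)\<rfloor>"
  have "of_int ?n \<le> (x + pi) / (2 * pi)" "(x + pi) / (2 * pi) < of_int ?n + 1" by linarith+
  then have "of_int ?n * (2 * pi) \<le> x + pi" "x + pi < (of_int ?n + 1) * (2 * pi)"
    using pos_le_divide_eq[of "2 * pi" "of_int ?n" "x + pi"] pos_divide_less_eq[of "2 * pi" "x + pi" "of_int ?n + 1"]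
    by (simp_all only: pi_gt_zero) (simp_all only: zero_less_mult_iff zero_less_numeral pi_gt_zero simp_thms)
  then show "-pi \<le> reduce x" "reduce x < pi"
    by (simp_all add: reduce_def algebra_simps)
qed

lemma reduce_id: "-pi \<le> x \<Longrightarrow> x < pi \<Longrightarrow> reduce x = x"
proof -
  assume "-pi \<le> x" "x < pi"
  then have "\<lfloor>(x + pi) / (2 * pi)\<rfloor> = 0" by (simp add: floor_eq_iff field_simps)
  then show ?thesis by (simp add: reduce_def)
qed

lemma per2pi_reduce: "per2pi f \<Longrightarrow> f (reduce x) = f x"
  using per2pi_int[of f "reduce x" "\<lfloor>(x + pi) / (2 * pi)\<rfloor>"] by (simp add: reduce_def)

lemma reduce_periodic: "reduce (x + 2 * pi) = reduce x"
proof -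
  have "(x + 2 * pi + pi) / (2 * pi) = (x + pi) / (2 * pi) + 1" by (simp add: field_simps)
  then show ?thesis by (simp add: reduce_def algebra_simps)
qed

lemma measurable_reduce [measurable]: "reduce \<in> borel_measurable borel"
  unfolding reduce_def[abs_def] by measurable

text \<open>The series is continuous and has the coefficients of \<open>u\<close>; by uniqueness the two functions agree almost
  everywhere, hence everywhere.\<close>

theorem eq_fser:
  assumes u: "continuous_on UNIV u" "per2pi u" and s: "(\<lambda>k. norm (fc u k)) summable_on UNIV"
  shows "u x = fser (fc u) x"
proof -
  have "AE x in circ. u x = fser (fc u) x"
    using u(1) continuous_fser[OF s] fc_fser[OF s]
    by (intro fc_eq_imp_AE_eq circ_L2_imp_integrable circ_L2_continuous) auto
  then have "u y = fser (fc u) y" if "y \<in> {-pi..pi}" for y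
    by (rule AE_eq_imp_eq_continuous[OF _ continuous_on_subset[OF u(1)] continuous_on_subset[OF continuous_fser[OF s]] that]) auto
  then have "u (reduce x) = fser (fc u) (reduce x)"
    using reduce_bounds[of x] by auto
  then show ?thesis
    using per2pi_reduce[OF u(2)] per2pi_reduce[of "fser (fc u)"] by (simp add: per2pi_def fser_periodic)
qed

lemma eq_if_fc_eq:
  assumes "continuous_on UNIV u" "per2pi u" "continuous_on UNIV v" "per2pi v" "\<And>k. fc u k = fc v k"
  shows "u x = v x"
proof -
  have "AE x in circ. u x = v x"
    using assms by (intro fc_eq_imp_AE_eq circ_L2_imp_integrable circ_L2_continuous) auto
  then have "u y = v y" if "y \<in> {-pi..pi}" for y
    by (rule AE_eq_imp_eq_continuous[OF _ continuous_on_subset[OF assms(1)] continuous_on_subset[OF assms(3)] that]) auto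
  then have "u (reduce x) = v (reduce x)"
    using reduce_bounds[of x] by auto
  then show ?thesis
    using per2pi_reduce[OF assms(2)] per2pi_reduce[OF assms(4)] by metis
qed

section \<open>Translations of periodic functions\<close>

lemma circ_lborel_Ioc:
  fixes f :: "real \<Rightarrow> 'b::{banach, second_countable_topology}"
  shows "integrable circ f \<longleftrightarrow> set_integrable lborel {-pi<..pi} f"
    and "integral\<^sup>L circ f = (LBINT x:{-pi<..pi}. f x)"
proof -
  have "set_integrable lborel {-pi..pi} f \<longleftrightarrow> set_integrable lborel {-pi<..pi} f"
    unfolding set_integrable_def
    by (rule integrable_discrete_difference[where X="{-pi}"]) (auto simp: indicator_def)
  then show "integrable circ f \<longleftrightarrow> set_integrable lborel {-pi<..pi} f"
    by (simp add: set_integrable_circ)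
  have "(LBINT x:{-pi..pi}. f x) = (LBINT x:{-pi<..pi}. f x)"
    unfolding set_lebesgue_integral_def
    by (rule integral_discrete_difference[where X="{-pi}"]) (auto simp: indicator_def)
  then show "integral\<^sup>L circ f = (LBINT x:{-pi<..pi}. f x)"
    by (simp add: set_integral_circ)
qed

lemma set_integral_shift:
  fixes f :: "real \<Rightarrow> 'b::{banach, second_countable_topology}"
  shows "set_integrable lborel {a<..b} (\<lambda>x. f (x + c)) \<longleftrightarrow> set_integrable lborel {a+c<..b+c} f"
    and "(LBINT x:{a<..b}. f (x + c)) = (LBINT x:{a+c<..b+c}. f x)"
proof -
  let ?g = "\<lambda>x. indicat_real {a+c<..b+c} x *\<^sub>R f x"
  have eq: "(\<lambda>x. indicat_real {a<..b} x *\<^sub>R f (x + c)) = (\<lambda>x. ?g (c + 1 * x))"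
    by (rule ext) (auto simp: indicator_def add.commute)
  show "set_integrable lborel {a<..b} (\<lambda>x. f (x + c)) \<longleftrightarrow> set_integrable lborel {a+c<..b+c} f"
    unfolding set_integrable_def eq using lborel_integrable_real_affine_iff[of 1 ?g c] by simp
  show "(LBINT x:{a<..b}. f (x + c)) = (LBINT x:{a+c<..b+c}. f x)"
    unfolding set_lebesgue_integral_def eq using lborel_integral_real_affine[of 1 ?g c] by simp
qed

lemma periodic_shift:
  fixes f :: "real \<Rightarrow> 'b::{banach, second_countable_topology}"
  assumes per: "per2pi f" and int: "integrable circ f"
  shows "integrable circ (\<lambda>x. f (x + c))"
    and "(\<integral>x. f (x + c) \<partial>circ) = (\<integral>x. f x \<partial>circ)"
proof -
  define a where "a = reduce (c - pi) + pi"
  have a: "0 \<le> a" "a \<le> 2 * pi" using reduce_bounds[of "c - pi"] by (auto simp: a_def)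
  have fa: "f (x + c) = f (x + a)" for x
    using per2pi_int[OF per, of "x + a" "\<lfloor>(c - pi + pi) / (2 * pi)\<rfloor>"]
    by (simp add: a_def reduce_def algebra_simps)
  have f2: "(\<lambda>x. f (x + 2 * pi)) = f" using per by (auto simp: per2pi_def)
  have i0: "set_integrable lborel {-pi<..pi} f" using int by (simp add: circ_lborel_Ioc)
  then have i1: "set_integrable lborel {pi<..3*pi} f"
    using set_integral_shift(1)[of "-pi" pi f "2*pi"] by (simp add: f2)
  have i2: "set_integrable lborel ({-pi<..pi} \<union> {pi<..3*pi}) f"
    by (intro set_integrable_Un i0 i1) auto
  have sub: "set_integrable lborel S f" if "S \<in> sets borel" "S \<subseteq> {-pi<..pi} \<union> {pi<..3*pi}" for S
    by (rule set_integrable_subset[OF i2]) (use that in auto)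
  have "set_integrable lborel {a-pi<..a+pi} f" using a by (intro sub) auto
  then show "integrable circ (\<lambda>x. f (x + c))"
    unfolding fa circ_lborel_Ioc using set_integral_shift(1)[of "-pi" pi f a] by (simp add: add.commute)
  have "(\<integral>x. f (x + c) \<partial>circ) = (LBINT x:{a-pi<..a+pi}. f x)"
    unfolding fa circ_lborel_Ioc using set_integral_shift(2)[of "-pi" pi f a] by (simp add: add.commute)
  also have "{a-pi<..a+pi} = {a-pi<..pi} \<union> {pi<..a+pi}" using a by auto
  also have "(LBINT x:{a-pi<..pi} \<union> {pi<..a+pi}. f x) = (LBINT x:{a-pi<..pi}. f x) + (LBINT x:{pi<..a+pi}. f x)"
    using a by (intro set_integral_Un sub) auto
  also have "(LBINT x:{pi<..a+pi}. f x) = (LBINT x:{-pi<..a-pi}. f x)"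
    using set_integral_shift(2)[of "-pi" "a-pi" f "2*pi", unfolded f2] by (simp add: algebra_simps)
  also have "(LBINT x:{a-pi<..pi}. f x) + (LBINT x:{-pi<..a-pi}. f x) = (LBINT x:{-pi<..a-pi} \<union> {a-pi<..pi}. f x)"
    using a by (subst set_integral_Un) (auto intro!: sub)
  also have "{-pi<..a-pi} \<union> {a-pi<..pi} = {-pi<..pi}" using a by auto
  finally show "(\<integral>x. f (x + c) \<partial>circ) = (\<integral>x. f x \<partial>circ)" by (simp add: circ_lborel_Ioc)
qed

lemma integral_circ_reflect:
  fixes f :: "real \<Rightarrow> 'b::{banach, second_countable_topology}"
  shows "integrable circ (\<lambda>x. f (- x)) \<longleftrightarrow> integrable circ f"
    and "(\<integral>x. f (- x) \<partial>circ) = (\<integral>x. f x \<partial>circ)"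
proof -
  let ?g = "\<lambda>x. indicat_real {-pi..pi} x *\<^sub>R f x"
  have eq: "(\<lambda>x. indicat_real {-pi..pi} x *\<^sub>R f (- x)) = (\<lambda>x. ?g (0 + (-1) * x))"
    by (rule ext) (auto simp: indicator_def)
  show "integrable circ (\<lambda>x. f (- x)) \<longleftrightarrow> integrable circ f"
    unfolding set_integrable_circ[symmetric] set_integrable_def eq
    using lborel_integrable_real_affine_iff[of "-1" ?g 0] by simp
  show "(\<integral>x. f (- x) \<partial>circ) = (\<integral>x. f x \<partial>circ)"
    unfolding set_integral_circ[symmetric] set_lebesgue_integral_def eq
    using lborel_integral_real_affine[of "-1" ?g 0] by simp
qed

lemma periodic_convolution_shift:
  fixes f :: "real \<Rightarrow> 'b::{banach, second_countable_topology}"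
  assumes per: "per2pi f"
  shows "integrable circ (\<lambda>z. f (x - z)) \<longleftrightarrow> integrable circ f"
    and "(\<integral>z. f (x - z) \<partial>circ) = (\<integral>y. f y \<partial>circ)"
proof -
  have p: "per2pi (\<lambda>z. f (z + c))" for c
    using per by (auto simp: per2pi_def algebra_simps) (metis add.assoc add.commute)
  have e: "(\<lambda>z. f (x - z)) = (\<lambda>z. (\<lambda>y. f (y + x)) (- z))" by (simp add: algebra_simps)
  have r: "integrable circ (\<lambda>z. f (z + x)) \<longleftrightarrow> integrable circ f"
    using periodic_shift(1)[OF per] periodic_shift(1)[OF p[of x], of "-x"] by auto
  show i: "integrable circ (\<lambda>z. f (x - z)) \<longleftrightarrow> integrable circ f"
    unfolding e integral_circ_reflect(1)[of "\<lambda>y. f (y + x)"] by (rule r)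
  show "(\<integral>z. f (x - z) \<partial>circ) = (\<integral>y. f y \<partial>circ)"
  proof (cases "integrable circ f")
    case True
    then show ?thesis unfolding e integral_circ_reflect(2)[of "\<lambda>y. f (y + x)"] by (rule periodic_shift(2)[OF per])
  next
    case False
    then show ?thesis using i by (simp add: not_integrable_integral_eq)
  qed
qed

lemma periodic_set_integrable:
  fixes f :: "real \<Rightarrow> 'b::{banach, second_countable_topology}"
  assumes per: "per2pi f" and int: "integrable circ f"
  shows "set_integrable lborel {a<..b} f"
proof -
  have 1: "set_integrable lborel {c<..c+2*pi} f" for c
    using periodic_shift(1)[OF per int, of "c+pi"] set_integral_shift(1)[of "-pi" pi f "c+pi"]
    unfolding circ_lborel_Ioc by (simp add: algebra_simps)
  have 2: "set_integrable lborel {a<..a+2*pi*real n} f" for n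
  proof (induction n)
    case (Suc n)
    have "{a<..a+2*pi*real (Suc n)} = {a<..a+2*pi*real n} \<union> {a+2*pi*real n<..(a+2*pi*real n)+2*pi}"
    proof -
      have e: "a+2*pi*real (Suc n) = (a+2*pi*real n)+2*pi" by (simp add: algebra_simps)
      have "{a<..r+2*pi} = {a<..r} \<union> {r<..r+2*pi}" if "a \<le> r" for r
        using that pi_gt_zero by (auto simp del: pi_gt_zero)
      then show ?thesis unfolding e by simp
    qed
    then show ?case using Suc 1 by (simp only:) (intro set_integrable_Un, auto)
  qed (simp add: set_integrable_def)
  obtain n where "(b - a) < real n * (2 * pi)" using reals_Archimedean3[of "2*pi"] by auto
  then have "{a<..b} \<subseteq> {a<..a+2*pi*real n}" by (auto simp: algebra_simps)
  then show ?thesis by (intro set_integrable_subset[OF 2[of n]]) auto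
qed

section \<open>Vector valued functions\<close>

text \<open>Complex valued coordinate functions, to which the scalar theory applies.\<close>

definition cmp :: "(real \<Rightarrow> real^3) \<Rightarrow> 3 \<Rightarrow> real \<Rightarrow> complex" where
  "cmp f j x = complex_of_real (f x $ j)"

abbreviation cf :: "(real \<Rightarrow> real^3) \<Rightarrow> 3 \<Rightarrow> int \<Rightarrow> complex" where
  "cf f j \<equiv> fc (cmp f j)"

lemma fourier_nth: "fourier f k $ j = cf f j k"
  unfolding fourier_def fc_def cmp_def by (simp add: set_integral_circ)

lemma fourier_eq_iff: "fourier f k = v \<longleftrightarrow> (\<forall>j. cf f j k = v $ j)"
  by (simp add: vec_eq_iff fourier_nth)

lemma norm_vec_square: "(norm (v :: 'a::real_normed_vector^3))\<^sup>2 = (\<Sum>j\<in>UNIV. (norm (v $ j))\<^sup>2)"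
  by (simp add: norm_vec_def L2_set_def sum_nonneg)

lemma norm_vec_le_sum: "norm (v :: 'a::real_normed_vector^3) \<le> (\<Sum>j\<in>UNIV. norm (v $ j))"
  unfolding norm_vec_def by (rule L2_set_le_sum) simp

lemma fourier_uminus_nth: "cf f j (- k) = cnj (cf f j k)"
proof -
  have "(\<lambda>x. cnj (cmp f j x)) = cmp f j" by (auto simp: cmp_def)
  then show ?thesis using fc_cnj[of "cmp f j" "-k"] by simp
qed

lemma measurable_vec_iff:
  fixes f :: "'a \<Rightarrow> real^3"
  shows "f \<in> borel_measurable M \<longleftrightarrow> (\<forall>j. (\<lambda>x. f x $ j) \<in> borel_measurable M)"
proof
  assume "f \<in> borel_measurable M"
  then show "\<forall>j. (\<lambda>x. f x $ j) \<in> borel_measurable M"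
    by (auto intro!: measurable_compose[of f M borel "\<lambda>v. v $ _"] borel_measurable_continuous_onI continuous_intros)
next
  assume "\<forall>j. (\<lambda>x. f x $ j) \<in> borel_measurable M"
  then show "f \<in> borel_measurable M"
    by (subst borel_measurable_euclidean_space) (auto simp: Basis_vec_def inner_axis)
qed

lemma cmp_measurable_iff: "cmp f j \<in> borel_measurable M \<longleftrightarrow> (\<lambda>x. f x $ j) \<in> borel_measurable M"
proof
  assume "cmp f j \<in> borel_measurable M"
  then have "(\<lambda>x. Re (cmp f j x)) \<in> borel_measurable M" by measurable
  then show "(\<lambda>x. f x $ j) \<in> borel_measurable M" by (simp add: cmp_def)
next
  assume [measurable]: "(\<lambda>x. f x $ j) \<in> borel_measurable M"
  show "cmp f j \<in> borel_measurable M" unfolding cmp_def[abs_def] by measurable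
qed

lemma L2_circle_iff: "L2_circle f \<longleftrightarrow> per2pi f \<and> (\<forall>j. circ_L2 (cmp f j))"
proof -
  have sq: "(norm (f x))\<^sup>2 = (\<Sum>j\<in>UNIV. (norm (cmp f j x))\<^sup>2)" for x
    by (simp add: norm_vec_square cmp_def)
  have "(f \<in> borel_measurable circ \<and> integrable circ (\<lambda>x. (norm (f x))\<^sup>2)) \<longleftrightarrow> (\<forall>j. circ_L2 (cmp f j))"
  proof (intro iffI conjI allI)
    assume a: "f \<in> borel_measurable circ \<and> integrable circ (\<lambda>x. (norm (f x))\<^sup>2)"
    fix j
    have m [measurable]: "cmp f j \<in> borel_measurable circ"
      using a by (auto simp: cmp_measurable_iff measurable_vec_iff)
    have "integrable circ (\<lambda>x. (norm (cmp f j x))\<^sup>2)"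
    proof (rule integrable_bound[of _ "\<lambda>x. (norm (f x))\<^sup>2"])
      show "AE x in circ. norm ((norm (cmp f j x))\<^sup>2) \<le> norm ((norm (f x))\<^sup>2)"
        by (intro AE_I2) (simp only: sq real_norm_def abs_power2,
            rule order_trans[OF member_le_sum[of j UNIV "\<lambda>j. (norm (cmp f j _))\<^sup>2"] abs_ge_self], auto)
    qed (use a in auto)
    then show "circ_L2 (cmp f j)" by (auto simp: circ_L2_def)
  next
    assume a: "\<forall>j. circ_L2 (cmp f j)"
    then show "f \<in> borel_measurable circ"
      by (auto simp: circ_L2_def cmp_measurable_iff measurable_vec_iff)
    show "integrable circ (\<lambda>x. (norm (f x))\<^sup>2)"
      unfolding sq using a by (intro integrable_sum) (auto simp: circ_L2_def)
  qed
  then show ?thesis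
    unfolding L2_circle_def per2pi_def by (simp add: set_measurable_circ set_integrable_circ)
qed

lemma L2_circle_measurable: "L2_circle f \<Longrightarrow> f \<in> borel_measurable circ"
  by (simp add: L2_circle_def set_measurable_circ)

lemma L2_circle_square: "L2_circle f \<Longrightarrow> integrable circ (\<lambda>x. (norm (f x))\<^sup>2)"
  by (simp add: L2_circle_def set_integrable_circ)

lemma L2_circle_integrable:
  assumes "L2_circle f" shows "integrable circ f"
proof -
  have "integrable circ (\<lambda>x. 1 + (norm (f x))\<^sup>2)" using L2_circle_square[OF assms] by simp
  then show ?thesis
  proof (rule integrable_bound)
    have t: "t \<le> \<bar>1 + t\<^sup>2\<bar>" for t :: real
    proof -
      have "2 * t \<le> 1 + t\<^sup>2" using sum_squares_bound[of 1 t] by simp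
      then show ?thesis using zero_le_power2[of t] by linarith
    qed
    show "AE x in circ. norm (f x) \<le> norm (1 + (norm (f x))\<^sup>2)"
      by (rule AE_I2) (simp only: real_norm_def t)
  qed (rule L2_circle_measurable[OF assms])
qed

lemma integral_vec_nth:
  fixes f :: "'a \<Rightarrow> real^3"
  assumes "integrable M f" shows "integral\<^sup>L M f $ j = (\<integral>x. f x $ j \<partial>M)"
  using integral_bounded_linear[OF bounded_linear_vec_nth assms, of j] by simp

lemma has_sum_sum:
  fixes f :: "'i \<Rightarrow> 'k \<Rightarrow> 'b::real_normed_vector"
  assumes "finite I" "\<And>i. i \<in> I \<Longrightarrow> (f i has_sum s i) A"
  shows "((\<lambda>k. \<Sum>i\<in>I. f i k) has_sum (\<Sum>i\<in>I. s i)) A"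
  using assms by (induction I rule: finite_induct) (auto intro!: has_sum_add has_sum_0)

lemma L2_circle_summable:
  assumes "L2_circle f"
  shows "(\<lambda>k. (norm (fourier f k))\<^sup>2) summable_on UNIV"
    and "2 * pi * (\<Sum>\<^sub>\<infinity>k. (norm (fourier f k))\<^sup>2) = (\<integral>x. (norm (f x))\<^sup>2 \<partial>circ)"
proof -
  have c: "circ_L2 (cmp f j)" for j using assms by (simp add: L2_circle_iff)
  have sq: "(norm (fourier f k))\<^sup>2 = (\<Sum>j\<in>UNIV. (norm (cf f j k))\<^sup>2)" for k
    by (simp add: norm_vec_square fourier_nth)
  show "(\<lambda>k. (norm (fourier f k))\<^sup>2) summable_on UNIV"
    unfolding sq by (rule has_sum_imp_summable[OF has_sum_sum]) (auto intro!: has_sum_infsum Bessel(1) c)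
  have "2 * pi * (\<Sum>\<^sub>\<infinity>k. (norm (fourier f k))\<^sup>2) = (\<Sum>j\<in>UNIV. 2 * pi * (\<Sum>\<^sub>\<infinity>k. (norm (cf f j k))\<^sup>2))"
    unfolding sq sum_distrib_left[symmetric]
    by (intro arg_cong[where f="\<lambda>t. _ * t"] infsumI has_sum_sum) (auto intro!: has_sum_infsum Bessel(1) c)
  also have "\<dots> = (\<Sum>j\<in>UNIV. (n2 (cmp f j))\<^sup>2)" by (simp only: Parseval[OF c])
  also have "\<dots> = (\<integral>x. (\<Sum>j\<in>UNIV. (norm (cmp f j x))\<^sup>2) \<partial>circ)"
    unfolding n2_square using c by (subst integral_sum) (auto simp: circ_L2_def)
  also have "\<dots> = (\<integral>x. (norm (f x))\<^sup>2 \<partial>circ)"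
    by (simp add: norm_vec_square cmp_def)
  finally show "2 * pi * (\<Sum>\<^sub>\<infinity>k. (norm (fourier f k))\<^sup>2) = (\<integral>x. (norm (f x))\<^sup>2 \<partial>circ)" .
qed

text \<open>The scalar limits are only real almost everywhere and live on one period; the real parts of their
  values at the reduced points give a periodic real representative.\<close>

lemma vec_Riesz_Fischer:
  fixes c :: "int \<Rightarrow> complex^3"
  assumes s: "(\<lambda>k. (norm (c k))\<^sup>2) summable_on UNIV" and real: "\<And>k j. c (- k) $ j = cnj (c k $ j)"
  obtains f where "L2_circle f" "\<And>k. fourier f k = c k"
proof -
  have "\<exists>u. circ_L2 u \<and> (\<forall>k. fc u k = c k $ j)" for j
  proof -
    have "(\<lambda>k. (norm (c k $ j))\<^sup>2) summable_on UNIV"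
      by (rule summable_on_comparison_test[OF s]) (auto intro!: power_mono Finite_Cartesian_Product.norm_nth_le)
    then show ?thesis using Riesz_Fischer by metis
  qed
  then obtain u where u: "\<And>j. circ_L2 (u j)" "\<And>j k. fc (u j) k = c k $ j" by metis
  define f where "f x = (\<chi> j. Re (u j (reduce x)))" for x
  have um: "u j \<in> borel_measurable circ" for j using u(1)[of j] by (simp add: circ_L2_def)
  have ae: "AE x in circ. cmp f j x = (u j x + cnj (u j x)) / 2" for j
  proof -
    have "AE x in circ. x \<noteq> pi" unfolding AE_circ using AE_lborel_singleton[of pi] by eventually_elim auto
    moreover have "AE x in circ. x \<in> {-pi..pi}" by (simp add: AE_circ)
    ultimately show ?thesis
    proof eventually_elim
      case (elim x)
      then have "reduce x = x" by (intro reduce_id) auto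
      then show ?case by (simp add: cmp_def f_def complex_eq_iff)
    qed
  qed
  have m: "cmp f j \<in> borel_measurable circ" for j
  proof -
    have "(\<lambda>x. indicat_real {-pi..pi} x *\<^sub>R u j x) \<in> borel_measurable borel"
      using um[of j] unfolding circ_def by (subst (asm) borel_measurable_restrict_space_iff) auto
    then have "(\<lambda>x. Re (indicat_real {-pi..pi} (reduce x) *\<^sub>R u j (reduce x))) \<in> borel_measurable borel"
      by measurable
    moreover have "indicat_real {-pi..pi} (reduce x) = 1" for x
      using reduce_bounds[of x] by (auto simp: indicator_def)
    ultimately have "(\<lambda>x. Re (u j (reduce x))) \<in> borel_measurable borel" by simp
    then show ?thesis unfolding cmp_measurable_iff f_def by (intro measurable_circI) simp
  qed
  have g: "circ_L2 (\<lambda>x. (u j x + cnj (u j x)) / 2)" for j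
    using circ_L2_cmult[OF circ_L2_add[OF u(1) circ_L2_cnj[OF u(1)]], of "1/2" j j] by simp
  have "circ_L2 (cmp f j)" for j
  proof -
    have "integrable circ (\<lambda>x. (norm (cmp f j x))\<^sup>2) \<longleftrightarrow> integrable circ (\<lambda>x. (norm ((u j x + cnj (u j x)) / 2))\<^sup>2)"
    proof (rule integrable_cong_AE)
      show "AE x in circ. (norm (cmp f j x))\<^sup>2 = (norm ((u j x + cnj (u j x)) / 2))\<^sup>2"
        using ae[of j] by eventually_elim (simp only:)
    qed (use m[of j] um[of j] in auto)
    with g[of j] m[of j] show ?thesis by (simp add: circ_L2_def)
  qed
  moreover have "per2pi f" by (simp add: per2pi_def f_def reduce_periodic)
  moreover have "cf f j k = c k $ j" for j k
  proof -
    have "cf f j k = fc (\<lambda>x. (1/2) * (u j x + cnj (u j x))) k"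
      using ae[of j] g[of j] m[of j] um[of j] by (intro fc_cong_AE) auto
    also have "\<dots> = (1/2) * (fc (u j) k + cnj (fc (u j) (- k)))"
      using u(1)[of j] circ_L2_cnj[OF u(1), of j] circ_L2_imp_integrable
      by (simp only: fc_mult_left fc_add fc_cnj)
    finally show ?thesis by (simp add: u(2) real)
  qed
  ultimately show ?thesis
    using that[of f] by (auto simp: L2_circle_iff fourier_eq_iff)
qed

section \<open>The mean zero primitive\<close>

lemma integral_cis_interval:
  assumes "j \<noteq> 0" "a \<le> b"
  shows "(LBINT z:{a..b}. cis (of_int j * z)) = (cis (of_int j * b) - cis (of_int j * a)) / (\<i> * of_int j)"
proof -
  have d: "((\<lambda>x. cis (of_int j * x) / (\<i> * of_int j)) has_vector_derivative cis (of_int j * x)) (at x within S)"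
    for x :: real and S
  proof -
    have "((\<lambda>z. exp (\<i> * of_int j * z) / (\<i> * of_int j)) has_field_derivative exp (\<i> * of_int j * of_real x))
        (at (of_real x))"
      using assms by (auto intro!: derivative_eq_intros)
    from has_vector_derivative_real_field[OF this] show ?thesis
      by (simp add: cis_conv_exp mult.assoc)
  qed
  have "(LBINT z=a..b. cis (of_int j * z)) = cis (of_int j * b) / (\<i> * of_int j) - cis (of_int j * a) / (\<i> * of_int j)"
    by (intro interval_integral_FTC_finite d) (auto intro!: continuous_intros)
  then show ?thesis using assms by (simp add: interval_integral_Icc diff_divide_distrib)
qed

lemma integral_ident_cis:
  assumes "j \<noteq> 0"
  shows "(\<integral>z. complex_of_real z * cis (of_int j * z) \<partial>circ) = 2 * pi * cis (of_int j * pi) / (\<i> * of_int j)"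
proof -
  have d: "((\<lambda>x. of_real x * cis (of_int j * x) / (\<i> * of_int j) + cis (of_int j * x) / (of_int j)\<^sup>2)
      has_vector_derivative of_real x * cis (of_int j * x)) (at x within S)"
    for x :: real and S
  proof -
    have "((\<lambda>z. z * exp (\<i> * of_int j * z) / (\<i> * of_int j) + exp (\<i> * of_int j * z) / (of_int j)\<^sup>2) has_field_derivative
        of_real x * exp (\<i> * of_int j * of_real x)) (at (of_real x))"
      using assms by (auto intro!: derivative_eq_intros simp: field_simps power2_eq_square)
    from has_vector_derivative_real_field[OF this] show ?thesis
      by (simp add: cis_conv_exp mult.assoc)
  qed
  have "(LBINT z=-pi..pi. complex_of_real z * cis (of_int j * z)) =
     (of_real pi * cis (of_int j * pi) / (\<i> * of_int j) + cis (of_int j * pi) / (of_int j)\<^sup>2)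
     - (of_real (-pi) * cis (of_int j * (-pi)) / (\<i> * of_int j) + cis (of_int j * (-pi)) / (of_int j)\<^sup>2)"
    by (intro interval_integral_FTC_finite d) (auto intro!: continuous_intros)
  also have "cis (of_int j * (-pi)) = cis (of_int j * pi)"
  proof -
    have "cis (of_int j * pi) = cis (of_int j * (-pi)) * cis (2 * pi * of_int j)"
      by (simp add: cis_mult algebra_simps)
    then show ?thesis by (simp add: cis_multiple_2pi)
  qed
  finally have "(LBINT z=-pi..pi. complex_of_real z * cis (of_int j * z)) = 2 * pi * cis (of_int j * pi) / (\<i> * of_int j)"
    using assms by (simp add: field_simps)
  then show ?thesis by (simp add: interval_integral_Icc set_integral_circ[symmetric])
qed

lemma mean_zero_iff: "mean_zero f \<longleftrightarrow> (\<integral>x. f x \<partial>circ) = 0"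
  by (simp add: mean_zero_def set_integral_circ)

lemma mean_zero_fc:
  assumes "L2_circle f"
  shows "mean_zero f \<longleftrightarrow> (\<forall>j. cf f j 0 = 0)"
proof -
  have "cf f j 0 = (1 / (2 * pi)) *\<^sub>R complex_of_real ((\<integral>x. f x \<partial>circ) $ j)" for j
    unfolding fc_0 cmp_def using integral_vec_nth[OF L2_circle_integrable[OF assms]] by simp
  then show ?thesis by (simp add: mean_zero_iff vec_eq_iff)
qed

lemma interval_integrable_periodic:
  fixes f :: "real \<Rightarrow> real^3"
  assumes "L2_circle f"
  shows "interval_lebesgue_integrable lborel (ereal a) (ereal b) f"
proof -
  have "set_integrable lborel {c<..d} f" for c d
    using assms L2_circle_integrable by (intro periodic_set_integrable) (auto simp: L2_circle_iff)
  then have "set_integrable lborel {c<..<d} f" for c d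
    by (rule set_integrable_subset[of lborel "{c<..d}"]) auto
  then show ?thesis unfolding interval_lebesgue_integrable_def by simp
qed

lemma primitive_diff:
  assumes "L2_circle f"
  shows "primitive f b - primitive f a = (LBINT z=a..b. f z)"
proof -
  have "(LBINT z=-pi..a. f z) + (LBINT z=a..b. f z) = (LBINT z=-pi..b. f z)"
  proof (rule interval_integral_sum)
    show "interval_lebesgue_integrable lborel (min (ereal (- pi)) (min (ereal a) (ereal b)))
     (max (ereal (- pi)) (max (ereal a) (ereal b))) f"
      using interval_integrable_periodic[OF assms, of "min (-pi) (min a b)" "max (-pi) (max a b)"]
      by (simp add: min_def max_def split: if_splits)
  qed
  then show ?thesis unfolding primitive_def by (simp add: algebra_simps)
qed

lemma primitive_per2pi:
  assumes f: "L2_circle f" and m: "mean_zero f"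
  shows "per2pi (primitive f)"
  unfolding per2pi_def
proof
  fix x
  have "primitive f (x + 2 * pi) - primitive f x = (LBINT z=x..x+2*pi. f z)"
    using primitive_diff[OF f, of "x + 2*pi" x] by simp
  also have "\<dots> = (LBINT z:{x<..x+2*pi}. f z)"
    by (subst interval_integral_Ioc) auto
  also have "\<dots> = (\<integral>y. f (y + (x + pi)) \<partial>circ)"
    unfolding circ_lborel_Ioc using set_integral_shift(2)[of "-pi" pi f "x + pi"] by (simp add: algebra_simps)
  also have "\<dots> = 0"
    using f m periodic_shift(2)[of f "x + pi"] L2_circle_integrable[OF f] by (simp add: L2_circle_iff mean_zero_iff)
  finally show "primitive f (x + 2 * pi) = primitive f x" by simp
qed

lemma summable_inverse_square_int: "(\<lambda>k::int. (1 / real_of_int \<bar>k\<bar>)\<^sup>2) summable_on UNIV"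
proof (rule summable_on_comparison_test)
  show "(\<lambda>k. 4 * wt k powr (- 2)) summable_on UNIV"
    by (intro summable_on_cmult_right summable_wt) simp
  fix k :: int
  show "(1 / real_of_int \<bar>k\<bar>)\<^sup>2 \<le> 4 * wt k powr (- 2)"
  proof (cases "k = 0")
    case False
    have w: "wt k powr (-2) = 1 / (wt k)\<^sup>2"
      using wt_pos[of k] by (simp add: powr_minus_divide powr_numeral)
    have "1 / real_of_int \<bar>k\<bar> \<le> 2 / wt k"
      using wt_le_abs[OF False] wt_pos[of k] False by (simp add: field_simps)
    then have "(1 / real_of_int \<bar>k\<bar>)\<^sup>2 \<le> (2 / wt k)\<^sup>2" by (intro power_mono) auto
    then show ?thesis unfolding w by (simp add: power_divide)
  qed simp
qed simp

lemma summable_fc_divide: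
  assumes c: "(\<lambda>k. (norm (c k))\<^sup>2) summable_on UNIV"
  shows "(\<lambda>k. norm (c k / (\<i> * of_int k))) summable_on UNIV"
  using infsum_Cauchy_Schwarz(1)[OF c summable_inverse_square_int]
  by (simp add: norm_mult norm_divide)

text \<open>The value of the primitive at \<open>x\<close> is the pairing of \<open>f\<close> with the kernel
  \<open>(z - \<pi>) / (2\<pi>) + indicator {-\<pi>..x} z\<close>, whose Fourier coefficients are those of a shifted sawtooth;
  the polarised Parseval identity then gives the Fourier series of the primitive.\<close>

theorem primitive_series:
  assumes f: "L2_circle f" and m: "mean_zero f"
  shows "cmp (primitive f) l x = fser (\<lambda>k. cf f l k / (\<i> * of_int k)) x"
proof -
  let ?u = "cmp f l"
  have u: "circ_L2 ?u" using f by (simp add: L2_circle_iff)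
  have main: "cmp (primitive f) l x = fser (\<lambda>k. fc ?u k / (\<i> * of_int k)) x" if x: "-pi \<le> x" "x \<le> pi" for x
  proof -
    let ?a = "\<lambda>z. ((z - pi) / (2 * pi)) * f z $ l" and ?b = "\<lambda>z. indicat_real {-pi..x} z * f z $ l"
    define \<phi> where "\<phi> z = complex_of_real ((z - pi) / (2 * pi)) + of_real (indicat_real {-pi..x} z)" for z
    have \<phi>m: "(\<lambda>z. (z - pi) / (2 * pi)) \<in> borel_measurable circ" "indicat_real {-pi..x} \<in> borel_measurable circ"
      by (auto intro!: measurable_circI)
    have \<phi>1: "circ_L2 (\<lambda>z. complex_of_real ((z - pi) / (2 * pi)))"
      by (intro circ_L2_continuous continuous_intros) auto
    have \<phi>2: "circ_L2 (\<lambda>z. complex_of_real (indicat_real {-pi..x} z))"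
      using \<phi>m by (intro circ_L2_bounded[where B=1]) (auto simp: indicator_def)
    have \<phi>: "circ_L2 \<phi>" unfolding \<phi>_def by (intro circ_L2_add \<phi>1 \<phi>2)
    have i1: "integrable circ ?a"
      using circ_L2_mult(1)[OF \<phi>1 u] by (simp add: cmp_def complex_of_real_integrable_eq flip: of_real_mult of_real_divide of_real_diff)
    have i2: "integrable circ ?b"
      using circ_L2_mult(1)[OF \<phi>2 u] by (simp add: cmp_def complex_of_real_integrable_eq flip: of_real_mult)
    have int_f: "integrable circ (\<lambda>z. (z - pi) *\<^sub>R f z)"
    proof (rule integrable_bound[of _ "\<lambda>z. 2 * pi * norm (f z)"])
      show "AE z in circ. norm ((z - pi) *\<^sub>R f z) \<le> norm (2 * pi * norm (f z))"
        by (intro AE_I2) (auto simp: abs_mult intro!: mult_right_mono)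
      show "(\<lambda>z. (z - pi) *\<^sub>R f z) \<in> borel_measurable circ"
        by (intro borel_measurable_scaleR measurable_circI L2_circle_measurable[OF f]) simp
    qed (use L2_circle_integrable[OF f] in auto)
    have "primitive f x $ l = (\<integral>z. ?a z \<partial>circ) + (\<integral>z. ?b z \<partial>circ)"
    proof -
      have "((1 / (2 * pi)) *\<^sub>R (LBINT z:{-pi..pi}. (z - pi) *\<^sub>R f z)) $ l = (\<integral>z. ?a z \<partial>circ)"
        unfolding set_integral_circ using integral_vec_nth[OF int_f, of l] by simp
      moreover have "(LBINT z=-pi..x. f z) $ l = (\<integral>z. ?b z \<partial>circ)"
      proof -
        have int: "integrable circ (\<lambda>z. indicat_real {-pi..x} z *\<^sub>R f z)"
          by (rule integrable_bound[OF L2_circle_integrable[OF f]])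
             (use L2_circle_measurable[OF f] \<phi>m in \<open>auto simp: indicator_def\<close>)
        have "(LBINT z=-pi..x. f z) = (LBINT z:{-pi..x}. f z)" using x by (intro interval_integral_Icc)
        also have "\<dots> = (LBINT z:{-pi..pi}. indicat_real {-pi..x} z *\<^sub>R f z)"
          unfolding set_lebesgue_integral_def
          by (intro integral_cong) (use x in \<open>auto simp: indicator_def\<close>)
        finally show ?thesis unfolding set_integral_circ using integral_vec_nth[OF int, of l] by simp
      qed
      ultimately show ?thesis unfolding primitive_def by simp
    qed
    then have "cmp (primitive f) l x = complex_of_real (\<integral>z. ?a z + ?b z \<partial>circ)"
      by (simp only: cmp_def integral_add[OF i1 i2])
    also have "\<dots> = (\<integral>z. complex_of_real (?a z + ?b z) \<partial>circ)"
      by (rule integral_complex_of_real[symmetric])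
    also have "\<dots> = (\<integral>z. ?u z * \<phi> z \<partial>circ)"
      by (intro integral_cong refl)
         (simp only: cmp_def \<phi>_def of_real_add of_real_mult distrib_left mult.commute)
    also have "\<dots> = 2 * pi * fc (\<lambda>z. ?u z * \<phi> z) 0"
      by (simp add: fc_0 scaleR_conv_of_real)
    also have "\<dots> = 2 * pi * (\<Sum>\<^sub>\<infinity>j. fc ?u j * fc \<phi> (0 - j))"
      by (simp only: fc_mult_L2[OF u \<phi>])
    also have "\<dots> = (\<Sum>\<^sub>\<infinity>j. (2 * pi) * (fc ?u j * fc \<phi> (0 - j)))"
      by (simp only: infsum_cmult_right')
    also have "\<dots> = (\<Sum>\<^sub>\<infinity>j. fc ?u j / (\<i> * of_int j) * cis (of_int j * x))"
    proof (rule infsum_cong)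
      fix j :: int
      show "(2 * pi) * (fc ?u j * fc \<phi> (0 - j)) = fc ?u j / (\<i> * of_int j) * cis (of_int j * x)"
      proof (cases "j = 0")
        case True
        then show ?thesis using m mean_zero_fc[OF f] by simp
      next
        case False
        have "2 * pi * fc \<phi> (0 - j) = (\<integral>z. \<phi> z * cis (of_int j * z) \<partial>circ)"
          by (simp add: fc_def scaleR_conv_of_real)
        also have "\<dots> = (\<integral>z. (1 / (2 * pi)) * (of_real z * cis (of_int j * z)) - (1/2) * cis (of_int j * z)
            + of_real (indicat_real {-pi..x} z) * cis (of_int j * z) \<partial>circ)"
          by (intro integral_cong) (auto simp: \<phi>_def field_simps)
        also have "\<dots> = (1 / (2 * pi)) * (\<integral>z. of_real z * cis (of_int j * z) \<partial>circ) - (1/2) * (\<integral>z. cis (of_int j * z) \<partial>circ)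
            + (\<integral>z. of_real (indicat_real {-pi..x} z) * cis (of_int j * z) \<partial>circ)"
        proof -
          have a: "integrable circ (\<lambda>z. (1 / (2 * pi)) * (of_real z * cis (of_int j * z)))"
            by (intro integrable_mult_right integrable_circ_continuous continuous_intros)
          have b: "integrable circ (\<lambda>z. (1/2) * cis (of_int j * z))"
            by (intro integrable_mult_right integrable_circ_continuous continuous_intros)
          have c: "integrable circ (\<lambda>z. of_real (indicat_real {-pi..x} z) * cis (of_int j * z))"
            by (intro integrable_mult_cis circ_L2_imp_integrable \<phi>2)
          show ?thesis
            unfolding integral_add[OF integrable_diff[OF a b] c]
              integral_diff[OF a b] integral_mult_right_zero ..
        qed
        also have "(\<integral>z. cis (of_int j * z) \<partial>circ) = 0" using False by (simp add: integral_cis)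
        also have "(\<integral>z. of_real z * cis (of_int j * z) \<partial>circ) = 2 * pi * cis (of_int j * pi) / (\<i> * of_int j)"
          by (rule integral_ident_cis[OF False])
        also have "(\<integral>z. of_real (indicat_real {-pi..x} z) * cis (of_int j * z) \<partial>circ) = (LBINT z:{-pi..x}. cis (of_int j * z))"
          unfolding set_integral_circ[symmetric] set_lebesgue_integral_def
          by (intro integral_cong) (use x in \<open>auto simp: indicator_def\<close>)
        also have "\<dots> = (cis (of_int j * x) - cis (of_int j * (-pi))) / (\<i> * of_int j)"
          using x by (intro integral_cis_interval False) auto
        also have "cis (of_int j * (-pi)) = cis (of_int j * pi)"
        proof -
          have "cis (of_int j * pi) = cis (of_int j * (-pi)) * cis (2 * pi * of_int j)"
            by (simp add: cis_mult algebra_simps)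
          then show ?thesis by (simp add: cis_multiple_2pi)
        qed
        finally have "2 * pi * fc \<phi> (0 - j) = cis (of_int j * x) / (\<i> * of_int j)"
          using False by (simp add: field_simps)
        then show ?thesis by (metis (no_types, lifting) mult.left_commute mult.commute times_divide_eq_right)
      qed
    qed
    finally show ?thesis by (simp add: fser_def)
  qed
  have "cmp (primitive f) l (reduce x) = fser (\<lambda>k. fc ?u k / (\<i> * of_int k)) (reduce x)"
    using main reduce_bounds[of x] by simp
  moreover have "per2pi (cmp (primitive f) l)"
    using primitive_per2pi[OF f m] by (simp add: per2pi_def cmp_def)
  ultimately show ?thesis
    using per2pi_reduce[of "cmp (primitive f) l" x] per2pi_reduce[of "fser (\<lambda>k. fc ?u k / (\<i> * of_int k))" x]
    by (simp add: per2pi_def fser_periodic)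
qed

lemma continuous_vec_cmp: "continuous_on S f \<longleftrightarrow> (\<forall>j. continuous_on S (cmp f j))"
proof
  assume "continuous_on S f"
  then show "\<forall>j. continuous_on S (cmp f j)"
    unfolding cmp_def[abs_def] by (intro allI continuous_intros)
next
  assume a: "\<forall>j. continuous_on S (cmp f j)"
  have "continuous_on S (\<lambda>x. \<chi> j. Re (cmp f j x))"
    using a by (intro continuous_intros) auto
  then show "continuous_on S f" by (simp add: cmp_def)
qed

lemma
  assumes f: "L2_circle f" and m: "mean_zero f"
  shows primitive_fc: "cf (primitive f) l k = cf f l k / (\<i> * of_int k)"
    and primitive_summable: "(\<lambda>k. norm (cf (primitive f) l k)) summable_on UNIV"
    and continuous_primitive: "continuous_on UNIV (primitive f)"
proof -
  have s: "(\<lambda>k. norm (cf f l k / (\<i> * of_int k))) summable_on UNIV" for l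
    using f by (intro summable_fc_divide Bessel(1)) (simp add: L2_circle_iff)
  have e: "cmp (primitive f) l = fser (\<lambda>k. cf f l k / (\<i> * of_int k))" for l
    by (rule ext) (rule primitive_series[OF f m])
  show fc: "cf (primitive f) l k = cf f l k / (\<i> * of_int k)" for k
    unfolding e by (rule fc_fser[OF s])
  show "(\<lambda>k. norm (cf (primitive f) l k)) summable_on UNIV"
    unfolding fc by (rule s)
  show "continuous_on UNIV (primitive f)"
    unfolding continuous_vec_cmp e using continuous_fser[OF s] by blast
qed

lemma primitive_has_derivative:
  assumes f: "L2_circle f" and c: "continuous_on UNIV f"
  shows "(primitive f has_vector_derivative f x) (at x)"
proof -
  have "((\<lambda>u. LBINT y=x-1..u. f y) has_vector_derivative f x) (at x within {x-1..x+1})"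
    using continuous_on_subset[OF c] by (intro interval_integral_FTC2) auto
  then have "((\<lambda>u. LBINT y=x-1..u. f y) has_vector_derivative f x) (at x)"
    by (simp add: at_within_Icc_at)
  then have "((\<lambda>u. primitive f (x-1) + (LBINT y=x-1..u. f y)) has_vector_derivative f x) (at x)"
    by (auto intro!: derivative_eq_intros)
  moreover have "primitive f (x-1) + (LBINT y=x-1..u. f y) = primitive f u" for u
    using primitive_diff[OF f, of u "x-1"] by (simp add: algebra_simps)
  ultimately show ?thesis by simp
qed

text \<open>Cauchy--Schwarz; an interval of length at most \<open>2 * pi\<close> meets every point of the circle at most once.\<close>

lemma primitive_Hoelder:
  assumes f: "L2_circle f" and ab: "a \<le> b" "b \<le> a + 2 * pi"
  shows "norm (primitive f b - primitive f a) \<le> sqrt (b - a) * sqrt (\<integral>x. (norm (f x))\<^sup>2 \<partial>circ)"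
proof -
  have per: "per2pi (\<lambda>x. (norm (f x))\<^sup>2)" "per2pi f" using f by (auto simp: L2_circle_iff per2pi_def)
  have fi: "set_integrable lborel {c<..d} f" for c d
    using f L2_circle_integrable by (intro periodic_set_integrable) (auto simp: L2_circle_iff)
  have f2i: "set_integrable lborel {c<..d} (\<lambda>x. (norm (f x))\<^sup>2)" for c d
    using f L2_circle_square by (intro periodic_set_integrable per) auto
  let ?I = "indicat_real {a<..b}"
  have m: "(\<lambda>x. ?I x *\<^sub>R f x) \<in> borel_measurable lborel"
    using fi[of a b] unfolding set_integrable_def by auto
  then have m1: "(\<lambda>x. norm (?I x *\<^sub>R f x)) \<in> borel_measurable lborel" by measurable
  have e1: "(norm (?I x *\<^sub>R f x))\<^sup>2 = ?I x *\<^sub>R (norm (f x))\<^sup>2" for x by (simp add: indicator_def)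
  have e2: "(?I x)\<^sup>2 = ?I x" for x by (simp add: indicator_def)
  have e3: "\<bar>?I x * norm (?I x *\<^sub>R f x)\<bar> = norm (?I x *\<^sub>R f x)" for x by (simp add: indicator_def)
  have X: "(\<integral>z. (norm (?I z *\<^sub>R f z))\<^sup>2 \<partial>lborel) \<le> (\<integral>x. (norm (f x))\<^sup>2 \<partial>circ)"
  proof -
    have "(\<integral>z. (norm (?I z *\<^sub>R f z))\<^sup>2 \<partial>lborel) = (LBINT z:{a<..b}. (norm (f z))\<^sup>2)"
      unfolding e1 set_lebesgue_integral_def ..
    also have "\<dots> \<le> (LBINT z:{a<..a+2*pi}. (norm (f z))\<^sup>2)"
      unfolding set_lebesgue_integral_def
      using f2i[of a b] f2i[of a "a+2*pi"] ab unfolding set_integrable_def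
      by (intro integral_mono) (auto simp: indicator_def)
    also have "\<dots> = (\<integral>y. (norm (f (y + (a + pi))))\<^sup>2 \<partial>circ)"
      unfolding circ_lborel_Ioc using set_integral_shift(2)[of "-pi" pi "\<lambda>x. (norm (f x))\<^sup>2" "a + pi"] by (simp add: algebra_simps)
    also have "\<dots> = (\<integral>x. (norm (f x))\<^sup>2 \<partial>circ)"
      using periodic_shift(2)[OF per(1) L2_circle_square[OF f]] by simp
    finally show ?thesis .
  qed
  have "norm (primitive f b - primitive f a) = norm (LBINT z:{a<..b}. f z)"
    using ab by (simp add: primitive_diff[OF f] interval_integral_Ioc)
  also have "\<dots> \<le> (\<integral>z. norm (?I z *\<^sub>R f z) \<partial>lborel)"
    unfolding set_lebesgue_integral_def by (rule integral_norm_bound)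
  also have "\<dots> = (\<integral>z. \<bar>?I z * norm (?I z *\<^sub>R f z)\<bar> \<partial>lborel)" by (simp only: e3)
  also have "\<dots> \<le> sqrt (\<integral>z. (?I z)\<^sup>2 \<partial>lborel) * sqrt (\<integral>z. (norm (?I z *\<^sub>R f z))\<^sup>2 \<partial>lborel)"
  proof (rule integral_Cauchy_Schwarz)
    show "integrable lborel (\<lambda>x. (norm (?I x *\<^sub>R f x))\<^sup>2)"
      unfolding e1 using f2i[of a b] unfolding set_integrable_def .
    show "integrable lborel (\<lambda>x. (?I x)\<^sup>2)" unfolding e2 using ab by simp
  qed (use m1 in auto)
  also have "(\<integral>z. (?I z)\<^sup>2 \<partial>lborel) = b - a" unfolding e2 using ab by simp
  also have "sqrt (b - a) * sqrt (\<integral>z. (norm (?I z *\<^sub>R f z))\<^sup>2 \<partial>lborel) \<le> sqrt (b - a) * sqrt (\<integral>x. (norm (f x))\<^sup>2 \<partial>circ)"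
    using X ab by (intro mult_left_mono real_sqrt_le_mono) auto
  finally show ?thesis .
qed

section \<open>The kernel\<close>

lemma deriv_on_works:
  assumes "f differentiable (at x within S)"
  shows "(f has_real_derivative deriv_on S f x) (at x within S)"
  using assms unfolding deriv_on_def has_real_derivative_iff_has_vector_derivative
  by (simp add: vector_derivative_works)

text \<open>With \<open>\<alpha> = v / w\<close> homogeneity reads \<open>K w v = h (v / w) * v powr (- p)\<close>, which is differentiated in \<open>w\<close>.\<close>

lemma K_u_homogeneous:
  assumes hom: "homogeneous K h p" and u: "0 < u" "u \<le> v"
  shows "K_u K u v = g_of h (v / u) * v powr (- p - 1)"
proof -
  have v: "v > 0" using u by simp
  let ?S = "{0<..v}"
  have a: "v / w \<in> {1..}" if "w \<in> ?S" for w using that by auto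
  have "Ck_on 1 {1..} h" using hom by (simp add: homogeneous_def)
  then have "h differentiable (at (v/u) within {1..})"
    using a[of u] u by (auto simp: Ck_on_def)
  then have "(h has_real_derivative deriv_on {1..} h (v/u)) (at (v/u) within {1..})"
    by (rule deriv_on_works)
  then have h': "(h has_real_derivative deriv_on {1..} h (v/u)) (at (v/u) within ((\<lambda>w. v / w) ` ?S))"
    by (rule DERIV_subset) (use a in auto)
  have "((\<lambda>w. v / w) has_real_derivative (- v / u\<^sup>2)) (at u within ?S)"
    using u by (auto intro!: derivative_eq_intros simp: power2_eq_square field_simps)
  from DERIV_image_chain[OF h' this]
  have "((\<lambda>w. h (v / w) * v powr (- p)) has_real_derivative
      deriv_on {1..} h (v/u) * (- v / u\<^sup>2) * v powr (- p)) (at u within ?S)"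
    unfolding o_def by (intro DERIV_cmult_right)
  moreover have "deriv_on {1..} h (v/u) * (- v / u\<^sup>2) * v powr (- p) = g_of h (v / u) * v powr (- p - 1)"
    using u v by (simp add: g_of_def powr_diff power2_eq_square field_simps)
  moreover have "K w v = h (v / w) * v powr (- p)" if "w \<in> ?S" for w
  proof -
    have "\<forall>\<alpha>\<ge>1. K (v / \<alpha>) v = h \<alpha> * v powr (- p)"
      using hom v unfolding homogeneous_def by blast
    then have "K (v / (v / w)) v = h (v / w) * v powr (- p)"
      using a[OF that] by (metis atLeast_iff)
    moreover have "v / (v / w) = w" using v that by simp
    ultimately show ?thesis by (simp only:)
  qed
  ultimately have "((\<lambda>w. K w v) has_real_derivative g_of h (v / u) * v powr (- p - 1)) (at u within ?S)"
    using u by (auto intro: has_field_derivative_transform_within[of _ _ _ _ 1])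
  moreover have "at u within ?S \<noteq> bot"
  proof -
    have "u islimpt {0<..<u}" using u by (simp add: islimpt_greaterThanLessThan2)
    then have "u islimpt ?S" by (rule islimpt_subset) (use u in auto)
    then show ?thesis by (simp add: trivial_limit_within)
  qed
  ultimately show ?thesis
    unfolding K_u_def deriv_on_def has_real_derivative_iff_has_vector_derivative
    by (intro vector_derivative_within)
qed

lemma Ck_on_deriv:
  assumes "Ck_on (Suc n) S f" shows "Ck_on n S (deriv_on S f)"
proof -
  have "(deriv_on S ^^ i) (deriv_on S f) = (deriv_on S ^^ Suc i) f" for i
    by (simp only: funpow_Suc_right o_def)
  then show ?thesis using assms unfolding Ck_on_def by (metis Suc_less_eq)
qed

text \<open>Each vanishing derivative at \<open>1\<close> lets the mean value theorem gain one factor \<open>\<alpha> - 1\<close>.\<close>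

lemma vanishing_derivatives_bound:
  assumes "Ck_on (Suc n) {1..} f" "\<And>i. 1 \<le> i \<Longrightarrow> i \<le> n \<Longrightarrow> (deriv_on {1..} ^^ i) f 1 = 0"
  shows "\<exists>R\<ge>0. \<forall>\<alpha>\<in>{1..B}. \<bar>deriv_on {1..} f \<alpha>\<bar> \<le> R * (\<alpha> - 1) ^ n"
  using assms
proof (induction n arbitrary: f)
  case 0
  have "continuous_on {1..B} (deriv_on {1..} f)"
    using 0 by (auto simp: Ck_on_def intro: continuous_on_subset)
  then have "bounded (deriv_on {1..} f ` {1..B})"
    by (intro compact_imp_bounded compact_continuous_image) auto
  then show ?case unfolding bounded_pos by (auto intro: less_imp_le)
next
  case (Suc n)
  let ?D = "deriv_on {1..}"
  have "Ck_on (Suc n) {1..} (?D f)" using Suc.prems(1) by (rule Ck_on_deriv)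
  moreover have "(?D ^^ i) (?D f) 1 = 0" if "1 \<le> i" "i \<le> n" for i
    using Suc.prems(2)[of "Suc i"] that by (simp only: funpow_Suc_right o_def)
  ultimately obtain R where R: "R \<ge> 0" "\<And>\<alpha>. \<alpha> \<in> {1..B} \<Longrightarrow> \<bar>?D (?D f) \<alpha>\<bar> \<le> R * (\<alpha> - 1) ^ n"
    using Suc.IH[of "?D f"] by blast
  have D1: "?D f 1 = 0" using Suc.prems(2)[of 1] by simp
  have "\<bar>?D f \<alpha>\<bar> \<le> R * (\<alpha> - 1) ^ Suc n" if \<alpha>: "\<alpha> \<in> {1..B}" for \<alpha>
  proof -
    have "norm (?D f \<alpha> - ?D f 1) \<le> R * (\<alpha> - 1) ^ n * norm (\<alpha> - 1)"
    proof (rule field_differentiable_bound[of "{1..\<alpha>}" "?D f" "?D (?D f)"])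
      fix z assume z: "z \<in> {1..\<alpha>}"
      have "?D f differentiable (at z within {1..})"
        using Suc.prems(1) z unfolding Ck_on_def by (auto dest!: spec[of _ 1])
      then show "(?D f has_real_derivative ?D (?D f) z) (at z within {1..\<alpha>})"
        by (intro DERIV_subset[OF deriv_on_works]) auto
      have "\<bar>?D (?D f) z\<bar> \<le> R * (z - 1) ^ n" using R(2)[of z] z \<alpha> by auto
      also have "\<dots> \<le> R * (\<alpha> - 1) ^ n" using z R(1) by (intro mult_left_mono power_mono) auto
      finally show "norm (?D (?D f) z) \<le> R * (\<alpha> - 1) ^ n" by simp
    qed (use \<alpha> in auto)
    then show ?thesis using D1 \<alpha> by (simp add: mult_ac)
  qed
  then show ?case using R(1) by blast
qed

text \<open>Both kinds of degeneracy are used only through the following consequence: after subtraction of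
  its value at \<open>1\<close> the function \<open>g\<close> vanishes to an order that makes the kernel integrable, and the
  constant \<open>g(1)\<close> can be nonzero only if \<open>p < 1/2\<close>.  A \<open>0\<close>-degenerate kernel is the case \<open>m = 0\<close>.\<close>

definition good_kernel :: "nat \<Rightarrow> (real \<Rightarrow> real) \<Rightarrow> real \<Rightarrow> bool" where
  "good_kernel m g p \<longleftrightarrow> p \<ge> 0 \<and> 4 * p < real m + 2 \<and> (p < 1/2 \<or> g 1 = 0) \<and> continuous_on {1..} g \<and>
    (\<forall>B. \<exists>R\<ge>0. (\<forall>\<alpha>\<in>{1..B}. \<bar>g \<alpha> - g 1\<bar> \<le> R * (\<alpha> - 1) ^ Suc m) \<and>
      (\<forall>c\<in>{1..B}. \<forall>\<alpha>\<in>{1..c}. \<forall>\<beta>\<in>{1..c}. \<bar>g \<alpha> - g \<beta>\<bar> \<le> R * (c - 1) ^ m * \<bar>\<alpha> - \<beta>\<bar>))"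

lemma good_kernelI:
  assumes "Ck_on (Suc m) {1..} g" "\<And>i. 1 \<le> i \<Longrightarrow> i \<le> m \<Longrightarrow> (deriv_on {1..} ^^ i) g 1 = 0"
    and p: "p \<ge> 0" "4 * p < real m + 2" "p < 1/2 \<or> g 1 = 0"
  shows "good_kernel m g p"
proof -
  have d: "(g has_real_derivative deriv_on {1..} g z) (at z within {1..})" if "z \<ge> 1" for z
    using assms(1) that unfolding Ck_on_def by (intro deriv_on_works) (auto dest!: spec[of _ 0])
  then have c: "continuous_on {1..} g"
    by (auto simp: continuous_on_eq_continuous_within intro!: DERIV_continuous)
  have "\<exists>R\<ge>0. (\<forall>\<alpha>\<in>{1..B}. \<bar>g \<alpha> - g 1\<bar> \<le> R * (\<alpha> - 1) ^ Suc m) \<and>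
      (\<forall>c\<in>{1..B}. \<forall>\<alpha>\<in>{1..c}. \<forall>\<beta>\<in>{1..c}. \<bar>g \<alpha> - g \<beta>\<bar> \<le> R * (c - 1) ^ m * \<bar>\<alpha> - \<beta>\<bar>)" for B
  proof -
    obtain R where R: "R \<ge> 0" "\<And>\<alpha>. \<alpha> \<in> {1..B} \<Longrightarrow> \<bar>deriv_on {1..} g \<alpha>\<bar> \<le> R * (\<alpha> - 1) ^ m"
      using vanishing_derivatives_bound[OF assms(1,2), of B] by blast
    have main: "\<bar>g \<alpha> - g \<beta>\<bar> \<le> R * (c - 1) ^ m * \<bar>\<alpha> - \<beta>\<bar>"
      if "c \<in> {1..B}" "\<alpha> \<in> {1..c}" "\<beta> \<in> {1..c}" for \<alpha> \<beta> c
    proof -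
      have "norm (g \<alpha> - g \<beta>) \<le> R * (c - 1) ^ m * norm (\<alpha> - \<beta>)"
      proof (rule field_differentiable_bound[of "{1..c}" g "deriv_on {1..} g"])
        fix z assume z: "z \<in> {1..c}"
        show "(g has_real_derivative deriv_on {1..} g z) (at z within {1..c})"
          using d[of z] z by (intro DERIV_subset[OF d]) auto
        have "\<bar>deriv_on {1..} g z\<bar> \<le> R * (z - 1) ^ m" using R(2)[of z] z that by auto
        also have "\<dots> \<le> R * (c - 1) ^ m" using z R(1) by (intro mult_left_mono power_mono) auto
        finally show "norm (deriv_on {1..} g z) \<le> R * (c - 1) ^ m" by simp
      qed (use that in auto)
      then show ?thesis by simp
    qed
    have "\<bar>g \<alpha> - g 1\<bar> \<le> R * (\<alpha> - 1) ^ Suc m" if "\<alpha> \<in> {1..B}" for \<alpha>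
      using main[of \<alpha> \<alpha> 1] that by (simp add: mult_ac)
    with main R(1) show ?thesis by blast
  qed
  with c p show ?thesis unfolding good_kernel_def by blast
qed

lemma good_kernel_exists:
  assumes "homogeneous K h p" "zero_degenerate h p \<or> (\<exists>m. m_degenerate m h p)"
  shows "\<exists>m. good_kernel m (g_of h) p"
proof -
  have p: "p \<ge> 0" using assms(1) by (simp add: homogeneous_def)
  from assms(2) show ?thesis
  proof
    assume "zero_degenerate h p"
    then have "good_kernel 0 (g_of h) p"
      using p by (intro good_kernelI) (auto simp: zero_degenerate_def)
    then show ?thesis ..
  next
    assume "\<exists>m. m_degenerate m h p"
    then obtain m where m: "m_degenerate m h p" ..
    then have "(deriv_on {1..} ^^ 0) (g_of h) 1 = 0" unfolding m_degenerate_def by blast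
    with m p have "good_kernel m (g_of h) p"
      by (intro good_kernelI) (auto simp: m_degenerate_def)
    then show ?thesis ..
  qed
qed

section \<open>Chords of unit speed curves\<close>

lemma curve_mean_value:
  fixes \<gamma> :: "real \<Rightarrow> 'a::real_inner"
  assumes \<gamma>: "\<And>x. (\<gamma> has_vector_derivative \<tau> x) (at x)"
  shows "\<exists>\<xi>. min x y \<le> \<xi> \<and> \<xi> \<le> max x y \<and> (\<gamma> x - \<gamma> y) \<bullet> e = (x - y) * (\<tau> \<xi> \<bullet> e)"
proof -
  have d: "((\<lambda>x. \<gamma> x \<bullet> e) has_real_derivative \<tau> x \<bullet> e) (at x)" for x
  proof -
    have "((\<lambda>x. \<gamma> x \<bullet> e) has_vector_derivative \<tau> x \<bullet> e) (at x)"
      by (rule bounded_linear.has_vector_derivative[OF bounded_linear_inner_left \<gamma>])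
    then show ?thesis by (simp add: has_real_derivative_iff_has_vector_derivative)
  qed
  consider "x < y" | "x = y" | "y < x" by linarith
  then show ?thesis
  proof cases
    case 1
    from MVT2[OF 1 d] obtain \<xi> where "x < \<xi>" "\<xi> < y" "\<gamma> y \<bullet> e - \<gamma> x \<bullet> e = (y - x) * (\<tau> \<xi> \<bullet> e)" by blast
    then show ?thesis using 1 by (intro exI[of _ \<xi>]) (auto simp: inner_diff_left algebra_simps)
  next
    case 3
    from MVT2[OF 3 d] obtain \<xi> where "y < \<xi>" "\<xi> < x" "\<gamma> x \<bullet> e - \<gamma> y \<bullet> e = (x - y) * (\<tau> \<xi> \<bullet> e)" by blast
    then show ?thesis using 3 by (intro exI[of _ \<xi>]) (auto simp: inner_diff_left algebra_simps)
  qed auto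
qed

lemma unit_inner: "norm a = 1 \<Longrightarrow> norm b = 1 \<Longrightarrow> a \<bullet> b = 1 - (norm (a - b))\<^sup>2 / 2"
  for a b :: "'a::real_inner"
  by (simp add: power2_norm_eq_inner inner_diff_left inner_diff_right inner_commute)
     (simp add: norm_eq_1 inner_commute field_simps)

lemma chord_le:
  fixes \<gamma> :: "real \<Rightarrow> 'a::real_inner"
  assumes \<gamma>: "\<And>x. (\<gamma> has_vector_derivative \<tau> x) (at x)" and \<tau>: "\<And>x. norm (\<tau> x) \<le> M"
  shows "norm (\<gamma> x - \<gamma> y) \<le> M * \<bar>x - y\<bar>"
proof -
  let ?e = "\<gamma> x - \<gamma> y"
  have M: "M \<ge> 0" using \<tau> norm_ge_zero order_trans by blast
  obtain \<xi> where "?e \<bullet> ?e = (x - y) * (\<tau> \<xi> \<bullet> ?e)" using curve_mean_value[OF \<gamma>] by blast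
  also have "\<dots> \<le> \<bar>x - y\<bar> * \<bar>\<tau> \<xi> \<bullet> ?e\<bar>" by (metis abs_ge_self abs_mult)
  also have "\<dots> \<le> \<bar>x - y\<bar> * (M * norm ?e)"
    by (intro mult_left_mono order_trans[OF Cauchy_Schwarz_ineq2 mult_right_mono[OF \<tau>]]) auto
  finally have "norm ?e * norm ?e \<le> (M * \<bar>x - y\<bar>) * norm ?e"
    by (simp add: dot_square_norm power2_eq_square mult_ac)
  then show ?thesis using M by (cases "norm ?e = 0") (auto simp: mult_le_cancel_right)
qed

text \<open>For unit vectors \<open>a \<bullet> b\<close> differs from \<open>1\<close> by half the squared distance, so both the shortening of the
  chord and the first variation of its length are quadratic in the oscillation of the tangent.\<close>

lemma chord_defect:
  fixes \<gamma> :: "real \<Rightarrow> 'a::real_inner"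
  assumes \<gamma>: "\<And>x. (\<gamma> has_vector_derivative \<tau> x) (at x)" and \<tau>: "\<And>x. norm (\<tau> x) = 1"
    and \<omega>: "\<And>a b. min x y \<le> a \<Longrightarrow> a \<le> max x y \<Longrightarrow> min x y \<le> b \<Longrightarrow> b \<le> max x y \<Longrightarrow> (norm (\<tau> a - \<tau> b))\<^sup>2 \<le> \<omega>"
  shows "\<bar>x - y\<bar> - norm (\<gamma> x - \<gamma> y) \<le> \<bar>x - y\<bar> * \<omega> / 2"
    and "\<bar>(\<gamma> x - \<gamma> y) \<bullet> (\<tau> x - \<tau> y)\<bar> \<le> \<bar>x - y\<bar> * \<omega> / 2"
proof -
  obtain \<xi> where \<xi>: "min x y \<le> \<xi>" "\<xi> \<le> max x y" "(\<gamma> x - \<gamma> y) \<bullet> \<tau> x = (x - y) * (\<tau> \<xi> \<bullet> \<tau> x)"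
    using curve_mean_value[OF \<gamma>] by blast
  have "1 - \<omega> / 2 \<le> \<tau> \<xi> \<bullet> \<tau> x"
    using unit_inner[OF \<tau> \<tau>, of \<xi> x] \<omega>[of \<xi> x] \<xi> by simp
  also have "\<dots> \<le> \<bar>\<tau> \<xi> \<bullet> \<tau> x\<bar>" by simp
  finally have "\<bar>x - y\<bar> * (1 - \<omega> / 2) \<le> \<bar>x - y\<bar> * \<bar>\<tau> \<xi> \<bullet> \<tau> x\<bar>" by (intro mult_left_mono) auto
  also have "\<dots> = \<bar>(\<gamma> x - \<gamma> y) \<bullet> \<tau> x\<bar>" using \<xi> by (simp add: abs_mult)
  also have "\<dots> \<le> norm (\<gamma> x - \<gamma> y)" using Cauchy_Schwarz_ineq2[of "\<gamma> x - \<gamma> y" "\<tau> x"] by (simp add: \<tau>)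
  finally show "\<bar>x - y\<bar> - norm (\<gamma> x - \<gamma> y) \<le> \<bar>x - y\<bar> * \<omega> / 2" by (simp add: algebra_simps)
  obtain \<xi> where \<xi>: "min x y \<le> \<xi>" "\<xi> \<le> max x y" "(\<gamma> x - \<gamma> y) \<bullet> (\<tau> x - \<tau> y) = (x - y) * (\<tau> \<xi> \<bullet> (\<tau> x - \<tau> y))"
    using curve_mean_value[OF \<gamma>] by blast
  have "\<tau> \<xi> \<bullet> (\<tau> x - \<tau> y) = ((norm (\<tau> \<xi> - \<tau> y))\<^sup>2 - (norm (\<tau> \<xi> - \<tau> x))\<^sup>2) / 2"
    by (simp add: inner_diff_right unit_inner[OF \<tau> \<tau>] field_simps)
  moreover have "(norm (\<tau> \<xi> - \<tau> y))\<^sup>2 \<le> \<omega>" "(norm (\<tau> \<xi> - \<tau> x))\<^sup>2 \<le> \<omega>" using \<omega> \<xi> by auto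
  moreover have "\<bar>(A - B) / 2\<bar> \<le> w / 2" if "A \<le> w" "B \<le> w" "0 \<le> A" "0 \<le> B" for A B w :: real
  proof -
    have "\<bar>A - B\<bar> \<le> w" using that by (simp add: abs_le_iff)
    then show ?thesis by simp
  qed
  ultimately have "\<bar>\<tau> \<xi> \<bullet> (\<tau> x - \<tau> y)\<bar> \<le> \<omega> / 2"
    by (metis zero_le_power2)
  then have "\<bar>x - y\<bar> * \<bar>\<tau> \<xi> \<bullet> (\<tau> x - \<tau> y)\<bar> \<le> \<bar>x - y\<bar> * (\<omega> / 2)" by (intro mult_left_mono) auto
  then show "\<bar>(\<gamma> x - \<gamma> y) \<bullet> (\<tau> x - \<tau> y)\<bar> \<le> \<bar>x - y\<bar> * \<omega> / 2" unfolding \<xi>(3) by (simp add: abs_mult)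
qed

lemma chord_ratio:
  fixes c l :: real
  assumes "0 < c" "c \<le> l" "l \<le> \<delta> * c" "l - c \<le> l * \<omega> / 2"
  shows "l\<^sup>2 / c\<^sup>2 \<in> {1..\<delta>\<^sup>2}" "l\<^sup>2 / c\<^sup>2 - 1 \<le> \<delta>\<^sup>2 * \<omega>"
proof -
  have "l\<^sup>2 \<le> (\<delta> * c)\<^sup>2" "c\<^sup>2 \<le> l\<^sup>2" using assms by (auto intro!: power_mono)
  then show "l\<^sup>2 / c\<^sup>2 \<in> {1..\<delta>\<^sup>2}" using assms by (simp add: field_simps power_mult_distrib)
  have "0 \<le> l * \<omega> / 2" using assms by linarith
  then have w: "\<omega> \<ge> 0" using assms by (simp add: zero_le_mult_iff)
  have "l\<^sup>2 - c\<^sup>2 = (l - c) * (l + c)" by (simp add: power2_eq_square algebra_simps)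
  also have "\<dots> \<le> (l * \<omega> / 2) * (2 * l)" using assms by (intro mult_mono) auto
  also have "\<dots> = \<omega> * l\<^sup>2" by (simp add: power2_eq_square)
  also have "\<dots> \<le> \<omega> * (\<delta> * c)\<^sup>2" using \<open>l\<^sup>2 \<le> (\<delta> * c)\<^sup>2\<close> w by (intro mult_left_mono)
  finally have "l\<^sup>2 - c\<^sup>2 \<le> \<delta>\<^sup>2 * \<omega> * c\<^sup>2" by (simp add: power_mult_distrib mult_ac)
  then show "l\<^sup>2 / c\<^sup>2 - 1 \<le> \<delta>\<^sup>2 * \<omega>" using assms by (simp add: field_simps)
qed

section \<open>Auxiliary integrals\<close>

lemma integrable_abs_powr:
  assumes "e > -1"
  shows "integrable circ (\<lambda>z. \<bar>z\<bar> powr e)"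
proof -
  have m: "(\<lambda>z. \<bar>z\<bar> powr e) \<in> borel_measurable borel" by measurable
  have "(\<lambda>x. x powr e) integrable_on {0..pi}"
    using assms by (intro integrable_on_powr_from_0) auto
  then have "set_integrable lebesgue {0..pi} (\<lambda>x. x powr e)"
    unfolding set_integrable_def by (intro nonnegative_absolutely_integrable_1 [unfolded set_integrable_def]) auto
  then have 1: "integrable lborel (\<lambda>x. indicator {0..pi} x *\<^sub>R x powr e)"
    unfolding set_integrable_def by (subst (asm) integrable_completion) auto
  have p: "integrable circ (\<lambda>x. indicator {0..} x *\<^sub>R x powr e)"
  proof -
    have "(\<lambda>x. indicat_real {-pi..pi} x *\<^sub>R (indicator {0..} x *\<^sub>R x powr e)) = (\<lambda>x. indicator {0..pi} x *\<^sub>R x powr e)"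
      by (rule ext) (auto simp: indicator_def)
    with 1 show ?thesis by (simp add: set_integrable_circ[symmetric] set_integrable_def)
  qed
  from p have "integrable circ (\<lambda>x. indicator {0..} (-x) *\<^sub>R (-x) powr e)"
    by (subst integral_circ_reflect(1)[of "\<lambda>x. indicator {0..} x *\<^sub>R x powr e"])
  from integrable_add[OF p this] show ?thesis
  proof (rule integrable_bound)
    show "AE z in circ. norm (\<bar>z\<bar> powr e) \<le> norm (indicator {0..} z *\<^sub>R z powr e + indicator {0..} (- z) *\<^sub>R (- z) powr e)"
      by (intro AE_I2) (auto simp: indicator_def)
  qed (use m in \<open>auto intro: measurable_circI\<close>)
qed

text \<open>Fubini for sums over the integers with a majorant that separates the two variables.\<close>

lemma integral_infsum_int:
  fixes f :: "int \<Rightarrow> 'a \<Rightarrow> 'b::{banach, second_countable_topology}"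
  assumes m: "\<And>k. f k \<in> borel_measurable M" and bd: "\<And>k x. x \<in> space M \<Longrightarrow> norm (f k x) \<le> b k * w x"
    and w: "integrable M w" and b: "b summable_on UNIV" and b0: "\<And>k. b k \<ge> 0"
  shows "integrable M (\<lambda>x. \<Sum>\<^sub>\<infinity>k. f k x)"
    and "(\<integral>x. (\<Sum>\<^sub>\<infinity>k. f k x) \<partial>M) = (\<Sum>\<^sub>\<infinity>k. \<integral>x. f k x \<partial>M)"
    and "(\<lambda>k. norm (\<integral>x. f k x \<partial>M)) summable_on UNIV"
proof -
  have bdw: "norm (f k x) \<le> norm (b k * w x)" if "x \<in> space M" for k x
    using bd[OF that, of k] by simp
  have i: "integrable M (f k)" for k
    by (rule integrable_bound[of _ "\<lambda>x. b k * w x"]) (use w m bdw in auto)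
  have s: "(\<lambda>k. norm (f k x)) summable_on UNIV" if "x \<in> space M" for x
    by (rule summable_on_comparison_test[OF summable_on_cmult_left[OF b, of "w x"]]) (use bd[OF that] in auto)
  have n: "norm (\<integral>x. f k x \<partial>M) \<le> b k * (\<integral>x. \<bar>w x\<bar> \<partial>M)"
    and n': "(\<integral>x. norm (f k x) \<partial>M) \<le> b k * (\<integral>x. \<bar>w x\<bar> \<partial>M)" for k
  proof -
    have "(\<integral>x. norm (f k x) \<partial>M) \<le> (\<integral>x. b k * \<bar>w x\<bar> \<partial>M)"
      by (rule integral_mono) (use i w bdw b0 in \<open>auto simp: abs_mult\<close>)
    then show "(\<integral>x. norm (f k x) \<partial>M) \<le> b k * (\<integral>x. \<bar>w x\<bar> \<partial>M)" by simp
    then show "norm (\<integral>x. f k x \<partial>M) \<le> b k * (\<integral>x. \<bar>w x\<bar> \<partial>M)"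
      using integral_norm_bound[of M "f k"] by linarith
  qed
  show s2: "(\<lambda>k. norm (\<integral>x. f k x \<partial>M)) summable_on UNIV"
    by (rule summable_on_comparison_test[OF summable_on_cmult_left[OF b, of "\<integral>x. \<bar>w x\<bar> \<partial>M"]]) (use n in auto)
  have eq: "(\<Sum>\<^sub>\<infinity>k. f k x) = (\<Sum>i. f (int_decode i) x)" if "x \<in> space M" for x
    using sums_int_decode[OF s[OF that]] by (rule sums_unique)
  have sb: "summable (\<lambda>i. b (int_decode i))" using b b0 by (subst (asm) summable_int_decode) auto
  have c1: "AE x in M. summable (\<lambda>i. norm (f (int_decode i) x))"
    using s by (intro AE_I2) (subst (asm) summable_int_decode, auto)
  have c2: "summable (\<lambda>i. \<integral>x. norm (f (int_decode i) x) \<partial>M)"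
    by (rule summable_comparison_test'[OF summable_mult2[OF sb, of "\<integral>x. \<bar>w x\<bar> \<partial>M"]]) (use n' in auto)
  have S: "integrable M (\<lambda>x. \<Sum>i. f (int_decode i) x)"
      "(\<lambda>i. \<integral>x. f (int_decode i) x \<partial>M) sums (\<integral>x. (\<Sum>i. f (int_decode i) x) \<partial>M)"
    using integrable_suminf[OF i c1 c2] sums_integral[OF i c1 c2] by auto
  then show "integrable M (\<lambda>x. \<Sum>\<^sub>\<infinity>k. f k x)"
    by (subst integrable_cong[OF refl eq]) auto
  have "(\<integral>x. (\<Sum>\<^sub>\<infinity>k. f k x) \<partial>M) = (\<integral>x. (\<Sum>i. f (int_decode i) x) \<partial>M)"
    by (intro integral_cong refl eq)
  also have "\<dots> = (\<Sum>\<^sub>\<infinity>k. \<integral>x. f k x \<partial>M)"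
    using S(2) sums_int_decode[OF s2] by (rule sums_unique2)
  finally show "(\<integral>x. (\<Sum>\<^sub>\<infinity>k. f k x) \<partial>M) = (\<Sum>\<^sub>\<infinity>k. \<integral>x. f k x \<partial>M)" .
qed

lemma vartheta_reduce: "vartheta z = min \<bar>reduce z\<bar> (2 * pi - \<bar>reduce z\<bar>)"
  by (simp add: vartheta_def reduce_def Let_def)

lemma vartheta_per: "per2pi vartheta"
  by (simp add: per2pi_def vartheta_reduce reduce_periodic)

lemma vartheta_small:
  assumes "\<bar>z\<bar> \<le> pi" shows "vartheta z = \<bar>z\<bar>"
proof (cases "z = pi")
  case True
  have "reduce pi = reduce (-pi)" using reduce_periodic[of "-pi"] by simp
  also have "\<dots> = -pi" by (rule reduce_id) auto
  finally show ?thesis using True by (simp add: vartheta_reduce)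
next
  case False
  then have "reduce z = z" using assms by (intro reduce_id) auto
  then show ?thesis using assms by (simp add: vartheta_reduce)
qed

section \<open>The two parts of the force\<close>

text \<open>The last condition says that the distortion is at most \<open>\<delta>\<close>, without a quotient.\<close>

definition admissible :: "real \<Rightarrow> (real \<Rightarrow> real^3) \<Rightarrow> bool" where
  "admissible \<delta> \<tau> \<longleftrightarrow> \<tau> \<in> H_space 1 \<and> mean_zero \<tau> \<and> unit_speed \<tau> \<and>
     (\<forall>x y. vartheta (x - y) \<le> \<delta> * norm (curve \<tau> x - curve \<tau> y))"

text \<open>The argument \<open>\<alpha>\<close> of \<open>g\<close> at the points \<open>x\<close> and \<open>x - z\<close>.  For unit speed curves the maximum
  matters only if \<open>z = 0\<close> or \<open>\<bar>z\<bar> > pi\<close>; it keeps \<open>\<alpha>\<close> in the domain of \<open>g\<close>.\<close>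

definition ratio :: "(real \<Rightarrow> real^3) \<Rightarrow> real \<Rightarrow> real \<Rightarrow> real" where
  "ratio \<gamma> x z = max 1 (z\<^sup>2 / (norm (\<gamma> x - \<gamma> (x - z)))\<^sup>2)"

text \<open>The kernel of the force after subtraction of \<open>g 1\<close>, in the variable \<open>z = x - y\<close>.\<close>

definition nlk :: "(real \<Rightarrow> real) \<Rightarrow> real \<Rightarrow> (real \<Rightarrow> real^3) \<Rightarrow> real \<Rightarrow> real \<Rightarrow> real^3" where
  "nlk g p \<gamma> x z = ((g (ratio \<gamma> x z) - g 1) * \<bar>z\<bar> powr (- 2 * p - 2)) *\<^sub>R (\<gamma> x - \<gamma> (x - z))"

abbreviation tr :: "real \<Rightarrow> real \<Rightarrow> 'a::zero \<Rightarrow> 'a" where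
  "tr \<epsilon> z v \<equiv> if \<epsilon> \<le> \<bar>z\<bar> then v else 0"

text \<open>For \<open>\<epsilon> = 0\<close> nothing is cut off; only \<open>Lin\<close> below requires the principal value.\<close>

definition NL :: "(real \<Rightarrow> real) \<Rightarrow> real \<Rightarrow> (real \<Rightarrow> real^3) \<Rightarrow> real \<Rightarrow> real \<Rightarrow> real^3" where
  "NL g p \<gamma> \<epsilon> x = (\<integral>z. tr \<epsilon> z (nlk g p \<gamma> x z) \<partial>circ)"

text \<open>The Fourier multiplier of \<open>Lin\<close> below, the convolution with the truncated power kernel.\<close>

definition mk :: "real \<Rightarrow> real \<Rightarrow> int \<Rightarrow> real" where
  "mk p \<epsilon> k = (\<integral>z. tr \<epsilon> z (\<bar>z\<bar> powr (- 2 * p - 2) * (1 - cos (of_int k * z))) \<partial>circ)"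

definition Lin :: "real \<Rightarrow> (real \<Rightarrow> real^3) \<Rightarrow> real \<Rightarrow> real \<Rightarrow> real^3" where
  "Lin p \<gamma> \<epsilon> x = (\<integral>z. tr \<epsilon> z (\<bar>z\<bar> powr (- 2 * p - 2) *\<^sub>R (\<gamma> x - \<gamma> (x - z))) \<partial>circ)"

lemma admissibleD:
  assumes "admissible \<delta> \<tau>"
  shows "continuous_on UNIV \<tau>" "L2_circle \<tau>" "mean_zero \<tau>" "norm (\<tau> x) = 1" "per2pi \<tau>"
    "(curve \<tau> has_vector_derivative \<tau> x) (at x)" "per2pi (curve \<tau>)" "continuous_on UNIV (curve \<tau>)"
    "vartheta (x - y) \<le> \<delta> * norm (curve \<tau> x - curve \<tau> y)"
    "norm (curve \<tau> x - curve \<tau> y) \<le> \<bar>x - y\<bar>"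
proof -
  show 1: "continuous_on UNIV \<tau>" "L2_circle \<tau>" "mean_zero \<tau>" "norm (\<tau> x) = 1"
    "vartheta (x - y) \<le> \<delta> * norm (curve \<tau> x - curve \<tau> y)" for x y
    using assms by (auto simp: admissible_def H_space_def unit_speed_def)
  show "per2pi \<tau>" using 1(2) by (simp add: L2_circle_iff)
  show d: "(curve \<tau> has_vector_derivative \<tau> x) (at x)" for x
    by (rule primitive_has_derivative[OF 1(2,1)])
  show "per2pi (curve \<tau>)" by (rule primitive_per2pi[OF 1(2,3)])
  show "continuous_on UNIV (curve \<tau>)" by (rule continuous_primitive[OF 1(2,3)])
  show "norm (curve \<tau> x - curve \<tau> y) \<le> \<bar>x - y\<bar>"
    using chord_le[OF d, of 1 x y] 1(4) by simp
qed

lemma H1_summable: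
  assumes "\<tau> \<in> H_space 1"
  shows "(\<lambda>k. (real_of_int \<bar>k\<bar> * norm (fourier \<tau> k))\<^sup>2) summable_on UNIV"
proof -
  have "(\<lambda>k. real_of_int \<bar>k\<bar> powr (2 * 1) * (norm (fourier \<tau> k))\<^sup>2) summable_on UNIV"
    using assms by (simp add: H_space_def)
  moreover have "real_of_int \<bar>k\<bar> powr (2 * 1) * (norm (fourier \<tau> k))\<^sup>2 = (real_of_int \<bar>k\<bar> * norm (fourier \<tau> k))\<^sup>2" for k
    by (simp add: power_mult_distrib)
  ultimately show ?thesis by simp
qed

lemma chord_bounds:
  assumes adm: "admissible \<delta> \<tau>" and z: "z \<noteq> 0" "\<bar>z\<bar> \<le> pi"
  shows "0 < norm (curve \<tau> x - curve \<tau> (x - z))" "norm (curve \<tau> x - curve \<tau> (x - z)) \<le> \<bar>z\<bar>"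
    "\<bar>z\<bar> \<le> \<delta> * norm (curve \<tau> x - curve \<tau> (x - z))"
    "ratio (curve \<tau>) x z = z\<^sup>2 / (norm (curve \<tau> x - curve \<tau> (x - z)))\<^sup>2"
proof -
  let ?c = "norm (curve \<tau> x - curve \<tau> (x - z))"
  have 1: "\<bar>z\<bar> \<le> \<delta> * ?c"
    using admissibleD(9)[OF adm, of x "x - z"] vartheta_small[OF z(2)] by simp
  show c: "?c \<le> \<bar>z\<bar>" using admissibleD(10)[OF adm, of x "x - z"] by simp
  have "?c \<noteq> 0" using 1 z by auto
  then show p: "0 < ?c" by simp
  show "\<bar>z\<bar> \<le> \<delta> * ?c" by fact
  have "?c\<^sup>2 \<le> z\<^sup>2" using power_mono[OF c, of 2] by simp
  then show "ratio (curve \<tau>) x z = z\<^sup>2 / ?c\<^sup>2"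
    using p by (simp add: ratio_def max_def field_simps)
qed

lemma ratio_bounds:
  assumes adm: "admissible \<delta> \<tau>" and z: "z \<noteq> 0" "\<bar>z\<bar> \<le> pi"
    and \<omega>: "\<And>a b. \<bar>a - b\<bar> \<le> \<bar>z\<bar> \<Longrightarrow> (norm (\<tau> a - \<tau> b))\<^sup>2 \<le> \<omega>"
  shows "ratio (curve \<tau>) x z \<in> {1..\<delta>\<^sup>2}" "ratio (curve \<tau>) x z - 1 \<le> \<delta>\<^sup>2 * \<omega>"
    "\<bar>(curve \<tau> x - curve \<tau> (x - z)) \<bullet> (\<tau> x - \<tau> (x - z))\<bar> \<le> \<bar>z\<bar> * \<omega> / 2"
proof -
  note cb = chord_bounds[OF adm z, of x]
  have \<omega>': "(norm (\<tau> a - \<tau> b))\<^sup>2 \<le> \<omega>"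
    if "min x (x - z) \<le> a" "a \<le> max x (x - z)" "min x (x - z) \<le> b" "b \<le> max x (x - z)" for a b
    using that by (intro \<omega>) (auto simp: min_def max_def split: if_splits)
  note cd = chord_defect[OF admissibleD(6)[OF adm] admissibleD(4)[OF adm], of x "x - z", OF \<omega>']
  have "\<bar>z\<bar> - norm (curve \<tau> x - curve \<tau> (x - z)) \<le> \<bar>z\<bar> * \<omega> / 2" using cd(1) by simp
  from chord_ratio[OF cb(1-3) this] cb(4)
  show "ratio (curve \<tau>) x z \<in> {1..\<delta>\<^sup>2}" "ratio (curve \<tau>) x z - 1 \<le> \<delta>\<^sup>2 * \<omega>" by auto
  show "\<bar>(curve \<tau> x - curve \<tau> (x - z)) \<bullet> (\<tau> x - \<tau> (x - z))\<bar> \<le> \<bar>z\<bar> * \<omega> / 2" using cd(2) by simp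
qed

subsection \<open>Bounds for the nonlinear part\<close>

text \<open>One fixed choice of the constant in \<^const>\<open>good_kernel\<close>, so that later bounds are functions of the
  parameters.\<close>

definition gconst :: "nat \<Rightarrow> (real \<Rightarrow> real) \<Rightarrow> real \<Rightarrow> real" where
  "gconst m g B = (SOME R. R \<ge> 0 \<and> (\<forall>\<alpha>\<in>{1..B}. \<bar>g \<alpha> - g 1\<bar> \<le> R * (\<alpha> - 1) ^ Suc m) \<and>
      (\<forall>c\<in>{1..B}. \<forall>\<alpha>\<in>{1..c}. \<forall>\<beta>\<in>{1..c}. \<bar>g \<alpha> - g \<beta>\<bar> \<le> R * (c - 1) ^ m * \<bar>\<alpha> - \<beta>\<bar>))"

lemma gconst:
  assumes "good_kernel m g p"
  shows "gconst m g B \<ge> 0"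
    "\<alpha> \<in> {1..B} \<Longrightarrow> \<bar>g \<alpha> - g 1\<bar> \<le> gconst m g B * (\<alpha> - 1) ^ Suc m"
    "c \<in> {1..B} \<Longrightarrow> \<alpha> \<in> {1..c} \<Longrightarrow> \<beta> \<in> {1..c} \<Longrightarrow> \<bar>g \<alpha> - g \<beta>\<bar> \<le> gconst m g B * (c - 1) ^ m * \<bar>\<alpha> - \<beta>\<bar>"
proof -
  have "\<exists>R. R \<ge> 0 \<and> (\<forall>\<alpha>\<in>{1..B}. \<bar>g \<alpha> - g 1\<bar> \<le> R * (\<alpha> - 1) ^ Suc m) \<and>
      (\<forall>c\<in>{1..B}. \<forall>\<alpha>\<in>{1..c}. \<forall>\<beta>\<in>{1..c}. \<bar>g \<alpha> - g \<beta>\<bar> \<le> R * (c - 1) ^ m * \<bar>\<alpha> - \<beta>\<bar>)"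
    using assms unfolding good_kernel_def by blast
  from someI_ex[OF this] show "gconst m g B \<ge> 0"
    "\<alpha> \<in> {1..B} \<Longrightarrow> \<bar>g \<alpha> - g 1\<bar> \<le> gconst m g B * (\<alpha> - 1) ^ Suc m"
    "c \<in> {1..B} \<Longrightarrow> \<alpha> \<in> {1..c} \<Longrightarrow> \<beta> \<in> {1..c} \<Longrightarrow> \<bar>g \<alpha> - g \<beta>\<bar> \<le> gconst m g B * (c - 1) ^ m * \<bar>\<alpha> - \<beta>\<bar>"
    unfolding gconst_def[symmetric] by blast+
qed

lemma nlk_0 [simp]: "nlk g p \<gamma> x 0 = 0"
  by (simp add: nlk_def)

text \<open>The constant in the size bound for the kernel \<open>nlk\<close> and, with \<open>nlL\<close>, in its Lipschitz bound; \<open>E\<close> and \<open>M\<close> are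
  the Hoelder and Lipschitz constants of the tangent.\<close>

definition nlC :: "nat \<Rightarrow> (real \<Rightarrow> real) \<Rightarrow> real \<Rightarrow> real \<Rightarrow> real" where
  "nlC m g \<delta> E = gconst m g (\<delta>\<^sup>2) * (\<delta>\<^sup>2 * E) ^ Suc m"

lemma nlk_bound:
  assumes gk: "good_kernel m g p" and adm: "admissible \<delta> \<tau>"
    and E: "\<And>a b. \<bar>a - b\<bar> \<le> pi \<Longrightarrow> (norm (\<tau> a - \<tau> b))\<^sup>2 \<le> E * \<bar>a - b\<bar>" "E \<ge> 0" and z: "\<bar>z\<bar> \<le> pi"
  shows "norm (nlk g p (curve \<tau>) x z) \<le> nlC m g \<delta> E * \<bar>z\<bar> powr (real m - 2 * p)"
proof (cases "z = 0")
  case True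
  then show ?thesis by simp
next
  case False
  have \<omega>: "(norm (\<tau> a - \<tau> b))\<^sup>2 \<le> E * \<bar>z\<bar>" if "\<bar>a - b\<bar> \<le> \<bar>z\<bar>" for a b
  proof -
    have "(norm (\<tau> a - \<tau> b))\<^sup>2 \<le> E * \<bar>a - b\<bar>" using that z by (intro E) auto
    also have "\<dots> \<le> E * \<bar>z\<bar>" using that E by (intro mult_left_mono) auto
    finally show ?thesis .
  qed
  let ?\<alpha> = "ratio (curve \<tau>) x z"
  note rb = ratio_bounds[OF adm False z \<omega>, of x]
  have "\<bar>g ?\<alpha> - g 1\<bar> \<le> gconst m g (\<delta>\<^sup>2) * (?\<alpha> - 1) ^ Suc m" using rb by (intro gconst[OF gk])
  also have "\<dots> \<le> gconst m g (\<delta>\<^sup>2) * (\<delta>\<^sup>2 * (E * \<bar>z\<bar>)) ^ Suc m"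
    using rb gconst[OF gk] by (intro mult_left_mono power_mono) auto
  also have "\<dots> = nlC m g \<delta> E * \<bar>z\<bar> ^ Suc m"
    unfolding nlC_def by (simp only: mult.assoc[symmetric] power_mult_distrib)
  finally have 1: "\<bar>g ?\<alpha> - g 1\<bar> \<le> nlC m g \<delta> E * \<bar>z\<bar> ^ Suc m" .
  have "norm (nlk g p (curve \<tau>) x z) = \<bar>g ?\<alpha> - g 1\<bar> * \<bar>z\<bar> powr (- 2 * p - 2) * norm (curve \<tau> x - curve \<tau> (x - z))"
    by (simp add: nlk_def abs_mult)
  also have "\<dots> \<le> (nlC m g \<delta> E * \<bar>z\<bar> ^ Suc m) * \<bar>z\<bar> powr (- 2 * p - 2) * \<bar>z\<bar>"
    using 1 chord_bounds[OF adm False z, of x] by (intro mult_mono mult_right_mono) auto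
  also have "\<dots> = nlC m g \<delta> E * (\<bar>z\<bar> powr (real (Suc m)) * \<bar>z\<bar> powr (- 2 * p - 2) * \<bar>z\<bar> powr 1)"
    using False powr_realpow[of "\<bar>z\<bar>" "Suc m"] by (simp del: power_Suc of_nat_Suc)
  also have "\<dots> = nlC m g \<delta> E * \<bar>z\<bar> powr (real m - 2 * p)"
    by (simp only: powr_add[symmetric]) simp
  finally show ?thesis .
qed

definition nlL :: "nat \<Rightarrow> (real \<Rightarrow> real) \<Rightarrow> real \<Rightarrow> real \<Rightarrow> real" where
  "nlL m g \<delta> M = gconst m g (\<delta>\<^sup>2) * (\<delta>\<^sup>2 * M\<^sup>2) ^ m * (\<delta> ^ 4 * M\<^sup>2 + \<delta>\<^sup>2 * M ^ 3 * pi)"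

text \<open>Differentiating the kernel in \<open>x\<close> costs only one power of \<open>\<bar>z\<bar>\<close>: the derivative of the squared
  chord length is \<open>2 \<langle>\<Delta>\<gamma>, \<Delta>\<tau>\<rangle>\<close>, and for unit vectors this is of third order in \<open>z\<close>.\<close>

lemma nlk_Lipschitz:
  assumes gk: "good_kernel m g p" and adm: "admissible \<delta> \<tau>"
    and M: "\<And>a b. norm (\<tau> a - \<tau> b) \<le> M * \<bar>a - b\<bar>" "M \<ge> 0" and z: "\<bar>z\<bar> \<le> pi"
  shows "norm (nlk g p (curve \<tau>) x z - nlk g p (curve \<tau>) y z) \<le> nlL m g \<delta> M * \<bar>x - y\<bar> * \<bar>z\<bar> powr (2 * real m - 2 * p)"
proof (cases "z = 0")
  case True
  then show ?thesis by simp
next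
  case False
  let ?\<gamma> = "curve \<tau>" and ?R = "gconst m g (\<delta>\<^sup>2)"
  define \<Delta> where "\<Delta> x = ?\<gamma> x - ?\<gamma> (x - z)" for x
  define \<alpha> where "\<alpha> x = ratio ?\<gamma> x z" for x
  let ?A = "\<delta> ^ 4 * M\<^sup>2 * \<bar>z\<bar> * \<bar>x - y\<bar>" and ?G = "\<delta>\<^sup>2 * M\<^sup>2 * z\<^sup>2"
  let ?D = "(norm (\<Delta> x))\<^sup>2 * (norm (\<Delta> y))\<^sup>2"
  have \<omega>: "(norm (\<tau> a - \<tau> b))\<^sup>2 \<le> M\<^sup>2 * z\<^sup>2" if "\<bar>a - b\<bar> \<le> \<bar>z\<bar>" for a b
  proof -
    have "norm (\<tau> a - \<tau> b) \<le> M * \<bar>z\<bar>" using M(1)[of a b] mult_left_mono[OF that M(2)] by linarith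
    then have "(norm (\<tau> a - \<tau> b))\<^sup>2 \<le> (M * \<bar>z\<bar>)\<^sup>2" by (intro power_mono) auto
    then show ?thesis by (simp add: power_mult_distrib)
  qed
  note rb = ratio_bounds[OF adm False z \<omega>, simplified, folded \<alpha>_def \<Delta>_def]
  note cb = chord_bounds[OF adm False z, folded \<alpha>_def \<Delta>_def]
  have R: "?R \<ge> 0" using gconst[OF gk] by blast
  have d\<Delta>: "(\<Delta> has_vector_derivative \<tau> x - \<tau> (x - z)) (at x)" for x
  proof -
    have "((\<lambda>x. ?\<gamma> (x - z)) has_vector_derivative 1 *\<^sub>R \<tau> (x - z)) (at x)"
      by (rule vector_diff_chain_at[of "\<lambda>x. x - z" 1 x ?\<gamma>, unfolded o_def])
         (auto intro!: derivative_eq_intros admissibleD(6)[OF adm])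
    then show ?thesis
      unfolding \<Delta>_def[abs_def] by (auto intro!: derivative_eq_intros admissibleD(6)[OF adm])
  qed
  have \<Delta>d: "norm (\<Delta> x - \<Delta> y) \<le> M * \<bar>z\<bar> * \<bar>x - y\<bar>"
  proof (rule chord_le[OF d\<Delta>])
    show "norm (\<tau> x - \<tau> (x - z)) \<le> M * \<bar>z\<bar>" for x using M(1)[of x "x - z"] by simp
  qed
  have Dd: "\<bar>(norm (\<Delta> x))\<^sup>2 - (norm (\<Delta> y))\<^sup>2\<bar> \<le> \<bar>z\<bar> * (M\<^sup>2 * z\<^sup>2) * \<bar>x - y\<bar>"
  proof -
    have d: "((\<lambda>x. (norm (\<Delta> x))\<^sup>2) has_vector_derivative 2 * (\<Delta> x \<bullet> (\<tau> x - \<tau> (x - z)))) (at x)" for x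
    proof -
      have "((\<lambda>x. \<Delta> x \<bullet> \<Delta> x) has_vector_derivative \<Delta> x \<bullet> (\<tau> x - \<tau> (x - z)) + (\<tau> x - \<tau> (x - z)) \<bullet> \<Delta> x) (at x)"
        by (rule bounded_bilinear.has_vector_derivative[OF bounded_bilinear_inner d\<Delta> d\<Delta>])
      then show ?thesis by (simp add: power2_norm_eq_inner inner_commute)
    qed
    have "norm ((norm (\<Delta> x))\<^sup>2 - (norm (\<Delta> y))\<^sup>2) \<le> (\<bar>z\<bar> * (M\<^sup>2 * z\<^sup>2)) * \<bar>x - y\<bar>"
    proof (rule chord_le[OF d])
      show "norm (2 * (\<Delta> x \<bullet> (\<tau> x - \<tau> (x - z)))) \<le> \<bar>z\<bar> * (M\<^sup>2 * z\<^sup>2)" for x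
        using rb(3)[of x] by (simp add: abs_mult mult.commute)
    qed
    then show ?thesis by simp
  qed
  have cpos: "norm (\<Delta> x) > 0" for x using cb(1) by simp
  have z2: "z\<^sup>2 \<le> \<delta>\<^sup>2 * (norm (\<Delta> x))\<^sup>2" for x
    using power_mono[OF cb(3)[of x], of 2] by (simp add: power_mult_distrib)
  have \<alpha>d: "\<bar>\<alpha> x - \<alpha> y\<bar> \<le> ?A"
  proof -
    have "\<alpha> x - \<alpha> y = z\<^sup>2 * ((norm (\<Delta> y))\<^sup>2 - (norm (\<Delta> x))\<^sup>2) / ?D"
      using cb(4) cpos[of x] cpos[of y] by (simp add: field_simps)
    then have "\<bar>\<alpha> x - \<alpha> y\<bar> = z\<^sup>2 * \<bar>(norm (\<Delta> x))\<^sup>2 - (norm (\<Delta> y))\<^sup>2\<bar> / ?D"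
      by (simp add: abs_mult abs_minus_commute)
    also have "\<dots> \<le> z\<^sup>2 * (\<bar>z\<bar> * (M\<^sup>2 * z\<^sup>2) * \<bar>x - y\<bar>) / ?D"
      using Dd by (intro divide_right_mono mult_left_mono) auto
    also have "\<dots> = (z\<^sup>2 * z\<^sup>2) * (\<bar>z\<bar> * M\<^sup>2 * \<bar>x - y\<bar>) / ?D"
      by (simp add: mult_ac)
    also have "\<dots> \<le> ((\<delta>\<^sup>2 * (norm (\<Delta> x))\<^sup>2) * (\<delta>\<^sup>2 * (norm (\<Delta> y))\<^sup>2)) * (\<bar>z\<bar> * M\<^sup>2 * \<bar>x - y\<bar>) / ?D"
      using z2 by (intro divide_right_mono mult_right_mono mult_mono) auto
    also have "\<dots> = ?A"
      using cpos[of x] cpos[of y] by (simp add: field_simps)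
    finally show ?thesis .
  qed
  let ?q = "(\<delta>\<^sup>2 * M\<^sup>2) ^ m * (z\<^sup>2) ^ m"
  have pw: "(t - 1) ^ m \<le> ?q" if "1 \<le> t" "t - 1 \<le> \<delta>\<^sup>2 * (M\<^sup>2 * z\<^sup>2)" for t
    using power_mono[OF that(2), of m] that(1) by (simp add: power_mult_distrib mult_ac)
  have g1: "\<bar>g (\<alpha> x) - g (\<alpha> y)\<bar> \<le> ?R * ?q * (?A)"
  proof -
    have "\<bar>g (\<alpha> x) - g (\<alpha> y)\<bar> \<le> ?R * (max (\<alpha> x) (\<alpha> y) - 1) ^ m * \<bar>\<alpha> x - \<alpha> y\<bar>"
      using rb(1)[of x] rb(1)[of y] by (intro gconst(3)[OF gk]) auto
    also have "\<dots> \<le> ?R * ?q * (?A)"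
      using rb(1,2)[of x] rb(1,2)[of y] R \<alpha>d by (intro mult_mono pw) (auto simp: max_def)
    finally show ?thesis .
  qed
  have g2: "\<bar>g (\<alpha> y) - g 1\<bar> \<le> ?R * (?q * ?G)"
  proof -
    have "\<bar>g (\<alpha> y) - g 1\<bar> \<le> ?R * (\<alpha> y - 1) ^ Suc m"
      using rb(1)[of y] by (intro gconst(2)[OF gk]) auto
    also have "(\<alpha> y - 1) ^ Suc m = (\<alpha> y - 1) ^ m * (\<alpha> y - 1)" by simp
    also have "?R * \<dots> \<le> ?R * (?q * ?G)"
      using rb(1,2)[of y] R by (intro mult_left_mono mult_mono pw) (auto simp: mult_ac)
    finally show ?thesis .
  qed
  let ?w = "\<bar>z\<bar> powr (- 2 * p - 2)"
  have "nlk g p ?\<gamma> x z - nlk g p ?\<gamma> y z =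
      ((g (\<alpha> x) - g (\<alpha> y)) * ?w) *\<^sub>R \<Delta> x + ((g (\<alpha> y) - g 1) * ?w) *\<^sub>R (\<Delta> x - \<Delta> y)"
    unfolding nlk_def \<alpha>_def \<Delta>_def by (simp add: algebra_simps)
  also have "norm \<dots> \<le> \<bar>g (\<alpha> x) - g (\<alpha> y)\<bar> * ?w * norm (\<Delta> x) + \<bar>g (\<alpha> y) - g 1\<bar> * ?w * norm (\<Delta> x - \<Delta> y)"
    by (rule order_trans[OF norm_triangle_ineq]) (simp add: abs_mult)
  also have "\<dots> \<le> ?R * ?q * (?A) * ?w * \<bar>z\<bar> + ?R * (?q * ?G) * ?w * (M * \<bar>z\<bar> * \<bar>x - y\<bar>)"
  proof (rule add_mono)
    show "\<bar>g (\<alpha> x) - g (\<alpha> y)\<bar> * ?w * norm (\<Delta> x) \<le> ?R * ?q * (?A) * ?w * \<bar>z\<bar>"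
      by (rule mult_mono[OF mult_right_mono[OF g1] cb(2)])
         (rule powr_ge_zero norm_ge_zero mult_nonneg_nonneg[OF order_trans[OF abs_ge_zero g1] powr_ge_zero])+
    show "\<bar>g (\<alpha> y) - g 1\<bar> * ?w * norm (\<Delta> x - \<Delta> y) \<le> ?R * (?q * ?G) * ?w * (M * \<bar>z\<bar> * \<bar>x - y\<bar>)"
      by (rule mult_mono[OF mult_right_mono[OF g2] \<Delta>d])
         (rule powr_ge_zero norm_ge_zero mult_nonneg_nonneg[OF order_trans[OF abs_ge_zero g2] powr_ge_zero])+
  qed
  also have "\<dots> = ?R * ?q * ?w * z\<^sup>2 * \<bar>x - y\<bar> * (\<delta> ^ 4 * M\<^sup>2 + \<delta>\<^sup>2 * M ^ 3 * \<bar>z\<bar>)"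
  proof -
    have alg: "R * q * (d4 * s * a * b) * w * a + R * (q * (d2 * s * (a * a))) * w * (M * a * b)
        = R * q * w * (a * a) * b * (d4 * s + d2 * (M * s) * a)" for R q d4 s a b w d2 :: real
      by (simp add: algebra_simps)
    have M3: "M ^ 3 = M * M\<^sup>2" by (simp add: power3_eq_cube power2_eq_square)
    have zz: "z\<^sup>2 = \<bar>z\<bar> * \<bar>z\<bar>" by (simp add: power2_eq_square)
    show ?thesis unfolding M3 zz by (rule alg)
  qed
  also have "\<dots> \<le> ?R * ?q * ?w * z\<^sup>2 * \<bar>x - y\<bar> * (\<delta> ^ 4 * M\<^sup>2 + \<delta>\<^sup>2 * M ^ 3 * pi)"
    using R z M(2) by (intro mult_left_mono add_left_mono mult_nonneg_nonneg) auto
  also have "\<dots> = nlL m g \<delta> M * \<bar>x - y\<bar> * ((z\<^sup>2) ^ m * ?w * z\<^sup>2)"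
    by (simp add: nlL_def mult_ac)
  also have "(z\<^sup>2) ^ m * ?w * z\<^sup>2 = \<bar>z\<bar> powr (2 * real m - 2 * p)"
  proof -
    have "(z\<^sup>2) ^ m = \<bar>z\<bar> powr (2 * real m)"
      using False powr_realpow[of "\<bar>z\<bar>" "2 * m"] by (simp add: power_mult)
    moreover have "z\<^sup>2 = \<bar>z\<bar> powr 2" using False by simp
    ultimately have "(z\<^sup>2) ^ m * ?w * z\<^sup>2 = \<bar>z\<bar> powr (2 * real m) * ?w * \<bar>z\<bar> powr 2" by (simp only:)
    also have "\<dots> = \<bar>z\<bar> powr (2 * real m - 2 * p)" by (simp only: powr_add[symmetric]) simp
    finally show ?thesis .
  qed
  finally show ?thesis .
qed

text \<open>From \<open>2 * p < m / 2 + 1\<close>; the two exponents are those of the size and the Lipschitz bound for \<open>nlk\<close>.\<close>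

lemma good_exponents:
  assumes "good_kernel m g p"
  shows "real m - 2 * p > -1" "2 * real m - 2 * p > -1"
  using assms unfolding good_kernel_def by auto

definition pint :: "real \<Rightarrow> real" where
  "pint e = (\<integral>z. \<bar>z\<bar> powr e \<partial>circ)"

lemma pint_nonneg: "pint e \<ge> 0"
  unfolding pint_def by (rule integral_nonneg) simp

lemma measurable_g_max:
  assumes "continuous_on {1..} (g :: real \<Rightarrow> real)"
  shows "(\<lambda>t. g (max 1 t)) \<in> borel_measurable borel"
  by (intro borel_measurable_continuous_onI continuous_on_compose2[OF assms] continuous_intros) auto

lemma measurable_nlk_pair:
  assumes g: "continuous_on {1..} g" and \<gamma>: "continuous_on UNIV \<gamma>"
  shows "(\<lambda>q. nlk g p \<gamma> (fst q) (snd q)) \<in> borel_measurable (borel \<Otimes>\<^sub>M borel)"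
proof -
  have [measurable]: "\<gamma> \<in> borel_measurable borel" by (intro borel_measurable_continuous_onI \<gamma>)
  have [measurable]: "(\<lambda>t. g (max 1 t)) \<in> borel_measurable borel" by (rule measurable_g_max[OF g])
  have "(\<lambda>q. g (max 1 ((snd q)\<^sup>2 / (norm (\<gamma> (fst q) - \<gamma> (fst q - snd q)))\<^sup>2))) \<in> borel_measurable (borel \<Otimes>\<^sub>M borel)"
    by measurable
  then show ?thesis unfolding nlk_def ratio_def by measurable
qed

lemma measurable_nlk:
  assumes g: "continuous_on {1..} g" and \<gamma>: "continuous_on UNIV \<gamma>"
  shows "(\<lambda>z. tr \<epsilon> z (nlk g p \<gamma> x z)) \<in> borel_measurable circ"
proof -
  have [measurable]: "nlk g p \<gamma> x \<in> borel_measurable borel"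
    using measurable_compose[OF measurable_Pair1' measurable_nlk_pair[OF g \<gamma>], of x] by simp
  show ?thesis by (intro measurable_circI) measurable
qed

lemma measurable_NL:
  assumes g: "continuous_on {1..} g" and \<gamma>: "continuous_on UNIV \<gamma>"
  shows "NL g p \<gamma> \<epsilon> \<in> borel_measurable borel"
proof -
  have [measurable]: "(\<lambda>q. nlk g p \<gamma> (fst q) (snd q)) \<in> borel_measurable (borel \<Otimes>\<^sub>M borel)"
    by (rule measurable_nlk_pair[OF g \<gamma>])
  have "(\<lambda>q. if \<epsilon> \<le> \<bar>snd q\<bar> then nlk g p \<gamma> (fst q) (snd q) else 0) \<in> borel_measurable (borel \<Otimes>\<^sub>M borel)"
    by measurable
  from measurable_compose[OF measurable_Pair[OF measurable_fst measurable_compose[OF measurable_snd measurable_circ_ident]] this]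
  have "(\<lambda>q. if \<epsilon> \<le> \<bar>snd q\<bar> then nlk g p \<gamma> (fst q) (snd q) else 0) \<in> borel_measurable (borel \<Otimes>\<^sub>M circ)"
    by (simp only: fst_conv snd_conv)
  then have "(\<lambda>x. \<integral>z. tr \<epsilon> z (nlk g p \<gamma> x z) \<partial>circ) \<in> borel_measurable borel"
    by (intro circ.borel_measurable_lebesgue_integral) (simp add: case_prod_unfold)
  then show ?thesis unfolding NL_def[abs_def] .
qed

lemma integrable_nlk:
  assumes gk: "good_kernel m g p" and adm: "admissible \<delta> \<tau>"
    and E: "\<And>a b. \<bar>a - b\<bar> \<le> pi \<Longrightarrow> (norm (\<tau> a - \<tau> b))\<^sup>2 \<le> E * \<bar>a - b\<bar>" "E \<ge> 0"
  shows "integrable circ (\<lambda>z. tr \<epsilon> z (nlk g p (curve \<tau>) x z))"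
proof (rule integrable_bound)
  show "integrable circ (\<lambda>z. nlC m g \<delta> E * \<bar>z\<bar> powr (real m - 2 * p))"
    by (intro integrable_mult_right integrable_abs_powr good_exponents(1)[OF gk])
  show "AE z in circ. norm (tr \<epsilon> z (nlk g p (curve \<tau>) x z)) \<le> norm (nlC m g \<delta> E * \<bar>z\<bar> powr (real m - 2 * p))"
  proof (rule AE_I2)
    fix z assume "z \<in> space circ"
    then have "\<bar>z\<bar> \<le> pi" by auto
    from nlk_bound[OF gk adm E this, of x]
    show "norm (tr \<epsilon> z (nlk g p (curve \<tau>) x z)) \<le> norm (nlC m g \<delta> E * \<bar>z\<bar> powr (real m - 2 * p))"
      by auto
  qed
  show "(\<lambda>z. tr \<epsilon> z (nlk g p (curve \<tau>) x z)) \<in> borel_measurable circ"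
    using gk admissibleD(8)[OF adm] by (intro measurable_nlk) (auto simp: good_kernel_def)
qed

lemma NL_bound:
  assumes gk: "good_kernel m g p" and adm: "admissible \<delta> \<tau>"
    and E: "\<And>a b. \<bar>a - b\<bar> \<le> pi \<Longrightarrow> (norm (\<tau> a - \<tau> b))\<^sup>2 \<le> E * \<bar>a - b\<bar>" "E \<ge> 0"
  shows "norm (NL g p (curve \<tau>) \<epsilon> x) \<le> nlC m g \<delta> E * pint (real m - 2 * p)"
proof -
  have "norm (NL g p (curve \<tau>) \<epsilon> x) \<le> (\<integral>z. norm (tr \<epsilon> z (nlk g p (curve \<tau>) x z)) \<partial>circ)"
    unfolding NL_def by (rule integral_norm_bound)
  also have "\<dots> \<le> (\<integral>z. nlC m g \<delta> E * \<bar>z\<bar> powr (real m - 2 * p) \<partial>circ)"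
  proof (rule integral_mono)
    fix z assume "z \<in> space circ"
    then have "\<bar>z\<bar> \<le> pi" by auto
    from nlk_bound[OF gk adm E this, of x]
    show "norm (tr \<epsilon> z (nlk g p (curve \<tau>) x z)) \<le> nlC m g \<delta> E * \<bar>z\<bar> powr (real m - 2 * p)"
      by (auto intro: order_trans[OF norm_ge_zero])
  next
    show "integrable circ (\<lambda>z. norm (tr \<epsilon> z (nlk g p (curve \<tau>) x z)))"
      by (rule integrable_norm[OF integrable_nlk[OF gk adm E]])
    show "integrable circ (\<lambda>z. nlC m g \<delta> E * \<bar>z\<bar> powr (real m - 2 * p))"
      by (rule integrable_mult_right[OF integrable_abs_powr[OF good_exponents(1)[OF gk]]])
  qed
  finally show ?thesis by (simp add: pint_def)
qed

text \<open>Half of the margin \<open>e + 1\<close> in the integrability of \<open>\<bar>z\<bar> powr e\<close> is spent on a rate in \<open>\<epsilon>\<close>, which makes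
  the convergence of the truncations uniform.\<close>

lemma NL_trunc_diff:
  assumes gk: "good_kernel m g p" and adm: "admissible \<delta> \<tau>"
    and E: "\<And>a b. \<bar>a - b\<bar> \<le> pi \<Longrightarrow> (norm (\<tau> a - \<tau> b))\<^sup>2 \<le> E * \<bar>a - b\<bar>" "E \<ge> 0" and "\<epsilon> > 0"
  defines "e \<equiv> real m - 2 * p"
  shows "norm (NL g p (curve \<tau>) \<epsilon> x - NL g p (curve \<tau>) 0 x) \<le> \<epsilon> powr ((e+1)/2) * (nlC m g \<delta> E * pint (e - (e+1)/2))"
proof -
  have e: "e > -1" "e - (e+1)/2 > -1" using good_exponents(1)[OF gk] by (auto simp: e_def field_simps)
  let ?f = "\<lambda>\<epsilon> z. tr \<epsilon> z (nlk g p (curve \<tau>) x z)"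
  have i: "integrable circ (?f \<epsilon>)" for \<epsilon> by (rule integrable_nlk[OF gk adm E])
  have eq: "NL g p (curve \<tau>) \<epsilon> x - NL g p (curve \<tau>) 0 x = (\<integral>z. ?f \<epsilon> z - ?f 0 z \<partial>circ)"
    unfolding NL_def by (rule integral_diff[symmetric, OF i i])
  have le: "(\<integral>z. norm (?f \<epsilon> z - ?f 0 z) \<partial>circ) \<le> (\<integral>z. \<epsilon> powr ((e+1)/2) * (nlC m g \<delta> E * \<bar>z\<bar> powr (e - (e+1)/2)) \<partial>circ)"
  proof (rule integral_mono)
    show "integrable circ (\<lambda>z. \<epsilon> powr ((e+1)/2) * (nlC m g \<delta> E * \<bar>z\<bar> powr (e - (e+1)/2)))"
      by (intro integrable_mult_right integrable_abs_powr e)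
    fix z assume "z \<in> space circ"
    then have z: "\<bar>z\<bar> \<le> pi" by auto
    have C: "nlC m g \<delta> E \<ge> 0" unfolding nlC_def using gconst[OF gk] E by (intro mult_nonneg_nonneg) auto
    show "norm (?f \<epsilon> z - ?f 0 z) \<le> \<epsilon> powr ((e+1)/2) * (nlC m g \<delta> E * \<bar>z\<bar> powr (e - (e+1)/2))"
    proof (cases "\<bar>z\<bar> < \<epsilon>")
      case True
      have 1: "norm (?f \<epsilon> z - ?f 0 z) \<le> nlC m g \<delta> E * \<bar>z\<bar> powr e"
        using True nlk_bound[OF gk adm E z, of x] by (auto simp: e_def)
      have 2: "\<bar>z\<bar> powr e = \<bar>z\<bar> powr ((e+1)/2) * \<bar>z\<bar> powr (e - (e+1)/2)"
        by (simp only: powr_add[symmetric]) simp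
      have "nlC m g \<delta> E * \<bar>z\<bar> powr e \<le> nlC m g \<delta> E * (\<epsilon> powr ((e+1)/2) * \<bar>z\<bar> powr (e - (e+1)/2))"
        unfolding 2 using True e(1) C by (intro mult_left_mono mult_right_mono powr_mono2) auto
      with 1 show ?thesis by (simp add: mult_ac)
    next
      case False
      then show ?thesis using C by simp
    qed
  qed (rule integrable_norm[OF integrable_diff[OF i i]])
  show ?thesis
    unfolding eq using order_trans[OF integral_norm_bound le] by (simp add: pint_def)
qed

lemma NL_Lipschitz:
  assumes gk: "good_kernel m g p" and adm: "admissible \<delta> \<tau>"
    and M: "\<And>a b. norm (\<tau> a - \<tau> b) \<le> M * \<bar>a - b\<bar>" "M \<ge> 0"
    and E: "\<And>a b. \<bar>a - b\<bar> \<le> pi \<Longrightarrow> (norm (\<tau> a - \<tau> b))\<^sup>2 \<le> E * \<bar>a - b\<bar>" "E \<ge> 0"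
  shows "norm (NL g p (curve \<tau>) 0 x - NL g p (curve \<tau>) 0 y) \<le> nlL m g \<delta> M * pint (2 * real m - 2 * p) * \<bar>x - y\<bar>"
proof -
  let ?f = "\<lambda>x z. if 0 \<le> \<bar>z\<bar> then nlk g p (curve \<tau>) x z else 0"
  have i: "integrable circ (?f x)" for x by (rule integrable_nlk[OF gk adm E])
  have eq: "NL g p (curve \<tau>) 0 x - NL g p (curve \<tau>) 0 y = (\<integral>z. ?f x z - ?f y z \<partial>circ)"
    unfolding NL_def by (rule integral_diff[symmetric, OF i i])
  have le: "(\<integral>z. norm (?f x z - ?f y z) \<partial>circ) \<le> (\<integral>z. nlL m g \<delta> M * \<bar>x - y\<bar> * \<bar>z\<bar> powr (2 * real m - 2 * p) \<partial>circ)"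
  proof (rule integral_mono)
    show "integrable circ (\<lambda>z. nlL m g \<delta> M * \<bar>x - y\<bar> * \<bar>z\<bar> powr (2 * real m - 2 * p))"
      by (intro integrable_mult_right integrable_abs_powr good_exponents(2)[OF gk])
    fix z assume "z \<in> space circ"
    then have "\<bar>z\<bar> \<le> pi" by auto
    from nlk_Lipschitz[OF gk adm M this, of x y]
    show "norm (?f x z - ?f y z) \<le> nlL m g \<delta> M * \<bar>x - y\<bar> * \<bar>z\<bar> powr (2 * real m - 2 * p)" by simp
  qed (rule integrable_norm[OF integrable_diff[OF i i]])
  show ?thesis
    unfolding eq using order_trans[OF integral_norm_bound le] by (simp add: pint_def mult_ac)
qed

lemma nlk_per2pi:
  assumes "per2pi \<gamma>" shows "per2pi (\<lambda>x. nlk g p \<gamma> x z)"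
  unfolding per2pi_def
proof
  fix x
  have a: "\<gamma> (x + 2 * pi) = \<gamma> x" using assms by (simp add: per2pi_def)
  have b: "\<gamma> (x + 2 * pi - z) = \<gamma> (x - z)"
    using assms[unfolded per2pi_def, THEN spec, of "x - z"] by (simp add: algebra_simps)
  show "nlk g p \<gamma> (x + 2 * pi) z = nlk g p \<gamma> x z"
    unfolding nlk_def ratio_def a b ..
qed

lemma NL_per2pi:
  assumes "per2pi \<gamma>" shows "per2pi (NL g p \<gamma> \<epsilon>)"
  using nlk_per2pi[OF assms] by (simp add: per2pi_def NL_def cong: if_cong)

lemma nlk_antisym: "nlk g p \<gamma> (x + z) z = - nlk g p \<gamma> x (- z)"
  unfolding nlk_def ratio_def by (simp add: norm_minus_commute algebra_simps)

text \<open>The total nonlinear force vanishes because the kernel is antisymmetric in the two points.\<close>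

lemma NL_mean_zero:
  assumes gk: "good_kernel m g p" and adm: "admissible \<delta> \<tau>"
    and E: "\<And>a b. \<bar>a - b\<bar> \<le> pi \<Longrightarrow> (norm (\<tau> a - \<tau> b))\<^sup>2 \<le> E * \<bar>a - b\<bar>" "E \<ge> 0"
  shows "(\<integral>x. NL g p (curve \<tau>) 0 x \<partial>circ) = 0"
proof -
  let ?I = "\<integral>x. NL g p (curve \<tau>) 0 x \<partial>circ"
  let ?k = "nlk g p (curve \<tau>)"
  interpret P: pair_sigma_finite circ circ by unfold_locales
  have ik: "integrable circ (?k x)" for x using integrable_nlk[OF gk adm E, of 0 x] by simp
  have NLk: "NL g p (curve \<tau>) 0 x = (\<integral>z. ?k x z \<partial>circ)" for x by (simp add: NL_def)
  have g: "continuous_on {1..} g" using gk by (simp add: good_kernel_def)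
  have [measurable]: "(\<lambda>q. ?k (fst q) (snd q)) \<in> borel_measurable (circ \<Otimes>\<^sub>M circ)"
  proof -
    have "(\<lambda>q. (fst q, snd q)) \<in> measurable (circ \<Otimes>\<^sub>M circ) (borel \<Otimes>\<^sub>M borel)"
      by (intro measurable_Pair measurable_compose[OF measurable_fst measurable_circ_ident] measurable_compose[OF measurable_snd measurable_circ_ident])
    from measurable_compose[OF this measurable_nlk_pair[OF g admissibleD(8)[OF adm]]] show ?thesis by simp
  qed
  have ip: "integrable (circ \<Otimes>\<^sub>M circ) (\<lambda>q. ?k (fst q) (snd q))"
  proof (rule P.Fubini_integrable)
    show "integrable circ (\<lambda>x. \<integral>y. norm (?k (fst (x, y)) (snd (x, y))) \<partial>circ)"
    proof (rule integrable_circ_bounded)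
      show "(\<lambda>x. \<integral>y. norm (?k (fst (x, y)) (snd (x, y))) \<partial>circ) \<in> borel_measurable circ"
        by (intro circ.borel_measurable_lebesgue_integral) (simp add: case_prod_unfold)
      fix x
      have "(\<integral>y. norm (?k x y) \<partial>circ) \<le> (\<integral>z. nlC m g \<delta> E * \<bar>z\<bar> powr (real m - 2 * p) \<partial>circ)"
        using ik integrable_abs_powr[OF good_exponents(1)[OF gk]] nlk_bound[OF gk adm E]
        by (intro integral_mono) auto
      then show "norm (\<integral>y. norm (?k (fst (x, y)) (snd (x, y))) \<partial>circ) \<le> (\<integral>z. nlC m g \<delta> E * \<bar>z\<bar> powr (real m - 2 * p) \<partial>circ)"
        by (simp add: integral_nonneg)
    qed
  qed (use ik in auto)
  define J where "J z = (\<integral>x. ?k x z \<partial>circ)" for z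
  have "?I = (\<integral>z. J z \<partial>circ)"
    unfolding NLk J_def using P.Fubini_integral[of "\<lambda>x z. ?k x z"] ip by (simp add: case_prod_unfold)
  moreover have "J z = - J (- z)" if iz: "integrable circ (\<lambda>x. ?k x z)" for z
  proof -
    have "J z = (\<integral>x. ?k (x + z) z \<partial>circ)"
      unfolding J_def by (rule periodic_shift(2)[symmetric, OF nlk_per2pi[OF admissibleD(7)[OF adm]] iz])
    then show ?thesis unfolding nlk_antisym J_def by simp
  qed
  moreover have "AE z in circ. integrable circ (\<lambda>x. ?k x z)"
    using P.AE_integrable_snd[of "\<lambda>x z. ?k x z"] ip by (simp add: case_prod_unfold)
  ultimately have eq: "?I = (\<integral>z. J z \<partial>circ)"
    and ae: "AE z in circ. J z = - J (- z)"
    by (blast, auto elim!: eventually_mono)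
  have "(\<integral>z. J z \<partial>circ) = (\<integral>z. - J (- z) \<partial>circ)"
  proof (rule integral_cong_AE)
    have iJ: "integrable circ J"
      unfolding J_def using P.integrable_snd[of "\<lambda>x z. ?k x z"] ip by (simp add: case_prod_unfold)
    then show "J \<in> borel_measurable circ" by simp
    have "integrable circ (\<lambda>z. J (- z))" using iJ integral_circ_reflect(1) by blast
    then show "(\<lambda>z. - J (- z)) \<in> borel_measurable circ" by simp
  qed (rule ae)
  moreover have "(\<integral>z. - J (- z) \<partial>circ) = - (\<integral>z. J z \<partial>circ)"
    using integral_circ_reflect(2)[of J] by simp
  ultimately have "?I = - ?I"
    unfolding eq by (rule trans)
  then have "2 *\<^sub>R ?I = 0"
    unfolding scaleR_2 by (simp only: eq_neg_iff_add_eq_0)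
  then show ?thesis by simp
qed

section \<open>The weak derivative\<close>

lemma weak_deriv:
  assumes "\<tau> \<in> H_space 1"
  shows "L2_circle (weak_deriv \<tau>)" "cf (weak_deriv \<tau>) j k = (\<i> * of_int k) * cf \<tau> j k"
proof -
  let ?c = "\<lambda>k. (\<i> * of_int k) *s fourier \<tau> k"
  have n: "norm (?c k) = real_of_int \<bar>k\<bar> * norm (fourier \<tau> k)" for k
  proof -
    have "(norm (?c k))\<^sup>2 = (real_of_int \<bar>k\<bar> * norm (fourier \<tau> k))\<^sup>2"
      by (simp add: norm_vec_square norm_mult power_mult_distrib sum_distrib_left)
    then show ?thesis by (rule power2_eq_imp_eq) auto
  qed
  have s: "(\<lambda>k. (norm (?c k))\<^sup>2) summable_on UNIV"
    unfolding n by (rule H1_summable[OF assms])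
  have r: "?c (- k) $ j = cnj (?c k $ j)" for k j
    by (simp add: fourier_nth fourier_uminus_nth)
  obtain f where f: "L2_circle f" "\<And>k. fourier f k = ?c k"
    using vec_Riesz_Fischer[of ?c, OF s r] by blast
  then have "\<exists>g. L2_circle g \<and> (\<forall>k. fourier g k = ?c k)" by blast
  from someI_ex[OF this] have w: "L2_circle (weak_deriv \<tau>)" "\<And>k. fourier (weak_deriv \<tau>) k = ?c k"
    unfolding weak_deriv_def by auto
  show "L2_circle (weak_deriv \<tau>)" by fact
  show "cf (weak_deriv \<tau>) j k = (\<i> * of_int k) * cf \<tau> j k"
    using w(2)[of k] by (simp add: fourier_eq_iff fourier_nth)
qed

lemma weak_deriv_mean_zero: "\<tau> \<in> H_space 1 \<Longrightarrow> mean_zero (weak_deriv \<tau>)"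
  by (subst mean_zero_fc) (auto simp: weak_deriv)

lemma per2pi_cmp: "per2pi f \<Longrightarrow> per2pi (cmp f j)"
  by (simp add: per2pi_def cmp_def)

lemma continuous_cmp: "continuous_on S f \<Longrightarrow> continuous_on S (cmp f j)"
  using continuous_vec_cmp by blast

lemma H_spaceD:
  assumes "\<tau> \<in> H_space s"
  shows "continuous_on UNIV \<tau>" "L2_circle \<tau>" "per2pi \<tau>" "circ_L2 (cmp \<tau> j)"
    "continuous_on UNIV (cmp \<tau> j)" "per2pi (cmp \<tau> j)"
proof -
  show c: "continuous_on UNIV \<tau>" and L: "L2_circle \<tau>" using assms by (simp_all add: H_space_def)
  show p: "per2pi \<tau>" and "circ_L2 (cmp \<tau> j)" using L by (simp_all add: L2_circle_iff)
  show "continuous_on UNIV (cmp \<tau> j)" using c unfolding continuous_vec_cmp by blast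
  show "per2pi (cmp \<tau> j)" using p by (simp add: per2pi_def cmp_def)
qed

lemma eq_if_cmp_fc_eq:
  assumes "continuous_on UNIV f" "per2pi f" "continuous_on UNIV h" "per2pi h"
    "\<And>j k. cf f j k = cf h j k"
  shows "f = h"
proof
  fix x
  have "cmp f j x = cmp h j x" for j
    by (rule eq_if_fc_eq[OF continuous_cmp[OF assms(1)] per2pi_cmp[OF assms(2)]
        continuous_cmp[OF assms(3)] per2pi_cmp[OF assms(4)] assms(5)])
  then show "f x = h x" by (simp add: cmp_def vec_eq_iff)
qed

lemma primitive_weak_deriv:
  assumes H: "\<tau> \<in> H_space 1" and m: "mean_zero \<tau>"
  shows "primitive (weak_deriv \<tau>) = \<tau>"
proof (rule eq_if_cmp_fc_eq)
  note w = weak_deriv[OF H] weak_deriv_mean_zero[OF H]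
  show "continuous_on UNIV (primitive (weak_deriv \<tau>))" by (rule continuous_primitive[OF w(1,3)])
  show "per2pi (primitive (weak_deriv \<tau>))" by (rule primitive_per2pi[OF w(1,3)])
  show "continuous_on UNIV \<tau>" "per2pi \<tau>" using H_spaceD[OF H] by auto
  show "cf (primitive (weak_deriv \<tau>)) j k = cf \<tau> j k" for j k
    using m mean_zero_fc[OF H_spaceD(2)[OF H]]
    by (cases "k = 0") (auto simp: primitive_fc[OF w(1,3)] w(2))
qed

text \<open>For unit speed \<open>\<tau>\<close> this is the squared \<open>L\<^sup>2\<close> norm of the curvature of the curve.\<close>

definition hE :: "(real \<Rightarrow> real^3) \<Rightarrow> real" where
  "hE \<tau> = (\<integral>x. (norm (weak_deriv \<tau> x))\<^sup>2 \<partial>circ)"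

lemma hE_nonneg: "hE \<tau> \<ge> 0"
  unfolding hE_def by (rule integral_nonneg) simp

lemma hE_eq:
  assumes "\<tau> \<in> H_space 1"
  shows "hE \<tau> = 2 * pi * (\<Sum>\<^sub>\<infinity>k. (real_of_int \<bar>k\<bar> * norm (fourier \<tau> k))\<^sup>2)"
proof -
  have "(norm (fourier (weak_deriv \<tau>) k))\<^sup>2 = (real_of_int \<bar>k\<bar> * norm (fourier \<tau> k))\<^sup>2" for k
    by (simp add: norm_vec_square fourier_nth weak_deriv[OF assms] norm_mult power_mult_distrib sum_distrib_left)
  then show ?thesis
    unfolding hE_def using L2_circle_summable(2)[OF weak_deriv(1)[OF assms]] by simp
qed

lemma Hoelder_half:
  assumes H: "\<tau> \<in> H_space 1" and m: "mean_zero \<tau>" and ab: "\<bar>a - b\<bar> \<le> pi"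
  shows "(norm (\<tau> a - \<tau> b))\<^sup>2 \<le> hE \<tau> * \<bar>a - b\<bar>"
proof -
  have main: "(norm (\<tau> y - \<tau> x))\<^sup>2 \<le> hE \<tau> * (y - x)" if "x \<le> y" "y - x \<le> pi" for x y
  proof -
    have "norm (primitive (weak_deriv \<tau>) y - primitive (weak_deriv \<tau>) x) \<le> sqrt (y - x) * sqrt (hE \<tau>)"
      unfolding hE_def using that pi_gt_zero by (intro primitive_Hoelder weak_deriv(1) H) linarith+
    then have "norm (\<tau> y - \<tau> x) \<le> sqrt ((y - x) * hE \<tau>)"
      by (simp add: primitive_weak_deriv[OF H m] real_sqrt_mult)
    then have "(norm (\<tau> y - \<tau> x))\<^sup>2 \<le> (sqrt ((y - x) * hE \<tau>))\<^sup>2" by (intro power_mono) auto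
    then show ?thesis using that hE_nonneg[of \<tau>] by (simp add: mult.commute)
  qed
  show ?thesis
  proof (cases "a \<le> b")
    case True
    then show ?thesis using main[of a b] ab by (simp add: norm_minus_commute)
  next
    case False
    then show ?thesis using main[of b a] ab by simp
  qed
qed

section \<open>The linear part of the force as a Fourier multiplier\<close>

lemma one_minus_cos_le: "1 - cos t \<le> t\<^sup>2 / 2" for t :: real
proof -
  have "1 - cos t = 2 * (sin (t / 2))\<^sup>2" using cos_double_sin[of "t / 2"] by simp
  also have "(sin (t / 2))\<^sup>2 \<le> (t / 2)\<^sup>2"
    using abs_sin_x_le_abs_x[of "t / 2"] by (simp only: abs_le_square_iff)
  finally show ?thesis by (simp add: power2_eq_square)
qed

lemma mk_integrand_bound:
  fixes z p :: real
  shows "\<bar>\<bar>z\<bar> powr (- 2 * p - 2) * (1 - cos (of_int k * z))\<bar> \<le> (of_int k)\<^sup>2 / 2 * \<bar>z\<bar> powr (- 2 * p)"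
proof (cases "z = 0")
  case False
  have "\<bar>\<bar>z\<bar> powr (- 2 * p - 2) * (1 - cos (of_int k * z))\<bar> \<le> \<bar>z\<bar> powr (- 2 * p - 2) * ((of_int k * z)\<^sup>2 / 2)"
    unfolding abs_mult using one_minus_cos_le[of "of_int k * z"] cos_le_one[of "of_int k * z"]
    by (intro mult_mono) auto
  also have "\<dots> = (of_int k)\<^sup>2 / 2 * (\<bar>z\<bar> powr (- 2 * p - 2) * \<bar>z\<bar> powr 2)"
    using False by (simp add: power_mult_distrib)
  also have "\<bar>z\<bar> powr (- 2 * p - 2) * \<bar>z\<bar> powr 2 = \<bar>z\<bar> powr (- 2 * p)"
    by (simp only: powr_add[symmetric]) simp
  finally show ?thesis .
qed simp

lemma integrable_mk:
  assumes "p < 1/2"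
  shows "integrable circ (\<lambda>z. tr \<epsilon> z (\<bar>z\<bar> powr (- 2 * p - 2) * (1 - cos (of_int k * z))))"
proof (rule integrable_bound)
  show "integrable circ (\<lambda>z. (of_int k)\<^sup>2 / 2 * \<bar>z\<bar> powr (- 2 * p))"
    using assms by (intro integrable_mult_right integrable_abs_powr) auto
  show "(\<lambda>z. tr \<epsilon> z (\<bar>z\<bar> powr (- 2 * p - 2) * (1 - cos (of_int k * z)))) \<in> borel_measurable circ"
    by (intro measurable_circI) measurable
  show "AE z in circ. norm (tr \<epsilon> z (\<bar>z\<bar> powr (- 2 * p - 2) * (1 - cos (of_int k * z))))
      \<le> norm ((of_int k)\<^sup>2 / 2 * \<bar>z\<bar> powr (- 2 * p))"
  proof (rule AE_I2)
    fix z
    have "0 \<le> (of_int k)\<^sup>2 / 2 * \<bar>z\<bar> powr (- 2 * p)" by simp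
    then show "norm (tr \<epsilon> z (\<bar>z\<bar> powr (- 2 * p - 2) * (1 - cos (of_int k * z))))
      \<le> norm ((of_int k)\<^sup>2 / 2 * \<bar>z\<bar> powr (- 2 * p))"
      unfolding real_norm_def using mk_integrand_bound[of z p k] by (cases "\<epsilon> \<le> \<bar>z\<bar>") (simp_all only: if_True if_False abs_zero abs_of_nonneg)
  qed
qed

lemma mk_bound:
  assumes "p < 1/2"
  shows "\<bar>mk p \<epsilon> k\<bar> \<le> (of_int k)\<^sup>2 * (pint (- 2 * p) / 2)"
proof -
  let ?f = "\<lambda>z. tr \<epsilon> z (\<bar>z\<bar> powr (- 2 * p - 2) * (1 - cos (of_int k * z)))"
  have "\<bar>mk p \<epsilon> k\<bar> \<le> (\<integral>z. \<bar>?f z\<bar> \<partial>circ)" unfolding mk_def by (rule integral_abs_bound)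
  also have "\<dots> \<le> (\<integral>z. (of_int k)\<^sup>2 / 2 * \<bar>z\<bar> powr (- 2 * p) \<partial>circ)"
  proof (rule integral_mono)
    show "integrable circ (\<lambda>z. (of_int k)\<^sup>2 / 2 * \<bar>z\<bar> powr (- 2 * p))"
      using assms by (intro integrable_mult_right integrable_abs_powr) auto
    fix z
    have "0 \<le> (of_int k)\<^sup>2 / 2 * \<bar>z\<bar> powr (- 2 * p)" by simp
    then show "\<bar>?f z\<bar> \<le> (of_int k)\<^sup>2 / 2 * \<bar>z\<bar> powr (- 2 * p)"
      using mk_integrand_bound[of z p k] by (cases "\<epsilon> \<le> \<bar>z\<bar>") (simp_all only: if_True if_False abs_zero)
  qed (intro integrable_abs integrable_mk assms)
  finally show ?thesis by (simp add: pint_def)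
qed

lemma mk_tendsto:
  assumes "p < 1/2"
  shows "((\<lambda>\<epsilon>. mk p \<epsilon> k) \<longlongrightarrow> mk p 0 k) (at_right 0)"
proof (rule tendsto_at_right_sequentially[of 0 1])
  fix S :: "nat \<Rightarrow> real" assume S: "\<And>n. 0 < S n" "S \<longlonglongrightarrow> 0"
  show "(\<lambda>n. mk p (S n) k) \<longlonglongrightarrow> mk p 0 k"
    unfolding mk_def
  proof (rule integral_dominated_convergence[where w="\<lambda>z. (of_int k)\<^sup>2 / 2 * \<bar>z\<bar> powr (- 2 * p)"])
    let ?f = "\<lambda>\<epsilon> z. tr \<epsilon> z (\<bar>z\<bar> powr (- 2 * p - 2) * (1 - cos (of_int k * z)))"
    show "?f 0 \<in> borel_measurable circ" "?f (S n) \<in> borel_measurable circ" for n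
      by (rule borel_measurable_integrable[OF integrable_mk[OF assms]])+
    show "integrable circ (\<lambda>z. (of_int k)\<^sup>2 / 2 * \<bar>z\<bar> powr (- 2 * p))"
      using assms by (intro integrable_mult_right integrable_abs_powr) auto
    show "AE z in circ. (\<lambda>n. ?f (S n) z) \<longlonglongrightarrow> ?f 0 z"
    proof (rule AE_I2)
      fix z
      show "(\<lambda>n. ?f (S n) z) \<longlonglongrightarrow> ?f 0 z"
      proof (cases "z = 0")
        case False
        then have "\<forall>\<^sub>F n in sequentially. S n < \<bar>z\<bar>" using S(2) by (intro order_tendstoD) auto
        then have "\<forall>\<^sub>F n in sequentially. ?f (S n) z = ?f 0 z" by eventually_elim auto
        then show ?thesis by (rule tendsto_eventually)
      next
        case True
        then have "?f e z = 0" for e by simp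
        then show ?thesis by (simp only: tendsto_const)
      qed
    qed
    show "AE z in circ. norm (?f (S n) z) \<le> (of_int k)\<^sup>2 / 2 * \<bar>z\<bar> powr (- 2 * p)" for n
    proof (rule AE_I2)
      fix z
      have "0 \<le> (of_int k)\<^sup>2 / 2 * \<bar>z\<bar> powr (- 2 * p)" by simp
      then show "norm (?f (S n) z) \<le> (of_int k)\<^sup>2 / 2 * \<bar>z\<bar> powr (- 2 * p)"
        unfolding real_norm_def using mk_integrand_bound[of z p k] by (cases "S n \<le> \<bar>z\<bar>") (simp_all only: if_True if_False abs_zero)
    qed
  qed
qed simp

lemma mk_uminus: "mk p \<epsilon> (- k) = mk p \<epsilon> k"
  by (simp add: mk_def cong: if_cong)

lemma mk_0: "mk p \<epsilon> 0 = 0"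
  by (simp add: mk_def cong: if_cong)

lemma trunc_weight:
  assumes "\<epsilon> > 0" "p \<ge> 0"
  shows "(\<lambda>z. tr \<epsilon> z (\<bar>z\<bar> powr (- 2 * p - 2))) \<in> borel_measurable circ"
    "(tr \<epsilon> z (\<bar>z\<bar> powr (- 2 * p - 2))) \<in> {0..\<epsilon> powr (- 2 * p - 2)}"
    "integrable circ (\<lambda>z. tr \<epsilon> z (\<bar>z\<bar> powr (- 2 * p - 2)))"
proof -
  show m: "(\<lambda>z. tr \<epsilon> z (\<bar>z\<bar> powr (- 2 * p - 2))) \<in> borel_measurable circ"
    by (intro measurable_circI) measurable
  show b: "(tr \<epsilon> z (\<bar>z\<bar> powr (- 2 * p - 2))) \<in> {0..\<epsilon> powr (- 2 * p - 2)}" for z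
    using assms powr_mono2'[of "- 2 * p - 2" \<epsilon> "\<bar>z\<bar>"] by auto
  show "integrable circ (\<lambda>z. tr \<epsilon> z (\<bar>z\<bar> powr (- 2 * p - 2)))"
    by (rule integrable_circ_bounded[OF m, of "\<epsilon> powr (- 2 * p - 2)"]) (use b in auto)
qed

text \<open>Reflection \<open>z \<mapsto> -z\<close> removes the odd part; the remaining factor \<open>1 - cos\<close> vanishes to second order.\<close>

lemma mk_complex:
  assumes "\<epsilon> > 0" "p \<ge> 0"
  shows "(\<integral>z. complex_of_real (tr \<epsilon> z (\<bar>z\<bar> powr (- 2 * p - 2))) * (1 - cis (- (of_int k * z))) \<partial>circ) = of_real (mk p \<epsilon> k)"
proof -
  let ?w = "\<lambda>z. (tr \<epsilon> z (\<bar>z\<bar> powr (- 2 * p - 2)))"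
  define q where "q z = complex_of_real (?w z) * (1 - cis (- (of_int k * z)))" for z
  have iq: "integrable circ q"
  proof (rule integrable_bound)
    show "integrable circ (\<lambda>z. 2 * ?w z)" by (rule integrable_mult_right[OF trunc_weight(3)[OF assms]])
    show "q \<in> borel_measurable circ" unfolding q_def[abs_def]
      using trunc_weight(1)[OF assms] by (intro borel_measurable_times borel_measurable_of_real borel_measurable_diff measurable_cis') auto
    show "AE z in circ. norm (q z) \<le> norm (2 * ?w z)"
    proof (rule AE_I2)
      fix z
      have "norm (1 - cis (- (of_int k * z))) \<le> 2" using norm_triangle_ineq4[of 1 "cis (- (of_int k * z))"] by simp
      from mult_left_mono[OF this, of "?w z"] show "norm (q z) \<le> norm (2 * ?w z)"
        unfolding q_def norm_mult by (auto simp: mult.commute)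
    qed
  qed
  have r: "integrable circ (\<lambda>z. q (- z))" "(\<integral>z. q (- z) \<partial>circ) = (\<integral>z. q z \<partial>circ)"
    using iq integral_circ_reflect[of q] by auto
  have "2 * (\<integral>z. q z \<partial>circ) = (\<integral>z. q z + q (- z) \<partial>circ)"
    by (simp add: integral_add[OF iq r(1)] r(2))
  also have "\<dots> = (\<integral>z. complex_of_real (2 * (tr \<epsilon> z (\<bar>z\<bar> powr (- 2 * p - 2) * (1 - cos (of_int k * z))))) \<partial>circ)"
  proof (intro integral_cong refl)
    fix z
    have "(1 - cis (- (of_int k * z))) + (1 - cis (of_int k * z)) = of_real (2 * (1 - cos (of_int k * z)))"
      by (simp add: complex_eq_iff)
    moreover have "q z + q (- z) = complex_of_real (?w z) * ((1 - cis (- (of_int k * z))) + (1 - cis (of_int k * z)))"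
      by (simp add: q_def algebra_simps)
    ultimately show "q z + q (- z) = complex_of_real (2 * (tr \<epsilon> z (\<bar>z\<bar> powr (- 2 * p - 2) * (1 - cos (of_int k * z)))))"
      by (simp only: of_real_mult[symmetric]) simp
  qed
  also have "\<dots> = of_real (2 * mk p \<epsilon> k)"
    unfolding mk_def by (subst integral_complex_of_real) simp
  finally show ?thesis by (simp add: q_def)
qed

lemma integrable_Lin:
  assumes adm: "admissible \<delta> \<tau>" and \<epsilon>: "\<epsilon> > 0" "p \<ge> 0"
  shows "integrable circ (\<lambda>z. tr \<epsilon> z (\<bar>z\<bar> powr (- 2 * p - 2) *\<^sub>R (curve \<tau> x - curve \<tau> (x - z))))"
proof -
  have [measurable]: "curve \<tau> \<in> borel_measurable borel"
    by (intro borel_measurable_continuous_onI admissibleD(8)[OF adm])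
  show ?thesis
  proof (rule integrable_circ_bounded)
    show "(\<lambda>z. tr \<epsilon> z (\<bar>z\<bar> powr (- 2 * p - 2) *\<^sub>R (curve \<tau> x - curve \<tau> (x - z)))) \<in> borel_measurable circ"
      by (intro measurable_circI) measurable
    fix z assume "z \<in> {-pi..pi}"
    then have "norm (curve \<tau> x - curve \<tau> (x - z)) \<le> pi" using admissibleD(10)[OF adm, of x "x - z"] by auto
    then have "(tr \<epsilon> z (\<bar>z\<bar> powr (- 2 * p - 2))) * norm (curve \<tau> x - curve \<tau> (x - z)) \<le> \<epsilon> powr (- 2 * p - 2) * pi"
      using trunc_weight(2)[OF \<epsilon>, of z] by (intro mult_mono) auto
    then show "norm (tr \<epsilon> z (\<bar>z\<bar> powr (- 2 * p - 2) *\<^sub>R (curve \<tau> x - curve \<tau> (x - z)))) \<le> \<epsilon> powr (- 2 * p - 2) * pi"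
      by (auto split: if_splits)
  qed
qed

lemma infsum_minus:
  fixes f g :: "'i \<Rightarrow> 'b::real_normed_vector"
  assumes "f summable_on A" "g summable_on A"
  shows "(\<Sum>\<^sub>\<infinity>k\<in>A. f k - g k) = (\<Sum>\<^sub>\<infinity>k\<in>A. f k) - (\<Sum>\<^sub>\<infinity>k\<in>A. g k)"
  using infsum_add[OF assms(1) summable_on_uminus[THEN iffD2, OF assms(2)]] by (simp add: infsum_uminus)

lemma Lin_series:
  assumes adm: "admissible \<delta> \<tau>" and \<epsilon>: "\<epsilon> > 0" "p \<ge> 0"
  shows "cmp (Lin p (curve \<tau>) \<epsilon>) j x = fser (\<lambda>k. of_real (mk p \<epsilon> k) * cf (curve \<tau>) j k) x" (is "_ = fser ?d x")
    and "(\<lambda>k. norm (of_real (mk p \<epsilon> k) * cf (curve \<tau>) j k)) summable_on UNIV"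
proof -
  let ?G = "cmp (curve \<tau>) j"
  let ?w = "\<lambda>z. (tr \<epsilon> z (\<bar>z\<bar> powr (- 2 * p - 2)))"
  note ad = admissibleD[OF adm]
  have s: "(\<lambda>k. norm (fc ?G k)) summable_on UNIV" by (rule primitive_summable[OF ad(2,3)])
  have G: "?G y = fser (fc ?G) y" for y
    by (rule eq_fser[OF continuous_cmp[OF ad(8)] per2pi_cmp[OF ad(7)] s])
  define f where "f k z = complex_of_real (?w z) * (1 - cis (- (of_int k * z))) * (fc ?G k * cis (of_int k * x))" for k z
  have mq: "(\<lambda>z. complex_of_real (?w z) * (1 - cis (- (of_int k * z)))) \<in> borel_measurable circ" for k
    using trunc_weight(1)[OF \<epsilon>] by (intro borel_measurable_times borel_measurable_of_real borel_measurable_diff measurable_cis') auto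
  have bd: "norm (f k z) \<le> norm (fc ?G k) * (2 * ?w z)" for k z
  proof -
    have "norm (1 - cis (- (of_int k * z))) \<le> 2" using norm_triangle_ineq4[of 1 "cis (- (of_int k * z))"] by simp
    from mult_left_mono[OF this, of "?w z * norm (fc ?G k)"] show ?thesis
      unfolding f_def norm_mult by (auto simp: mult_ac)
  qed
  note S = integral_infsum_int[of f circ "\<lambda>k. norm (fc ?G k)" "\<lambda>z. 2 * ?w z"]
  have m: "f k \<in> borel_measurable circ" for k
    unfolding f_def[abs_def] by (intro borel_measurable_times mq) auto
  have w2: "integrable circ (\<lambda>z. 2 * ?w z)" by (rule integrable_mult_right[OF trunc_weight(3)[OF \<epsilon>]])
  have int: "(\<integral>z. f k z \<partial>circ) = ?d k * cis (of_int k * x)" for k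
    unfolding f_def by (subst integral_mult_left_zero) (simp only: mk_complex[OF \<epsilon>] mult.assoc)
  have "cmp (Lin p (curve \<tau>) \<epsilon>) j x = complex_of_real (\<integral>z. (tr \<epsilon> z (\<bar>z\<bar> powr (- 2 * p - 2) *\<^sub>R (curve \<tau> x - curve \<tau> (x - z)))) $ j \<partial>circ)"
    unfolding cmp_def Lin_def by (subst integral_vec_nth[OF integrable_Lin[OF adm \<epsilon>]]) simp
  also have "\<dots> = (\<integral>z. (\<Sum>\<^sub>\<infinity>k. f k z) \<partial>circ)"
  proof (subst integral_complex_of_real[symmetric], intro integral_cong refl)
    fix z
    have "(\<Sum>\<^sub>\<infinity>k. f k z) = (\<Sum>\<^sub>\<infinity>k. complex_of_real (?w z) * (fc ?G k * cis (of_int k * x) - fc ?G k * cis (of_int k * (x - z))))"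
    proof (rule infsum_cong)
      fix k :: int
      have "cis (of_int k * (x - z)) = cis (of_int k * x) * cis (- (of_int k * z))" by (simp add: cis_mult algebra_simps)
      then show "f k z = complex_of_real (?w z) * (fc ?G k * cis (of_int k * x) - fc ?G k * cis (of_int k * (x - z)))"
        unfolding f_def by (simp only:) (simp add: algebra_simps)
    qed
    also have "\<dots> = complex_of_real (?w z) * ((\<Sum>\<^sub>\<infinity>k. fc ?G k * cis (of_int k * x)) - (\<Sum>\<^sub>\<infinity>k. fc ?G k * cis (of_int k * (x - z))))"
      by (subst infsum_cmult_right', subst infsum_minus) (auto intro: abs_summable_summable abs_summable_fser[OF s])
    also have "\<dots> = complex_of_real (?w z) * (?G x - ?G (x - z))" by (simp only: G fser_def)
    finally show "complex_of_real ((tr \<epsilon> z (\<bar>z\<bar> powr (- 2 * p - 2) *\<^sub>R (curve \<tau> x - curve \<tau> (x - z)))) $ j) = (\<Sum>\<^sub>\<infinity>k. f k z)"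
      by (simp add: cmp_def)
  qed
  also have "\<dots> = (\<Sum>\<^sub>\<infinity>k. \<integral>z. f k z \<partial>circ)"
    by (rule S(2)[OF m bd w2 s]) auto
  finally show "cmp (Lin p (curve \<tau>) \<epsilon>) j x = fser ?d x" by (simp add: int fser_def)
  show "(\<lambda>k. norm (?d k)) summable_on UNIV"
    using S(3)[OF m bd w2 s] by (simp add: int norm_mult)
qed

section \<open>The principal value\<close>

locale kernel =
  fixes K :: "real \<Rightarrow> real \<Rightarrow> real" and h :: "real \<Rightarrow> real" and p :: real and m :: nat
  assumes hom: "homogeneous K h p" and gk: "good_kernel m (g_of h) p"
begin

abbreviation "g \<equiv> g_of h"
abbreviation "F \<tau> \<equiv> bigF K (curve \<tau>)"
abbreviation "nl \<tau> \<equiv> NL g p (curve \<tau>) 0"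

end

text \<open>The truncated integral is translated to be centred at \<open>x\<close>, where the distance is \<open>\<bar>z\<bar>\<close>.\<close>

lemma (in kernel) force_trunc_eq:
  assumes adm: "admissible \<delta> \<tau>" and \<epsilon>: "\<epsilon> > 0"
  shows "force_trunc K (curve \<tau>) \<epsilon> x = NL g p (curve \<tau>) \<epsilon> x + g_of h 1 *\<^sub>R Lin p (curve \<tau>) \<epsilon> x"
proof -
  let ?\<gamma> = "curve \<tau>" and ?g = "g_of h"
  note ad = admissibleD[OF adm]
  have p: "p \<ge> 0" using hom by (simp add: homogeneous_def)
  define f where "f y = (if \<epsilon> \<le> vartheta (x - y) then K_u K ((norm (?\<gamma> x - ?\<gamma> y))\<^sup>2) ((vartheta (x - y))\<^sup>2) *\<^sub>R (?\<gamma> x - ?\<gamma> y) else 0)" for y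
  have "force_trunc K ?\<gamma> \<epsilon> x = (LBINT y:{-pi..pi}. f y)"
    unfolding force_trunc_def set_lebesgue_integral_def
    by (intro integral_cong) (auto simp: f_def indicator_def)
  also have "\<dots> = (\<integral>y. f y \<partial>circ)" by (rule set_integral_circ)
  also have "\<dots> = (\<integral>z. f (x - z) \<partial>circ)"
  proof (rule periodic_convolution_shift(2)[symmetric])
    show "per2pi f" unfolding per2pi_def
    proof
      fix y
      have "?\<gamma> (y + 2 * pi) = ?\<gamma> y" using ad(7) by (simp add: per2pi_def)
      moreover have "vartheta (x - (y + 2 * pi)) = vartheta (x - y)"
        using vartheta_per[unfolded per2pi_def, THEN spec, of "x - (y + 2 * pi)"] by (simp add: algebra_simps)
      ultimately show "f (y + 2 * pi) = f y" unfolding f_def by simp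
    qed
  qed
  also have "\<dots> = (\<integral>z. (tr \<epsilon> z (nlk ?g p ?\<gamma> x z)) +
      ?g 1 *\<^sub>R (tr \<epsilon> z (\<bar>z\<bar> powr (- 2 * p - 2) *\<^sub>R (?\<gamma> x - ?\<gamma> (x - z)))) \<partial>circ)"
  proof (intro integral_cong refl)
    fix z assume "z \<in> space circ"
    then have z: "\<bar>z\<bar> \<le> pi" by auto
    then have v: "vartheta z = \<bar>z\<bar>" by (rule vartheta_small)
    show "f (x - z) = (tr \<epsilon> z (nlk ?g p ?\<gamma> x z)) +
      ?g 1 *\<^sub>R (tr \<epsilon> z (\<bar>z\<bar> powr (- 2 * p - 2) *\<^sub>R (?\<gamma> x - ?\<gamma> (x - z))))"
    proof (cases "\<epsilon> \<le> \<bar>z\<bar>")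
      case True
      with \<epsilon> have z0: "z \<noteq> 0" by auto
      note cb = chord_bounds[OF adm z0 z, of x]
      have le: "(norm (?\<gamma> x - ?\<gamma> (x - z)))\<^sup>2 \<le> (\<bar>z\<bar>)\<^sup>2" using power_mono[OF cb(2), of 2] by simp
      have "K_u K ((norm (?\<gamma> x - ?\<gamma> (x - z)))\<^sup>2) ((\<bar>z\<bar>)\<^sup>2) = ?g (ratio ?\<gamma> x z) * ((\<bar>z\<bar>)\<^sup>2) powr (- p - 1)"
        using K_u_homogeneous[OF hom _ le] cb(1,4) by simp
      also have "((\<bar>z\<bar>)\<^sup>2) powr (- p - 1) = \<bar>z\<bar> powr (- 2 * p - 2)"
      proof -
        have "(\<bar>z\<bar>)\<^sup>2 = \<bar>z\<bar> powr 2" using z0 by simp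
        then show ?thesis by (simp only: powr_powr) (simp add: algebra_simps)
      qed
      finally show ?thesis using True by (simp add: f_def v nlk_def algebra_simps)
    qed (simp add: f_def v)
  qed
  also have "\<dots> = NL ?g p ?\<gamma> \<epsilon> x + ?g 1 *\<^sub>R Lin p ?\<gamma> \<epsilon> x"
  proof -
    have i1: "integrable circ (\<lambda>z. tr \<epsilon> z (nlk ?g p ?\<gamma> x z))"
      using adm hE_nonneg by (intro integrable_nlk[OF gk adm, of "hE \<tau>"] Hoelder_half) (auto simp: admissible_def)
    note i2 = integrable_Lin[OF adm \<epsilon> p, of x]
    show ?thesis
      unfolding NL_def Lin_def
      by (subst integral_add[OF i1 integrable_scaleR_right[OF i2]]) simp
  qed
  finally show ?thesis .
qed

definition fmult :: "(real \<Rightarrow> real) \<Rightarrow> real \<Rightarrow> int \<Rightarrow> real" where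
  "fmult g p k = g 1 * mk p 0 k"

lemma l2_add:
  fixes a b :: "int \<Rightarrow> complex"
  assumes "(\<lambda>k. (norm (a k))\<^sup>2) summable_on UNIV" "(\<lambda>k. (norm (b k))\<^sup>2) summable_on UNIV"
  shows "(\<lambda>k. (norm (a k + b k))\<^sup>2) summable_on UNIV"
    "(\<Sum>\<^sub>\<infinity>k. (norm (a k + b k))\<^sup>2) \<le> 2 * (\<Sum>\<^sub>\<infinity>k. (norm (a k))\<^sup>2) + 2 * (\<Sum>\<^sub>\<infinity>k. (norm (b k))\<^sup>2)"
proof -
  have le: "(norm (u + v))\<^sup>2 \<le> 2 * (norm u)\<^sup>2 + 2 * (norm v)\<^sup>2" for u v :: complex
  proof -
    have "(norm (u + v))\<^sup>2 \<le> (norm u + norm v)\<^sup>2" by (intro power_mono norm_triangle_ineq) auto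
    also have "\<dots> \<le> 2 * (norm u)\<^sup>2 + 2 * (norm v)\<^sup>2"
      using sum_squares_bound[of "norm u" "norm v"] by (simp add: power2_sum)
    finally show ?thesis .
  qed
  have d: "(\<lambda>k. 2 * (norm (a k))\<^sup>2 + 2 * (norm (b k))\<^sup>2) summable_on UNIV"
    by (intro summable_on_add summable_on_cmult_right assms)
  show s: "(\<lambda>k. (norm (a k + b k))\<^sup>2) summable_on UNIV"
    by (rule summable_on_comparison_test[OF d]) (use le in auto)
  have "(\<Sum>\<^sub>\<infinity>k. (norm (a k + b k))\<^sup>2) \<le> (\<Sum>\<^sub>\<infinity>k. 2 * (norm (a k))\<^sup>2 + 2 * (norm (b k))\<^sup>2)"
    by (intro infsum_mono s d le)
  also have "\<dots> = 2 * (\<Sum>\<^sub>\<infinity>k. (norm (a k))\<^sup>2) + 2 * (\<Sum>\<^sub>\<infinity>k. (norm (b k))\<^sup>2)"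
    by (subst infsum_add) (auto intro!: summable_on_cmult_right assms simp: infsum_cmult_right')
  finally show "(\<Sum>\<^sub>\<infinity>k. (norm (a k + b k))\<^sup>2) \<le> 2 * (\<Sum>\<^sub>\<infinity>k. (norm (a k))\<^sup>2) + 2 * (\<Sum>\<^sub>\<infinity>k. (norm (b k))\<^sup>2)" .
qed

lemma mult_curve_l2:
  assumes adm: "admissible \<delta> \<tau>" and c: "\<And>k. \<bar>c k\<bar> \<le> C * (of_int k)\<^sup>2" and C: "C \<ge> 0"
  shows "(norm (complex_of_real (c k) * cf (curve \<tau>) j k))\<^sup>2 \<le> C\<^sup>2 * (real_of_int \<bar>k\<bar> * norm (fourier \<tau> k))\<^sup>2"
proof (cases "k = 0")
  case True
  then show ?thesis using c[of 0] by simp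
next
  case False
  note ad = admissibleD[OF adm]
  have "norm (complex_of_real (c k) * cf (curve \<tau>) j k) = \<bar>c k\<bar> * (norm (cf \<tau> j k) / \<bar>of_int k\<bar>)"
    by (simp add: primitive_fc[OF ad(2,3)] norm_mult norm_divide)
  also have "\<dots> \<le> (C * (of_int k)\<^sup>2) * (norm (fourier \<tau> k) / \<bar>of_int k\<bar>)"
    using c[of k] C Finite_Cartesian_Product.norm_nth_le[of "fourier \<tau> k" j]
    by (intro mult_mono divide_right_mono) (auto simp: fourier_nth)
  also have "\<dots> = C * (real_of_int \<bar>k\<bar> * norm (fourier \<tau> k))"
    using False by (simp add: power2_eq_square field_simps abs_if)
  finally have "(norm (complex_of_real (c k) * cf (curve \<tau>) j k))\<^sup>2 \<le> (C * (real_of_int \<bar>k\<bar> * norm (fourier \<tau> k)))\<^sup>2"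
    by (intro power_mono) auto
  then show ?thesis by (simp only: power_mult_distrib)
qed

text \<open>The linear parts of the truncations converge in \<open>L\<^sup>2\<close> by dominated convergence of their coefficients,
  the nonlinear parts uniformly.  Limits in \<open>L\<^sup>2\<close> have unique Fourier coefficients, so the representative
  chosen for the principal value has the coefficients of this limit.\<close>

theorem (in kernel) force_fourier:
  assumes adm: "admissible \<delta> \<tau>"
  defines "\<gamma> \<equiv> curve \<tau>"
  shows "L2_circle (force K \<gamma>)" "mean_zero (force K \<gamma>)"
    "cf (force K \<gamma>) j k = of_real (fmult g p k) * cf \<gamma> j k + cf (NL g p \<gamma> 0) j k"
proof -
  let ?NL = "NL g p \<gamma>"
  let ?ft = "force_trunc K \<gamma>"
  note ad = admissibleD[OF adm]
  have p: "p \<ge> 0" using hom by (simp add: homogeneous_def)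
  have H: "\<tau> \<in> H_space 1" "mean_zero \<tau>" using adm by (auto simp: admissible_def)
  have E: "\<And>a b. \<bar>a - b\<bar> \<le> pi \<Longrightarrow> (norm (\<tau> a - \<tau> b))\<^sup>2 \<le> hE \<tau> * \<bar>a - b\<bar>" "hE \<tau> \<ge> 0"
    using Hoelder_half[OF H] hE_nonneg by auto
  have gcont: "continuous_on {1..} g" using gk by (simp add: good_kernel_def)
  define B where "B = nlC m g \<delta> (hE \<tau>) * pint (real m - 2 * p)"
  have NLb: "norm (?NL \<epsilon> x) \<le> B" for \<epsilon> x
    unfolding B_def \<gamma>_def by (rule NL_bound[OF gk adm E])
  have cmpb: "norm (cmp v i x) \<le> norm (v x)" for v i x
    using component_le_norm_cart[of "v x" i] by (simp add: cmp_def)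
  have NLc: "circ_L2 (cmp (?NL \<epsilon>) i)" for \<epsilon> i
  proof (rule circ_L2_bounded)
    have "?NL \<epsilon> \<in> borel_measurable circ"
      unfolding \<gamma>_def by (intro measurable_circI measurable_NL gcont ad)
    then show "cmp (?NL \<epsilon>) i \<in> borel_measurable circ"
      unfolding cmp_measurable_iff measurable_vec_iff by blast
    show "norm (cmp (?NL \<epsilon>) i x) \<le> B" for x
      using cmpb[of "?NL \<epsilon>" i x] NLb[of \<epsilon> x] by linarith
  qed
  let ?L = "\<lambda>\<epsilon> i k. complex_of_real (g 1 * mk p \<epsilon> k) * cf \<gamma> i k"
  define C where "C = \<bar>g 1\<bar> * (pint (- 2 * p) / 2)"
  have C: "C \<ge> 0" unfolding C_def using pint_nonneg by auto
  have g1: "g 1 = 0 \<or> p < 1/2" using gk by (auto simp: good_kernel_def)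
  have Cb: "\<bar>g 1 * mk p \<epsilon> k\<bar> \<le> C * (of_int k)\<^sup>2" for \<epsilon> k
  proof (cases "g 1 = 0")
    case True
    then show ?thesis by (simp add: C_def)
  next
    case False
    then have "p < 1/2" using g1 by simp
    from mult_left_mono[OF mk_bound[OF this, of \<epsilon> k], of "\<bar>g 1\<bar>"] show ?thesis
      by (simp add: C_def abs_mult mult_ac)
  qed
  have Cb': "\<bar>g 1 * mk p \<epsilon> k - g 1 * mk p 0 k\<bar> \<le> (2 * C) * (of_int k)\<^sup>2" for \<epsilon> k
    using Cb[of \<epsilon> k] Cb[of 0 k] by (simp add: abs_le_iff algebra_simps)
  have dom: "(\<lambda>k. D * (real_of_int \<bar>k\<bar> * norm (fourier \<tau> k))\<^sup>2) summable_on UNIV" for D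
    by (intro summable_on_cmult_right H1_summable H)
  have Ls: "(\<lambda>k. (norm (?L \<epsilon> i k))\<^sup>2) summable_on UNIV" for \<epsilon> i
    unfolding \<gamma>_def by (rule summable_on_comparison_test[OF dom[of "C\<^sup>2"]]) (use mult_curve_l2[OF adm Cb C] in auto)
  \<comment> \<open>The expected coefficients of the limit; \<open>?L\<close> is the linear part.\<close>
  define c where "c k = (\<chi> i. ?L 0 i k + cf (?NL 0) i k)" for k
  have cs: "(\<lambda>k. (norm (c k))\<^sup>2) summable_on UNIV"
  proof -
    have "(\<lambda>k. (norm (c k $ i))\<^sup>2) summable_on UNIV" for i
      unfolding c_def using l2_add(1)[OF Ls Bessel(1)[OF NLc], of 0 i 0 i] by simp
    then show ?thesis
      unfolding norm_vec_square by (intro has_sum_imp_summable[OF has_sum_sum]) (auto intro: has_sum_infsum)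
  qed
  have cr: "c (- k) $ j = cnj (c k $ j)" for k j
    by (simp add: c_def mk_uminus fourier_uminus_nth)
  obtain f where f: "L2_circle f" "\<And>k. fourier f k = c k"
    using vec_Riesz_Fischer[OF cs cr] by blast
  have trunc: "cmp (?ft \<epsilon>) i x = cmp (?NL \<epsilon>) i x + of_real (g 1) * cmp (Lin p \<gamma> \<epsilon>) i x" if "\<epsilon> > 0" for \<epsilon> i x
    using force_trunc_eq[OF adm that, of x] by (simp add: cmp_def \<gamma>_def)
  have Linc: "cmp (Lin p \<gamma> \<epsilon>) i = fser (\<lambda>k. of_real (mk p \<epsilon> k) * cf \<gamma> i k)"
    "circ_L2 (cmp (Lin p \<gamma> \<epsilon>) i)" "cf (Lin p \<gamma> \<epsilon>) i k = of_real (mk p \<epsilon> k) * cf \<gamma> i k"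
    if "\<epsilon> > 0" for \<epsilon> i k
  proof -
    show e: "cmp (Lin p \<gamma> \<epsilon>) i = fser (\<lambda>k. of_real (mk p \<epsilon> k) * cf \<gamma> i k)"
      unfolding \<gamma>_def using Lin_series(1)[OF adm that p] by (intro ext)
    have s: "(\<lambda>k. norm (of_real (mk p \<epsilon> k) * cf \<gamma> i k)) summable_on UNIV"
      unfolding \<gamma>_def by (rule Lin_series(2)[OF adm that p])
    show "circ_L2 (cmp (Lin p \<gamma> \<epsilon>) i)" unfolding e by (intro circ_L2_continuous continuous_fser s)
    show "cf (Lin p \<gamma> \<epsilon>) i k = of_real (mk p \<epsilon> k) * cf \<gamma> i k" unfolding e by (rule fc_fser[OF s])
  qed
  have truncL: "L2_circle (?ft \<epsilon>)" if \<epsilon>: "\<epsilon> > 0" for \<epsilon>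
    unfolding L2_circle_iff
  proof (intro conjI allI)
    show "circ_L2 (cmp (?ft \<epsilon>) i)" for i
      unfolding ext[of "cmp (?ft \<epsilon>) i", OF trunc[OF \<epsilon>]]
      by (intro circ_L2_add NLc circ_L2_cmult Linc \<epsilon>)
    have "per2pi (cmp (?ft \<epsilon>) i)" for i
      using NL_per2pi[OF ad(7)[folded \<gamma>_def], of g p \<epsilon>]
      by (simp add: per2pi_def trunc[OF \<epsilon>] Linc(1)[OF \<epsilon>] fser_periodic cmp_def[of "?NL \<epsilon>"])
    then show "per2pi (?ft \<epsilon>)" by (simp add: per2pi_def cmp_def vec_eq_iff)
  qed
  have truncfc: "cf (?ft \<epsilon>) i k = ?L \<epsilon> i k + cf (?NL \<epsilon>) i k" if \<epsilon>: "\<epsilon> > 0" for \<epsilon> i k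
    unfolding ext[of "cmp (?ft \<epsilon>) i", OF trunc[OF \<epsilon>]]
    by (subst fc_add) (auto intro: circ_L2_imp_integrable NLc circ_L2_cmult Linc \<epsilon> simp: fc_mult_left Linc(3)[OF \<epsilon>])
  let ?e = "real m - 2 * p"
  define R where "R = nlC m g \<delta> (hE \<tau>) * pint (?e - (?e+1)/2)"
  define rate where "rate \<epsilon> = \<epsilon> powr ((?e+1)/2) * R" for \<epsilon>
  have e1: "?e + 1 > 0" using good_exponents(1)[OF gk] by simp
  have NLd: "2 * pi * (\<Sum>\<^sub>\<infinity>k. (norm (cf (?NL \<epsilon>) i k - cf (?NL 0) i k))\<^sup>2) \<le> 2 * pi * (rate \<epsilon>)\<^sup>2"
    if \<epsilon>: "\<epsilon> > 0" for \<epsilon> i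
  proof -
    let ?v = "\<lambda>x. cmp (?NL \<epsilon>) i x - cmp (?NL 0) i x"
    have v: "circ_L2 ?v" by (intro circ_L2_diff NLc)
    have "fc ?v k = cf (?NL \<epsilon>) i k - cf (?NL 0) i k" for k
      by (intro fc_diff circ_L2_imp_integrable NLc)
    then have "2 * pi * (\<Sum>\<^sub>\<infinity>k. (norm (cf (?NL \<epsilon>) i k - cf (?NL 0) i k))\<^sup>2) \<le> (n2 ?v)\<^sup>2"
      using Bessel(2)[OF v] by simp
    also have "\<dots> \<le> (\<integral>x. (rate \<epsilon>)\<^sup>2 \<partial>circ)"
      unfolding n2_square
    proof (rule integral_mono)
      show "integrable circ (\<lambda>x. (norm (?v x))\<^sup>2)" using v by (simp add: circ_L2_def)
      fix x
      have "norm (?v x) \<le> norm (?NL \<epsilon> x - ?NL 0 x)"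
        using cmpb[of "\<lambda>x. ?NL \<epsilon> x - ?NL 0 x" i x] by (simp add: cmp_def)
      also have "\<dots> \<le> rate \<epsilon>"
        unfolding rate_def R_def \<gamma>_def by (rule NL_trunc_diff[OF gk adm E \<epsilon>])
      finally show "(norm (?v x))\<^sup>2 \<le> (rate \<epsilon>)\<^sup>2" by (intro power_mono) auto
    qed simp
    also have "\<dots> = 2 * pi * (rate \<epsilon>)\<^sup>2" by (simp add: measure_circ)
    finally show ?thesis .
  qed
  have conv: "((\<lambda>\<epsilon>. L2_norm (\<lambda>x. ?ft \<epsilon> x - f x)) \<longlongrightarrow> 0) (at_right 0)"
  proof -
    define Q where "Q \<epsilon> i = (\<Sum>\<^sub>\<infinity>k. (norm (?L \<epsilon> i k - ?L 0 i k))\<^sup>2)" for \<epsilon> i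
    have Ldd: "(norm (?L \<epsilon> i k - ?L 0 i k))\<^sup>2 \<le> (2 * C)\<^sup>2 * (real_of_int \<bar>k\<bar> * norm (fourier \<tau> k))\<^sup>2" for \<epsilon> i k
      using mult_curve_l2[OF adm Cb'[of \<epsilon>], of k i] C by (simp add: \<gamma>_def left_diff_distrib)
    have Lds: "(\<lambda>k. (norm (?L \<epsilon> i k - ?L 0 i k))\<^sup>2) summable_on UNIV" for \<epsilon> i
      by (rule summable_on_comparison_test[OF dom[of "(2 * C)\<^sup>2"]]) (use Ldd in auto)
    have Q0: "((\<lambda>\<epsilon>. Q \<epsilon> i) \<longlongrightarrow> 0) (at_right 0)" for i
    proof -
      have "((\<lambda>\<epsilon>. Q \<epsilon> i) \<longlongrightarrow> (\<Sum>\<^sub>\<infinity>k::int. 0)) (at_right 0)"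
        unfolding Q_def
      proof (rule infsum_tendsto_dominated[OF _ _ dom[of "(2 * C)\<^sup>2"]])
        show "\<forall>\<^sub>F \<epsilon> in at_right 0. \<forall>k. norm ((norm (?L \<epsilon> i k - ?L 0 i k))\<^sup>2) \<le> (2 * C)\<^sup>2 * (real_of_int \<bar>k\<bar> * norm (fourier \<tau> k))\<^sup>2"
          using Ldd by simp
        show "((\<lambda>\<epsilon>. (norm (?L \<epsilon> i k - ?L 0 i k))\<^sup>2) \<longlongrightarrow> 0) (at_right 0)" for k
        proof (cases "g 1 = 0")
          case False
          then have "((\<lambda>\<epsilon>. mk p \<epsilon> k) \<longlongrightarrow> mk p 0 k) (at_right 0)" using g1 by (intro mk_tendsto) simp
          then have "((\<lambda>\<epsilon>. (norm (?L \<epsilon> i k - ?L 0 i k))\<^sup>2) \<longlongrightarrow> (norm (?L 0 i k - ?L 0 i k))\<^sup>2) (at_right 0)"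
            by (intro tendsto_intros)
          then show ?thesis by simp
        qed simp
      qed
      then show ?thesis by simp
    qed
    have sq: "(L2_norm (\<lambda>x. ?ft \<epsilon> x - f x))\<^sup>2 \<le> (\<Sum>i\<in>UNIV. 2 * Q \<epsilon> i + 2 * (rate \<epsilon>)\<^sup>2)"
      if \<epsilon>: "\<epsilon> > 0" for \<epsilon>
    proof -
      let ?N = "\<lambda>i k. cf (?NL \<epsilon>) i k - cf (?NL 0) i k"
      have Ns: "(\<lambda>k. (norm (?N i k))\<^sup>2) summable_on UNIV" for i
        using Bessel(1)[OF circ_L2_diff[OF NLc NLc], of \<epsilon> i 0 i] NLc
        by (simp add: fc_diff circ_L2_imp_integrable)
      have nth: "fourier (\<lambda>x. ?ft \<epsilon> x - f x) k $ i = (?L \<epsilon> i k - ?L 0 i k) + ?N i k" for i k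
      proof -
        have "cmp (\<lambda>x. ?ft \<epsilon> x - f x) i = (\<lambda>x. cmp (?ft \<epsilon>) i x - cmp f i x)"
          by (auto simp: cmp_def)
        moreover have "cf f i k = c k $ i" using f(2)[of k] by (simp add: fourier_eq_iff)
        ultimately show ?thesis
          using truncL[OF \<epsilon>] f(1) unfolding fourier_nth
          by (simp add: fc_diff circ_L2_imp_integrable L2_circle_iff truncfc[OF \<epsilon>] c_def)
      qed
      have "(L2_norm (\<lambda>x. ?ft \<epsilon> x - f x))\<^sup>2 = (\<Sum>\<^sub>\<infinity>k. (norm (fourier (\<lambda>x. ?ft \<epsilon> x - f x) k))\<^sup>2)"
        unfolding L2_norm_def by (simp add: infsum_nonneg)
      also have "\<dots> = (\<Sum>\<^sub>\<infinity>k. \<Sum>i\<in>UNIV. (norm ((?L \<epsilon> i k - ?L 0 i k) + ?N i k))\<^sup>2)"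
        by (simp only: norm_vec_square nth)
      also have "\<dots> = (\<Sum>i\<in>UNIV. \<Sum>\<^sub>\<infinity>k. (norm ((?L \<epsilon> i k - ?L 0 i k) + ?N i k))\<^sup>2)"
        by (rule infsumI[OF has_sum_sum]) (simp, intro has_sum_infsum l2_add(1) Lds Ns)
      also have "\<dots> \<le> (\<Sum>i\<in>UNIV. 2 * Q \<epsilon> i + 2 * (rate \<epsilon>)\<^sup>2)"
      proof (rule sum_mono)
        fix i
        have "(\<Sum>\<^sub>\<infinity>k. (norm (?N i k))\<^sup>2) \<le> (rate \<epsilon>)\<^sup>2" using NLd[OF \<epsilon>, of i] by simp
        with l2_add(2)[OF Lds[of \<epsilon> i] Ns[of i]]
        show "(\<Sum>\<^sub>\<infinity>k. (norm ((?L \<epsilon> i k - ?L 0 i k) + ?N i k))\<^sup>2) \<le> 2 * Q \<epsilon> i + 2 * (rate \<epsilon>)\<^sup>2"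
          unfolding Q_def by linarith
      qed
      finally show ?thesis .
    qed
    have "((\<lambda>\<epsilon>. \<epsilon> powr ((?e+1)/2)) \<longlongrightarrow> 0) (at_right 0)"
    proof (rule tendsto_zero_powrI[where b="(?e+1)/2"])
      show "((\<lambda>\<epsilon>::real. \<epsilon>) \<longlongrightarrow> 0) (at_right 0)" by (rule tendsto_ident_at)
      show "\<forall>\<^sub>F \<epsilon>::real in at_right 0. 0 \<le> \<epsilon>"
        using eventually_at_right_less[of "0::real"] by eventually_elim simp
    qed (use e1 in auto)
    from tendsto_mult_right[OF this, of R] have pw: "(rate \<longlongrightarrow> 0) (at_right 0)"
      unfolding rate_def[abs_def] by simp
    have "((\<lambda>\<epsilon>. sqrt (\<Sum>i\<in>UNIV. 2 * Q \<epsilon> i + 2 * (rate \<epsilon>)\<^sup>2)) \<longlongrightarrow> sqrt (\<Sum>i\<in>(UNIV::3 set). 2 * 0 + 2 * 0\<^sup>2)) (at_right 0)"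
      by (intro tendsto_intros Q0 pw)
    then have lim: "((\<lambda>\<epsilon>. sqrt (\<Sum>i\<in>UNIV. 2 * Q \<epsilon> i + 2 * (rate \<epsilon>)\<^sup>2)) \<longlongrightarrow> 0) (at_right 0)" by simp
    show ?thesis
    proof (rule tendsto_sandwich[OF _ _ tendsto_const lim])
      show "\<forall>\<^sub>F \<epsilon> in at_right 0. 0 \<le> L2_norm (\<lambda>x. ?ft \<epsilon> x - f x)"
        by (simp add: L2_norm_def infsum_nonneg)
      show "\<forall>\<^sub>F \<epsilon> in at_right 0. L2_norm (\<lambda>x. ?ft \<epsilon> x - f x) \<le> sqrt (\<Sum>i\<in>UNIV. 2 * Q \<epsilon> i + 2 * (rate \<epsilon>)\<^sup>2)"
        using eventually_at_right_less[of 0] by eventually_elim (rule real_le_rsqrt[OF sq])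
    qed
  qed
  have ev: "\<forall>\<^sub>F \<epsilon> in at_right 0. L2_circle (?ft \<epsilon>)"
    using eventually_at_right_less[of 0] by eventually_elim (rule truncL)
  have "\<exists>f. L2_circle f \<and> (\<forall>\<^sub>F \<epsilon> in at_right 0. L2_circle (?ft \<epsilon>)) \<and>
     ((\<lambda>\<epsilon>. L2_norm (\<lambda>x. ?ft \<epsilon> x - f x)) \<longlongrightarrow> 0) (at_right 0)"
    using f(1) ev conv by blast
  from someI_ex[OF this] have F: "L2_circle (force K \<gamma>)"
     "((\<lambda>\<epsilon>. L2_norm (\<lambda>x. ?ft \<epsilon> x - force K \<gamma> x)) \<longlongrightarrow> 0) (at_right 0)"
    unfolding force_def by auto
  show "L2_circle (force K \<gamma>)" by (rule F(1))
  have coef: "((\<lambda>\<epsilon>. cf (?ft \<epsilon>) j k) \<longlongrightarrow> cf v j k) (at_right 0)"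
    if v: "L2_circle v" "((\<lambda>\<epsilon>. L2_norm (\<lambda>x. ?ft \<epsilon> x - v x)) \<longlongrightarrow> 0) (at_right 0)" for v j k
  proof (rule LIM_zero_cancel[OF Lim_null_comparison[OF _ v(2)]])
    show "\<forall>\<^sub>F \<epsilon> in at_right 0. norm (cf (?ft \<epsilon>) j k - cf v j k) \<le> L2_norm (\<lambda>x. ?ft \<epsilon> x - v x)"
      using ev
    proof eventually_elim
      case (elim \<epsilon>)
      let ?d = "\<lambda>x. ?ft \<epsilon> x - v x"
      have e: "cmp ?d i = (\<lambda>x. cmp (?ft \<epsilon>) i x - cmp v i x)" for i by (auto simp: cmp_def)
      have dL: "L2_circle ?d"
        using elim v(1) by (auto simp: L2_circle_iff e per2pi_def intro: circ_L2_diff)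
      have "norm (cf (?ft \<epsilon>) j k - cf v j k) = norm (fourier ?d k $ j)"
        unfolding fourier_nth e using elim v(1) by (simp add: fc_diff circ_L2_imp_integrable L2_circle_iff)
      also have "\<dots> \<le> norm (fourier ?d k)" by (rule Finite_Cartesian_Product.norm_nth_le)
      also have "\<dots> \<le> L2_norm ?d"
      proof -
        have "(\<Sum>k\<in>{k}. (norm (fourier ?d k))\<^sup>2) \<le> (\<Sum>\<^sub>\<infinity>k. (norm (fourier ?d k))\<^sup>2)"
          by (intro finite_sum_le_infsum L2_circle_summable(1) dL) auto
        then have "sqrt ((norm (fourier ?d k))\<^sup>2) \<le> L2_norm ?d" unfolding L2_norm_def by (intro real_sqrt_le_mono) simp
        then show ?thesis by simp
      qed
      finally show ?case .
    qed
  qed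
  have "cf (force K \<gamma>) i k = cf f i k" for i k
    by (rule tendsto_unique[OF _ coef[OF F] coef[OF f(1) conv]]) simp
  then have val: "cf (force K \<gamma>) i k = ?L 0 i k + cf (?NL 0) i k" for i k
    using f(2)[of k] by (simp add: fourier_eq_iff c_def)
  then show "cf (force K \<gamma>) j k = of_real (fmult g p k) * cf \<gamma> j k + cf (?NL 0) j k"
    by (simp add: fmult_def)
  show "mean_zero (force K \<gamma>)"
    unfolding mean_zero_fc[OF F(1)]
  proof
    fix i
    have "integrable circ (?NL 0)"
    proof (rule integrable_circ_bounded[OF _ NLb])
      show "?NL 0 \<in> borel_measurable circ"
        unfolding \<gamma>_def by (intro measurable_circI measurable_NL gcont ad)
    qed
    from integral_vec_nth[OF this, of i] have "cf (?NL 0) i 0 = 0"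
      unfolding fc_0 cmp_def by (simp add: NL_mean_zero[OF gk adm E, folded \<gamma>_def])
    then show "cf (force K \<gamma>) i 0 = 0" by (simp add: val mk_0)
  qed
qed

lemma fmult_bound:
  assumes "good_kernel m g p"
  shows "\<bar>fmult g p k\<bar> \<le> (\<bar>g 1\<bar> * (pint (- 2 * p) / 2)) * (of_int k)\<^sup>2"
proof (cases "g 1 = 0")
  case True
  then show ?thesis by (simp add: fmult_def)
next
  case False
  then have "p < 1/2" using assms by (simp add: good_kernel_def)
  from mult_left_mono[OF mk_bound[OF this, of 0 k], of "\<bar>g 1\<bar>"] show ?thesis
    by (simp add: fmult_def abs_mult mult_ac)
qed

section \<open>States and their Fourier coefficients\<close>

text \<open>What is known about \<open>\<tau>(t)\<close> at every time; all bounds below depend on the state only through \<open>A\<close>, \<open>\<delta>\<close>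
  and \<open>H\<close>.\<close>

definition good_state :: "real \<Rightarrow> real \<Rightarrow> real \<Rightarrow> (real \<Rightarrow> real^3) \<Rightarrow> bool" where
  "good_state A \<delta> H \<tau> \<longleftrightarrow> admissible \<delta> \<tau> \<and> H_norm 1 \<tau> \<le> H \<and> invertible (A_mat \<tau>) \<and>
     onorm ((*v) (matrix_inv (A_mat \<tau>))) \<le> A"

text \<open>The scalar \<open>\<langle>F, \<tau>\<rangle> - \<bar>d\<bar>\<^sup>2\<close> that occurs in both Lagrange multipliers.\<close>

definition qc :: "(real \<Rightarrow> real \<Rightarrow> real) \<Rightarrow> (real \<Rightarrow> real^3) \<Rightarrow> (real \<Rightarrow> real^3) \<Rightarrow> real \<Rightarrow> complex" where
  "qc K \<tau> d x = (\<Sum>j\<in>UNIV. cmp (bigF K (curve \<tau>)) j x * cmp \<tau> j x) - (\<Sum>j\<in>UNIV. cmp d j x * cmp d j x)"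

lemma sum_le_H:
  assumes H: "\<tau> \<in> H_space 1" and h: "H_norm 1 \<tau> \<le> h"
  shows "(\<Sum>\<^sub>\<infinity>k. (real_of_int \<bar>k\<bar> * norm (fourier \<tau> k))\<^sup>2) \<le> h\<^sup>2"
proof -
  have e: "(\<Sum>\<^sub>\<infinity>k. (real_of_int \<bar>k\<bar> * norm (fourier \<tau> k))\<^sup>2) = (Hdot_norm 1 \<tau>)\<^sup>2"
  proof -
    have "real_of_int \<bar>k\<bar> powr (2 * 1) * (norm (fourier \<tau> k))\<^sup>2 = (real_of_int \<bar>k\<bar> * norm (fourier \<tau> k))\<^sup>2" for k
      by (simp add: power_mult_distrib)
    then show ?thesis unfolding Hdot_norm_def by (simp add: infsum_nonneg)
  qed
  have "(Hdot_norm 1 \<tau>)\<^sup>2 \<le> (H_norm 1 \<tau>)\<^sup>2" unfolding H_norm_def by simp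
  also have "\<dots> \<le> h\<^sup>2" using h by (intro power_mono) (auto simp: H_norm_def)
  finally show ?thesis unfolding e .
qed

lemma coeff_le_H:
  assumes H: "\<tau> \<in> H_space 1" and h: "H_norm 1 \<tau> \<le> h"
  shows "real_of_int \<bar>k\<bar> * norm (fourier \<tau> k) \<le> h"
proof -
  have "(\<Sum>k\<in>{k}. (real_of_int \<bar>k\<bar> * norm (fourier \<tau> k))\<^sup>2) \<le> (\<Sum>\<^sub>\<infinity>k. (real_of_int \<bar>k\<bar> * norm (fourier \<tau> k))\<^sup>2)"
    by (intro finite_sum_le_infsum H1_summable H) auto
  also have "\<dots> \<le> h\<^sup>2" by (rule sum_le_H[OF H h])
  finally have "(real_of_int \<bar>k\<bar> * norm (fourier \<tau> k))\<^sup>2 \<le> h\<^sup>2" by simp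
  moreover have "h \<ge> 0" using h order_trans[OF _ h, of 0] by (simp add: H_norm_def)
  ultimately show ?thesis by (rule power2_le_imp_le)
qed

lemma good_stateD:
  assumes "good_state A \<delta> H \<tau>"
  shows "admissible \<delta> \<tau>" "\<tau> \<in> H_space 1" "mean_zero \<tau>" "unit_speed \<tau>" "H_norm 1 \<tau> \<le> H" "H \<ge> 0"
    "hE \<tau> \<le> 2 * pi * H\<^sup>2" "invertible (A_mat \<tau>)" "onorm ((*v) (matrix_inv (A_mat \<tau>))) \<le> A"
    "norm (cf \<tau> j k) * real_of_int \<bar>k\<bar> \<le> H" "cf \<tau> j 0 = 0"
    "\<bar>a - b\<bar> \<le> pi \<Longrightarrow> (norm (\<tau> a - \<tau> b))\<^sup>2 \<le> 2 * pi * H\<^sup>2 * \<bar>a - b\<bar>"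
    "norm (cmp \<tau> j x) \<le> 1"
proof -
  show a: "admissible \<delta> \<tau>" and H: "H_norm 1 \<tau> \<le> H" and "invertible (A_mat \<tau>)"
    "onorm ((*v) (matrix_inv (A_mat \<tau>))) \<le> A"
    using assms by (auto simp: good_state_def)
  show b: "\<tau> \<in> H_space 1" and m: "mean_zero \<tau>" and u: "unit_speed \<tau>" using a by (auto simp: admissible_def)
  show "H \<ge> 0" using order_trans[OF _ H, of 0] by (simp add: H_norm_def)
  show hE: "hE \<tau> \<le> 2 * pi * H\<^sup>2" using sum_le_H[OF b H] by (simp add: hE_eq[OF b])
  show "norm (cf \<tau> j k) * real_of_int \<bar>k\<bar> \<le> H"
  proof -
    have "norm (cf \<tau> j k) * real_of_int \<bar>k\<bar> \<le> norm (fourier \<tau> k) * real_of_int \<bar>k\<bar>"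
      using Finite_Cartesian_Product.norm_nth_le[of "fourier \<tau> k" j]
      by (intro mult_right_mono) (simp_all add: fourier_nth)
    also have "\<dots> \<le> H" using coeff_le_H[OF b H, of k] by (simp add: mult.commute)
    finally show ?thesis .
  qed
  show "cf \<tau> j 0 = 0" using m mean_zero_fc[OF H_spaceD(2)[OF b]] by blast
  show "(norm (\<tau> a - \<tau> b))\<^sup>2 \<le> 2 * pi * H\<^sup>2 * \<bar>a - b\<bar>" if "\<bar>a - b\<bar> \<le> pi" for a b
    using Hoelder_half[OF b m that] mult_right_mono[OF hE, of "\<bar>a - b\<bar>"] by linarith
  show "norm (cmp \<tau> j x) \<le> 1"
    using component_le_norm_cart[of "\<tau> x" j] u by (simp add: cmp_def unit_speed_def)
qed

definition W :: "real \<Rightarrow> real" where "W s = (\<Sum>\<^sub>\<infinity>k. wt k powr (- s))"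

lemma W_nonneg: "W s \<ge> 0"
  unfolding W_def by (rule infsum_nonneg) simp

lemma wt_powr_le_1: "s \<ge> 0 \<Longrightarrow> wt k powr (- s) \<le> 1"
  using powr_mono2'[of "-s" 1 "wt k"] wt_ge_1[of k] by simp

lemma divide_abs_le_wt:
  assumes "k \<noteq> 0" "C \<ge> 0" shows "C / real_of_int \<bar>k\<bar> \<le> 2 * C * wt k powr (- 1)"
proof -
  have w: "wt k powr (- 1) = 1 / wt k" using wt_pos[of k] by (simp add: powr_minus_divide)
  have "1 / real_of_int \<bar>k\<bar> \<le> 2 / wt k" using wt_le_abs[OF assms(1)] wt_pos[of k] assms(1) by (simp add: field_simps)
  from mult_left_mono[OF this assms(2)] show ?thesis unfolding w by (simp add: mult.commute)
qed

lemma divide_square_le_wt: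
  assumes "k \<noteq> 0" "C \<ge> 0" shows "C / (real_of_int k)\<^sup>2 \<le> 4 * C * wt k powr (- 2)"
proof -
  have w: "wt k powr (-2) = 1 / (wt k)\<^sup>2"
    using wt_pos[of k] by (simp add: powr_minus_divide powr_numeral)
  have "1 / real_of_int \<bar>k\<bar> \<le> 2 / wt k" using wt_le_abs[OF assms(1)] wt_pos[of k] assms(1) by (simp add: field_simps)
  then have "(1 / real_of_int \<bar>k\<bar>)\<^sup>2 \<le> (2 / wt k)\<^sup>2" by (intro power_mono) auto
  then have "1 / (real_of_int k)\<^sup>2 \<le> 4 / (wt k)\<^sup>2" by (simp add: power_divide)
  from mult_left_mono[OF this assms(2)] show ?thesis unfolding w by (simp add: mult.commute)
qed

subsection \<open>The nonlocal force\<close>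

text \<open>The constants \<open>gB\<close>, \<open>NLB\<close>, \<open>FB\<close>, \<open>QB\<close>, \<open>LB\<close> and \<open>NB\<close> below bound the linear multiplier, the nonlinear force,
  the coefficients of \<open>F\<close>, the \<open>L\<^sup>1\<close> norm of the scalar \<open>qc\<close>, the multiplier \<open>\<lambda>\<close> and the coefficients of the
  nonlinearity.  They are explicit because the final constant may not depend on the solution.\<close>

definition gB :: "(real \<Rightarrow> real) \<Rightarrow> real \<Rightarrow> real" where
  "gB g p = \<bar>g 1\<bar> * (pint (- 2 * p) / 2)"

lemma gB_nonneg: "gB g p \<ge> 0"
  unfolding gB_def using pint_nonneg by auto

lemma (in kernel) bigF_props:
  assumes adm: "admissible \<delta> \<tau>"
  shows "continuous_on UNIV (F \<tau>)" "per2pi (F \<tau>)"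
    "circ_L2 (cmp (F \<tau>) j)"
    "cf (F \<tau>) j k = (of_real (fmult g p k) * cf \<tau> j k / (\<i> * of_int k)
       + cf (nl \<tau>) j k) / (\<i> * of_int k)"
    "norm (cf (F \<tau>) j k) \<le> gB g p * norm (cf \<tau> j k)
       + norm (cf (nl \<tau>) j k) / \<bar>of_int k\<bar>"
    "cf (F \<tau>) j 0 = 0"
proof -
  note ff = force_fourier[OF adm]
  note ad = admissibleD[OF adm]
  show c: "continuous_on UNIV (F \<tau>)"
    unfolding bigF_def by (rule continuous_primitive[OF ff(1,2)])
  show "per2pi (F \<tau>)"
    unfolding bigF_def by (rule primitive_per2pi[OF ff(1,2)])
  show "circ_L2 (cmp (F \<tau>) j)" by (intro circ_L2_continuous continuous_cmp c)
  show f: "cf (F \<tau>) j k = (of_real (fmult g p k) * cf \<tau> j k / (\<i> * of_int k)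
       + cf (nl \<tau>) j k) / (\<i> * of_int k)" for k
    unfolding bigF_def by (simp add: primitive_fc[OF ff(1,2)] ff(3) primitive_fc[OF ad(2,3)])
  then show "cf (F \<tau>) j 0 = 0" by simp
  show "norm (cf (F \<tau>) j k) \<le> gB g p * norm (cf \<tau> j k)
       + norm (cf (nl \<tau>) j k) / \<bar>of_int k\<bar>"
  proof (cases "k = 0")
    case True
    then show ?thesis using f[of 0] gB_nonneg[of "g_of h" p] by simp
  next
    case False
    have "norm (cf (F \<tau>) j k) \<le>
        norm (of_real (fmult g p k) * cf \<tau> j k / (\<i> * of_int k) / (\<i> * of_int k))
        + norm (cf (nl \<tau>) j k / (\<i> * of_int k))"
      unfolding f add_divide_distrib by (rule norm_triangle_ineq)
    also have "norm (of_real (fmult g p k) * cf \<tau> j k / (\<i> * of_int k) / (\<i> * of_int k))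
        = \<bar>fmult g p k\<bar> / (of_int k)\<^sup>2 * norm (cf \<tau> j k)"
      by (simp add: norm_mult norm_divide power2_eq_square abs_mult[symmetric])
    also have "\<dots> \<le> gB g p * norm (cf \<tau> j k)"
      using fmult_bound[OF gk, of k] False by (intro mult_right_mono) (auto simp: gB_def field_simps)
    finally show ?thesis by (simp add: norm_mult norm_divide)
  qed
qed

definition NLB :: "nat \<Rightarrow> (real \<Rightarrow> real) \<Rightarrow> real \<Rightarrow> real \<Rightarrow> real \<Rightarrow> real" where
  "NLB m g p \<delta> H = nlC m g \<delta> (2 * pi * H\<^sup>2) * pint (real m - 2 * p)"

lemma NL_state_bound:
  assumes gk: "good_kernel m g p" and gs: "good_state A \<delta> H \<tau>"
  shows "norm (NL g p (curve \<tau>) \<epsilon> x) \<le> NLB m g p \<delta> H" "NLB m g p \<delta> H \<ge> 0"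
    "circ_L2 (cmp (NL g p (curve \<tau>) \<epsilon>) j)" "norm (cf (NL g p (curve \<tau>) \<epsilon>) j k) \<le> NLB m g p \<delta> H"
    "norm (cmp (NL g p (curve \<tau>) \<epsilon>) j x) \<le> NLB m g p \<delta> H"
proof -
  note gd = good_stateD[OF gs]
  have E: "2 * pi * H\<^sup>2 \<ge> 0" by simp
  show b: "norm (NL g p (curve \<tau>) \<epsilon> x) \<le> NLB m g p \<delta> H" for x
    unfolding NLB_def by (rule NL_bound[OF gk gd(1) gd(12) E])
  show B: "NLB m g p \<delta> H \<ge> 0" using order_trans[OF norm_ge_zero b[of 0]] .
  show b': "norm (cmp (NL g p (curve \<tau>) \<epsilon>) j x) \<le> NLB m g p \<delta> H" for x
    using b[of x] component_le_norm_cart[of "NL g p (curve \<tau>) \<epsilon> x" j] by (simp add: cmp_def)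
  show L: "circ_L2 (cmp (NL g p (curve \<tau>) \<epsilon>) j)"
  proof (rule circ_L2_bounded[OF _ b'])
    have "NL g p (curve \<tau>) \<epsilon> \<in> borel_measurable circ"
      using gk admissibleD(8)[OF gd(1)] by (intro measurable_circI measurable_NL) (auto simp: good_kernel_def)
    then show "cmp (NL g p (curve \<tau>) \<epsilon>) j \<in> borel_measurable circ"
      unfolding cmp_measurable_iff measurable_vec_iff by blast
  qed
  have "norm (cf (NL g p (curve \<tau>) \<epsilon>) j k) \<le> (1 / (2 * pi)) * (\<integral>x. norm (cmp (NL g p (curve \<tau>) \<epsilon>) j x) \<partial>circ)"
    by (rule norm_fc_le[OF circ_L2_imp_integrable[OF L]])
  also have "\<dots> \<le> (1 / (2 * pi)) * (\<integral>x. NLB m g p \<delta> H \<partial>circ)"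
    using circ_L2_imp_integrable[OF L] b' by (intro mult_left_mono integral_mono) auto
  finally show "norm (cf (NL g p (curve \<tau>) \<epsilon>) j k) \<le> NLB m g p \<delta> H" by (simp add: measure_circ)
qed

definition FB :: "nat \<Rightarrow> (real \<Rightarrow> real) \<Rightarrow> real \<Rightarrow> real \<Rightarrow> real \<Rightarrow> real" where
  "FB m g p \<delta> H = 2 * (gB g p * H + NLB m g p \<delta> H)"

lemma (in kernel) bigF_coeff_bound:
  assumes gs: "good_state A \<delta> H \<tau>"
  shows "norm (cf (F \<tau>) j k) \<le> FB m g p \<delta> H * wt k powr (- 1)" "FB m g p \<delta> H \<ge> 0"
proof -
  note gd = good_stateD[OF gs] and bp = bigF_props[OF good_stateD(1)[OF gs]]
  let ?B = "NLB m g p \<delta> H"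
  have nn: "0 \<le> gB g p * H + ?B"
    using gB_nonneg gd(6) NL_state_bound(2)[OF gk gs] by (intro add_nonneg_nonneg mult_nonneg_nonneg)
  then show F0: "FB m g p \<delta> H \<ge> 0" by (simp add: FB_def)
  show "norm (cf (F \<tau>) j k) \<le> FB m g p \<delta> H * wt k powr (- 1)"
  proof (cases "k = 0")
    case True
    then show ?thesis using bp(6) F0 by simp
  next
    case False
    have "norm (cf (F \<tau>) j k) \<le> gB g p * (H / \<bar>of_int k\<bar>) + ?B / \<bar>of_int k\<bar>"
      using gd(10)[of j k] NL_state_bound(4)[OF gk gs, of 0 j k] False gB_nonneg
      by (intro order_trans[OF bp(5)] add_mono mult_left_mono divide_right_mono) (auto simp: field_simps)
    also have "\<dots> = (gB g p * H + ?B) / real_of_int \<bar>k\<bar>" by (simp add: add_divide_distrib)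
    also have "\<dots> \<le> 2 * (gB g p * H + ?B) * wt k powr (- 1)" by (rule divide_abs_le_wt[OF False nn])
    finally show ?thesis by (simp add: FB_def)
  qed
qed

lemma n2_le_coeffs:
  assumes u: "circ_L2 u" and b: "\<And>k. norm (fc u k) \<le> C * wt k powr (- 1)" and C: "C \<ge> 0"
  shows "n2 u \<le> sqrt (2 * pi) * C * sqrt (W 2)"
proof -
  have s: "(\<lambda>k. C\<^sup>2 * wt k powr (- 2)) summable_on UNIV" by (intro summable_on_cmult_right summable_wt) simp
  have le: "(norm (fc u k))\<^sup>2 \<le> C\<^sup>2 * wt k powr (- 2)" for k
  proof -
    have "(norm (fc u k))\<^sup>2 \<le> (C * wt k powr (- 1))\<^sup>2" using b[of k] by (intro power_mono) auto
    also have "\<dots> = C\<^sup>2 * wt k powr (- 1 + - 1)"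
      unfolding power_mult_distrib power2_eq_square[of "wt k powr (- 1)"] powr_add ..
    also have "\<dots> = C\<^sup>2 * wt k powr (- 2)" by simp
    finally show ?thesis .
  qed
  have "(n2 u)\<^sup>2 = 2 * pi * (\<Sum>\<^sub>\<infinity>k. (norm (fc u k))\<^sup>2)" using Parseval[OF u] by simp
  also have "\<dots> \<le> 2 * pi * (\<Sum>\<^sub>\<infinity>k. C\<^sup>2 * wt k powr (- 2))"
    by (intro mult_left_mono infsum_mono Bessel(1) u s le) simp
  also have "\<dots> = (sqrt (2 * pi) * C * sqrt (W 2))\<^sup>2"
    using W_nonneg[of 2] by (simp add: power_mult_distrib infsum_cmult_right' W_def[symmetric])
  finally show ?thesis
    by (rule power2_le_imp_le) (auto intro!: mult_nonneg_nonneg C W_nonneg)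
qed

subsection \<open>The nonlinearity\<close>

lemma cmp_T_L2: "\<tau> \<in> H_space s \<Longrightarrow> circ_L2 (cmp \<tau> j)"
  by (rule H_spaceD(4))

lemma bounded_mult_integrable:
  fixes u v :: "real \<Rightarrow> complex"
  assumes "u \<in> borel_measurable circ" "\<And>x. norm (u x) \<le> 1" "integrable circ v"
  shows "integrable circ (\<lambda>x. u x * v x)" "(\<integral>x. norm (u x * v x) \<partial>circ) \<le> (\<integral>x. norm (v x) \<partial>circ)"
proof -
  have le: "norm (u x * v x) \<le> norm (v x)" for x
    using mult_right_mono[OF assms(2)[of x], of "norm (v x)"] by (simp add: norm_mult)
  show i: "integrable circ (\<lambda>x. u x * v x)"
    by (rule integrable_bound[OF assms(3)]) (use assms le in auto)
  show "(\<integral>x. norm (u x * v x) \<partial>circ) \<le> (\<integral>x. norm (v x) \<partial>circ)"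
    using i assms(3) le by (intro integral_mono) auto
qed

lemma (in kernel) qc_integrable:
  assumes gs: "good_state A \<delta> H \<tau>"
    and d: "L2_circle d"
  shows "integrable circ (qc K \<tau> d)" "integrable circ (\<lambda>x. cmp \<tau> i x * qc K \<tau> d x)"
    "fc (qc K \<tau> d) k = (\<Sum>j\<in>UNIV. fc (\<lambda>x. cmp (F \<tau>) j x * cmp \<tau> j x) k) - (\<Sum>j\<in>UNIV. fc (\<lambda>x. cmp d j x * cmp d j x) k)"
proof -
  note gd = good_stateD[OF gs] and bp = bigF_props[OF good_stateD(1)[OF gs]]
  have 1: "integrable circ (\<lambda>x. cmp (F \<tau>) j x * cmp \<tau> j x)" for j
    by (intro circ_L2_mult(1) bp cmp_T_L2[OF gd(2)])
  have 2: "integrable circ (\<lambda>x. cmp d j x * cmp d j x)" for j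
    using d by (intro circ_L2_mult(1)) (auto simp: L2_circle_iff)
  show q: "integrable circ (qc K \<tau> d)"
    unfolding qc_def[abs_def] by (intro integrable_diff integrable_sum 1 2)
  show "fc (qc K \<tau> d) k = (\<Sum>j\<in>UNIV. fc (\<lambda>x. cmp (F \<tau>) j x * cmp \<tau> j x) k) - (\<Sum>j\<in>UNIV. fc (\<lambda>x. cmp d j x * cmp d j x) k)"
    unfolding qc_def[abs_def]
    by (subst fc_diff) (auto intro!: integrable_sum 1 2 simp: fc_sum 1 2)
  show "integrable circ (\<lambda>x. cmp \<tau> i x * qc K \<tau> d x)"
    using cmp_T_L2[OF gd(2), of i] gd(13) by (intro bounded_mult_integrable q) (auto simp: circ_L2_def)
qed

lemma qc_eq:
  "qc K \<tau> d x = complex_of_real (bigF K (curve \<tau>) x \<bullet> \<tau> x - (norm (d x))\<^sup>2)"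
proof -
  have "(norm (d x))\<^sup>2 = (\<Sum>j\<in>UNIV. d x $ j * d x $ j)"
    unfolding norm_vec_square by (simp add: power2_eq_square)
  then show ?thesis by (simp add: qc_def cmp_def inner_vec_def)
qed

text \<open>The right hand side of the linear system for \<open>\<lambda>\<close>, simplified by unit speed.\<close>

definition bvec :: "(real \<Rightarrow> real \<Rightarrow> real) \<Rightarrow> (real \<Rightarrow> real^3) \<Rightarrow> (real \<Rightarrow> real^3) \<Rightarrow> real^3" where
  "bvec K \<tau> d = (1 / (2 * pi)) *\<^sub>R (\<integral>x. (bigF K (curve \<tau>) x \<bullet> \<tau> x - (norm (d x))\<^sup>2) *\<^sub>R \<tau> x \<partial>circ)"

lemma lambda_mult_eq:
  assumes "unit_speed \<tau>" shows "lambda_mult K \<tau> d = matrix_inv (A_mat \<tau>) *v bvec K \<tau> d"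
  using assms unfolding lambda_mult_def bvec_def set_integral_circ unit_speed_def by simp

lemma integrable_vecI:
  fixes f :: "'a \<Rightarrow> real^3"
  assumes "\<And>j. integrable M (\<lambda>x. f x $ j)" shows "integrable M f"
proof (rule integrable_bound[of _ "\<lambda>x. \<Sum>j\<in>UNIV. norm (f x $ j)"])
  show "f \<in> borel_measurable M" unfolding measurable_vec_iff using assms by auto
  show "AE x in M. norm (f x) \<le> norm (\<Sum>j\<in>UNIV. norm (f x $ j))"
    by (intro AE_I2 order_trans[OF norm_vec_le_sum]) simp
qed (use assms in auto)

lemma (in kernel) bvec_nth:
  assumes gs: "good_state A \<delta> H \<tau>"
    and d: "L2_circle d"
  shows "complex_of_real (bvec K \<tau> d $ i) = fc (\<lambda>x. cmp \<tau> i x * qc K \<tau> d x) 0"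
proof -
  let ?f = "\<lambda>x. (F \<tau> x \<bullet> \<tau> x - (norm (d x))\<^sup>2) *\<^sub>R \<tau> x"
  have fj: "?f x $ j = (F \<tau> x \<bullet> \<tau> x - (norm (d x))\<^sup>2) * \<tau> x $ j" for x j by simp
  have e: "cmp \<tau> j x * qc K \<tau> d x = complex_of_real (?f x $ j)" for j x
    unfolding qc_eq cmp_def fj by (simp add: mult.commute)
  have "integrable circ (\<lambda>x. ?f x $ j)" for j
    using qc_integrable(2)[OF gs d, of j] unfolding e by (simp only: complex_of_real_integrable_eq)
  then have "integrable circ ?f" by (rule integrable_vecI)
  then have "bvec K \<tau> d $ i = (1 / (2 * pi)) * (\<integral>x. ?f x $ i \<partial>circ)"
    unfolding bvec_def vector_scaleR_component by (subst integral_vec_nth) auto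
  then show ?thesis unfolding fc_0 e integral_complex_of_real by (simp only: scaleR_conv_of_real of_real_mult)
qed

lemma nonlinearity_cmp:
  assumes "unit_speed \<tau>"
  shows "cmp (nonlinearity K \<tau> d) i x = cmp (bigF K (curve \<tau>)) i x + of_real (lambda_mult K \<tau> d $ i)
    - cmp \<tau> i x * qc K \<tau> d x - (\<Sum>j\<in>UNIV. of_real (lambda_mult K \<tau> d $ j) * (cmp \<tau> j x * cmp \<tau> i x))"
proof -
  have "nonlinearity K \<tau> d x = bigF K (curve \<tau>) x + lambda_mult K \<tau> d
      - (bigF K (curve \<tau>) x \<bullet> \<tau> x - (norm (d x))\<^sup>2) *\<^sub>R \<tau> x - (lambda_mult K \<tau> d \<bullet> \<tau> x) *\<^sub>R \<tau> x"
    using assms by (simp add: nonlinearity_def mu_mult_def unit_speed_def algebra_simps)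
  then show ?thesis
    unfolding qc_eq by (simp add: cmp_def inner_vec_def sum_distrib_right sum_distrib_left mult_ac)
qed

lemma (in kernel) nonlinearity_fc:
  assumes gs: "good_state A \<delta> H \<tau>"
    and d: "L2_circle d"
  shows "integrable circ (cmp (nonlinearity K \<tau> d) i)"
    "cf (nonlinearity K \<tau> d) i k = cf (F \<tau>) i k + (if k = 0 then of_real (lambda_mult K \<tau> d $ i) else 0)
    - fc (\<lambda>x. cmp \<tau> i x * qc K \<tau> d x) k - (\<Sum>j\<in>UNIV. of_real (lambda_mult K \<tau> d $ j) * fc (\<lambda>x. cmp \<tau> j x * cmp \<tau> i x) k)"
proof -
  note gd = good_stateD[OF gs] and bp = bigF_props[OF good_stateD(1)[OF gs]]
  let ?l = "\<lambda>j. complex_of_real (lambda_mult K \<tau> d $ j)"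
  have i1: "integrable circ (cmp (F \<tau>) i)" by (intro circ_L2_imp_integrable bp)
  have i2: "integrable circ (\<lambda>x. ?l i)" by simp
  note i3 = qc_integrable(2)[OF gs d, of i]
  have i4: "integrable circ (\<lambda>x. ?l j * (cmp \<tau> j x * cmp \<tau> i x))" for j
    by (intro integrable_mult_right circ_L2_mult(1) cmp_T_L2[OF gd(2)])
  have i5: "integrable circ (\<lambda>x. \<Sum>j\<in>UNIV. ?l j * (cmp \<tau> j x * cmp \<tau> i x))"
    by (intro integrable_sum i4)
  have e: "cmp (nonlinearity K \<tau> d) i = (\<lambda>x. cmp (F \<tau>) i x + ?l i
    - cmp \<tau> i x * qc K \<tau> d x - (\<Sum>j\<in>UNIV. ?l j * (cmp \<tau> j x * cmp \<tau> i x)))"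
    by (rule ext) (rule nonlinearity_cmp[OF gd(4)])
  show "integrable circ (cmp (nonlinearity K \<tau> d) i)"
    unfolding e by (intro integrable_diff integrable_add i1 i2 i3 i5)
  have c: "fc (\<lambda>x. ?l i) k = (if k = 0 then ?l i else 0)"
    using fc_mult_left[of "?l i" "\<lambda>_. 1" k] fc_cis[of 0 k] by auto
  show "cf (nonlinearity K \<tau> d) i k = cf (F \<tau>) i k + (if k = 0 then ?l i else 0)
    - fc (\<lambda>x. cmp \<tau> i x * qc K \<tau> d x) k - (\<Sum>j\<in>UNIV. ?l j * fc (\<lambda>x. cmp \<tau> j x * cmp \<tau> i x) k)"
    unfolding e
    by (subst fc_diff, intro integrable_diff integrable_add i1 i2 i3, rule i5,
        subst fc_diff, intro integrable_add i1 i2, rule i3,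
        subst fc_add[OF i1 i2], subst fc_sum[OF i4]) (simp add: c fc_mult_left)
qed

text \<open>The weak derivative is determined up to null sets only; this exchanges it for the classical one.\<close>

lemma (in kernel) AE_eq_nonlinearity:
  assumes gs: "good_state A \<delta> H \<tau>"
    and d: "L2_circle d" "L2_circle d'" and fc: "\<And>j k. cf d j k = cf d' j k"
  shows "lambda_mult K \<tau> d = lambda_mult K \<tau> d'"
    and "cf (nonlinearity K \<tau> d) i k = cf (nonlinearity K \<tau> d') i k"
proof -
  have c: "circ_L2 (cmp d j)" "circ_L2 (cmp d' j)" for j using d by (auto simp: L2_circle_iff)
  have ae: "AE x in circ. cmp d j x = cmp d' j x" for j
    using c fc by (intro fc_eq_imp_AE_eq circ_L2_imp_integrable) auto
  have "AE x in circ. \<forall>j. cmp d j x = cmp d' j x"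
    using ae by (intro AE_finite_allI[of UNIV, simplified]) auto
  then have aq: "AE x in circ. qc K \<tau> d x = qc K \<tau> d' x"
    by eventually_elim (simp add: qc_def)
  have eq: "fc (\<lambda>x. cmp \<tau> i x * qc K \<tau> d x) k = fc (\<lambda>x. cmp \<tau> i x * qc K \<tau> d' x) k" for i k
  proof (rule fc_cong_AE)
    show "AE x in circ. cmp \<tau> i x * qc K \<tau> d x = cmp \<tau> i x * qc K \<tau> d' x"
      using aq by eventually_elim simp
  qed (use qc_integrable(2)[OF gs d(1), of i] qc_integrable(2)[OF gs d(2), of i] in auto)
  have "bvec K \<tau> d = bvec K \<tau> d'"
  proof (subst vec_eq_iff, rule allI)
    fix i
    have "complex_of_real (bvec K \<tau> d $ i) = complex_of_real (bvec K \<tau> d' $ i)"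
      unfolding bvec_nth[OF gs d(1)] bvec_nth[OF gs d(2)] by (rule eq)
    then show "bvec K \<tau> d $ i = bvec K \<tau> d' $ i" by (simp only: of_real_eq_iff)
  qed
  then show l: "lambda_mult K \<tau> d = lambda_mult K \<tau> d'"
    using lambda_mult_eq[OF good_stateD(4)[OF gs]] by metis
  show "cf (nonlinearity K \<tau> d) i k = cf (nonlinearity K \<tau> d') i k"
    unfolding nonlinearity_fc(2)[OF gs d(1)] nonlinearity_fc(2)[OF gs d(2)] l eq ..
qed

definition QB :: "nat \<Rightarrow> (real \<Rightarrow> real) \<Rightarrow> real \<Rightarrow> real \<Rightarrow> real \<Rightarrow> real" where
  "QB m g p \<delta> H = 3 * (2 * pi * FB m g p \<delta> H * sqrt (W 2)) + 2 * pi * H\<^sup>2"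

lemma (in kernel) qc_L1_bound:
  assumes gs: "good_state A \<delta> H \<tau>"
  shows "(\<integral>x. norm (qc K \<tau> (weak_deriv \<tau>) x) \<partial>circ) \<le> QB m g p \<delta> H"
proof -
  note gd = good_stateD[OF gs] and bp = bigF_props[OF good_stateD(1)[OF gs]]
  note fb = bigF_coeff_bound[OF gs]
  let ?F = "F \<tau>" and ?d = "weak_deriv \<tau>"
  note dL = weak_deriv(1)[OF gd(2)]
  have Tm: "cmp \<tau> j \<in> borel_measurable circ" for j using cmp_T_L2[OF gd(2)] by (auto simp: circ_L2_def)
  have Fi: "integrable circ (cmp ?F j)" for j by (intro circ_L2_imp_integrable bp)
  have FTi: "integrable circ (\<lambda>x. cmp ?F j x * cmp \<tau> j x)" for j
    by (intro circ_L2_mult(1) bp cmp_T_L2[OF gd(2)])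
  have FT: "(\<integral>x. norm (cmp ?F j x * cmp \<tau> j x) \<partial>circ) \<le> 2 * pi * FB m g p \<delta> H * sqrt (W 2)" for j
  proof -
    have "(\<integral>x. norm (cmp ?F j x * cmp \<tau> j x) \<partial>circ) \<le> (\<integral>x. norm (cmp ?F j x) \<partial>circ)"
      using bounded_mult_integrable(2)[OF Tm gd(13) Fi, of j] by (simp add: mult.commute)
    also have "\<dots> \<le> sqrt (2 * pi) * n2 (cmp ?F j)" by (intro integral_norm_le_n2 bp)
    also have "\<dots> \<le> sqrt (2 * pi) * (sqrt (2 * pi) * FB m g p \<delta> H * sqrt (W 2))"
      by (intro mult_left_mono n2_le_coeffs bp fb) simp
    also have "\<dots> = 2 * pi * FB m g p \<delta> H * sqrt (W 2)" by (simp add: mult.assoc[symmetric])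
    finally show ?thesis .
  qed
  have dd: "integrable circ (\<lambda>x. (norm (?d x))\<^sup>2)" by (rule L2_circle_square[OF dL])
  have sFT: "integrable circ (\<lambda>x. \<Sum>j\<in>UNIV. norm (cmp ?F j x * cmp \<tau> j x))"
    by (intro integrable_sum integrable_norm FTi)
  have "(\<integral>x. norm (qc K \<tau> ?d x) \<partial>circ) \<le> (\<integral>x. (\<Sum>j\<in>UNIV. norm (cmp ?F j x * cmp \<tau> j x)) + (norm (?d x))\<^sup>2 \<partial>circ)"
  proof (rule integral_mono)
    show "integrable circ (\<lambda>x. norm (qc K \<tau> ?d x))"
      by (intro integrable_norm qc_integrable[OF gs dL])
    show "integrable circ (\<lambda>x. (\<Sum>j\<in>UNIV. norm (cmp ?F j x * cmp \<tau> j x)) + (norm (?d x))\<^sup>2)"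
      by (intro integrable_add sFT dd)
    fix x
    have "(\<Sum>j\<in>UNIV. cmp ?d j x * cmp ?d j x) = complex_of_real ((norm (?d x))\<^sup>2)"
    proof -
      have "(norm (?d x))\<^sup>2 = (\<Sum>j\<in>UNIV. ?d x $ j * ?d x $ j)"
        unfolding norm_vec_square by (simp add: power2_eq_square)
      then show ?thesis by (simp add: cmp_def)
    qed
    then have "norm (\<Sum>j\<in>UNIV. cmp ?d j x * cmp ?d j x) = (norm (?d x))\<^sup>2" by (simp only: norm_of_real) simp
    then show "norm (qc K \<tau> ?d x) \<le> (\<Sum>j\<in>UNIV. norm (cmp ?F j x * cmp \<tau> j x)) + (norm (?d x))\<^sup>2"
      unfolding qc_def by (intro order_trans[OF norm_triangle_ineq4] add_mono norm_sum) simp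
  qed
  also have "\<dots> = (\<Sum>j\<in>UNIV. \<integral>x. norm (cmp ?F j x * cmp \<tau> j x) \<partial>circ) + hE \<tau>"
    unfolding integral_add[OF sFT dd] hE_def
    by (subst integral_sum) (auto intro!: integrable_norm FTi)
  also have "\<dots> \<le> (\<Sum>j\<in>(UNIV::3 set). 2 * pi * FB m g p \<delta> H * sqrt (W 2)) + 2 * pi * H\<^sup>2"
    by (intro add_mono sum_mono FT gd)
  finally show ?thesis by (simp add: QB_def)
qed

lemma (in kernel) Tqc_coeff_bound:
  assumes gs: "good_state A \<delta> H \<tau>"
  shows "norm (fc (\<lambda>x. cmp \<tau> i x * qc K \<tau> (weak_deriv \<tau>) x) k) \<le> QB m g p \<delta> H"
proof -
  note gd = good_stateD[OF gs]
  note dL = weak_deriv(1)[OF gd(2)]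
  have Tm: "cmp \<tau> j \<in> borel_measurable circ" for j using cmp_T_L2[OF gd(2)] by (auto simp: circ_L2_def)
  let ?I = "\<integral>x. norm (cmp \<tau> i x * qc K \<tau> (weak_deriv \<tau>) x) \<partial>circ"
  have I: "?I \<le> QB m g p \<delta> H"
    using bounded_mult_integrable(2)[OF Tm gd(13) qc_integrable(1)[OF gs dL]] qc_L1_bound[OF gs] by (rule order_trans)
  have I0: "?I \<ge> 0" by (rule integral_nonneg) simp
  have "norm (fc (\<lambda>x. cmp \<tau> i x * qc K \<tau> (weak_deriv \<tau>) x) k) \<le> (1 / (2 * pi)) * ?I"
    by (intro norm_fc_le qc_integrable[OF gs dL])
  also have "\<dots> \<le> 1 * ?I" using pi_gt3 I0 by (intro mult_right_mono) auto
  finally show ?thesis using I by simp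
qed

lemma TT_coeff_bound:
  assumes gs: "good_state A \<delta> H \<tau>"
  shows "norm (fc (\<lambda>x. cmp \<tau> i x * cmp \<tau> j x) k) \<le> 1"
proof -
  note gd = good_stateD[OF gs]
  have Tm: "cmp \<tau> j \<in> borel_measurable circ" for j using cmp_T_L2[OF gd(2)] by (auto simp: circ_L2_def)
  have Ti: "integrable circ (cmp \<tau> j)" for j by (intro circ_L2_imp_integrable cmp_T_L2[OF gd(2)])
  have "norm (fc (\<lambda>x. cmp \<tau> i x * cmp \<tau> j x) k) \<le> (1 / (2 * pi)) * (\<integral>x. norm (cmp \<tau> i x * cmp \<tau> j x) \<partial>circ)"
    by (intro norm_fc_le circ_L2_mult cmp_T_L2[OF gd(2)])
  also have "\<dots> \<le> (1 / (2 * pi)) * (\<integral>x. norm (cmp \<tau> j x) \<partial>circ)"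
    by (intro mult_left_mono bounded_mult_integrable(2)[OF Tm gd(13) Ti]) auto
  also have "\<dots> \<le> (1 / (2 * pi)) * (\<integral>x. 1 \<partial>circ)"
    using Ti gd(13) by (intro mult_left_mono integral_mono) auto
  finally show ?thesis by (simp add: measure_circ)
qed

lemma (in kernel) lambda_bound:
  assumes gs: "good_state A \<delta> H \<tau>"
  shows "norm (lambda_mult K \<tau> (weak_deriv \<tau>)) \<le> A * (3 * QB m g p \<delta> H)" "A \<ge> 0"
proof -
  note gd = good_stateD[OF gs]
  note dL = weak_deriv(1)[OF gd(2)]
  let ?b = "bvec K \<tau> (weak_deriv \<tau>)"
  have "norm ?b \<le> (\<Sum>i\<in>UNIV. norm (?b $ i))" by (rule norm_vec_le_sum)
  also have "\<dots> \<le> (\<Sum>i\<in>(UNIV::3 set). QB m g p \<delta> H)"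
  proof (rule sum_mono)
    fix i
    have "norm (?b $ i) = norm (complex_of_real (?b $ i))" by simp
    also have "\<dots> \<le> QB m g p \<delta> H"
      unfolding bvec_nth[OF gs dL] by (rule Tqc_coeff_bound[OF gs])
    finally show "norm (?b $ i) \<le> QB m g p \<delta> H" .
  qed
  finally have b: "norm ?b \<le> 3 * QB m g p \<delta> H" by simp
  have o: "norm (matrix_inv (A_mat \<tau>) *v v) \<le> A * norm v" for v
    by (rule order_trans[OF onorm[OF matrix_vector_mul_bounded_linear] mult_right_mono[OF gd(9) norm_ge_zero]])
  show A: "A \<ge> 0"
    using gd(9) onorm_pos_le[OF matrix_vector_mul_bounded_linear, of "matrix_inv (A_mat \<tau>)"] by linarith
  show "norm (lambda_mult K \<tau> (weak_deriv \<tau>)) \<le> A * (3 * QB m g p \<delta> H)"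
    unfolding lambda_mult_eq[OF gd(4)] using o[of ?b] mult_left_mono[OF b A] by linarith
qed

definition LB :: "nat \<Rightarrow> (real \<Rightarrow> real) \<Rightarrow> real \<Rightarrow> real \<Rightarrow> real \<Rightarrow> real \<Rightarrow> real" where
  "LB m g p A \<delta> H = A * (3 * QB m g p \<delta> H)"

lemma (in kernel) lambda_nth_bound:
  assumes "good_state A \<delta> H \<tau>"
  shows "\<bar>lambda_mult K \<tau> (weak_deriv \<tau>) $ i\<bar> \<le> LB m g p A \<delta> H"
  using component_le_norm_cart[of "lambda_mult K \<tau> (weak_deriv \<tau>)" i] lambda_bound(1)[OF assms]
  by (simp add: LB_def)

definition NB :: "nat \<Rightarrow> (real \<Rightarrow> real) \<Rightarrow> real \<Rightarrow> real \<Rightarrow> real \<Rightarrow> real \<Rightarrow> real" where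
  "NB m g p A \<delta> H = FB m g p \<delta> H + LB m g p A \<delta> H + QB m g p \<delta> H + 3 * LB m g p A \<delta> H"

lemma (in kernel) nonlinearity_coeff_bound:
  assumes gs: "good_state A \<delta> H \<tau>"
  shows "norm (cf (nonlinearity K \<tau> (weak_deriv \<tau>)) i k) \<le> NB m g p A \<delta> H"
proof -
  note gd = good_stateD[OF gs]
  note dL = weak_deriv(1)[OF gd(2)]
  let ?l = "\<lambda>j. complex_of_real (lambda_mult K \<tau> (weak_deriv \<tau>) $ j)"
  let ?L = "LB m g p A \<delta> H"
  have l: "norm (?l j) \<le> ?L" for j using lambda_nth_bound[OF assms] by simp
  then have L0: "?L \<ge> 0" using norm_ge_zero order_trans by blast
  have F: "norm (cf (F \<tau>) i k) \<le> FB m g p \<delta> H"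
    using bigF_coeff_bound(1)[OF assms, of i k] mult_left_mono[OF wt_powr_le_1[of 1 k], of "FB m g p \<delta> H"] bigF_coeff_bound(2)[OF assms] by linarith
  have S: "norm (\<Sum>j\<in>UNIV. ?l j * fc (\<lambda>x. cmp \<tau> j x * cmp \<tau> i x) k) \<le> 3 * ?L"
  proof -
    have "norm (\<Sum>j\<in>UNIV. ?l j * fc (\<lambda>x. cmp \<tau> j x * cmp \<tau> i x) k) \<le> (\<Sum>j\<in>(UNIV::3 set). ?L * 1)"
      unfolding norm_mult by (intro order_trans[OF norm_sum] sum_mono) (simp only: norm_mult, intro mult_mono l TT_coeff_bound[OF gs] L0 norm_ge_zero)
    then show ?thesis by simp
  qed
  have "norm (cf (nonlinearity K \<tau> (weak_deriv \<tau>)) i k) \<le>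
     norm (cf (F \<tau>) i k) + norm (if k = 0 then ?l i else 0) + norm (fc (\<lambda>x. cmp \<tau> i x * qc K \<tau> (weak_deriv \<tau>) x) k)
     + norm (\<Sum>j\<in>UNIV. ?l j * fc (\<lambda>x. cmp \<tau> j x * cmp \<tau> i x) k)"
    unfolding nonlinearity_fc(2)[OF gs dL]
    by (intro order_trans[OF norm_triangle_ineq4] add_right_mono order_trans[OF norm_triangle_ineq4] norm_triangle_ineq)
  also have "\<dots> \<le> FB m g p \<delta> H + ?L + QB m g p \<delta> H + 3 * ?L"
    using l[of i] L0 by (intro add_mono F S Tqc_coeff_bound[OF gs]) auto
  finally show ?thesis by (simp add: NB_def)
qed

section \<open>Continuity in the energy space\<close>

text \<open>Along a sequence of states that converges in \<open>H\<^sup>1\<close> every Fourier coefficient of the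
  nonlinearity converges.\<close>

lemma integral_mult_diff_tendsto:
  fixes u v :: "real \<Rightarrow> complex" and U V :: "nat \<Rightarrow> real \<Rightarrow> complex"
  assumes u: "circ_L2 u" "\<And>n. circ_L2 (U n)" "(\<lambda>n. n2 (\<lambda>x. U n x - u x)) \<longlonglongrightarrow> 0" (is "?a \<longlonglongrightarrow> 0")
    and v: "circ_L2 v" "\<And>n. circ_L2 (V n)" "(\<lambda>n. n2 (\<lambda>x. V n x - v x)) \<longlonglongrightarrow> 0" (is "?b \<longlonglongrightarrow> 0")
  shows "(\<lambda>n. \<integral>x. norm (U n x * V n x - u x * v x) \<partial>circ) \<longlonglongrightarrow> 0"
proof (rule tendsto_sandwich[of "\<lambda>_. 0" _ _ "\<lambda>n. ?a n * n2 v + n2 u * ?b n + ?a n * ?b n"])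
  show "\<forall>\<^sub>F n in sequentially. 0 \<le> (\<integral>x. norm (U n x * V n x - u x * v x) \<partial>circ)"
    by (simp add: integral_nonneg)
  have "(\<integral>x. norm (U n x * V n x - u x * v x) \<partial>circ)
      \<le> ?a n * n2 v + n2 u * ?b n + ?a n * ?b n" for n
  proof -
    note du = circ_L2_diff[OF u(2,1)] and dv = circ_L2_diff[OF v(2,1)]
    have i1: "integrable circ (\<lambda>x. norm ((U n x - u x) * v x))" by (intro integrable_norm circ_L2_mult(1) du v)
    have i2: "integrable circ (\<lambda>x. norm (u x * (V n x - v x)))" by (intro integrable_norm circ_L2_mult(1) dv u)
    have i3: "integrable circ (\<lambda>x. norm ((U n x - u x) * (V n x - v x)))" by (intro integrable_norm circ_L2_mult(1) du dv)
    have "(\<integral>x. norm (U n x * V n x - u x * v x) \<partial>circ)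
        \<le> (\<integral>x. norm ((U n x - u x) * v x) + norm (u x * (V n x - v x)) + norm ((U n x - u x) * (V n x - v x)) \<partial>circ)"
    proof (rule integral_mono)
      show "integrable circ (\<lambda>x. norm (U n x * V n x - u x * v x))"
        by (intro integrable_norm integrable_diff circ_L2_mult(1) u v)
      show "integrable circ (\<lambda>x. norm ((U n x - u x) * v x) + norm (u x * (V n x - v x)) + norm ((U n x - u x) * (V n x - v x)))"
        by (intro integrable_add i1 i2 i3)
      fix x
      have "U n x * V n x - u x * v x = (U n x - u x) * v x + u x * (V n x - v x) + (U n x - u x) * (V n x - v x)"
        by (simp add: algebra_simps)
      then show "norm (U n x * V n x - u x * v x) \<le> norm ((U n x - u x) * v x) + norm (u x * (V n x - v x)) + norm ((U n x - u x) * (V n x - v x))"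
        by (simp only:) (intro order_trans[OF norm_triangle_ineq] add_right_mono norm_triangle_ineq)
    qed
    also have "\<dots> = (\<integral>x. norm ((U n x - u x) * v x) \<partial>circ) + (\<integral>x. norm (u x * (V n x - v x)) \<partial>circ) + (\<integral>x. norm ((U n x - u x) * (V n x - v x)) \<partial>circ)"
      by (simp only: integral_add[OF integrable_add[OF i1 i2] i3] integral_add[OF i1 i2])
    also have "\<dots> \<le> ?a n * n2 v + n2 u * ?b n + ?a n * ?b n"
      by (intro add_mono circ_L2_mult(2) du dv u v)
    finally show ?thesis .
  qed
  then show "\<forall>\<^sub>F n in sequentially. (\<integral>x. norm (U n x * V n x - u x * v x) \<partial>circ)
      \<le> ?a n * n2 v + n2 u * ?b n + ?a n * ?b n" by simp
  have "(\<lambda>n. ?a n * n2 v + n2 u * ?b n + ?a n * ?b n)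
      \<longlonglongrightarrow> 0 * n2 v + n2 u * 0 + 0 * 0"
    by (intro tendsto_intros u v)
  then show "(\<lambda>n. ?a n * n2 v + n2 u * ?b n + ?a n * ?b n) \<longlonglongrightarrow> 0"
    by simp
qed simp

lemma norm_mult_diff_le: "norm (a * b - c * d) \<le> norm a * norm (b - d) + norm (a - c) * norm d"
  for a b c d :: complex
proof -
  have "a * b - c * d = a * (b - d) + (a - c) * d" by (simp add: algebra_simps)
  then show ?thesis using norm_triangle_ineq[of "a * (b - d)" "(a - c) * d"] by (simp add: norm_mult)
qed

lemma fc_tendsto_L1:
  assumes "integrable circ u" "\<And>n. integrable circ (U n)" "(\<lambda>n. \<integral>x. norm (U n x - u x) \<partial>circ) \<longlonglongrightarrow> 0"
  shows "(\<lambda>n. fc (U n) k) \<longlonglongrightarrow> fc u k"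
proof (rule LIM_zero_cancel[OF Lim_null_comparison])
  show "(\<lambda>n. (1 / (2 * pi)) * (\<integral>x. norm (U n x - u x) \<partial>circ)) \<longlonglongrightarrow> 0"
    by (intro tendsto_mult_right_zero assms)
  show "\<forall>\<^sub>F n in sequentially. norm (fc (U n) k - fc u k) \<le> (1 / (2 * pi)) * (\<integral>x. norm (U n x - u x) \<partial>circ)"
    using norm_fc_le[OF integrable_diff[OF assms(2,1)]] by (simp add: fc_diff[OF assms(2,1)])
qed

text \<open>Parseval turns convergence of each coefficient, under a square summable bound, into convergence in
  \<open>L\<^sup>2\<close>.\<close>

lemma n2_tendsto_Parseval:
  assumes u: "circ_L2 u" "\<And>n. circ_L2 (U n)" and c: "\<And>k. (\<lambda>n. fc (U n) k) \<longlonglongrightarrow> fc u k"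
    and b: "\<And>n k. norm (fc (U n) k - fc u k) \<le> C * wt k powr (- 1)"
  shows "(\<lambda>n. n2 (\<lambda>x. U n x - u x)) \<longlonglongrightarrow> 0"
proof -
  have p: "(n2 (\<lambda>x. U n x - u x))\<^sup>2 = 2 * pi * (\<Sum>\<^sub>\<infinity>k. (norm (fc (U n) k - fc u k))\<^sup>2)" for n
    using Parseval[OF circ_L2_diff[OF u(2,1)], of n] by (simp add: fc_diff circ_L2_imp_integrable u)
  have le: "(norm (fc (U n) k - fc u k))\<^sup>2 \<le> C\<^sup>2 * wt k powr (- 2)" for n k
  proof -
    have "(norm (fc (U n) k - fc u k))\<^sup>2 \<le> (C * wt k powr (- 1))\<^sup>2" using b[of n k] by (intro power_mono) auto
    also have "\<dots> = C\<^sup>2 * wt k powr (- 1 + - 1)"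
      unfolding power_mult_distrib power2_eq_square[of "wt k powr (- 1)"] powr_add ..
    finally show ?thesis by simp
  qed
  have "(\<lambda>n. \<Sum>\<^sub>\<infinity>k. (norm (fc (U n) k - fc u k))\<^sup>2) \<longlonglongrightarrow> (\<Sum>\<^sub>\<infinity>k::int. (norm (fc u k - fc u k))\<^sup>2)"
  proof (rule infsum_tendsto_dominated)
    show "(\<lambda>k. C\<^sup>2 * wt k powr (- 2)) summable_on UNIV" by (intro summable_on_cmult_right summable_wt) simp
    show "\<forall>\<^sub>F n in sequentially. \<forall>k. norm ((norm (fc (U n) k - fc u k))\<^sup>2) \<le> C\<^sup>2 * wt k powr (- 2)"
      using le by simp
    show "(\<lambda>n. (norm (fc (U n) k - fc u k))\<^sup>2) \<longlonglongrightarrow> (norm (fc u k - fc u k))\<^sup>2" for k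
      by (intro tendsto_intros c)
  qed
  then have "(\<lambda>n. sqrt (2 * pi * (\<Sum>\<^sub>\<infinity>k. (norm (fc (U n) k - fc u k))\<^sup>2))) \<longlonglongrightarrow> sqrt (2 * pi * 0)"
    by (intro tendsto_intros) simp
  then have "(\<lambda>n. sqrt ((n2 (\<lambda>x. U n x - u x))\<^sup>2)) \<longlonglongrightarrow> 0" by (simp only: p) simp
  then show ?thesis by simp
qed

lemma H_space_diff:
  assumes "f \<in> H_space s" "h \<in> H_space s"
  shows "(\<lambda>x. f x - h x) \<in> H_space s" "cf (\<lambda>x. f x - h x) j k = cf f j k - cf h j k"
proof -
  note F = H_spaceD[OF assms(1)] and G = H_spaceD[OF assms(2)]
  have e: "cmp (\<lambda>x. f x - h x) j = (\<lambda>x. cmp f j x - cmp h j x)" for j by (auto simp: cmp_def)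
  show fcd: "cf (\<lambda>x. f x - h x) j k = cf f j k - cf h j k" for j k
    unfolding e by (intro fc_diff circ_L2_imp_integrable F G)
  have L: "L2_circle (\<lambda>x. f x - h x)"
    using F G by (auto simp: L2_circle_iff e per2pi_def intro: circ_L2_diff)
  let ?w = "\<lambda>k::int. real_of_int \<bar>k\<bar> powr (2 * s)"
  have le: "?w k * (norm (fourier (\<lambda>x. f x - h x) k))\<^sup>2 \<le> 2 * (?w k * (norm (fourier f k))\<^sup>2) + 2 * (?w k * (norm (fourier h k))\<^sup>2)" for k
  proof -
    have "fourier (\<lambda>x. f x - h x) k = fourier f k - fourier h k" by (simp add: vec_eq_iff fourier_nth fcd)
    then have "(norm (fourier (\<lambda>x. f x - h x) k))\<^sup>2 \<le> (norm (fourier f k) + norm (fourier h k))\<^sup>2"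
      by (simp add: norm_triangle_ineq4 power_mono)
    also have "\<dots> \<le> 2 * (norm (fourier f k))\<^sup>2 + 2 * (norm (fourier h k))\<^sup>2"
      using sum_squares_bound[of "norm (fourier f k)" "norm (fourier h k)"] by (simp add: power2_sum)
    finally have "?w k * (norm (fourier (\<lambda>x. f x - h x) k))\<^sup>2 \<le> ?w k * (2 * (norm (fourier f k))\<^sup>2 + 2 * (norm (fourier h k))\<^sup>2)"
      by (intro mult_left_mono) auto
    then show ?thesis by (simp add: algebra_simps)
  qed
  have d: "(\<lambda>k. 2 * (?w k * (norm (fourier f k))\<^sup>2) + 2 * (?w k * (norm (fourier h k))\<^sup>2)) summable_on UNIV"
    using assms by (intro summable_on_add summable_on_cmult_right) (auto simp: H_space_def)
  have "(\<lambda>k. ?w k * (norm (fourier (\<lambda>x. f x - h x) k))\<^sup>2) summable_on UNIV"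
    by (rule summable_on_comparison_test[OF d]) (use le in auto)
  then show "(\<lambda>x. f x - h x) \<in> H_space s"
    using F G L by (auto simp: H_space_def intro: continuous_on_diff)
qed

lemma matrix_inv_mult:
  fixes M :: "real^3^3"
  assumes "invertible M"
  shows "matrix_inv M ** M = mat 1" "M ** matrix_inv M = mat 1"
proof -
  have "\<exists>B. M ** B = mat 1 \<and> B ** M = mat 1" using assms by (simp add: invertible_def)
  from someI_ex[OF this] show "matrix_inv M ** M = mat 1" "M ** matrix_inv M = mat 1"
    unfolding matrix_inv_def by auto
qed

text \<open>Continuity in time is proved along sequences \<open>\<tau>(t\<^sub>n)\<close>.\<close>

locale state_sequence = kernel +
  fixes A \<delta> H :: real and \<tau>n :: "nat \<Rightarrow> real \<Rightarrow> real^3" and \<tau> :: "real \<Rightarrow> real^3"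
  assumes gsn: "\<And>n. good_state A \<delta> H (\<tau>n n)" and gs: "good_state A \<delta> H \<tau>"
    and conv: "(\<lambda>n. H_norm 1 (\<lambda>x. \<tau>n n x - \<tau> x)) \<longlonglongrightarrow> 0"
begin

definition "e n = H_norm 1 (\<lambda>x. \<tau>n n x - \<tau> x)"

lemma e_tendsto: "e \<longlonglongrightarrow> 0"
  using conv unfolding e_def[abs_def] .

lemma e_nonneg: "e n \<ge> 0"
  by (simp add: e_def H_norm_def)

lemmas gd = good_stateD[OF gs] and gdn = good_stateD[OF gsn]

lemma diff_H: "(\<lambda>x. \<tau>n n x - \<tau> x) \<in> H_space 1"
  by (intro H_space_diff gdn gd)

lemma diff_fc: "fourier (\<lambda>x. \<tau>n n x - \<tau> x) k $ j = cf (\<tau>n n) j k - cf \<tau> j k"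
  unfolding fourier_nth by (rule H_space_diff(2)[OF gdn(2) gd(2)])

lemma coeff_diff:
  "real_of_int \<bar>k\<bar> * norm (cf (\<tau>n n) j k - cf \<tau> j k) \<le> e n"
proof -
  have "real_of_int \<bar>k\<bar> * norm (cf (\<tau>n n) j k - cf \<tau> j k) \<le> real_of_int \<bar>k\<bar> * norm (fourier (\<lambda>x. \<tau>n n x - \<tau> x) k)"
    unfolding diff_fc[symmetric] by (intro mult_left_mono Finite_Cartesian_Product.norm_nth_le) simp
  also have "\<dots> \<le> e n" by (rule coeff_le_H[OF diff_H]) (simp add: e_def)
  finally show ?thesis .
qed

lemma coeff_diff_wt: "norm (cf (\<tau>n n) j k - cf \<tau> j k) \<le> 2 * e n * wt k powr (- 1)"
proof (cases "k = 0")
  case True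
  then show ?thesis using gd(11) gdn(11) e_nonneg by simp
next
  case False
  have "norm (cf (\<tau>n n) j k - cf \<tau> j k) \<le> e n / real_of_int \<bar>k\<bar>"
    using coeff_diff[of k n j] False by (simp add: field_simps)
  also have "\<dots> \<le> 2 * e n * wt k powr (- 1)" by (rule divide_abs_le_wt[OF False e_nonneg])
  finally show ?thesis .
qed

lemma T_coeff_tendsto: "(\<lambda>n. cf (\<tau>n n) j k) \<longlonglongrightarrow> cf \<tau> j k"
proof (rule LIM_zero_cancel[OF Lim_null_comparison])
  show "(\<lambda>n. 2 * e n * wt k powr (- 1)) \<longlonglongrightarrow> 0"
    by (intro tendsto_mult_left_zero tendsto_mult_right_zero e_tendsto)
qed (simp only: coeff_diff_wt eventually_True)

text \<open>The embedding of \<open>H\<^sup>1\<close> into the continuous functions: the coefficients of the difference are summed by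
  Cauchy--Schwarz.\<close>

lemma T_uniform: "norm (cmp (\<tau>n n) j x - cmp \<tau> j x) \<le> e n * (sqrt (W 2) * 2)"
proof -
  let ?u = "\<lambda>x. cmp (\<tau>n n) j x - cmp \<tau> j x" and ?f = "\<lambda>x. \<tau>n n x - \<tau> x"
  have eq: "?u = cmp ?f j" by (auto simp: cmp_def)
  note F = H_spaceD[OF diff_H[of n]]
  let ?a = "\<lambda>k. real_of_int \<bar>k\<bar> * norm (fourier ?f k)" and ?b = "\<lambda>k::int. 1 / real_of_int \<bar>k\<bar>"
  have sa: "(\<lambda>k. (?a k)\<^sup>2) summable_on UNIV" by (rule H1_summable[OF diff_H])
  have le: "norm (cf ?f j k) \<le> \<bar>?a k * ?b k\<bar>" for k
  proof (cases "k = 0")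
    case True
    then show ?thesis using gd(11) gdn(11) unfolding fourier_nth[symmetric] diff_fc by simp
  next
    case False
    then show ?thesis using Finite_Cartesian_Product.norm_nth_le[of "fourier ?f k" j] by (simp add: fourier_nth)
  qed
  note CS = infsum_Cauchy_Schwarz[OF sa summable_inverse_square_int]
  have s: "(\<lambda>k. norm (cf ?f j k)) summable_on UNIV"
    by (rule summable_on_comparison_test[OF CS(1)]) (use le in auto)
  have "norm (?u x) = norm (fser (cf ?f j) x)"
    using eq_fser[OF F(5) F(6) s, of x] fun_cong[OF eq, of x] by simp
  also have "\<dots> \<le> (\<Sum>\<^sub>\<infinity>k. norm (cf ?f j k))" by (rule norm_fser_le[OF s])
  also have "\<dots> \<le> (\<Sum>\<^sub>\<infinity>k. \<bar>?a k * ?b k\<bar>)" by (intro infsum_mono s CS(1) le)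
  also have "\<dots> \<le> sqrt (\<Sum>\<^sub>\<infinity>k. (?a k)\<^sup>2) * sqrt (\<Sum>\<^sub>\<infinity>k. (?b k)\<^sup>2)" by (rule CS(2))
  also have "\<dots> \<le> e n * (sqrt (W 2) * 2)"
  proof (intro mult_mono)
    have "sqrt (\<Sum>\<^sub>\<infinity>k. (?a k)\<^sup>2) \<le> sqrt ((e n)\<^sup>2)" by (intro real_sqrt_le_mono sum_le_H[OF diff_H]) (simp add: e_def)
    then show "sqrt (\<Sum>\<^sub>\<infinity>k. (?a k)\<^sup>2) \<le> e n" using e_nonneg[of n] by simp
    have "(\<Sum>\<^sub>\<infinity>k. (?b k)\<^sup>2) \<le> (\<Sum>\<^sub>\<infinity>k. 4 * wt k powr (- 2))"
    proof (intro infsum_mono summable_inverse_square_int summable_on_cmult_right summable_wt)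
      show "(?b k)\<^sup>2 \<le> 4 * wt k powr (- 2)" for k
        using divide_square_le_wt[of k 1] by (cases "k = 0") (auto simp: power_divide)
    qed simp
    also have "\<dots> = W 2 * 4" by (simp add: infsum_cmult_right' W_def)
    finally show "sqrt (\<Sum>\<^sub>\<infinity>k. (?b k)\<^sup>2) \<le> sqrt (W 2) * 2"
      using real_sqrt_le_mono[of _ "W 2 * 4"] by (simp add: real_sqrt_mult)
  qed (auto intro: e_nonneg infsum_nonneg)
  finally show ?thesis .
qed

lemma T_L2: "circ_L2 (cmp (\<tau>n n) j)" "circ_L2 (cmp \<tau> j)"
  using cmp_T_L2 gdn(2) gd(2) by blast+

lemma T_n2: "(\<lambda>n. n2 (\<lambda>x. cmp (\<tau>n n) j x - cmp \<tau> j x)) \<longlonglongrightarrow> 0"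
proof -
  obtain B where "\<And>n. norm (e n) \<le> B"
    using e_tendsto convergent_imp_Bseq[OF convergentI, of e 0] unfolding Bseq_def by blast
  then have B: "e n \<le> B" for n using abs_le_D1 by (metis real_norm_def)
  show ?thesis
  proof (rule n2_tendsto_Parseval[OF T_L2(2,1) T_coeff_tendsto])
    fix n k
    have "norm (cf (\<tau>n n) j k - cf \<tau> j k) \<le> 2 * e n * wt k powr (- 1)" by (rule coeff_diff_wt)
    also have "\<dots> \<le> (2 * B) * wt k powr (- 1)" using B[of n] by (intro mult_right_mono) auto
    finally show "norm (cf (\<tau>n n) j k - cf \<tau> j k) \<le> (2 * B) * wt k powr (- 1)" .
  qed
qed

lemma D_L2: "circ_L2 (cmp (weak_deriv (\<tau>n n)) j)" "circ_L2 (cmp (weak_deriv \<tau>) j)"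
  using weak_deriv(1)[OF gdn(2)] weak_deriv(1)[OF gd(2)] by (auto simp: L2_circle_iff)

lemma D_n2: "(\<lambda>n. n2 (\<lambda>x. cmp (weak_deriv (\<tau>n n)) j x - cmp (weak_deriv \<tau>) j x)) \<longlonglongrightarrow> 0"
proof (rule tendsto_sandwich[OF _ _ tendsto_const])
  show "(\<lambda>n. sqrt (2 * pi) * e n) \<longlonglongrightarrow> 0" by (intro tendsto_mult_right_zero e_tendsto)
  have "n2 (\<lambda>x. cmp (weak_deriv (\<tau>n n)) j x - cmp (weak_deriv \<tau>) j x) \<le> sqrt (2 * pi) * e n" for n
  proof -
    let ?u = "\<lambda>x. cmp (weak_deriv (\<tau>n n)) j x - cmp (weak_deriv \<tau>) j x" and ?f = "\<lambda>x. \<tau>n n x - \<tau> x"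
    have u: "circ_L2 ?u" by (intro circ_L2_diff D_L2)
    have le: "(norm (fc ?u k))\<^sup>2 \<le> (real_of_int \<bar>k\<bar> * norm (fourier ?f k))\<^sup>2" for k
    proof -
      have "fc ?u k = \<i> * of_int k * (fourier ?f k $ j)"
        unfolding diff_fc by (simp add: fc_diff circ_L2_imp_integrable D_L2 weak_deriv(2)[OF gdn(2)] weak_deriv(2)[OF gd(2)] algebra_simps)
      then have "norm (fc ?u k) \<le> real_of_int \<bar>k\<bar> * norm (fourier ?f k)"
        using Finite_Cartesian_Product.norm_nth_le[of "fourier ?f k" j] by (simp add: norm_mult mult_left_mono)
      then show ?thesis by (intro power_mono) auto
    qed
    have "(n2 ?u)\<^sup>2 = 2 * pi * (\<Sum>\<^sub>\<infinity>k. (norm (fc ?u k))\<^sup>2)" using Parseval[OF u] by simp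
    also have "\<dots> \<le> 2 * pi * (\<Sum>\<^sub>\<infinity>k. (real_of_int \<bar>k\<bar> * norm (fourier ?f k))\<^sup>2)"
      by (intro mult_left_mono infsum_mono Bessel(1) u H1_summable diff_H le) simp
    also have "\<dots> \<le> 2 * pi * (e n)\<^sup>2"
      by (intro mult_left_mono sum_le_H[OF diff_H]) (auto simp: e_def)
    also have "\<dots> = (sqrt (2 * pi) * e n)\<^sup>2" by (simp add: power_mult_distrib)
    finally show ?thesis by (rule power2_le_imp_le) (use e_nonneg[of n] in simp)
  qed
  then show "\<forall>\<^sub>F n in sequentially. n2 (\<lambda>x. cmp (weak_deriv (\<tau>n n)) j x - cmp (weak_deriv \<tau>) j x) \<le> sqrt (2 * pi) * e n" by simp
qed simp

lemma curve_tendsto: "(\<lambda>n. curve (\<tau>n n) x) \<longlonglongrightarrow> curve \<tau> x"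
proof -
  have "(\<lambda>n. cmp (curve (\<tau>n n)) j x) \<longlonglongrightarrow> cmp (curve \<tau>) j x" for j
  proof -
    note a = admissibleD[OF gd(1)] and an = admissibleD[OF gdn(1)]
    have e1: "cmp (curve (\<tau>n n)) j x = (\<Sum>\<^sub>\<infinity>k. cf (\<tau>n n) j k / (\<i> * of_int k) * cis (of_int k * x))" for n
      unfolding primitive_series[OF an(2,3)] fser_def ..
    have e2: "cmp (curve \<tau>) j x = (\<Sum>\<^sub>\<infinity>k. cf \<tau> j k / (\<i> * of_int k) * cis (of_int k * x))"
      unfolding primitive_series[OF a(2,3)] fser_def ..
    show ?thesis unfolding e1 e2
    proof (rule infsum_tendsto_dominated)
      show "(\<lambda>k. 4 * H * wt k powr (- 2)) summable_on UNIV" by (intro summable_on_cmult_right summable_wt) simp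
      show "(\<lambda>n. cf (\<tau>n n) j k / (\<i> * of_int k) * cis (of_int k * x)) \<longlonglongrightarrow> cf \<tau> j k / (\<i> * of_int k) * cis (of_int k * x)" for k
      proof (cases "k = 0")
        case False
        then show ?thesis by (intro tendsto_intros T_coeff_tendsto) auto
      qed simp
      have "norm (cf (\<tau>n n) j k / (\<i> * of_int k) * cis (of_int k * x)) \<le> 4 * H * wt k powr (- 2)" for n k
      proof (cases "k = 0")
        case True
        then show ?thesis using gd(6) by simp
      next
        case False
        have "norm (cf (\<tau>n n) j k / (\<i> * of_int k) * cis (of_int k * x)) = norm (cf (\<tau>n n) j k) / real_of_int \<bar>k\<bar>"
          by (simp add: norm_mult norm_divide)
        also have "\<dots> \<le> (H / real_of_int \<bar>k\<bar>) / real_of_int \<bar>k\<bar>"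
          using gdn(10)[of n j k] False by (intro divide_right_mono) (auto simp: field_simps)
        also have "\<dots> = H / (real_of_int k)\<^sup>2" by (simp add: power2_eq_square abs_mult[symmetric])
        also have "\<dots> \<le> 4 * H * wt k powr (- 2)" by (rule divide_square_le_wt[OF False gd(6)])
        finally show ?thesis .
      qed
      then show "\<forall>\<^sub>F n in sequentially. \<forall>k. norm (cf (\<tau>n n) j k / (\<i> * of_int k) * cis (of_int k * x)) \<le> 4 * H * wt k powr (- 2)" by simp
    qed
  qed
  then have "(\<lambda>n. Re (cmp (curve (\<tau>n n)) j x)) \<longlonglongrightarrow> Re (cmp (curve \<tau>) j x)" for j
    by (intro tendsto_intros)
  then show ?thesis by (intro vec_tendstoI) (simp add: cmp_def)
qed

text \<open>The size bound for \<open>nlk\<close> is uniform over states and serves as majorant.\<close>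

lemma NL_tendsto: "(\<lambda>n. nl (\<tau>n n) x) \<longlonglongrightarrow> nl \<tau> x"
proof -
  let ?g = "g_of h" and ?E = "2 * pi * H\<^sup>2"
  have E: "?E \<ge> 0" by simp
  have gc: "continuous_on {1..} ?g" using gk by (simp add: good_kernel_def)
  have gm: "isCont (\<lambda>t. ?g (max 1 t)) s" for s
  proof -
    have "continuous_on UNIV (\<lambda>t. ?g (max 1 t))"
      by (intro continuous_on_compose2[OF gc] continuous_intros) auto
    then show ?thesis by (simp add: continuous_on_eq_continuous_at)
  qed
  note i = integrable_nlk[OF gk gd(1) gd(12) E, of 0 x]
  show ?thesis
    unfolding NL_def
  proof (rule integral_dominated_convergence[where w="\<lambda>z. nlC m ?g \<delta> ?E * \<bar>z\<bar> powr (real m - 2 * p)"])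
    show "(\<lambda>z. tr 0 z (nlk ?g p (curve \<tau>) x z)) \<in> borel_measurable circ"
      by (rule borel_measurable_integrable[OF i])
    show "(\<lambda>z. tr 0 z (nlk ?g p (curve (\<tau>n n)) x z)) \<in> borel_measurable circ" for n
      by (rule borel_measurable_integrable[OF integrable_nlk[OF gk gdn(1) gdn(12) E]])
    show "integrable circ (\<lambda>z. nlC m ?g \<delta> ?E * \<bar>z\<bar> powr (real m - 2 * p))"
      by (rule integrable_mult_right[OF integrable_abs_powr[OF good_exponents(1)[OF gk]]])
    show "AE z in circ. norm (tr 0 z (nlk ?g p (curve (\<tau>n n)) x z)) \<le> nlC m ?g \<delta> ?E * \<bar>z\<bar> powr (real m - 2 * p)" for n
    proof (rule AE_I2)
      fix z assume "z \<in> space circ"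
      then have "\<bar>z\<bar> \<le> pi" by auto
      from nlk_bound[OF gk gdn(1) gdn(12) E this]
      show "norm (tr 0 z (nlk ?g p (curve (\<tau>n n)) x z)) \<le> nlC m ?g \<delta> ?E * \<bar>z\<bar> powr (real m - 2 * p)" by simp
    qed
    show "AE z in circ. (\<lambda>n. tr 0 z (nlk ?g p (curve (\<tau>n n)) x z)) \<longlonglongrightarrow> (tr 0 z (nlk ?g p (curve \<tau>) x z))"
    proof (rule AE_I2)
      fix z assume "z \<in> space circ"
      then have z: "\<bar>z\<bar> \<le> pi" by auto
      have "(\<lambda>n. nlk ?g p (curve (\<tau>n n)) x z) \<longlonglongrightarrow> nlk ?g p (curve \<tau>) x z"
      proof (cases "z = 0")
        case False
        have pos: "norm (curve \<tau> x - curve \<tau> (x - z)) \<noteq> 0" using chord_bounds(1)[OF gd(1) False z, of x] by simp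
        have r: "(\<lambda>n. z\<^sup>2 / (norm (curve (\<tau>n n) x - curve (\<tau>n n) (x - z)))\<^sup>2) \<longlonglongrightarrow> z\<^sup>2 / (norm (curve \<tau> x - curve \<tau> (x - z)))\<^sup>2"
          using pos by (intro tendsto_intros curve_tendsto) auto
        show ?thesis
          unfolding nlk_def ratio_def by (intro tendsto_intros isCont_tendsto_compose[OF gm] r curve_tendsto)
      qed simp
      then show "(\<lambda>n. tr 0 z (nlk ?g p (curve (\<tau>n n)) x z)) \<longlonglongrightarrow> (tr 0 z (nlk ?g p (curve \<tau>) x z))" by simp
    qed
  qed
qed

lemma NL_coeff_tendsto:
  "(\<lambda>n. cf (nl (\<tau>n n)) j k) \<longlonglongrightarrow> cf (nl \<tau>) j k"
  unfolding fc_def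
proof (intro tendsto_scaleR tendsto_const integral_dominated_convergence[where w="\<lambda>_. NLB m g p \<delta> H"])
  note b = NL_state_bound[OF gk gs] and bn = NL_state_bound[OF gk gsn]
  show "(\<lambda>x. cmp (nl \<tau>) j x * cis (- (real_of_int k * x))) \<in> borel_measurable circ"
    using circ_L2_measurable[OF b(3)] by (intro borel_measurable_times measurable_cis')
  show "(\<lambda>x. cmp (nl (\<tau>n n)) j x * cis (- (real_of_int k * x))) \<in> borel_measurable circ" for n
    using circ_L2_measurable[OF bn(3)] by (intro borel_measurable_times measurable_cis')
  show "AE x in circ. norm (cmp (nl (\<tau>n n)) j x * cis (- (real_of_int k * x))) \<le> NLB m g p \<delta> H" for n
    using bn(5) by (simp add: norm_mult)
  show "AE x in circ. (\<lambda>n. cmp (nl (\<tau>n n)) j x * cis (- (real_of_int k * x)))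
      \<longlonglongrightarrow> cmp (nl \<tau>) j x * cis (- (real_of_int k * x))"
    unfolding cmp_def by (intro AE_I2 tendsto_intros NL_tendsto)
qed simp

lemma F_coeff_tendsto: "(\<lambda>n. cf (F (\<tau>n n)) j k) \<longlonglongrightarrow> cf (F \<tau>) j k"
proof (cases "k = 0")
  case True
  then show ?thesis using bigF_props(6)[OF gd(1)] bigF_props(6)[OF gdn(1)] by simp
next
  case False
  then show ?thesis
    unfolding bigF_props(4)[OF gd(1)] bigF_props(4)[OF gdn(1)]
    by (intro tendsto_intros T_coeff_tendsto NL_coeff_tendsto) auto
qed

lemma F_n2: "(\<lambda>n. n2 (\<lambda>x. cmp (F (\<tau>n n)) j x - cmp (F \<tau>) j x)) \<longlonglongrightarrow> 0"
proof (rule n2_tendsto_Parseval[OF bigF_props(3)[OF gd(1)] bigF_props(3)[OF gdn(1)] F_coeff_tendsto])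
  fix n k
  show "norm (cf (F (\<tau>n n)) j k - cf (F \<tau>) j k) \<le> (2 * FB m g p \<delta> H) * wt k powr (- 1)"
    using norm_triangle_ineq4[of "cf (F (\<tau>n n)) j k" "cf (F \<tau>) j k"]
      bigF_coeff_bound(1)[OF gs, of j k] bigF_coeff_bound(1)[OF gsn, of n j k] by linarith
qed

abbreviation "q n \<equiv> qc K (\<tau>n n) (weak_deriv (\<tau>n n))"
abbreviation "q0 \<equiv> qc K \<tau> (weak_deriv \<tau>)"

lemma q_integrable: "integrable circ (q n)" "integrable circ q0"
  using qc_integrable(1)[OF gsn weak_deriv(1)[OF gdn(2)]] qc_integrable(1)[OF gs weak_deriv(1)[OF gd(2)]] by auto

lemma q_tendsto: "(\<lambda>n. \<integral>x. norm (q n x - q0 x) \<partial>circ) \<longlonglongrightarrow> 0"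
proof -
  let ?F = "\<lambda>n j x. cmp (F (\<tau>n n)) j x * cmp (\<tau>n n) j x - cmp (F \<tau>) j x * cmp \<tau> j x"
  let ?D = "\<lambda>n j x. cmp (weak_deriv (\<tau>n n)) j x * cmp (weak_deriv (\<tau>n n)) j x - cmp (weak_deriv \<tau>) j x * cmp (weak_deriv \<tau>) j x"
  let ?S = "\<lambda>n. (\<Sum>j\<in>UNIV. \<integral>x. norm (?F n j x) \<partial>circ) + (\<Sum>j\<in>UNIV. \<integral>x. norm (?D n j x) \<partial>circ)"
  let ?f = "\<lambda>n x. (\<Sum>j\<in>UNIV. norm (?F n j x)) + (\<Sum>j\<in>UNIV. norm (?D n j x))"
  let ?I = "\<lambda>n. \<integral>x. norm (q n x - q0 x) \<partial>circ"
  note FL = bigF_props(3)[OF gd(1)] and FLn = bigF_props(3)[OF gdn(1)]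
  have F: "(\<lambda>n. \<integral>x. norm (?F n j x) \<partial>circ) \<longlonglongrightarrow> 0" for j
    by (rule integral_mult_diff_tendsto[OF FL FLn F_n2 T_L2(2) T_L2(1) T_n2])
  have D: "(\<lambda>n. \<integral>x. norm (?D n j x) \<partial>circ) \<longlonglongrightarrow> 0" for j
    by (rule integral_mult_diff_tendsto[OF D_L2(2) D_L2(1) D_n2 D_L2(2) D_L2(1) D_n2])
  have iF: "integrable circ (\<lambda>x. norm (?F n j x))" for n j
    by (intro integrable_norm integrable_diff circ_L2_mult(1) FL FLn T_L2)
  have iD: "integrable circ (\<lambda>x. norm (?D n j x))" for n j
    by (intro integrable_norm integrable_diff circ_L2_mult(1) D_L2)
  show ?thesis
  proof (rule tendsto_sandwich[OF _ _ tendsto_const])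
    show "\<forall>\<^sub>F n in sequentially. 0 \<le> ?I n"
      by (simp add: integral_nonneg)
    have "?S \<longlonglongrightarrow> (\<Sum>j\<in>(UNIV::3 set). 0) + (\<Sum>j\<in>(UNIV::3 set). 0)"
      by (intro tendsto_intros F D)
    then show "?S \<longlonglongrightarrow> 0" by simp
    have "?I n \<le> ?S n" for n
    proof -
      have "?I n \<le> (\<integral>x. ?f n x \<partial>circ)"
      proof (rule integral_mono)
        show "integrable circ (\<lambda>x. norm (q n x - q0 x))"
          by (intro integrable_norm integrable_diff q_integrable)
        show "integrable circ (?f n)"
          by (intro integrable_add integrable_sum iF iD)
        fix x
        have "q n x - q0 x = (\<Sum>j\<in>UNIV. ?F n j x) - (\<Sum>j\<in>UNIV. ?D n j x)"
          unfolding qc_def by (simp add: sum_subtractf)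
        then show "norm (q n x - q0 x) \<le> ?f n x"
          by (simp only:) (intro order_trans[OF norm_triangle_ineq4] add_mono norm_sum)
      qed
      also have "\<dots> = ?S n"
        by (simp only: integral_add[OF integrable_sum[OF iF] integrable_sum[OF iD]]
            integral_sum[OF iF] integral_sum[OF iD])
      finally show ?thesis .
    qed
    then show "\<forall>\<^sub>F n in sequentially. ?I n \<le> ?S n" by simp
  qed
qed

lemma Tq_coeff_tendsto:
  "(\<lambda>n. fc (\<lambda>x. cmp (\<tau>n n) i x * q n x) k) \<longlonglongrightarrow> fc (\<lambda>x. cmp \<tau> i x * q0 x) k"
proof (rule fc_tendsto_L1)
  note iTq = qc_integrable(2)[OF gs weak_deriv(1)[OF gd(2)], of i]
  note iTqn = qc_integrable(2)[OF gsn weak_deriv(1)[OF gdn(2)], of _ i]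
  show "integrable circ (\<lambda>x. cmp \<tau> i x * q0 x)" by (rule iTq)
  show "integrable circ (\<lambda>x. cmp (\<tau>n n) i x * q n x)" for n by (rule iTqn)
  let ?I = "\<integral>x. norm (q0 x) \<partial>circ"
  let ?u = "\<lambda>n x. norm (cmp (\<tau>n n) i x * q n x - cmp \<tau> i x * q0 x)"
  let ?v = "\<lambda>n x. norm (q n x - q0 x)" and ?e = "\<lambda>n. e n * (sqrt (W 2) * 2)"
  show "(\<lambda>n. \<integral>x. ?u n x \<partial>circ) \<longlonglongrightarrow> 0"
  proof (rule tendsto_sandwich[OF _ _ tendsto_const])
    show "\<forall>\<^sub>F n in sequentially. 0 \<le> (\<integral>x. ?u n x \<partial>circ)"
      by (simp add: integral_nonneg)
    have "(\<lambda>n. (\<integral>x. ?v n x \<partial>circ) + ?e n * ?I) \<longlonglongrightarrow> 0 + 0 * (sqrt (W 2) * 2) * ?I"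
      by (intro tendsto_intros q_tendsto e_tendsto)
    then show "(\<lambda>n. (\<integral>x. ?v n x \<partial>circ) + ?e n * ?I) \<longlonglongrightarrow> 0" by simp
    have "(\<integral>x. ?u n x \<partial>circ)
        \<le> (\<integral>x. ?v n x + ?e n * norm (q0 x) \<partial>circ)" for n
    proof (rule integral_mono)
      show "integrable circ (?u n)"
        by (intro integrable_norm integrable_diff iTq iTqn)
      show "integrable circ (\<lambda>x. ?v n x + ?e n * norm (q0 x))"
        by (intro integrable_add integrable_norm integrable_mult_right integrable_diff q_integrable)
      fix x
      have "?u n x
          \<le> norm (cmp (\<tau>n n) i x) * ?v n x + norm (cmp (\<tau>n n) i x - cmp \<tau> i x) * norm (q0 x)"
        by (rule norm_mult_diff_le)
      also have "\<dots> \<le> 1 * ?v n x + ?e n * norm (q0 x)"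
        by (intro add_mono mult_right_mono gdn(13) T_uniform norm_ge_zero)
      finally show "?u n x \<le> ?v n x + ?e n * norm (q0 x)" by simp
    qed
    then have "(\<integral>x. ?u n x \<partial>circ)
        \<le> (\<integral>x. ?v n x \<partial>circ) + ?e n * ?I" for n
      by (simp add: integral_add integrable_norm integrable_diff q_integrable)
    then show "\<forall>\<^sub>F n in sequentially. (\<integral>x. ?u n x \<partial>circ)
        \<le> (\<integral>x. ?v n x \<partial>circ) + ?e n * ?I" by simp
  qed
qed

lemma TT_coeff_tendsto:
  "(\<lambda>n. fc (\<lambda>x. cmp (\<tau>n n) i x * cmp (\<tau>n n) j x) k) \<longlonglongrightarrow> fc (\<lambda>x. cmp \<tau> i x * cmp \<tau> j x) k"
  by (rule fc_tendsto_L1[OF circ_L2_mult(1) circ_L2_mult(1) integral_mult_diff_tendsto])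
     (intro T_L2 T_n2)+

lemma A_mat_nth:
  assumes "\<tau>' \<in> H_space 1" "unit_speed \<tau>'"
  shows "complex_of_real (A_mat \<tau>' $ i $ j) = (if i = j then 1 else 0) - fc (\<lambda>x. cmp \<tau>' i x * cmp \<tau>' j x) 0"
  using assms(2) unfolding A_mat_def fc_0 cmp_def set_integral_circ unit_speed_def
  by (simp add: mat_def scaleR_conv_of_real flip: of_real_mult)

lemma A_mat_tendsto: "(\<lambda>n. A_mat (\<tau>n n) $ i $ j) \<longlonglongrightarrow> A_mat \<tau> $ i $ j"
proof -
  have "(\<lambda>n. complex_of_real (A_mat (\<tau>n n) $ i $ j)) \<longlonglongrightarrow> complex_of_real (A_mat \<tau> $ i $ j)"
    unfolding A_mat_nth[OF gd(2,4)] A_mat_nth[OF gdn(2,4)] by (intro tendsto_intros TT_coeff_tendsto)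
  then show ?thesis by (simp only: tendsto_of_real_iff)
qed

lemma b_tendsto: "(\<lambda>n. bvec K (\<tau>n n) (weak_deriv (\<tau>n n))) \<longlonglongrightarrow> bvec K \<tau> (weak_deriv \<tau>)"
proof (rule vec_tendstoI)
  fix i
  have "(\<lambda>n. complex_of_real (bvec K (\<tau>n n) (weak_deriv (\<tau>n n)) $ i)) \<longlonglongrightarrow> complex_of_real (bvec K \<tau> (weak_deriv \<tau>) $ i)"
    unfolding bvec_nth[OF gs weak_deriv(1)[OF gd(2)]] bvec_nth[OF gsn weak_deriv(1)[OF gdn(2)]]
    by (rule Tq_coeff_tendsto)
  then show "(\<lambda>n. bvec K (\<tau>n n) (weak_deriv (\<tau>n n)) $ i) \<longlonglongrightarrow> bvec K \<tau> (weak_deriv \<tau>) $ i"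
    by (simp only: tendsto_of_real_iff)
qed

text \<open>The uniform bound on the inverse matrices turns convergence of the linear systems into
  convergence of their solutions.\<close>

lemma lambda_tendsto: "(\<lambda>n. lambda_mult K (\<tau>n n) (weak_deriv (\<tau>n n))) \<longlonglongrightarrow> lambda_mult K \<tau> (weak_deriv \<tau>)"
proof (rule LIM_zero_cancel[OF Lim_null_comparison])
  let ?l = "lambda_mult K \<tau> (weak_deriv \<tau>)" and ?b = "\<lambda>n. bvec K (\<tau>n n) (weak_deriv (\<tau>n n))"
  have Al: "A_mat \<tau> *v ?l = bvec K \<tau> (weak_deriv \<tau>)"
    using matrix_inv_mult(2)[OF gd(8)] by (simp add: lambda_mult_eq[OF gd(4)] matrix_vector_mul_assoc)
  have "(\<lambda>n. A_mat (\<tau>n n) *v ?l) \<longlonglongrightarrow> A_mat \<tau> *v ?l"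
    by (rule vec_tendstoI) (simp add: matrix_vector_mult_def, intro tendsto_intros A_mat_tendsto)
  then have "(\<lambda>n. ?b n - A_mat (\<tau>n n) *v ?l) \<longlonglongrightarrow> bvec K \<tau> (weak_deriv \<tau>) - A_mat \<tau> *v ?l"
    by (intro tendsto_diff b_tendsto)
  then have "(\<lambda>n. norm (?b n - A_mat (\<tau>n n) *v ?l)) \<longlonglongrightarrow> 0" unfolding Al by (simp add: tendsto_norm_zero)
  then show "(\<lambda>n. A * norm (?b n - A_mat (\<tau>n n) *v ?l)) \<longlonglongrightarrow> 0" by (rule tendsto_mult_right_zero)
  have "norm (lambda_mult K (\<tau>n n) (weak_deriv (\<tau>n n)) - ?l) \<le> A * norm (?b n - A_mat (\<tau>n n) *v ?l)" for n
  proof -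
    have "?l = matrix_inv (A_mat (\<tau>n n)) *v (A_mat (\<tau>n n) *v ?l)"
      using matrix_inv_mult(1)[OF gdn(8)] by (simp add: matrix_vector_mul_assoc)
    then have eq: "lambda_mult K (\<tau>n n) (weak_deriv (\<tau>n n)) - ?l = matrix_inv (A_mat (\<tau>n n)) *v (?b n - A_mat (\<tau>n n) *v ?l)"
      unfolding lambda_mult_eq[OF gdn(4)] matrix_vector_mult_diff_distrib by (rule arg_cong)
    show ?thesis unfolding eq
      by (rule order_trans[OF onorm[OF matrix_vector_mul_bounded_linear] mult_right_mono[OF gdn(9) norm_ge_zero]])
  qed
  then show "\<forall>\<^sub>F n in sequentially. norm (lambda_mult K (\<tau>n n) (weak_deriv (\<tau>n n)) - ?l) \<le> A * norm (?b n - A_mat (\<tau>n n) *v ?l)" by simp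
qed

theorem nonlinearity_coeff_tendsto:
  "(\<lambda>n. cf (nonlinearity K (\<tau>n n) (weak_deriv (\<tau>n n))) i k) \<longlonglongrightarrow> cf (nonlinearity K \<tau> (weak_deriv \<tau>)) i k"
proof -
  have l: "(\<lambda>n. complex_of_real (lambda_mult K (\<tau>n n) (weak_deriv (\<tau>n n)) $ j)) \<longlonglongrightarrow> complex_of_real (lambda_mult K \<tau> (weak_deriv \<tau>) $ j)" for j
    by (intro tendsto_of_real tendsto_vec_nth lambda_tendsto)
  have l0: "(\<lambda>n. if k = 0 then complex_of_real (lambda_mult K (\<tau>n n) (weak_deriv (\<tau>n n)) $ i) else 0)
      \<longlonglongrightarrow> (if k = 0 then complex_of_real (lambda_mult K \<tau> (weak_deriv \<tau>) $ i) else 0)"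
    using l[of i] by simp
  show ?thesis
    unfolding nonlinearity_fc(2)[OF gs weak_deriv(1)[OF gd(2)]] nonlinearity_fc(2)[OF gsn weak_deriv(1)[OF gdn(2)]]
    by (intro tendsto_add tendsto_diff tendsto_sum tendsto_mult F_coeff_tendsto l l0 Tq_coeff_tendsto TT_coeff_tendsto)
qed

end

section \<open>Decay of the coefficients of the nonlinearity\<close>

text \<open>The constant with which multiplication of functions with decays \<open>a\<close> and \<open>b\<close> gives decay \<open>\<sigma>\<close>.\<close>

definition conv_const :: "real \<Rightarrow> real \<Rightarrow> real \<Rightarrow> real \<Rightarrow> bool" where
  "conv_const a b \<sigma> C \<longleftrightarrow> (\<forall>(u :: int \<Rightarrow> complex) v U V k.
     (\<forall>j. norm (u j) \<le> U * wt j powr (-a)) \<longrightarrow> (\<forall>j. norm (v j) \<le> V * wt j powr (-b)) \<longrightarrow>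
     norm (\<Sum>\<^sub>\<infinity>j. u j * v (k - j)) \<le> U * V * C * wt k powr (-\<sigma>))"

lemma conv_constD:
  fixes u v :: "int \<Rightarrow> complex"
  assumes "conv_const a b \<sigma> C" "\<And>j. norm (u j) \<le> U * wt j powr (-a)" "\<And>j. norm (v j) \<le> V * wt j powr (-b)"
  shows "norm (\<Sum>\<^sub>\<infinity>j. u j * v (k - j)) \<le> U * V * C * wt k powr (-\<sigma>)"
  using assms unfolding conv_const_def by blast

lemma conv_const_exists:
  assumes "0 \<le> \<sigma>" "\<sigma> \<le> a" "\<sigma> \<le> b" "a + b - \<sigma> > 1"
  shows "\<exists>C. conv_const a b \<sigma> C"
proof -
  obtain C where C: "C \<ge> 0"
    "\<And>k. (\<lambda>j. wt j powr (-a) * wt (k - j) powr (-b)) summable_on UNIV"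
    "\<And>k. (\<Sum>\<^sub>\<infinity>j. wt j powr (-a) * wt (k - j) powr (-b)) \<le> C * wt k powr (-\<sigma>)"
    using convolution_weights[OF assms] by blast
  have "norm (\<Sum>\<^sub>\<infinity>j. u j * v (k - j)) \<le> U * V * C * wt k powr (-\<sigma>)"
    if u: "\<And>j. norm (u j :: complex) \<le> U * wt j powr (-a)" and v: "\<And>j. norm (v j :: complex) \<le> V * wt j powr (-b)" for u v U V k
  proof -
    have U0: "U \<ge> 0" using order_trans[OF norm_ge_zero u[of 0]] by (simp add: wt_def)
    have V0: "V \<ge> 0" using order_trans[OF norm_ge_zero v[of 0]] by (simp add: wt_def)
    have le: "norm (u j * v (k - j)) \<le> U * V * (wt j powr (-a) * wt (k - j) powr (-b))" for j
    proof -
      have "norm (u j) * norm (v (k - j)) \<le> (U * wt j powr (-a)) * (V * wt (k - j) powr (-b))"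
        using u v U0 by (intro mult_mono) auto
      then show ?thesis by (simp add: norm_mult mult_ac)
    qed
    have d: "(\<lambda>j. U * V * (wt j powr (-a) * wt (k - j) powr (-b))) summable_on UNIV"
      by (intro summable_on_cmult_right C)
    have s: "(\<lambda>j. norm (u j * v (k - j))) summable_on UNIV"
      by (rule summable_on_comparison_test[OF d]) (use le in auto)
    have "norm (\<Sum>\<^sub>\<infinity>j. u j * v (k - j)) \<le> (\<Sum>\<^sub>\<infinity>j. norm (u j * v (k - j)))" by (rule norm_infsum_bound[OF s])
    also have "\<dots> \<le> (\<Sum>\<^sub>\<infinity>j. U * V * (wt j powr (-a) * wt (k - j) powr (-b)))" by (intro infsum_mono s d le)
    also have "\<dots> = U * V * (\<Sum>\<^sub>\<infinity>j. wt j powr (-a) * wt (k - j) powr (-b))" by (rule infsum_cmult_right')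
    also have "\<dots> \<le> U * V * (C * wt k powr (-\<sigma>))" using U0 V0 by (intro mult_left_mono C) auto
    finally show ?thesis by (simp add: mult.assoc)
  qed
  then show ?thesis unfolding conv_const_def by blast
qed

lemma wt_powr_mono: "a \<le> b \<Longrightarrow> wt k powr (- b) \<le> wt k powr (- a)"
  using wt_ge_1[of k] by (intro powr_mono) auto

lemma summable_wt_bound:
  fixes c :: "int \<Rightarrow> complex"
  assumes "\<And>k. norm (c k) \<le> B * wt k powr (- s)" "s > 1"
  shows "(\<lambda>k. norm (c k)) summable_on UNIV"
  by (rule summable_on_comparison_test[OF summable_on_cmult_right[OF summable_wt[OF assms(2)], of B]]) (use assms(1) in auto)

text \<open>Decay \<open>b\<close> of the tangent and \<open>c\<close> of \<open>F\<close> give decay \<open>\<sigma>\<close> of the nonlinearity, with a constant that is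
  uniform over states.\<close>

definition (in kernel) nonlinear_decay :: "real \<Rightarrow> real \<Rightarrow> real \<Rightarrow> real \<Rightarrow> real \<Rightarrow> real \<Rightarrow> real \<Rightarrow> real \<Rightarrow> real \<Rightarrow> bool" where
  "nonlinear_decay A \<delta> H Bt b Cf c C \<sigma> \<longleftrightarrow> (\<forall>\<tau>. good_state A \<delta> H \<tau> \<longrightarrow>
     (\<forall>j k. norm (cf \<tau> j k) \<le> Bt * wt k powr (- b)) \<longrightarrow> (\<forall>j k. norm (cf (F \<tau>) j k) \<le> Cf * wt k powr (- c)) \<longrightarrow>
     (\<forall>i k. norm (cf (nonlinearity K \<tau> (weak_deriv \<tau>)) i k) \<le> C * wt k powr (- \<sigma>)))"

lemma (in kernel) nonlinear_decay:
  assumes "nonlinear_decay A \<delta> H Bt b Cf c C \<sigma>" "good_state A \<delta> H \<tau>"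
    "\<And>j k. norm (cf \<tau> j k) \<le> Bt * wt k powr (- b)" "\<And>j k. norm (cf (F \<tau>) j k) \<le> Cf * wt k powr (- c)"
  shows "norm (cf (nonlinearity K \<tau> (weak_deriv \<tau>)) i k) \<le> C * wt k powr (- \<sigma>)"
  using assms unfolding nonlinear_decay_def by blast

text \<open>The derivative has decay \<open>b - 1\<close>, so its square needs \<open>2 * (b - 1) - \<sigma> > 1\<close>; the other products are
  better.\<close>

lemma (in kernel) decay_step:
  assumes e: "b > 1" "0 \<le> \<sigma>" "\<sigma> \<le> b - 1" "\<sigma> \<le> c" "2 * (b - 1) - \<sigma> > 1"
  shows "\<exists>C. nonlinear_decay A \<delta> H Bt b Cf c C \<sigma>"
proof -
  \<comment> \<open>Constants for \<open>\<tau>\<^sub>x \<tau>\<^sub>x\<close>, \<open>F \<tau>\<close>, \<open>\<tau>\<close> times the scalar \<open>qc\<close>, and \<open>\<tau> \<tau>\<close>.\<close>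
  obtain K1 where K1: "conv_const (b-1) (b-1) \<sigma> K1"
    using conv_const_exists[of \<sigma> "b-1" "b-1"] e by (auto simp: algebra_simps)
  obtain K2 where K2: "conv_const c b \<sigma> K2" using conv_const_exists[of \<sigma> c b] e by auto
  obtain K3 where K3: "conv_const b \<sigma> \<sigma> K3" using conv_const_exists[of \<sigma> b \<sigma>] e by auto
  obtain K4 where K4: "conv_const b b \<sigma> K4" using conv_const_exists[of \<sigma> b b] e by auto
  define L where "L = LB m g p A \<delta> H"
  define Q where "Q = 3 * (Cf * Bt * K2) + 3 * (Bt * Bt * K1)"
  define C where "C = Cf + L + Bt * Q * K3 + 3 * (L * (Bt * Bt * K4))"
  show ?thesis
    unfolding nonlinear_decay_def
  proof (intro exI[of _ C] allI impI)
    fix \<tau> i k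
    assume gs: "good_state A \<delta> H \<tau>" and T: "\<forall>j k. norm (cf \<tau> j k) \<le> Bt * wt k powr (- b)"
      and F: "\<forall>j k. norm (cf (F \<tau>) j k) \<le> Cf * wt k powr (- c)"
    note gd = good_stateD[OF gs] and bp = bigF_props[OF good_stateD(1)[OF gs]]
    let ?d = "weak_deriv \<tau>"
    let ?w = "\<lambda>k. wt k powr (-\<sigma>)" and ?qc = "qc K \<tau> (weak_deriv \<tau>)"
    note dL = weak_deriv(1)[OF gd(2)]
    have dc: "circ_L2 (cmp ?d j)" for j using dL by (simp add: L2_circle_iff)
    have Tc: "circ_L2 (cmp \<tau> j)" for j by (rule cmp_T_L2[OF gd(2)])
    have Cf0: "Cf \<ge> 0" using order_trans[OF norm_ge_zero F[rule_format, of 1 0]] by (simp add: wt_def)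
    have D: "norm (cf ?d j k) \<le> Bt * wt k powr (-(b-1))" for j k
    proof -
      have "norm (cf ?d j k) = real_of_int \<bar>k\<bar> * norm (cf \<tau> j k)"
        by (simp add: weak_deriv(2)[OF gd(2)] norm_mult)
      also have "\<dots> \<le> wt k * (Bt * wt k powr (- b))"
        using T abs_le_wt[of k] wt_pos[of k] by (intro mult_mono) auto
      also have "\<dots> = Bt * (wt k powr 1 * wt k powr (- b))" using wt_pos[of k] by simp
      also have "wt k powr 1 * wt k powr (- b) = wt k powr (-(b-1))" by (simp only: powr_add[symmetric]) (simp add: algebra_simps)
      finally show ?thesis .
    qed
    have DD: "norm (fc (\<lambda>x. cmp ?d j x * cmp ?d j x) k) \<le> Bt * Bt * K1 * ?w k" for j k
      unfolding fc_mult_L2(2)[OF dc dc] by (rule conv_constD[OF K1 D D])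
    have FT: "norm (fc (\<lambda>x. cmp (F \<tau>) j x * cmp \<tau> j x) k) \<le> Cf * Bt * K2 * ?w k" for j k
      unfolding fc_mult_L2(2)[OF bp(3) Tc] using F T by (intro conv_constD[OF K2]) auto
    have q: "norm (fc (?qc) k) \<le> Q * ?w k" for k
    proof -
      have "norm (fc (?qc) k) \<le> norm (\<Sum>j\<in>UNIV. fc (\<lambda>x. cmp (F \<tau>) j x * cmp \<tau> j x) k) + norm (\<Sum>j\<in>UNIV. fc (\<lambda>x. cmp ?d j x * cmp ?d j x) k)"
        unfolding qc_integrable(3)[OF gs dL] by (rule norm_triangle_ineq4)
      also have "\<dots> \<le> (\<Sum>j\<in>(UNIV::3 set). Cf * Bt * K2 * ?w k) + (\<Sum>j\<in>(UNIV::3 set). Bt * Bt * K1 * ?w k)"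
        by (intro add_mono order_trans[OF norm_sum] sum_mono FT DD)
      also have "\<dots> = Q * ?w k" by (simp add: Q_def algebra_simps)
      finally show ?thesis .
    qed
    have Ts: "(\<lambda>k. norm (cf \<tau> j k)) summable_on UNIV" for j
      by (rule summable_wt_bound[OF _ e(1)]) (use T in blast)
    have Tser: "cmp \<tau> j x = fser (cf \<tau> j) x" for j x
      by (rule eq_fser[OF H_spaceD(5)[OF gd(2)] H_spaceD(6)[OF gd(2)] Ts])
    have Tq: "norm (fc (\<lambda>x. cmp \<tau> i x * ?qc x) k) \<le> Bt * Q * K3 * ?w k"
    proof -
      have "fc (\<lambda>x. cmp \<tau> i x * ?qc x) k = fc (\<lambda>x. fser (cf \<tau> i) x * ?qc x) k"
        by (rule fc_cong) (simp add: Tser)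
      also have "\<dots> = (\<Sum>\<^sub>\<infinity>j. cf \<tau> i j * fc (?qc) (k - j))"
        by (rule fc_mult_fser(3)[OF qc_integrable(1)[OF gs dL] Ts])
      finally show ?thesis using T q by (simp only:) (intro conv_constD[OF K3], auto)
    qed
    have TT: "norm (fc (\<lambda>x. cmp \<tau> j x * cmp \<tau> i x) k) \<le> Bt * Bt * K4 * ?w k" for j
      unfolding fc_mult_L2(2)[OF Tc Tc] using T by (intro conv_constD[OF K4]) auto
    let ?l = "\<lambda>j. complex_of_real (lambda_mult K \<tau> ?d $ j)"
    have l: "norm (?l j) \<le> L" for j using lambda_nth_bound[OF gs] by (simp add: L_def)
    then have L0: "L \<ge> 0" using norm_ge_zero order_trans by blast
    have S: "norm (\<Sum>j\<in>UNIV. ?l j * fc (\<lambda>x. cmp \<tau> j x * cmp \<tau> i x) k) \<le> (\<Sum>j\<in>(UNIV::3 set). L * (Bt * Bt * K4 * ?w k))"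
      by (intro order_trans[OF norm_sum] sum_mono) (simp only: norm_mult, intro mult_mono l TT L0 norm_ge_zero)
    have l0: "norm (if k = 0 then ?l i else 0) \<le> L * ?w k"
      using l[of i] L0 by (auto simp: wt_def)
    have F': "norm (cf (F \<tau>) i k) \<le> Cf * ?w k"
      using F[rule_format, of i k] mult_left_mono[OF wt_powr_mono[OF e(4), of k] Cf0] by linarith
    have "norm (cf (nonlinearity K \<tau> ?d) i k) \<le>
       norm (cf (F \<tau>) i k) + norm (if k = 0 then ?l i else 0) + norm (fc (\<lambda>x. cmp \<tau> i x * ?qc x) k)
       + norm (\<Sum>j\<in>UNIV. ?l j * fc (\<lambda>x. cmp \<tau> j x * cmp \<tau> i x) k)"
      unfolding nonlinearity_fc(2)[OF gs dL]
      by (intro order_trans[OF norm_triangle_ineq4] add_right_mono order_trans[OF norm_triangle_ineq4] norm_triangle_ineq)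
    also have "\<dots> \<le> Cf * ?w k + L * ?w k + Bt * Q * K3 * ?w k
       + (\<Sum>j\<in>(UNIV::3 set). L * (Bt * Bt * K4 * ?w k))"
      by (intro add_mono F' l0 Tq S)
    also have "\<dots> = C * ?w k" by (simp add: C_def algebra_simps)
    finally show "norm (cf (nonlinearity K \<tau> ?d) i k) \<le> C * ?w k" .
  qed
qed

text \<open>Translating by half a period of the frequency changes the sign of the coefficient, so twice the
  coefficient is that of a difference of translates.\<close>

lemma fc_Lipschitz:
  assumes per: "per2pi u" and int: "integrable circ u" and L: "\<And>x y. norm (u x - u y) \<le> L * \<bar>x - y\<bar>" and k: "k \<noteq> 0"
  shows "norm (fc u k) \<le> L * (pi / 2) / real_of_int \<bar>k\<bar>"
proof -
  define c where "c = pi / real_of_int k"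
  define v where "v x = u x * cis (- (of_int k * x))" for x
  have vper: "per2pi v" unfolding per2pi_def
  proof
    fix x
    have "cis (- (of_int k * x)) = cis (- (of_int k * (x + 2 * pi))) * cis (2 * pi * of_int k)"
      by (simp add: cis_mult algebra_simps)
    then have "cis (- (of_int k * (x + 2 * pi))) = cis (- (of_int k * x))" by (simp add: cis_multiple_2pi)
    then show "v (x + 2 * pi) = v x" using per by (simp add: v_def per2pi_def)
  qed
  have vint: "integrable circ v" unfolding v_def by (rule integrable_mult_cis'[OF int])
  have ci: "cis (- (of_int k * (x + c))) = - cis (- (of_int k * x))" for x
  proof -
    have "cis (- (of_int k * (x + c))) = cis (- (of_int k * x)) * cis (- pi)"
      using k by (simp add: c_def cis_mult algebra_simps)
    also have "cis (- pi) = -1" by (simp add: complex_eq_iff)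
    finally show ?thesis by simp
  qed
  have ucper: "integrable circ (\<lambda>x. u (x + c))" by (rule periodic_shift(1)[OF per int])
  have "fc u k = (1 / (2 * pi)) *\<^sub>R (\<integral>x. v (x + c) \<partial>circ)"
    unfolding fc_def v_def[symmetric] by (subst periodic_shift(2)[OF vper vint]) simp
  also have "\<dots> = - fc (\<lambda>x. u (x + c)) k"
    unfolding fc_def v_def ci by simp
  finally have "2 * fc u k = fc (\<lambda>x. u x - u (x + c)) k"
    by (simp add: fc_diff[OF int ucper])
  then have "norm (2 * fc u k) \<le> (1 / (2 * pi)) * (\<integral>x. norm (u x - u (x + c)) \<partial>circ)"
    using norm_fc_le[OF integrable_diff[OF int ucper], of k] by simp
  also have "\<dots> \<le> (1 / (2 * pi)) * (\<integral>x. L * \<bar>c\<bar> \<partial>circ)"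
  proof (intro mult_left_mono integral_mono)
    show "integrable circ (\<lambda>x. norm (u x - u (x + c)))" by (intro integrable_norm integrable_diff int ucper)
    show "norm (u x - u (x + c)) \<le> L * \<bar>c\<bar>" for x using L[of x "x + c"] by simp
  qed simp_all
  also have "\<dots> = L * \<bar>c\<bar>" by (simp add: measure_circ)
  finally have "2 * norm (fc u k) \<le> L * \<bar>c\<bar>" by (simp add: norm_mult)
  moreover have "\<bar>c\<bar> = pi / real_of_int \<bar>k\<bar>" by (simp add: c_def abs_divide)
  ultimately show ?thesis by (simp add: field_simps)
qed

lemma norm_cis_diff_le: "norm (cis a - cis b) \<le> \<bar>a - b\<bar>"
proof -
  have "(norm (cis a - cis b))\<^sup>2 = (cos a - cos b)\<^sup>2 + (sin a - sin b)\<^sup>2" by (simp add: cmod_power2)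
  also have "\<dots> = 2 * (1 - cos (a - b))"
    using sin_cos_squared_add[of a] sin_cos_squared_add[of b] by (simp add: power2_diff cos_diff algebra_simps)
  also have "\<dots> \<le> \<bar>a - b\<bar>\<^sup>2" using one_minus_cos_le[of "a - b"] by simp
  finally show ?thesis by (rule power2_le_imp_le) simp
qed

text \<open>The derived series converges absolutely.\<close>

lemma Lipschitz_of_decay:
  assumes H: "\<tau> \<in> H_space 1" and T: "\<And>j k. norm (cf \<tau> j k) \<le> Bt * wt k powr (- b)" and b: "b > 2"
  shows "norm (\<tau> x - \<tau> y) \<le> 3 * (Bt * W (b - 1)) * \<bar>x - y\<bar>"
proof -
  have Ts: "(\<lambda>k. norm (cf \<tau> j k)) summable_on UNIV" for j
    by (rule summable_wt_bound[OF T]) (use b in simp)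
  have Tser: "cmp \<tau> j x = fser (cf \<tau> j) x" for j x
    by (rule eq_fser[OF H_spaceD(5)[OF H] H_spaceD(6)[OF H] Ts])
  have c: "norm (cmp \<tau> j x - cmp \<tau> j y) \<le> Bt * W (b - 1) * \<bar>x - y\<bar>" for j
  proof -
    let ?f = "\<lambda>x k. cf \<tau> j k * cis (of_int k * x)"
    have le: "norm (?f x k - ?f y k) \<le> (Bt * \<bar>x - y\<bar>) * wt k powr (- (b - 1))" for k
    proof -
      have "norm (?f x k - ?f y k) = norm (cf \<tau> j k) * norm (cis (of_int k * x) - cis (of_int k * y))"
        by (simp add: right_diff_distrib[symmetric] norm_mult)
      also have "\<dots> \<le> (Bt * wt k powr (- b)) * (wt k * \<bar>x - y\<bar>)"
      proof (intro mult_mono T)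
        have "norm (cis (of_int k * x) - cis (of_int k * y)) \<le> \<bar>of_int k * x - of_int k * y\<bar>" by (rule norm_cis_diff_le)
        also have "\<dots> = real_of_int \<bar>k\<bar> * \<bar>x - y\<bar>" by (simp add: right_diff_distrib[symmetric] abs_mult)
        also have "\<dots> \<le> wt k * \<bar>x - y\<bar>" by (intro mult_right_mono abs_le_wt) simp
        finally show "norm (cis (of_int k * x) - cis (of_int k * y)) \<le> wt k * \<bar>x - y\<bar>" .
        show "0 \<le> Bt * wt k powr (- b)" using order_trans[OF norm_ge_zero T] .
      qed simp
      also have "\<dots> = (Bt * \<bar>x - y\<bar>) * (wt k powr 1 * wt k powr (- b))" using wt_pos[of k] by simp
      also have "wt k powr 1 * wt k powr (- b) = wt k powr (-(b-1))" by (simp only: powr_add[symmetric]) (simp add: algebra_simps)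
      finally show ?thesis .
    qed
    have d: "(\<lambda>k. (Bt * \<bar>x - y\<bar>) * wt k powr (- (b - 1))) summable_on UNIV"
      using b by (intro summable_on_cmult_right summable_wt) simp
    have s: "(\<lambda>k. norm (?f x k - ?f y k)) summable_on UNIV"
      by (rule summable_on_comparison_test[OF d]) (use le in auto)
    have "cmp \<tau> j x - cmp \<tau> j y = (\<Sum>\<^sub>\<infinity>k. ?f x k - ?f y k)"
      unfolding Tser[of j x] Tser[of j y] fser_def
      by (rule infsum_minus[symmetric]) (rule abs_summable_summable[OF abs_summable_fser[OF Ts]])+
    also have "norm \<dots> \<le> (\<Sum>\<^sub>\<infinity>k. norm (?f x k - ?f y k))" by (rule norm_infsum_bound[OF s])
    also have "\<dots> \<le> (\<Sum>\<^sub>\<infinity>k. (Bt * \<bar>x - y\<bar>) * wt k powr (- (b - 1)))" by (intro infsum_mono s d le)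
    also have "\<dots> = Bt * W (b - 1) * \<bar>x - y\<bar>" by (simp add: infsum_cmult_right' W_def mult_ac)
    finally show ?thesis .
  qed
  have "norm (\<tau> x - \<tau> y) \<le> (\<Sum>j\<in>UNIV. norm ((\<tau> x - \<tau> y) $ j))" by (rule norm_vec_le_sum)
  also have "\<dots> \<le> (\<Sum>j\<in>(UNIV::3 set). Bt * W (b - 1) * \<bar>x - y\<bar>)"
  proof (rule sum_mono)
    fix j
    have "norm ((\<tau> x - \<tau> y) $ j) = norm (cmp \<tau> j x - cmp \<tau> j y)" by (simp add: cmp_def of_real_diff[symmetric] del: of_real_diff)
    then show "norm ((\<tau> x - \<tau> y) $ j) \<le> Bt * W (b - 1) * \<bar>x - y\<bar>" using c by simp
  qed
  finally show ?thesis by simp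
qed

text \<open>The primitive gains one power over the nonlinear force, which is now Lipschitz and so gains another one.\<close>

lemma (in kernel) bigF_decay:
  assumes gs: "good_state A \<delta> H \<tau>" and b: "b > 2" and T: "\<And>j k. norm (cf \<tau> j k) \<le> Bt * wt k powr (- b)"
  defines "M \<equiv> 3 * (Bt * W (b - 1))"
  shows "norm (cf (F \<tau>) j k)
    \<le> (gB g p * Bt + 4 * (nlL m g \<delta> M * pint (2 * real m - 2 * p) * (pi / 2))) * wt k powr (- 2)"
proof -
  note gd = good_stateD[OF gs] and bp = bigF_props[OF good_stateD(1)[OF gs]] and ad = admissibleD[OF good_stateD(1)[OF gs]]
  have Bt: "Bt \<ge> 0" using order_trans[OF norm_ge_zero T[of 1 0]] by (simp add: wt_def)
  have M: "M \<ge> 0" unfolding M_def using Bt W_nonneg by simp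
  define L where "L = nlL m g \<delta> M * pint (2 * real m - 2 * p)"
  have E: "2 * pi * H\<^sup>2 \<ge> 0" by simp
  have lip: "norm (nl \<tau> x - nl \<tau> y) \<le> L * \<bar>x - y\<bar>" for x y
    unfolding L_def
    by (rule NL_Lipschitz[OF gk gd(1) _ M gd(12) E]) (use Lipschitz_of_decay[OF gd(2) T b] in \<open>simp add: M_def\<close>)
  have clip: "norm (cmp (nl \<tau>) j x - cmp (nl \<tau>) j y) \<le> L * \<bar>x - y\<bar>" for x y
  proof -
    have "norm (cmp (nl \<tau>) j x - cmp (nl \<tau>) j y)
        = \<bar>(nl \<tau> x - nl \<tau> y) $ j\<bar>"
      by (simp add: cmp_def of_real_diff[symmetric] del: of_real_diff)
    also have "\<dots> \<le> norm (nl \<tau> x - nl \<tau> y)" by (rule component_le_norm_cart)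
    finally show ?thesis using lip[of x y] by linarith
  qed
  have L0: "L \<ge> 0" using order_trans[OF norm_ge_zero lip[of 1 0]] by simp
  have "norm (cf (F \<tau>) j k) \<le> (gB g p * Bt + 4 * (L * (pi / 2))) * wt k powr (- 2)"
  proof (cases "k = 0")
    case True
    have "0 \<le> gB g p * Bt + 4 * (L * (pi / 2))" using L0 Bt gB_nonneg by (intro add_nonneg_nonneg mult_nonneg_nonneg) auto
    then show ?thesis using bp(6) True by simp
  next
    case False
    have 1: "norm (cf (nl \<tau>) j k) \<le> L * (pi / 2) / real_of_int \<bar>k\<bar>"
      by (rule fc_Lipschitz[OF per2pi_cmp[OF NL_per2pi[OF ad(7)]] circ_L2_imp_integrable[OF NL_state_bound(3)[OF gk gs]] clip False])
    have 2: "norm (cf (nl \<tau>) j k) / \<bar>of_int k\<bar> \<le> 4 * (L * (pi / 2)) * wt k powr (- 2)"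
    proof -
      have "norm (cf (nl \<tau>) j k) / \<bar>of_int k\<bar> \<le> (L * (pi / 2) / real_of_int \<bar>k\<bar>) / \<bar>of_int k\<bar>"
        using 1 by (intro divide_right_mono) auto
      also have "\<dots> = L * (pi / 2) / (real_of_int k)\<^sup>2" by (simp add: power2_eq_square abs_mult[symmetric])
      also have "\<dots> \<le> 4 * (L * (pi / 2)) * wt k powr (- 2)" using L0 by (intro divide_square_le_wt False) auto
      finally show ?thesis .
    qed
    have 3: "gB g p * norm (cf \<tau> j k) \<le> gB g p * Bt * wt k powr (- 2)"
    proof -
      have "norm (cf \<tau> j k) \<le> Bt * wt k powr (- 2)"
        using T[of j k] mult_left_mono[OF wt_powr_mono[of 2 b k] Bt] b by linarith
      from mult_left_mono[OF this gB_nonneg] show ?thesis by (simp add: mult.assoc)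
    qed
    show ?thesis using order_trans[OF bp(5) add_mono[OF 3 2]] by (simp add: distrib_right)
  qed
  then show ?thesis by (simp add: L_def)
qed

section \<open>The coefficients solve ordinary differential equations\<close>

text \<open>The exponents are a compromise: \<open>3/2 > 1\<close> for the sum over \<open>k\<close>, \<open>3/4 < 1\<close> for the integral over \<open>r\<close>.\<close>

lemma exp_heat_bound:
  assumes r: "r > 0"
  shows "exp (- (of_int k)\<^sup>2 * r) \<le> (4 * wt k powr (- (3/2))) * (r powr (- (3/4)) + 1)"
proof (cases "k = 0")
  case True
  then show ?thesis using r by (simp add: wt_def)
next
  case False
  let ?x = "(of_int k)\<^sup>2 * r"
  have x: "?x > 0" using False r by simp
  have "?x powr (3/4) \<le> exp ?x"
  proof (cases "?x \<le> 1")
    case True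
    have "?x powr (3/4) \<le> 1 powr (3/4)" using True x by (intro powr_mono2) auto
    also have "\<dots> \<le> exp ?x" using x by simp
    finally show ?thesis .
  next
    case False
    have "?x powr (3/4) \<le> ?x powr 1" using False by (intro powr_mono) auto
    also have "?x powr 1 = ?x" using x by (rule powr_one[OF less_imp_le])
    also have "?x \<le> exp ?x" using exp_ge_add_one_self[of ?x] by linarith
    finally show ?thesis .
  qed
  then have "exp (- ?x) \<le> ?x powr (- (3/4))"
    unfolding exp_minus powr_minus by (rule le_imp_inverse_le) (use x False r in simp)
  also have "\<dots> = (real_of_int \<bar>k\<bar>) powr (- (3/2)) * r powr (- (3/4))"
  proof -
    have "(real_of_int k)\<^sup>2 = real_of_int \<bar>k\<bar> powr 2" using False by (simp add: powr_numeral)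
    then have "?x powr (- (3/4)) = (real_of_int \<bar>k\<bar> powr 2) powr (- (3/4)) * r powr (- (3/4))"
      using r by (simp only: powr_mult)
    moreover have "(real_of_int \<bar>k\<bar> powr 2) powr (- (3/4)) = real_of_int \<bar>k\<bar> powr (- (3/2))"
      unfolding powr_powr by simp
    ultimately show ?thesis by (simp only:)
  qed
  also have "\<dots> \<le> (4 * wt k powr (- (3/2))) * (r powr (- (3/4)) + 1)"
  proof (intro mult_mono)
    have "real_of_int \<bar>k\<bar> \<ge> wt k / 2" using wt_le_abs[OF False] by simp
    then have "(real_of_int \<bar>k\<bar>) powr (- (3/2)) \<le> (wt k / 2) powr (- (3/2))"
      using wt_pos[of k] by (intro powr_mono2') auto
    also have "\<dots> = wt k powr (- (3/2)) * 2 powr (3/2)"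
      using wt_pos[of k] by (simp add: powr_divide powr_minus field_simps)
    also have "\<dots> \<le> wt k powr (- (3/2)) * 4"
    proof (intro mult_left_mono)
      have "(2::real) powr (3/2) \<le> 2 powr 2" by (intro powr_mono) auto
      then show "(2::real) powr (3/2) \<le> 4" by simp
    qed simp
    finally show "(real_of_int \<bar>k\<bar>) powr (- (3/2)) \<le> 4 * wt k powr (- (3/2))" by (simp add: mult.commute)
  qed auto
  finally show ?thesis by simp
qed

lemma integrable_time_weight:
  fixes t :: real
  assumes "t > 0"
  shows "set_integrable lborel {0..t} (\<lambda>s. (t - s) powr (- (3/4)) + 1)"
proof -
  have "(\<lambda>x::real. x powr (- (3/4))) integrable_on {0..t}"
    using assms by (intro integrable_on_powr_from_0) auto
  then have "set_integrable lebesgue {0..t} (\<lambda>x. x powr (- (3/4)))"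
    unfolding set_integrable_def by (intro nonnegative_absolutely_integrable_1 [unfolded set_integrable_def]) auto
  then have "integrable lborel (\<lambda>x. indicator {0..t} x *\<^sub>R x powr (- (3/4)))"
    unfolding set_integrable_def by (subst (asm) integrable_completion) auto
  from lborel_integrable_real_affine[OF this, of "-1" t]
  have "integrable lborel (\<lambda>x. indicator {0..t} (t - x) *\<^sub>R (t - x) powr (- (3/4)))" by simp
  moreover have "(\<lambda>x. indicat_real {0..t} (t - x) *\<^sub>R (t - x) powr (- (3/4))) = (\<lambda>x. indicator {0..t} x *\<^sub>R (t - x) powr (- (3/4)))"
    by (rule ext) (auto simp: indicator_def)
  ultimately have 1: "set_integrable lborel {0..t} (\<lambda>x. (t - x) powr (- (3/4)))" by (simp add: set_integrable_def)
  have 2: "set_integrable lborel {0..t} (\<lambda>x. 1::real)" by (rule borel_integrable_atLeastAtMost'[OF continuous_on_const])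
  show ?thesis by (rule set_integral_add(1)[OF 1 2])
qed

lemma fser_real:
  assumes "\<And>k. c (- k) = cnj (c k)"
  shows "complex_of_real (Re (fser c x)) = fser c x"
proof -
  have "cnj (fser c x) = (\<Sum>\<^sub>\<infinity>k. cnj (c k * cis (of_int k * x)))" unfolding fser_def by (rule infsum_cnj[symmetric])
  also have "\<dots> = (\<Sum>\<^sub>\<infinity>k. c (- k) * cis (of_int (- k) * x))" by (simp add: assms cis_cnj)
  also have "\<dots> = fser c x"
    unfolding fser_def by (rule infsum_reindex_bij_betw) (rule bij_betwI[where g=uminus], auto)
  finally show ?thesis by (simp add: complex_eq_iff)
qed

locale solution = kernel +
  fixes A \<delta> H T :: real and \<tau>\<^sub>0 :: "real \<Rightarrow> real^3" and \<tau> :: "real \<Rightarrow> real \<Rightarrow> real^3"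
  assumes T: "T > 0"
    and mild: "mild_solution K T \<tau>\<^sub>0 \<tau>" and gs: "\<And>t. t \<in> {0..T} \<Longrightarrow> good_state A \<delta> H (\<tau> t)"
begin

definition N :: "real \<Rightarrow> real \<Rightarrow> real^3" where
  "N t = nonlinearity K (\<tau> t) (weak_deriv (\<tau> t))"

definition y :: "3 \<Rightarrow> int \<Rightarrow> real \<Rightarrow> complex" where "y j k t = cf (\<tau> t) j k"

definition n :: "3 \<Rightarrow> int \<Rightarrow> real \<Rightarrow> complex" where "n j k t = cf (N t) j k"

lemma n_continuous: "continuous_on {0..T} (n j k)"
  unfolding continuous_on_eq_continuous_within continuous_within tendsto_at_iff_sequentially
proof (intro ballI allI impI)
  fix t X assume t: "t \<in> {0..T}" and X: "\<forall>i. X i \<in> {0..T} - {t}" and lim: "X \<longlonglongrightarrow> t"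
  have "((\<lambda>r. H_norm 1 (\<lambda>x. \<tau> r x - \<tau> t x)) \<longlongrightarrow> 0) (at t within {0..T})"
    using mild t by (auto simp: mild_solution_def C_into_H_def)
  then have "((\<lambda>r. H_norm 1 (\<lambda>x. \<tau> r x - \<tau> t x)) \<circ> X) \<longlonglongrightarrow> 0"
    unfolding tendsto_at_iff_sequentially using X lim by blast
  then interpret state_sequence K h p m A \<delta> H "\<lambda>i. \<tau> (X i)" "\<tau> t"
    using X t by unfold_locales (auto intro: hom gk gs simp: o_def)
  show "(n j k \<circ> X) \<longlonglongrightarrow> n j k t"
    unfolding n_def N_def o_def by (rule nonlinearity_coeff_tendsto)
qed

lemma n_bound: "t \<in> {0..T} \<Longrightarrow> norm (n j k t) \<le> NB m g p A \<delta> H"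
  unfolding n_def N_def by (rule nonlinearity_coeff_bound[OF gs])

lemma y_uminus: "y j (- k) t = cnj (y j k t)" and n_uminus: "n j (- k) t = cnj (n j k t)"
  by (simp_all add: y_def n_def fourier_uminus_nth)

lemma y_0: "t \<in> {0..T} \<Longrightarrow> y j 0 t = 0"
  unfolding y_def by (rule good_stateD(11)[OF gs])

lemma y_bound: "t \<in> {0..T} \<Longrightarrow> norm (y j k t) * real_of_int \<bar>k\<bar> \<le> H"
  unfolding y_def by (rule good_stateD(10)[OF gs])

text \<open>The Duhamel formula for the coefficients.  The time integral and the sum over the frequencies
  may be exchanged because \<open>exp (- k\<^sup>2 r) \<le> C \<bar>k\<bar> powr (-3/2) * r powr (-3/4)\<close> separates the two
  variables into two convergent factors.\<close>

lemma Duhamel: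
  assumes t: "t \<in> {0..T}"
  shows "y j k t = exp (- (of_int k)\<^sup>2 * t) *\<^sub>R y j k 0 + (LBINT s:{0..t}. exp (- (of_int k)\<^sup>2 * (t - s)) *\<^sub>R n j k s)"
proof (cases "t = 0")
  case True
  have "(LBINT s:{0..0}. exp (- (of_int k)\<^sup>2 * (0 - s)) *\<^sub>R n j k s) = 0"
    unfolding set_lebesgue_integral_def
  proof (rule integral_eq_zero_AE)
    show "AE s in lborel. indicat_real {0..0} s *\<^sub>R (exp (- (of_int k)\<^sup>2 * (0 - s)) *\<^sub>R n j k s) = 0"
      using AE_lborel_singleton[of 0] by eventually_elim auto
  qed
  then show ?thesis using True by simp
next
  case False
  with t have t0: "t > 0" by simp
  let ?e = "\<lambda>k r. exp (- (real_of_int k)\<^sup>2 * r)"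
  define M where "M = restrict_space lborel {0..t}"
  have set_int: "(LBINT s:{0..t}. f s) = integral\<^sup>L M f" for f :: "real \<Rightarrow> 'b::{banach, second_countable_topology}"
    unfolding M_def set_lebesgue_integral_def by (subst integral_restrict_space) auto
  have set_intb: "set_integrable lborel {0..t} f \<longleftrightarrow> integrable M f" for f :: "real \<Rightarrow> 'b::{banach, second_countable_topology}"
    unfolding M_def set_integrable_def by (subst integrable_restrict_space) auto
  have spM: "space M = {0..t}" by (simp add: M_def space_restrict_space)
  have aeM: "AE s in M. s < t"
  proof -
    have "AE s in lborel. s \<noteq> t" by (rule AE_lborel_singleton)
    then show ?thesis unfolding M_def by (subst AE_restrict_space_iff) (auto elim!: eventually_mono)
  qed
  let ?B = "NB m g p A \<delta> H"
  have B0: "?B \<ge> 0" using order_trans[OF norm_ge_zero n_bound[OF t, of 1 0]] .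
  let ?w = "\<lambda>s. (t - s) powr (- (3/4)) + 1"
  have wM: "integrable M ?w" using integrable_time_weight[OF t0] by (simp add: set_intb)
  \<comment> \<open>The integrand is cut off at \<open>s = t\<close>, where the semigroup is not smoothing and the bound fails.\<close>
  define f where "f j x k s = (if s < t then ?e k (t - s) *\<^sub>R (n j k s * cis (of_int k * x)) else 0)" for j x k s
  have nM: "n j k \<in> borel_measurable M" for j k
  proof -
    have "continuous_on {0..t} (n j k)" using t by (intro continuous_on_subset[OF n_continuous]) auto
    then have "n j k \<in> borel_measurable (restrict_space borel {0..t})" by (rule borel_measurable_continuous_on_restrict)
    then show ?thesis unfolding M_def by (simp add: measurable_def space_restrict_space sets_restrict_space)
  qed
  have idM: "(\<lambda>s. s) \<in> borel_measurable M" unfolding M_def by (intro measurable_restrict_space1) simp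
  have fM: "f j x k \<in> borel_measurable M" for j x k
    unfolding f_def[abs_def] using nM[of j k] idM by measurable
  have fb: "norm (f j x k s) \<le> (?B * (4 * wt k powr (- (3/2)))) * ?w s" if "s \<in> space M" for j x k s
  proof (cases "s < t")
    case True
    have "norm (f j x k s) = ?e k (t - s) * norm (n j k s)" using True by (simp add: f_def norm_mult)
    also have "\<dots> \<le> ((4 * wt k powr (- (3/2))) * ?w s) * ?B"
      using True that t n_bound[of s j k] exp_heat_bound[of "t - s" k] by (intro mult_mono) (auto simp: spM)
    finally show ?thesis by (simp add: mult_ac)
  next
    case False
    then show ?thesis using B0 by (simp add: f_def)
  qed
  have bs: "(\<lambda>k. ?B * (4 * wt k powr (- (3/2)))) summable_on UNIV"
    by (intro summable_on_cmult_right summable_wt) simp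
  have bpos: "?B * (4 * wt k powr (- (3/2))) \<ge> 0" for k using B0 by simp
  have I1: "integrable M (\<lambda>s. \<Sum>\<^sub>\<infinity>k. f j x k s)"
    and I2: "(\<integral>s. (\<Sum>\<^sub>\<infinity>k. f j x k s) \<partial>M) = (\<Sum>\<^sub>\<infinity>k. \<integral>s. f j x k s \<partial>M)"
    and I3: "(\<lambda>k. norm (\<integral>s. f j x k s \<partial>M)) summable_on UNIV" for j x
    by (rule integral_infsum_int[OF fM fb wM bs bpos]; assumption)+
  let ?J = "\<lambda>j k. LBINT s:{0..t}. ?e k (t - s) *\<^sub>R n j k s"
  have Jf: "(\<integral>s. f j x k s \<partial>M) = ?J j k * cis (of_int k * x)" for j x k
  proof -
    have "(\<integral>s. f j x k s \<partial>M) = (\<integral>s. (?e k (t - s) *\<^sub>R n j k s) * cis (of_int k * x) \<partial>M)"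
    proof (rule integral_cong_AE)
      show "AE s in M. f j x k s = (?e k (t - s) *\<^sub>R n j k s) * cis (of_int k * x)"
        using aeM by eventually_elim (simp add: f_def)
      show "(\<lambda>s. exp (- (real_of_int k)\<^sup>2 * (t - s)) *\<^sub>R n j k s * cis (real_of_int k * x)) \<in> borel_measurable M"
        using nM[of j k] idM by measurable
    qed (rule fM)
    then show ?thesis by (simp only: set_int integral_mult_left_zero)
  qed
  define c where "c j k = ?e k t *\<^sub>R y j k 0 + ?J j k" for j k
  have Js: "(\<lambda>k. norm (?J j k)) summable_on UNIV" for j
    using I3[of j 0] by (simp add: Jf norm_mult)
  have gs0: "good_state A \<delta> H (\<tau> 0)" using T by (intro gs) auto
  have ys: "(\<lambda>k. norm (?e k t *\<^sub>R y j k 0)) summable_on UNIV" for j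
  proof (rule summable_on_comparison_test)
    show "(\<lambda>k. (4 * (t powr (- (3/4)) + 1) * (H + 1)) * wt k powr (- (3/2))) summable_on UNIV"
      by (intro summable_on_cmult_right summable_wt) simp
    fix k
    have H0: "H \<ge> 0" by (rule good_stateD(6)[OF gs0])
    have y1: "norm (y j k 0) \<le> H + 1"
    proof (cases "k = 0")
      case True
      then show ?thesis using y_0[of 0 j] T H0 by simp
    next
      case False
      then have "norm (y j k 0) * 1 \<le> norm (y j k 0) * real_of_int \<bar>k\<bar>" by (intro mult_left_mono) auto
      then show ?thesis using y_bound[of 0 j k] T by simp
    qed
    have "?e k t * norm (y j k 0) \<le> ((4 * wt k powr (- (3/2))) * (t powr (- (3/4)) + 1)) * (H + 1)"
      using exp_heat_bound[OF t0, of k] y1 by (intro mult_mono) auto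
    then show "norm (?e k t *\<^sub>R y j k 0) \<le> (4 * (t powr (- (3/4)) + 1) * (H + 1)) * wt k powr (- (3/2))"
      by (simp add: algebra_simps)
  qed simp
  have cs: "(\<lambda>k. norm (c j k)) summable_on UNIV" for j
    by (rule summable_on_comparison_test[OF summable_on_add[OF ys[of j] Js[of j]]]) (simp_all only: c_def norm_triangle_ineq norm_ge_zero)
  have creal: "c j (- k) = cnj (c j k)" for j k
  proof -
    have "?J j (- k) = cnj (?J j k)"
      unfolding set_int by (subst integral_cnj[symmetric]) (simp add: n_uminus)
    then show ?thesis by (simp add: c_def y_uminus)
  qed
  have "cmp (\<tau> t) j x = fser (c j) x" for j x
  proof -
    have hN: "heat (t - s) (N s) x $ j = Re (\<Sum>\<^sub>\<infinity>k. f j x k s)" if "s < t" for s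
      using that by (simp add: heat_def f_def n_def fourier_nth)
    have mi: "set_integrable lborel {0..t} (\<lambda>s. heat (t - s) (N s) x)"
      and me: "\<tau> t x = heat t \<tau>\<^sub>0 x + (LBINT s:{0..t}. heat (t - s) (N s) x)"
      using mild t by (auto simp: mild_solution_def N_def)
    have tau0: "\<tau>\<^sub>0 = \<tau> 0" using mild by (simp add: mild_solution_def)
    have "(LBINT s:{0..t}. heat (t - s) (N s) x) $ j = (\<integral>s. heat (t - s) (N s) x $ j \<partial>M)"
      unfolding set_int using mi by (intro integral_vec_nth) (simp add: set_intb)
    also have "\<dots> = (\<integral>s. Re (\<Sum>\<^sub>\<infinity>k. f j x k s) \<partial>M)"
    proof (rule integral_cong_AE)
      show "AE s in M. heat (t - s) (N s) x $ j = Re (\<Sum>\<^sub>\<infinity>k. f j x k s)"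
        using aeM by eventually_elim (rule hN)
      have "integrable M (\<lambda>s. heat (t - s) (N s) x)" using mi by (simp add: set_intb)
      then have "(\<lambda>s. heat (t - s) (N s) x) \<in> borel_measurable M" by (rule borel_measurable_integrable)
      then show "(\<lambda>s. heat (t - s) (N s) x $ j) \<in> borel_measurable M" unfolding measurable_vec_iff by blast
      show "(\<lambda>s. Re (\<Sum>\<^sub>\<infinity>k. f j x k s)) \<in> borel_measurable M"
        using borel_measurable_integrable[OF I1[of j x]] by measurable
    qed
    also have "\<dots> = Re (\<Sum>\<^sub>\<infinity>k. ?J j k * cis (of_int k * x))"
      unfolding integral_Re[OF I1[of j x]] I2 Jf ..
    finally have 1: "(LBINT s:{0..t}. heat (t - s) (N s) x) $ j = Re (\<Sum>\<^sub>\<infinity>k. ?J j k * cis (of_int k * x))" .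
    have 2: "heat t \<tau>\<^sub>0 x $ j = Re (\<Sum>\<^sub>\<infinity>k. (?e k t *\<^sub>R y j k 0) * cis (of_int k * x))"
      using t0 by (simp add: heat_def tau0 y_def fourier_nth)
    have "\<tau> t x $ j = Re ((\<Sum>\<^sub>\<infinity>k. (?e k t *\<^sub>R y j k 0) * cis (of_int k * x)) + (\<Sum>\<^sub>\<infinity>k. ?J j k * cis (of_int k * x)))"
      unfolding me by (simp only: vector_add_component 1 2 plus_complex.sel)
    also have "\<dots> = Re (fser (c j) x)"
      unfolding fser_def c_def distrib_right
      by (subst infsum_add[OF abs_summable_summable[OF abs_summable_fser[OF ys]] abs_summable_summable[OF abs_summable_fser[OF Js]]]) simp
    finally show ?thesis unfolding cmp_def by (simp add: fser_real[of "c j", OF creal])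
  qed
  then have "cmp (\<tau> t) j = fser (c j)" by (rule ext)
  then have "y j k t = c j k" by (simp add: y_def fc_fser[OF cs])
  then show ?thesis by (simp add: c_def)
qed

lemma y_has_derivative:
  assumes t: "t \<in> {0..T}"
  shows "(y j k has_vector_derivative (- ((of_int k)\<^sup>2 *\<^sub>R y j k t) + n j k t)) (at t within {0..T})"
proof -
  let ?\<kappa> = "(real_of_int k)\<^sup>2"
  let ?f = "\<lambda>s. exp (?\<kappa> * s) *\<^sub>R n j k s"
  have fc: "continuous_on {0..T} ?f" by (intro continuous_intros n_continuous)
  have eq: "y j k r = exp (- ?\<kappa> * r) *\<^sub>R (y j k 0 + integral {0..r} ?f)" if r: "r \<in> {0..T}" for r
  proof -
    have "continuous_on {0..r} ?f" using r by (intro continuous_on_subset[OF fc]) auto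
    then have si: "set_integrable lborel {0..r} ?f" by (intro borel_integrable_atLeastAtMost')
    have "(LBINT s:{0..r}. exp (- ?\<kappa> * (r - s)) *\<^sub>R n j k s) = (LBINT s:{0..r}. exp (- ?\<kappa> * r) *\<^sub>R ?f s)"
      by (intro set_lebesgue_integral_cong) (auto simp: exp_add[symmetric] algebra_simps)
    also have "\<dots> = exp (- ?\<kappa> * r) *\<^sub>R (LBINT s:{0..r}. ?f s)" by (rule set_integral_scaleR_right)
    also have "(LBINT s:{0..r}. ?f s) = integral {0..r} ?f" by (rule set_borel_integral_eq_integral(2)[OF si])
    finally show ?thesis using Duhamel[OF r, of j k] by (simp add: scaleR_add_right)
  qed
  have d: "((\<lambda>r. y j k 0 + integral {0..r} ?f) has_vector_derivative ?f t) (at t within {0..T})"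
    using integral_has_vector_derivative[OF fc t] by (auto intro!: derivative_eq_intros)
  have "((\<lambda>r. exp (- ?\<kappa> * r)) has_real_derivative (- ?\<kappa>) * exp (- ?\<kappa> * t)) (at t within {0..T})"
    by (auto intro!: derivative_eq_intros)
  from has_vector_derivative_scaleR[OF this d]
  have "((\<lambda>r. exp (- ?\<kappa> * r) *\<^sub>R (y j k 0 + integral {0..r} ?f)) has_vector_derivative
     (exp (- ?\<kappa> * t) *\<^sub>R ?f t + (- ?\<kappa> * exp (- ?\<kappa> * t)) *\<^sub>R (y j k 0 + integral {0..t} ?f))) (at t within {0..T})" .
  moreover have "exp (- ?\<kappa> * t) *\<^sub>R ?f t + (- ?\<kappa> * exp (- ?\<kappa> * t)) *\<^sub>R (y j k 0 + integral {0..t} ?f) = - (?\<kappa> *\<^sub>R y j k t) + n j k t"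
    unfolding eq[OF t] by (simp add: exp_minus)
  ultimately have D: "((\<lambda>r. exp (- ?\<kappa> * r) *\<^sub>R (y j k 0 + integral {0..r} ?f)) has_vector_derivative
     - (?\<kappa> *\<^sub>R y j k t) + n j k t) (at t within {0..T})" by (simp only:)
  show ?thesis by (rule has_vector_derivative_transform[OF t eq D])
qed

lemma y_continuous: "continuous_on {0..T} (y j k)"
  using y_has_derivative
  by (intro continuous_on_vector_derivative)

text \<open>Over a time step \<open>\<eta>\<close> the heat semigroup forgets the initial value and gains two powers of the
  frequency.\<close>

lemma parabolic_gain:
  assumes t0: "0 \<le> t\<^sub>0" and \<eta>: "\<eta> > 0" and \<sigma>: "0 \<le> \<sigma>" "\<sigma> \<le> 2"
    and nb: "\<And>s k. s \<in> {t\<^sub>0..T} \<Longrightarrow> norm (n j k s) \<le> B * wt k powr (- \<sigma>)" and t: "t \<in> {t\<^sub>0 + \<eta>..T}"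
  shows "norm (y j k t) \<le> (32 * H / \<eta>\<^sup>2 + 4 * B) * wt k powr (- (\<sigma> + 2))"
proof -
  have tT: "t \<in> {0..T}" "t\<^sub>0 \<in> {0..T}" "t\<^sub>0 < t" using t t0 \<eta> by auto
  have H0: "H \<ge> 0" by (rule good_stateD(6)[OF gs[OF tT(1)]])
  have B0: "B \<ge> 0" using order_trans[OF norm_ge_zero nb[of t 0]] tT t0 by (simp add: wt_def)
  show ?thesis
  proof (cases "k = 0")
    case True
    then show ?thesis using y_0[OF tT(1)] H0 B0 by simp
  next
    case False
    let ?\<kappa> = "(real_of_int k)\<^sup>2" and ?b = "B * wt k powr (- \<sigma>)"
    have \<kappa>: "?\<kappa> > 0" using False by simp
    \<comment> \<open>The integrating factor removes the linear term of the equation.\<close>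
    define z where "z s = exp (?\<kappa> * s) *\<^sub>R y j k s" for s
    have "norm (z t - z t\<^sub>0) \<le> ?b / ?\<kappa> * exp (?\<kappa> * t) - ?b / ?\<kappa> * exp (?\<kappa> * t\<^sub>0)"
    proof (rule differentiable_bound_general[OF tT(3)])
      show "continuous_on {t\<^sub>0..t} z"
        unfolding z_def using tT t by (intro continuous_intros continuous_on_subset[OF y_continuous]) auto
      show "continuous_on {t\<^sub>0..t} (\<lambda>s. ?b / ?\<kappa> * exp (?\<kappa> * s))" by (intro continuous_intros)
      fix s assume s: "t\<^sub>0 < s" "s < t"
      have sT: "s \<in> {0..T}" "s \<in> {0<..<T}" "s \<in> {t\<^sub>0..T}" using s t t0 by auto
      have "at s within {0..T} = at s" using sT(2) by (simp add: at_within_Icc_at)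
      then have dy: "(y j k has_vector_derivative (- (?\<kappa> *\<^sub>R y j k s) + n j k s)) (at s)"
        using y_has_derivative[OF sT(1), of j k] by simp
      have "((\<lambda>s. exp (?\<kappa> * s)) has_real_derivative ?\<kappa> * exp (?\<kappa> * s)) (at s)"
        by (auto intro!: derivative_eq_intros)
      from has_vector_derivative_scaleR[OF this dy]
      show "(z has_vector_derivative exp (?\<kappa> * s) *\<^sub>R n j k s) (at s)"
        unfolding z_def[abs_def] by (simp add: algebra_simps)
      have "((\<lambda>s. exp (?\<kappa> * s)) has_real_derivative ?\<kappa> * exp (?\<kappa> * s)) (at s)"
        by (auto intro!: derivative_eq_intros)
      from DERIV_cmult[OF this, of "?b / ?\<kappa>"]
      have "((\<lambda>s. ?b / ?\<kappa> * exp (?\<kappa> * s)) has_real_derivative ?b * exp (?\<kappa> * s)) (at s)"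
        using False by (simp add: mult.assoc)
      then show "((\<lambda>s. ?b / ?\<kappa> * exp (?\<kappa> * s)) has_vector_derivative ?b * exp (?\<kappa> * s)) (at s)"
        by (simp add: has_real_derivative_iff_has_vector_derivative)
      show "norm (exp (?\<kappa> * s) *\<^sub>R n j k s) \<le> ?b * exp (?\<kappa> * s)"
        using mult_right_mono[OF nb[OF sT(3), of k], of "exp (?\<kappa> * s)"] by (simp add: mult_ac)
    qed
    also have "\<dots> \<le> ?b / ?\<kappa> * exp (?\<kappa> * t)" using B0 by simp
    finally have "norm (z t) \<le> norm (z t\<^sub>0) + ?b / ?\<kappa> * exp (?\<kappa> * t)"
      using norm_triangle_ineq2[of "z t" "z t\<^sub>0"] by linarith
    then have "exp (?\<kappa> * t) * norm (y j k t) \<le> exp (?\<kappa> * t\<^sub>0) * norm (y j k t\<^sub>0) + ?b / ?\<kappa> * exp (?\<kappa> * t)"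
      by (simp add: z_def)
    moreover have "Y \<le> exp (- (a - a0)) * Y0 + c" if "exp a * Y \<le> exp a0 * Y0 + c * exp a" for a a0 Y Y0 c :: real
    proof -
      have "Y \<le> (exp a0 * Y0 + c * exp a) / exp a" using that by (simp add: pos_le_divide_eq mult.commute)
      then show ?thesis by (simp add: add_divide_distrib exp_diff)
    qed
    ultimately have "norm (y j k t) \<le> exp (- (?\<kappa> * t - ?\<kappa> * t\<^sub>0)) * norm (y j k t\<^sub>0) + ?b / ?\<kappa>" by blast
    then have 1: "norm (y j k t) \<le> exp (- (?\<kappa> * (t - t\<^sub>0))) * norm (y j k t\<^sub>0) + ?b / ?\<kappa>"
      by (simp only: right_diff_distrib)
    \<comment> \<open>From \<open>exp (- x) \<le> 2 / x\<^sup>2\<close> and \<open>1 / k\<^sup>2 \<le> 4 * wt k powr -2\<close>; thus \<open>32 = 2 * 4\<^sup>2\<close>.\<close>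
    have e: "exp (- (?\<kappa> * (t - t\<^sub>0))) \<le> 32 / \<eta>\<^sup>2 * wt k powr (- (\<sigma> + 2))"
    proof -
      let ?x = "?\<kappa> * \<eta>"
      have x: "?x > 0" using \<kappa> \<eta> by simp
      have "exp (- (?\<kappa> * (t - t\<^sub>0))) \<le> exp (- ?x)" using t \<kappa> by simp
      also have "\<dots> \<le> 2 / ?x\<^sup>2"
      proof -
        have "exp (- X) \<le> 2 / X\<^sup>2" if "X > 0" for X :: real
        proof -
          have "X\<^sup>2 / 2 \<le> exp X" using exp_lower_Taylor_quadratic[of X] that by simp
          then show ?thesis using that by (simp add: exp_minus field_simps)
        qed
        then show ?thesis using x by blast
      qed
      also have "\<dots> = 2 / \<eta>\<^sup>2 * (1 / ?\<kappa>)\<^sup>2" by (simp add: power_mult_distrib power_divide field_simps)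
      also have "\<dots> \<le> 2 / \<eta>\<^sup>2 * (4 * wt k powr (- 2))\<^sup>2"
        using divide_square_le_wt[OF False, of 1] by (intro mult_left_mono power_mono) auto
      also have "\<dots> = 32 / \<eta>\<^sup>2 * wt k powr (- 2 + - 2)"
        unfolding powr_add by (simp add: power2_eq_square)
      also have "\<dots> \<le> 32 / \<eta>\<^sup>2 * wt k powr (- (\<sigma> + 2))"
        using \<sigma> wt_ge_1[of k] by (intro mult_left_mono powr_mono) auto
      finally show ?thesis .
    qed
    have y0: "norm (y j k t\<^sub>0) \<le> H"
    proof -
      have "norm (y j k t\<^sub>0) * 1 \<le> norm (y j k t\<^sub>0) * real_of_int \<bar>k\<bar>" using False by (intro mult_left_mono) auto
      then show ?thesis using y_bound[OF tT(2), of j k] by simp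
    qed
    have "exp (- (?\<kappa> * (t - t\<^sub>0))) * norm (y j k t\<^sub>0) \<le> (32 / \<eta>\<^sup>2 * wt k powr (- (\<sigma> + 2))) * H"
      using e y0 by (intro mult_mono) auto
    moreover have "?b / ?\<kappa> \<le> 4 * B * wt k powr (- (\<sigma> + 2))"
    proof -
      have "?b / ?\<kappa> \<le> 4 * ?b * wt k powr (- 2)" using B0 by (intro divide_square_le_wt False) auto
      also have "\<dots> = 4 * B * (wt k powr (- \<sigma>) * wt k powr (- 2))" by simp
      also have "wt k powr (- \<sigma>) * wt k powr (- 2) = wt k powr (- (\<sigma> + 2))" by (simp only: powr_add[symmetric]) simp
      finally show ?thesis .
    qed
    ultimately show ?thesis using 1 by (simp add: algebra_simps)
  qed
qed

end

section \<open>Bootstrap\<close>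

text \<open>Four steps, each lasting a quarter of the waiting time, improve the decay of the solution from
  \<open>\<bar>k\<bar> powr -1\<close> to \<open>\<bar>k\<bar> powr -2\<close>, \<open>-5/2\<close>, \<open>-7/2\<close> and \<open>-4\<close>.\<close>

theorem (in kernel) bootstrap:
  assumes \<epsilon>: "\<epsilon> > 0"
  shows "\<exists>B C. \<forall>T \<tau>\<^sub>0 \<tau>. solution K h p m A \<delta> H T \<tau>\<^sub>0 \<tau> \<longrightarrow> (\<forall>t\<in>{\<epsilon>..T}. \<forall>j k.
     norm (cf (\<tau> t) j k) \<le> B * wt k powr (- 4) \<and>
     norm (cf (nonlinearity K (\<tau> t) (weak_deriv (\<tau> t))) j k) \<le> C * wt k powr (- 2))"
proof -
  define \<eta> where "\<eta> = \<epsilon> / 4"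
  have \<eta>: "\<eta> > 0" using \<epsilon> by (simp add: \<eta>_def)
  define N0 where "N0 = NB m g p A \<delta> H"
  define B1 where "B1 = 32 * H / \<eta>\<^sup>2 + 4 * N0"
  obtain N1 where N1: "nonlinear_decay A \<delta> H B1 2 (FB m g p \<delta> H) 1 N1 (1/2)"
    using decay_step[of 2 "1/2" 1 A \<delta> H B1 "FB m g p \<delta> H"] by auto
  define B2 where "B2 = 32 * H / \<eta>\<^sup>2 + 4 * N1"
  \<comment> \<open>From here on the tangent is Lipschitz and \<open>F\<close> has decay \<open>2\<close>.\<close>
  define F2 where "F2 = gB g p * B2 + 4 * (nlL m g \<delta> (3 * (B2 * W (5/2 - 1))) * pint (2 * real m - 2 * p) * (pi / 2))"
  obtain N2 where N2: "nonlinear_decay A \<delta> H B2 (5/2) F2 2 N2 (3/2)"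
    using decay_step[of "5/2" "3/2" 2 A \<delta> H B2 F2] by auto
  define B3 where "B3 = 32 * H / \<eta>\<^sup>2 + 4 * N2"
  obtain N3 where N3: "nonlinear_decay A \<delta> H B3 (7/2) F2 2 N3 2"
    using decay_step[of "7/2" 2 2 A \<delta> H B3 F2] by auto
  define B4 where "B4 = 32 * H / \<eta>\<^sup>2 + 4 * N3"
  show ?thesis
  proof (rule exI[of _ B4], rule exI[of _ N3], intro allI impI ballI)
    fix T \<tau>\<^sub>0 \<tau> t j k
    assume sol: "solution K h p m A \<delta> H T \<tau>\<^sub>0 \<tau>" and t: "t \<in> {\<epsilon>..T}"
    interpret solution K h p m A \<delta> H T \<tau>\<^sub>0 \<tau> by (rule sol)
    have n0: "norm (n j k s) \<le> N0 * wt k powr (- 0)" if "s \<in> {0..T}" for j k s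
      using n_bound[OF that] wt_pos[of k] by (simp add: N0_def)
    have y1: "norm (y j k s) \<le> B1 * wt k powr (- 2)" if "s \<in> {\<eta>..T}" for j k s
      using parabolic_gain[of 0 \<eta> 0 j N0 s k] n0 \<eta> that by (simp add: B1_def)
    have n1: "norm (n j k s) \<le> N1 * wt k powr (- (1/2))" if s: "s \<in> {\<eta>..T}" for j k s
      unfolding n_def N_def
    proof (rule nonlinear_decay[OF N1])
      show "good_state A \<delta> H (\<tau> s)" using s \<eta> by (intro gs) auto
      then show "norm (cf (F (\<tau> s)) j k) \<le> FB m g p \<delta> H * wt k powr (- 1)" for j k
        by (rule bigF_coeff_bound(1))
      show "norm (cf (\<tau> s) j k) \<le> B1 * wt k powr (- 2)" for j k using y1[OF s] by (simp add: y_def)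
    qed
    have y2: "norm (y j k s) \<le> B2 * wt k powr (- (5/2))" if "s \<in> {2 * \<eta>..T}" for j k s
      using parabolic_gain[of \<eta> \<eta> "1/2" j N1 s k] n1 \<eta> that by (simp add: B2_def)
    have F2b: "norm (cf (F (\<tau> s)) j k) \<le> F2 * wt k powr (- 2)" if s: "s \<in> {2 * \<eta>..T}" for j k s
      unfolding F2_def
    proof (rule bigF_decay)
      show "good_state A \<delta> H (\<tau> s)" using s \<eta> by (intro gs) auto
      show "norm (cf (\<tau> s) j k) \<le> B2 * wt k powr (- (5/2))" for j k using y2[OF s] by (simp add: y_def)
    qed simp
    have n2: "norm (n j k s) \<le> N2 * wt k powr (- (3/2))" if s: "s \<in> {2 * \<eta>..T}" for j k s
      unfolding n_def N_def
    proof (rule nonlinear_decay[OF N2])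
      show "good_state A \<delta> H (\<tau> s)" using s \<eta> by (intro gs) auto
      show "norm (cf (\<tau> s) j k) \<le> B2 * wt k powr (- (5/2))" for j k using y2[OF s] by (simp add: y_def)
    qed (rule F2b[OF s])
    have y3: "norm (y j k s) \<le> B3 * wt k powr (- (7/2))" if "s \<in> {3 * \<eta>..T}" for j k s
      using parabolic_gain[of "2 * \<eta>" \<eta> "3/2" j N2 s k] n2 \<eta> that by (simp add: B3_def)
    have n3: "norm (n j k s) \<le> N3 * wt k powr (- 2)" if s: "s \<in> {3 * \<eta>..T}" for j k s
      unfolding n_def N_def
    proof (rule nonlinear_decay[OF N3])
      show "good_state A \<delta> H (\<tau> s)" using s \<eta> by (intro gs) auto
      show "norm (cf (\<tau> s) j k) \<le> B3 * wt k powr (- (7/2))" for j k using y3[OF s] by (simp add: y_def)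
      show "norm (cf (F (\<tau> s)) j k) \<le> F2 * wt k powr (- 2)" for j k
        using s \<eta> by (intro F2b) auto
    qed
    have y4: "norm (y j k s) \<le> B4 * wt k powr (- 4)" if "s \<in> {4 * \<eta>..T}" for j k s
      using parabolic_gain[of "3 * \<eta>" \<eta> 2 j N3 s k] n3 \<eta> that by (simp add: B4_def)
    have "t \<in> {4 * \<eta>..T}" "t \<in> {3 * \<eta>..T}" using t \<epsilon> by (auto simp: \<eta>_def)
    then show "norm (cf (\<tau> t) j k) \<le> B4 * wt k powr (- 4) \<and>
       norm (cf (nonlinearity K (\<tau> t) (weak_deriv (\<tau> t))) j k) \<le> N3 * wt k powr (- 2)"
      using y4[of t j k] n3[of t j k] by (simp add: y_def n_def N_def)
  qed
qed

section \<open>Real vector valued Fourier series and Sobolev norms\<close>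

definition vser :: "(3 \<Rightarrow> int \<Rightarrow> complex) \<Rightarrow> real \<Rightarrow> real^3" where
  "vser c x = (\<chi> j. Re (fser (c j) x))"

lemma
  assumes s: "\<And>j. (\<lambda>k. norm (c j k)) summable_on UNIV" and r: "\<And>j k. c j (- k) = cnj (c j k)"
  shows cmp_vser: "cmp (vser c) j = fser (c j)"
    and fc_vser: "cf (vser c) j k = c j k"
    and vser_continuous: "continuous_on UNIV (vser c)"
    and vser_per2pi: "per2pi (vser c)"
    and vser_L2: "L2_circle (vser c)"
proof -
  show e: "cmp (vser c) j = fser (c j)" for j
    by (rule ext) (simp add: cmp_def vser_def fser_real[of "c j" for j, OF r])
  show "cf (vser c) j k = c j k" unfolding e by (rule fc_fser[OF s])
  show c: "continuous_on UNIV (vser c)" unfolding continuous_vec_cmp e using continuous_fser[OF s] by blast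
  show p: "per2pi (vser c)" by (simp add: per2pi_def vser_def fser_periodic)
  show "L2_circle (vser c)" unfolding L2_circle_iff e using p by (auto intro: circ_L2_continuous continuous_fser s)
qed

lemma norm_fourier_le:
  assumes "\<And>j. norm (cf f j k) \<le> B" shows "norm (fourier f k) \<le> 3 * B"
proof -
  have "norm (fourier f k) \<le> (\<Sum>j\<in>UNIV. norm (fourier f k $ j))" by (rule norm_vec_le_sum)
  also have "\<dots> \<le> (\<Sum>j\<in>(UNIV::3 set). B)" by (intro sum_mono) (simp add: fourier_nth assms)
  finally show ?thesis by simp
qed

lemma weighted_coeff_le:
  assumes b: "\<And>j. norm (cf f j k) \<le> B * wt k powr (- b)" and s: "s \<ge> 0"
  shows "real_of_int \<bar>k\<bar> powr (2 * s) * (norm (fourier f k))\<^sup>2 \<le> (3 * B)\<^sup>2 * wt k powr (- (2 * b - 2 * s))"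
proof -
  have "norm (fourier f k) \<le> 3 * (B * wt k powr (- b))" by (rule norm_fourier_le[OF b])
  then have "(norm (fourier f k))\<^sup>2 \<le> (3 * (B * wt k powr (- b)))\<^sup>2" by (intro power_mono) auto
  also have "\<dots> = (3 * B)\<^sup>2 * (wt k powr (- b + - b))"
    unfolding powr_add by (simp add: power2_eq_square mult_ac)
  finally have 1: "(norm (fourier f k))\<^sup>2 \<le> (3 * B)\<^sup>2 * wt k powr (- b + - b)" .
  have "real_of_int \<bar>k\<bar> powr (2 * s) \<le> wt k powr (2 * s)"
    using s abs_le_wt[of k] by (intro powr_mono2) auto
  then have "real_of_int \<bar>k\<bar> powr (2 * s) * (norm (fourier f k))\<^sup>2 \<le> wt k powr (2 * s) * ((3 * B)\<^sup>2 * wt k powr (- b + - b))"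
    using 1 by (intro mult_mono) auto
  also have "\<dots> = (3 * B)\<^sup>2 * (wt k powr (2 * s) * wt k powr (- b + - b))" by simp
  also have "wt k powr (2 * s) * wt k powr (- b + - b) = wt k powr (- (2 * b - 2 * s))"
    by (simp only: powr_add[symmetric]) simp
  finally show ?thesis .
qed

lemma H_spaceI:
  assumes "continuous_on UNIV f" "L2_circle f" "\<And>j k. norm (cf f j k) \<le> B * wt k powr (- b)" "s \<ge> 0" "2 * b - 2 * s > 1"
  shows "f \<in> H_space s"
proof -
  have "(\<lambda>k. real_of_int \<bar>k\<bar> powr (2 * s) * (norm (fourier f k))\<^sup>2) summable_on UNIV"
    by (rule summable_on_comparison_test[OF summable_on_cmult_right[OF summable_wt[OF assms(5)], of "(3 * B)\<^sup>2"]])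
       (use weighted_coeff_le[OF assms(3,4)] in auto)
  then show ?thesis using assms by (simp add: H_space_def)
qed

lemma H_norm_le:
  assumes b: "\<And>j k. norm (cf f j k) \<le> B * wt k powr (- b)" and s: "s \<ge> 0" "2 * b - 2 * s > 1"
    and z: "fourier f 0 = 0" and B: "B \<ge> 0"
  shows "H_norm s f \<le> 3 * B * sqrt (W (2 * b - 2 * s))"
proof -
  let ?d = "\<lambda>k. (3 * B)\<^sup>2 * wt k powr (- (2 * b - 2 * s))"
  have d: "?d summable_on UNIV" by (intro summable_on_cmult_right summable_wt s)
  have sm: "(\<lambda>k. real_of_int \<bar>k\<bar> powr (2 * s) * (norm (fourier f k))\<^sup>2) summable_on UNIV"
    by (rule summable_on_comparison_test[OF d]) (use weighted_coeff_le[OF b s(1)] in auto)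
  have "(\<Sum>\<^sub>\<infinity>k. real_of_int \<bar>k\<bar> powr (2 * s) * (norm (fourier f k))\<^sup>2) \<le> (\<Sum>\<^sub>\<infinity>k. ?d k)"
    by (intro infsum_mono sm d weighted_coeff_le[OF b s(1)])
  also have "\<dots> = (3 * B)\<^sup>2 * W (2 * b - 2 * s)" by (simp add: infsum_cmult_right' W_def)
  finally have "Hdot_norm s f \<le> sqrt ((3 * B)\<^sup>2 * W (2 * b - 2 * s))"
    unfolding Hdot_norm_def by (rule real_sqrt_le_mono)
  also have "\<dots> = 3 * B * sqrt (W (2 * b - 2 * s))" using B by (simp add: real_sqrt_mult)
  finally have h: "Hdot_norm s f \<le> 3 * B * sqrt (W (2 * b - 2 * s))" .
  have "0 \<le> Hdot_norm s f" unfolding Hdot_norm_def by (auto intro: infsum_nonneg)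
  then have "H_norm s f = Hdot_norm s f" by (simp add: H_norm_def z)
  then show ?thesis using h by simp
qed

lemma H_norm_tendsto_0:
  assumes c: "\<And>j k. ((\<lambda>r. cf (f r) j k) \<longlongrightarrow> 0) F"
    and b: "\<forall>\<^sub>F r in F. \<forall>j k. norm (cf (f r) j k) \<le> B * wt k powr (- b)" and s: "s \<ge> 0" "2 * b - 2 * s > 1"
  shows "((\<lambda>r. H_norm s (f r)) \<longlongrightarrow> 0) F"
proof -
  have n0: "((\<lambda>r. norm (fourier (f r) k)) \<longlongrightarrow> 0) F" for k
  proof (rule tendsto_norm_zero, rule vec_tendstoI)
    show "((\<lambda>r. fourier (f r) k $ j) \<longlongrightarrow> 0 $ j) F" for j using c by (simp add: fourier_nth)
  qed
  have "((\<lambda>r. \<Sum>\<^sub>\<infinity>k. real_of_int \<bar>k\<bar> powr (2 * s) * (norm (fourier (f r) k))\<^sup>2) \<longlongrightarrow> (\<Sum>\<^sub>\<infinity>k::int. real_of_int \<bar>k\<bar> powr (2 * s) * 0\<^sup>2)) F"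
  proof (rule infsum_tendsto_dominated)
    show "(\<lambda>k. (3 * B)\<^sup>2 * wt k powr (- (2 * b - 2 * s))) summable_on UNIV"
      by (intro summable_on_cmult_right summable_wt s)
    show "\<forall>\<^sub>F r in F. \<forall>k. norm (real_of_int \<bar>k\<bar> powr (2 * s) * (norm (fourier (f r) k))\<^sup>2) \<le> (3 * B)\<^sup>2 * wt k powr (- (2 * b - 2 * s))"
      using b
    proof eventually_elim
      case (elim r)
      then have "real_of_int \<bar>k\<bar> powr (2 * s) * (norm (fourier (f r) k))\<^sup>2 \<le> (3 * B)\<^sup>2 * wt k powr (- (2 * b - 2 * s))" for k
        using s by (intro weighted_coeff_le) auto
      then show ?case by simp
    qed
    show "((\<lambda>r. real_of_int \<bar>k\<bar> powr (2 * s) * (norm (fourier (f r) k))\<^sup>2) \<longlongrightarrow> real_of_int \<bar>k\<bar> powr (2 * s) * 0\<^sup>2) F" for k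
      by (intro tendsto_intros n0)
  qed
  then have 1: "((\<lambda>r. \<Sum>\<^sub>\<infinity>k. real_of_int \<bar>k\<bar> powr (2 * s) * (norm (fourier (f r) k))\<^sup>2) \<longlongrightarrow> 0) F" by simp
  have "((\<lambda>r. sqrt ((norm (fourier (f r) 0))\<^sup>2 + (sqrt (\<Sum>\<^sub>\<infinity>k. real_of_int \<bar>k\<bar> powr (2 * s) * (norm (fourier (f r) k))\<^sup>2))\<^sup>2)) \<longlongrightarrow> sqrt (0\<^sup>2 + (sqrt 0)\<^sup>2)) F"
    by (intro tendsto_intros n0 1)
  then show ?thesis unfolding H_norm_def Hdot_norm_def by simp
qed

section \<open>The solution is classical\<close>

abbreviation dq :: "(real \<Rightarrow> 'a::real_normed_vector) \<Rightarrow> real \<Rightarrow> real \<Rightarrow> 'a" where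
  "dq f t r \<equiv> (1 / (r - t)) *\<^sub>R (f r - f t)"

text \<open>The \<open>C\<^sup>1\<close> regularity in \<open>H\<^sup>1\<close> is stated with difference quotients, the equation with derivatives.\<close>

lemma has_vector_derivative_iff_quotient:
  "(f has_vector_derivative D) (at t within S) \<longleftrightarrow> (dq f t \<longlongrightarrow> D) (at t within S)"
proof -
  have "norm ((1 / norm (r - t)) *\<^sub>R (f r - (f t + (r - t) *\<^sub>R D))) = norm (dq f t r - D)" if "r \<noteq> t" for r
  proof -
    have "dq f t r - D = (1 / (r - t)) *\<^sub>R (f r - (f t + (r - t) *\<^sub>R D))"
      using that by (simp add: scaleR_diff_right scaleR_add_right)
    then show ?thesis by simp
  qed
  then have "((\<lambda>r. norm ((1 / norm (r - t)) *\<^sub>R (f r - (f t + (r - t) *\<^sub>R D)))) \<longlongrightarrow> 0) (at t within S)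
      \<longleftrightarrow> ((\<lambda>r. norm (dq f t r - D)) \<longlongrightarrow> 0) (at t within S)"
    by (intro Lim_cong_within) auto
  then have "((\<lambda>r. (1 / norm (r - t)) *\<^sub>R (f r - (f t + (r - t) *\<^sub>R D))) \<longlongrightarrow> 0) (at t within S)
      \<longleftrightarrow> (dq f t \<longlongrightarrow> D) (at t within S)"
    unfolding tendsto_norm_zero_iff LIM_zero_iff .
  then show ?thesis
    unfolding has_vector_derivative_def has_derivative_within using bounded_linear_scaleR_left by blast
qed

context solution
begin

abbreviation "near t \<equiv> at t within {0<..T}"

definition y' :: "3 \<Rightarrow> int \<Rightarrow> real \<Rightarrow> complex" where
  "y' j k t = - ((of_int k)\<^sup>2 *\<^sub>R y j k t) + n j k t"

definition \<tau>' :: "real \<Rightarrow> real \<Rightarrow> real^3" where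
  "\<tau>' t = vser (\<lambda>j k. y' j k t)"

lemma decay:
  assumes "\<epsilon> > 0"
  obtains B C where "B \<ge> 0" "C \<ge> 0"
    "\<And>t j k. t \<in> {\<epsilon>..T} \<Longrightarrow> norm (y j k t) \<le> B * wt k powr (- 4)"
    "\<And>t j k. t \<in> {\<epsilon>..T} \<Longrightarrow> norm (n j k t) \<le> C * wt k powr (- 2)"
    "\<And>t j k. t \<in> {\<epsilon>..T} \<Longrightarrow> norm (y' j k t) \<le> (B + C) * wt k powr (- 2)"
    "\<And>t j k. t \<in> {\<epsilon>..T} \<Longrightarrow> norm ((of_int k)\<^sup>2 *\<^sub>R y j k t) \<le> B * wt k powr (- 2)"
proof -
  obtain B0 C0 where BC: "\<forall>T \<tau>\<^sub>0 \<tau>. solution K h p m A \<delta> H T \<tau>\<^sub>0 \<tau> \<longrightarrow> (\<forall>t\<in>{\<epsilon>..T}. \<forall>j k.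
     norm (cf (\<tau> t) j k) \<le> B0 * wt k powr (- 4) \<and>
     norm (cf (nonlinearity K (\<tau> t) (weak_deriv (\<tau> t))) j k) \<le> C0 * wt k powr (- 2))"
    using bootstrap[OF assms] by blast
  define B C where "B = max B0 0" and "C = max C0 0"
  have 0: "B \<ge> 0" "C \<ge> 0" by (auto simp: B_def C_def)
  have y4: "norm (y j k t) \<le> B * wt k powr (- 4)" and n2: "norm (n j k t) \<le> C * wt k powr (- 2)" if t: "t \<in> {\<epsilon>..T}" for t j k
  proof -
    have "solution K h p m A \<delta> H T \<tau>\<^sub>0 \<tau>" by unfold_locales
    then have "norm (y j k t) \<le> B0 * wt k powr (- 4)" "norm (n j k t) \<le> C0 * wt k powr (- 2)"
      using BC t unfolding y_def n_def N_def by blast+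
    moreover have "B0 * wt k powr (- 4) \<le> B * wt k powr (- 4)" "C0 * wt k powr (- 2) \<le> C * wt k powr (- 2)"
      by (auto simp: B_def C_def intro!: mult_right_mono)
    ultimately show "norm (y j k t) \<le> B * wt k powr (- 4)" "norm (n j k t) \<le> C * wt k powr (- 2)" by linarith+
  qed
  have k2: "norm ((of_int k)\<^sup>2 *\<^sub>R y j k t) \<le> B * wt k powr (- 2)" if t: "t \<in> {\<epsilon>..T}" for t j k
  proof -
    have "(real_of_int k)\<^sup>2 \<le> (wt k)\<^sup>2" using abs_le_wt[of k] by (metis abs_le_square_iff abs_of_pos of_int_abs wt_pos)
    then have "(real_of_int k)\<^sup>2 * norm (y j k t) \<le> (wt k)\<^sup>2 * (B * wt k powr (- 4))"
      using y4[OF t, of j k] by (intro mult_mono) auto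
    also have "(wt k)\<^sup>2 = wt k powr 2" using wt_pos[of k] by (simp add: powr_numeral)
    also have "wt k powr 2 * (B * wt k powr (- 4)) = B * (wt k powr 2 * wt k powr (- 4))" by simp
    also have "wt k powr 2 * wt k powr (- 4) = wt k powr (- 2)" by (simp only: powr_add[symmetric]) simp
    finally show ?thesis by simp
  qed
  have yp: "norm (y' j k t) \<le> (B + C) * wt k powr (- 2)" if t: "t \<in> {\<epsilon>..T}" for t j k
  proof -
    have "norm (y' j k t) \<le> norm ((of_int k)\<^sup>2 *\<^sub>R y j k t) + norm (n j k t)"
      unfolding y'_def by (rule order_trans[OF norm_triangle_ineq]) simp
    then show ?thesis using k2[OF t, of k j] n2[OF t, of j k] by (simp add: distrib_right)
  qed
  show ?thesis by (rule that[OF 0 y4 n2 yp k2])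
qed

lemma decay_at:
  assumes "t \<in> {0<..T}"
  obtains B where "B \<ge> 0" "\<And>j k. norm (y j k t) \<le> B * wt k powr (- 4)" "\<And>j k. norm (n j k t) \<le> B * wt k powr (- 2)"
    "\<And>j k. norm (y' j k t) \<le> B * wt k powr (- 2)"
    "\<And>j k. norm ((of_int k)\<^sup>2 *\<^sub>R y j k t) \<le> B * wt k powr (- 2)"
proof -
  have t: "t > 0" "t \<in> {t..T}" using assms by auto
  obtain B C where B: "B \<ge> 0" "C \<ge> 0" "\<And>j k. norm (y j k t) \<le> B * wt k powr (- 4)" "\<And>j k. norm (n j k t) \<le> C * wt k powr (- 2)"
    "\<And>j k. norm (y' j k t) \<le> (B + C) * wt k powr (- 2)" "\<And>j k. norm ((of_int k)\<^sup>2 *\<^sub>R y j k t) \<le> B * wt k powr (- 2)"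
    using decay[OF t(1)] t(2) by metis
  have w: "B * x \<le> (B + C) * x" "C * x \<le> (B + C) * x" if "x \<ge> 0" for x
    using B(1,2) that by (auto simp: distrib_right)
  show ?thesis
  proof (rule that[of "B + C"])
    show "norm (y j k t) \<le> (B + C) * wt k powr (- 4)" for j k by (rule order_trans[OF B(3) w(1)]) simp
    show "norm (n j k t) \<le> (B + C) * wt k powr (- 2)" for j k by (rule order_trans[OF B(4) w(2)]) simp
    show "norm ((of_int k)\<^sup>2 *\<^sub>R y j k t) \<le> (B + C) * wt k powr (- 2)" for j k
      by (rule order_trans[OF B(6) w(1)]) simp
  qed (use B in auto)
qed

lemma y'_uminus: "y' j (- k) t = cnj (y' j k t)"
  by (simp add: y'_def y_uminus n_uminus)

lemma state_H: "t \<in> {0..T} \<Longrightarrow> \<tau> t \<in> H_space 1"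
  by (rule good_stateD(2)[OF gs])

lemma H3:
  assumes "t \<in> {0<..T}" shows "\<tau> t \<in> H_space 3"
proof -
  obtain B where "\<And>j k. norm (y j k t) \<le> B * wt k powr (- 4)" using decay_at[OF assms] by metis
  then show ?thesis
    using H_spaceD(1,2)[OF state_H, of t] assms by (intro H_spaceI[of _ B 4]) (auto simp: y_def)
qed

lemma y'_tendsto:
  assumes t: "t \<in> {0<..T}"
  shows "((\<lambda>r. y j k r) \<longlongrightarrow> y j k t) (near t)" "((\<lambda>r. y' j k r) \<longlongrightarrow> y' j k t) (near t)"
proof -
  have yc: "(y j k \<longlongrightarrow> y j k t) (near t)"
    by (rule tendsto_within_subset[of _ _ _ "{0..T}"]) (use y_continuous[of j k] t in \<open>auto simp: continuous_on_def\<close>)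
  then show "((\<lambda>r. y j k r) \<longlongrightarrow> y j k t) (near t)" .
  have nc: "(n j k \<longlongrightarrow> n j k t) (near t)"
    by (rule tendsto_within_subset[of _ _ _ "{0..T}"]) (use n_continuous[of j k] t in \<open>auto simp: continuous_on_def\<close>)
  show "((\<lambda>r. y' j k r) \<longlongrightarrow> y' j k t) (near t)"
    unfolding y'_def by (intro tendsto_intros yc nc)
qed

text \<open>The decay estimates are uniform only away from time zero.\<close>

lemma eventually_late:
  assumes t: "t \<in> {0<..T}"
  shows "\<forall>\<^sub>F r in near t. r \<in> {t / 2..T}"
proof -
  have "\<forall>\<^sub>F r in near t. r \<in> {t/2<..}"
    using t by (intro topological_tendstoD[OF tendsto_ident_at]) auto
  moreover have "\<forall>\<^sub>F r in near t. r \<in> {0<..T}" by (simp add: eventually_at_filter)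
  ultimately show ?thesis by eventually_elim auto
qed

lemma fc_time_diff:
  assumes "r \<in> {0..T}" "t \<in> {0..T}"
  shows "cf (\<lambda>x. \<tau> r x - \<tau> t x) j k = y j k r - y j k t"
  unfolding y_def by (rule H_space_diff(2)[OF state_H[OF assms(1)] state_H[OF assms(2)]])

lemma C_into_H3: "C_into_H 3 {0<..T} \<tau>"
  unfolding C_into_H_def
proof (intro ballI conjI H3)
  fix t assume t: "t \<in> {0<..T}"
  then have t2: "t / 2 > 0" by simp
  obtain B where B: "\<And>r j k. r \<in> {t/2..T} \<Longrightarrow> norm (y j k r) \<le> B * wt k powr (- 4)"
    using decay[OF t2] by metis
  show "((\<lambda>r. H_norm 3 (\<lambda>x. \<tau> r x - \<tau> t x)) \<longlongrightarrow> 0) (near t)"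
  proof (rule H_norm_tendsto_0[of _ _ "2 * B" 4])
    show "((\<lambda>r. cf (\<lambda>x. \<tau> r x - \<tau> t x) j k) \<longlongrightarrow> 0) (near t)" for j k
    proof (rule Lim_transform_eventually)
      show "((\<lambda>r. y j k r - y j k t) \<longlongrightarrow> 0) (near t)"
        using tendsto_diff[OF y'_tendsto(1)[OF t, of j k] tendsto_const[of "y j k t"]] by simp
      show "\<forall>\<^sub>F r in near t. y j k r - y j k t = cf (\<lambda>x. \<tau> r x - \<tau> t x) j k"
        using eventually_late[OF t] by eventually_elim (use t in \<open>auto simp: fc_time_diff\<close>)
    qed
    show "\<forall>\<^sub>F r in near t. \<forall>j k. norm (cf (\<lambda>x. \<tau> r x - \<tau> t x) j k) \<le> 2 * B * wt k powr (- 4)"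
      using eventually_late[OF t]
    proof eventually_elim
      case (elim r)
      have "norm (y j k r - y j k t) \<le> 2 * B * wt k powr (- 4)" for j k
        using norm_triangle_ineq4[of "y j k r" "y j k t"] B[OF elim, of j k] B[of t j k] t by auto
      then show ?case using elim t by (auto simp: fc_time_diff)
    qed
  qed auto
qed

lemma C_into_H1: "C_into_H 1 {0<..T} \<tau>"
  using mild unfolding mild_solution_def C_into_H_def
  by (auto intro: tendsto_within_subset[of _ _ _ "{0..T}"])

lemma y'_summable:
  assumes t: "t \<in> {0<..T}"
  shows "(\<lambda>k. norm (y' j k t)) summable_on UNIV" "(\<lambda>k. norm (n j k t)) summable_on UNIV"
    "(\<lambda>k. norm (- ((of_int k)\<^sup>2 *\<^sub>R y j k t))) summable_on UNIV"
    "(\<lambda>k. norm (\<i> * of_int k * y j k t)) summable_on UNIV"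
    "(\<lambda>k. norm (y j k t)) summable_on UNIV"
proof -
  obtain B where B: "B \<ge> 0" "\<And>j k. norm (y j k t) \<le> B * wt k powr (- 4)" "\<And>j k. norm (n j k t) \<le> B * wt k powr (- 2)"
    "\<And>j k. norm (y' j k t) \<le> B * wt k powr (- 2)"
    "\<And>j k. norm ((of_int k)\<^sup>2 *\<^sub>R y j k t) \<le> B * wt k powr (- 2)" using decay_at[OF t] by metis
  show "(\<lambda>k. norm (y' j k t)) summable_on UNIV" by (rule summable_wt_bound[OF B(4)]) simp
  show "(\<lambda>k. norm (n j k t)) summable_on UNIV" by (rule summable_wt_bound[OF B(3)]) simp
  show "(\<lambda>k. norm (y j k t)) summable_on UNIV" by (rule summable_wt_bound[OF B(2)]) simp
  show a: "(\<lambda>k. norm (- ((of_int k)\<^sup>2 *\<^sub>R y j k t))) summable_on UNIV"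
    unfolding norm_minus_cancel by (rule summable_wt_bound[OF B(5)]) simp
  show "(\<lambda>k. norm (\<i> * of_int k * y j k t)) summable_on UNIV"
  proof (rule summable_on_comparison_test[OF a])
    fix k :: int
    have "\<bar>real_of_int k\<bar> \<le> (real_of_int k)\<^sup>2"
    proof (cases "k = 0")
      case False
      then have "1 \<le> \<bar>real_of_int k\<bar>" by (simp flip: of_int_abs)
      then show ?thesis using mult_left_mono[of 1 "\<bar>real_of_int k\<bar>" "\<bar>real_of_int k\<bar>"] by (simp add: power2_eq_square)
    qed simp
    then show "norm (\<i> * of_int k * y j k t) \<le> norm (- ((of_int k)\<^sup>2 *\<^sub>R y j k t))"
      by (simp add: norm_mult mult_right_mono)
  qed simp
qed

lemma fc_\<tau>': "t \<in> {0<..T} \<Longrightarrow> cf (\<tau>' t) j k = y' j k t"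
  unfolding \<tau>'_def by (rule fc_vser[OF y'_summable(1) y'_uminus])

lemma \<tau>'_H1: "t \<in> {0<..T} \<Longrightarrow> \<tau>' t \<in> H_space 1"
proof -
  assume t: "t \<in> {0<..T}"
  obtain B where B: "\<And>j k. norm (y' j k t) \<le> B * wt k powr (- 2)" using decay_at[OF t] by metis
  show ?thesis
  proof (rule H_spaceI[of _ B 2])
    show "continuous_on UNIV (\<tau>' t)" unfolding \<tau>'_def by (rule vser_continuous[OF y'_summable(1)[OF t] y'_uminus])
    show "L2_circle (\<tau>' t)" unfolding \<tau>'_def by (rule vser_L2[OF y'_summable(1)[OF t] y'_uminus])
  qed (use B fc_\<tau>'[OF t] in auto)
qed

lemma C_into_H_\<tau>': "C_into_H 1 {0<..T} \<tau>'"
  unfolding C_into_H_def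
proof (intro ballI conjI \<tau>'_H1)
  fix t assume t: "t \<in> {0<..T}"
  then have t2: "t / 2 > 0" by simp
  obtain B where B: "\<And>r j k. r \<in> {t/2..T} \<Longrightarrow> norm (y' j k r) \<le> B * wt k powr (- 2)"
    using decay[OF t2] by metis
  have fcd: "cf (\<lambda>x. \<tau>' r x - \<tau>' t x) j k = y' j k r - y' j k t" if "r \<in> {t/2..T}" for r j k
    using H_space_diff(2)[OF \<tau>'_H1 \<tau>'_H1, of r t j k] that t t2 fc_\<tau>'[of r j k] fc_\<tau>'[OF t, of j k] by auto
  show "((\<lambda>r. H_norm 1 (\<lambda>x. \<tau>' r x - \<tau>' t x)) \<longlongrightarrow> 0) (near t)"
  proof (rule H_norm_tendsto_0[of _ _ "2 * B" 2])
    show "((\<lambda>r. cf (\<lambda>x. \<tau>' r x - \<tau>' t x) j k) \<longlongrightarrow> 0) (near t)" for j k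
    proof (rule Lim_transform_eventually)
      show "((\<lambda>r. y' j k r - y' j k t) \<longlongrightarrow> 0) (near t)"
        using tendsto_diff[OF y'_tendsto(2)[OF t, of j k] tendsto_const[of "y' j k t"]] by simp
      show "\<forall>\<^sub>F r in near t. y' j k r - y' j k t = cf (\<lambda>x. \<tau>' r x - \<tau>' t x) j k"
        using eventually_late[OF t] by eventually_elim (simp add: fcd)
    qed
    show "\<forall>\<^sub>F r in near t. \<forall>j k. norm (cf (\<lambda>x. \<tau>' r x - \<tau>' t x) j k) \<le> 2 * B * wt k powr (- 2)"
      using eventually_late[OF t]
    proof eventually_elim
      case (elim r)
      have "norm (y' j k r - y' j k t) \<le> 2 * B * wt k powr (- 2)" for j k
        using norm_triangle_ineq4[of "y' j k r" "y' j k t"] B[OF elim, of j k] B[of t j k] t by auto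
      then show ?case using elim by (simp add: fcd)
    qed
  qed auto
qed

lemma y_derivative_within:
  assumes t: "t \<in> {0<..T}"
  shows "(dq (y j k) t \<longlongrightarrow> y' j k t) (near t)"
proof -
  have "t \<in> {0..T}" using t by auto
  from y_has_derivative[OF this, of j k] show ?thesis
    unfolding has_vector_derivative_iff_quotient y'_def by (rule tendsto_within_subset) auto
qed

text \<open>The mean value inequality bounds the quotients by the summable bound for the derivatives, which
  dominates the limit \<open>r \<rightarrow> t\<close>.\<close>

lemma y_quotient_bound:
  assumes t: "t \<in> {0<..T}" and r: "r \<in> {t/2..T}" and B: "\<And>s j k. s \<in> {t/2..T} \<Longrightarrow> norm (y' j k s) \<le> B * wt k powr (- 2)"
  shows "norm (dq (y j k) t r) \<le> B * wt k powr (- 2)"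
proof (cases "r = t")
  case True
  have "0 \<le> B * wt k powr (- 2)" using B[of t j k] t by (intro order_trans[OF norm_ge_zero]) auto
  then show ?thesis using True by simp
next
  case False
  have "norm (y j k r - y j k t) \<le> (B * wt k powr (- 2)) * norm (r - t)"
  proof (rule differentiable_bound[of "{t/2..T}" "y j k" "\<lambda>s d. d *\<^sub>R y' j k s"])
    fix s assume s: "s \<in> {t/2..T}"
    then have "s \<in> {0..T}" using t by auto
    from y_has_derivative[OF this, of j k]
    show "(y j k has_derivative (\<lambda>d. d *\<^sub>R y' j k s)) (at s within {t/2..T})"
      unfolding has_vector_derivative_def y'_def using t by (auto intro: has_derivative_subset)
    have "onorm (\<lambda>d. d *\<^sub>R y' j k s) \<le> norm (y' j k s)"
      by (rule onorm_bound) (auto simp: mult.commute)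
    then show "onorm (\<lambda>d. d *\<^sub>R y' j k s) \<le> B * wt k powr (- 2)" using B[OF s, of j k] by linarith
  qed (use t r in auto)
  then have "norm (y j k r - y j k t) / \<bar>r - t\<bar> \<le> B * wt k powr (- 2)"
    using False by (simp add: pos_divide_le_eq)
  then show ?thesis by simp
qed

lemma C1_into_H1: "C1_into_H 1 {0<..T} \<tau>"
  unfolding C1_into_H_def
proof (intro conjI C_into_H1 exI[of _ \<tau>'] C_into_H_\<tau>' ballI)
  fix t assume t: "t \<in> {0<..T}"
  then have t2: "t / 2 > 0" and tT: "t \<in> {0..T}" by auto
  let ?q = "\<lambda>r x. dq (\<lambda>r. \<tau> r x) t r - \<tau>' t x"
  obtain B where B: "\<And>r j k. r \<in> {t/2..T} \<Longrightarrow> norm (y' j k r) \<le> B * wt k powr (- 2)"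
    using decay[OF t2] by metis
  have fcd: "cf (?q r) j k = dq (y j k) t r - y' j k t"
    if "r \<in> {t/2..T}" for r j k
  proof -
    have rT: "r \<in> {0..T}" using that t by auto
    have e: "cmp (?q r) j
        = (\<lambda>x. of_real (1 / (r - t)) * cmp (\<lambda>x. \<tau> r x - \<tau> t x) j x - cmp (\<tau>' t) j x)"
      by (auto simp: cmp_def)
    have i1: "integrable circ (cmp (\<lambda>x. \<tau> r x - \<tau> t x) j)"
      by (intro circ_L2_imp_integrable H_spaceD(4)[OF H_space_diff(1)[OF state_H[OF rT] state_H[OF tT]]])
    have i2: "integrable circ (cmp (\<tau>' t) j)" by (intro circ_L2_imp_integrable H_spaceD(4)[OF \<tau>'_H1[OF t]])
    show ?thesis
      unfolding e fc_diff[OF integrable_mult_right[OF i1] i2] fc_mult_left fc_time_diff[OF rT tT] fc_\<tau>'[OF t]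
      by (simp only: scaleR_conv_of_real)
  qed
  show "((\<lambda>r. H_norm 1 (?q r)) \<longlongrightarrow> 0) (near t)"
  proof (rule H_norm_tendsto_0[of _ _ "2 * B" 2])
    show "((\<lambda>r. cf (?q r) j k) \<longlongrightarrow> 0) (near t)" for j k
    proof (rule Lim_transform_eventually)
      show "((\<lambda>r. dq (y j k) t r - y' j k t) \<longlongrightarrow> 0) (near t)"
        using tendsto_diff[OF y_derivative_within[OF t, of j k] tendsto_const[of "y' j k t"]] by simp
      show "\<forall>\<^sub>F r in near t. dq (y j k) t r - y' j k t = cf (?q r) j k"
        using eventually_late[OF t] by eventually_elim (simp only: fcd)
    qed
    show "\<forall>\<^sub>F r in near t. \<forall>j k. norm (cf (?q r) j k) \<le> 2 * B * wt k powr (- 2)"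
      using eventually_late[OF t]
    proof eventually_elim
      case (elim r)
      have "norm (dq (y j k) t r - y' j k t) \<le> 2 * B * wt k powr (- 2)" for j k
      proof -
        have "t \<in> {t/2..T}" using t by auto
        then show ?thesis
          using norm_triangle_ineq4[of "dq (y j k) t r" "y' j k t"] y_quotient_bound[OF t elim B, of j k] B[of t j k] by linarith
      qed
      then show ?case unfolding fcd[OF elim] by blast
    qed
  qed auto
qed

lemma time_derivative:
  assumes t: "t \<in> {0<..T}"
  shows "((\<lambda>s. \<tau> s x) has_vector_derivative \<tau>' t x) (near t)"
proof -
  let ?S = "\<lambda>j r. \<Sum>\<^sub>\<infinity>k. dq (y j k) t r * cis (of_int k * x)"
  from t have t2: "t / 2 > 0" by simp
  obtain B where B: "\<And>r j k. r \<in> {t/2..T} \<Longrightarrow> norm (y' j k r) \<le> B * wt k powr (- 2)"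
    using decay[OF t2] by metis
  have ser: "cmp (\<tau> r) j x = (\<Sum>\<^sub>\<infinity>k. y j k r * cis (of_int k * x))" if "r \<in> {t/2..T}" for r j
  proof -
    have r: "r \<in> {0<..T}" "r \<in> {0..T}" using that t by auto
    have "cmp (\<tau> r) j x = fser (cf (\<tau> r) j) x"
      using y'_summable(5)[OF r(1), of j] H_spaceD(5,6)[OF state_H[OF r(2)], of j] by (intro eq_fser) (auto simp: y_def)
    then show ?thesis by (simp add: fser_def y_def)
  qed
  have c: "(dq (\<lambda>r. cmp (\<tau> r) j x) t \<longlongrightarrow> cmp (\<tau>' t) j x) (near t)" for j
  proof (rule Lim_transform_eventually)
    have "(?S j \<longlongrightarrow> (\<Sum>\<^sub>\<infinity>k. y' j k t * cis (of_int k * x))) (near t)"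
    proof (rule infsum_tendsto_dominated)
      show "(\<lambda>k. B * wt k powr (- 2)) summable_on UNIV" by (intro summable_on_cmult_right summable_wt) simp
      show "((\<lambda>r. dq (y j k) t r * cis (of_int k * x)) \<longlongrightarrow> y' j k t * cis (of_int k * x)) (near t)" for k
        by (intro tendsto_mult tendsto_const y_derivative_within t)
      show "\<forall>\<^sub>F r in near t. \<forall>k. norm (dq (y j k) t r * cis (of_int k * x)) \<le> B * wt k powr (- 2)"
        using eventually_late[OF t]
      proof eventually_elim
        case (elim r)
        then show ?case using y_quotient_bound[OF t elim B] by (simp only: norm_mult norm_cis mult_1_right) blast
      qed
    qed
    then show "(?S j \<longlongrightarrow> cmp (\<tau>' t) j x) (near t)"
      unfolding \<tau>'_def cmp_vser[OF y'_summable(1)[OF t] y'_uminus] fser_def .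
    show "\<forall>\<^sub>F r in near t. ?S j r = dq (\<lambda>r. cmp (\<tau> r) j x) t r"
      using eventually_late[OF t]
    proof eventually_elim
      case (elim r)
      have r: "r \<in> {0<..T}" and tt: "t \<in> {t/2..T}" using elim t by auto
      have s: "(\<lambda>k. y j k q * cis (of_int k * x)) summable_on UNIV" if "q \<in> {0<..T}" for q
        by (rule abs_summable_summable[OF abs_summable_fser[OF y'_summable(5)[OF that]]])
      have "?S j r
          = (\<Sum>\<^sub>\<infinity>k. (1 / (r - t)) *\<^sub>R (y j k r * cis (of_int k * x) - y j k t * cis (of_int k * x)))"
        by (simp add: left_diff_distrib)
      also have "\<dots> = (1 / (r - t)) *\<^sub>R ((\<Sum>\<^sub>\<infinity>k. y j k r * cis (of_int k * x)) - (\<Sum>\<^sub>\<infinity>k. y j k t * cis (of_int k * x)))"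
        by (simp only: infsum_scaleR_right infsum_minus[OF s[OF r] s[OF t]])
      finally show ?case unfolding ser[OF elim] ser[OF tt] .
    qed
  qed
  have "(dq (\<lambda>r. \<tau> r x) t \<longlongrightarrow> \<tau>' t x) (near t)"
  proof (rule vec_tendstoI)
    fix j
    have "((\<lambda>r. Re (dq (\<lambda>r. cmp (\<tau> r) j x) t r)) \<longlongrightarrow> Re (cmp (\<tau>' t) j x)) (near t)"
      by (intro tendsto_Re c)
    then show "((\<lambda>r. (dq (\<lambda>r. \<tau> r x) t r) $ j) \<longlongrightarrow> \<tau>' t x $ j) (near t)"
      by (simp add: cmp_def)
  qed
  then show ?thesis unfolding has_vector_derivative_iff_quotient .
qed

text \<open>The first two derivatives in \<open>x\<close> are the sums of the differentiated series; that they are derivatives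
  is read off from the coefficients of their primitives.  The equation then holds because both sides
  are continuous and have the same coefficients.\<close>

lemma classical:
  assumes t: "t \<in> {0<..T}"
  shows "classical_at K T \<tau> t"
proof -
  have tT: "t \<in> {0..T}" using t by auto
  note gst = gs[OF tT]
  note gd = good_stateD[OF gst] and bp = bigF_props[OF good_stateD(1)[OF gst]]
  let ?c1 = "\<lambda>j k. \<i> * of_int k * y j k t" and ?c2 = "\<lambda>j k. - ((of_int k)\<^sup>2 *\<^sub>R y j k t)"
  define \<tau>x where "\<tau>x = vser ?c1"
  define \<tau>xx where "\<tau>xx = vser ?c2"
  have r1: "?c1 j (- k) = cnj (?c1 j k)" and r2: "?c2 j (- k) = cnj (?c2 j k)" for j k
    by (simp_all add: y_uminus)
  note s1 = y'_summable(4)[OF t] and s2 = y'_summable(3)[OF t]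
  note v1 = vser_continuous[of ?c1, OF s1 r1, folded \<tau>x_def] vser_L2[of ?c1, OF s1 r1, folded \<tau>x_def] vser_per2pi[of ?c1, OF s1 r1, folded \<tau>x_def]
  note v2 = vser_continuous[of ?c2, OF s2 r2, folded \<tau>xx_def] vser_L2[of ?c2, OF s2 r2, folded \<tau>xx_def]
  have f1: "cf \<tau>x j k = \<i> * of_int k * y j k t" for j k unfolding \<tau>x_def by (rule fc_vser[OF s1 r1])
  have f2: "cf \<tau>xx j k = - ((of_int k)\<^sup>2 *\<^sub>R y j k t)" for j k unfolding \<tau>xx_def by (rule fc_vser[OF s2 r2])
  have m1: "mean_zero \<tau>x" using mean_zero_fc[OF v1(2)] f1 by simp
  have m2: "mean_zero \<tau>xx" using mean_zero_fc[OF v2(2)] f2 by simp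
  have p1: "primitive \<tau>x = \<tau> t"
  proof (rule eq_if_cmp_fc_eq)
    show "continuous_on UNIV (primitive \<tau>x)" by (rule continuous_primitive[OF v1(2) m1])
    show "per2pi (primitive \<tau>x)" by (rule primitive_per2pi[OF v1(2) m1])
    show "continuous_on UNIV (\<tau> t)" "per2pi (\<tau> t)" using H_spaceD(1,3)[OF state_H[OF tT]] by auto
    show "cf (primitive \<tau>x) j k = cf (\<tau> t) j k" for j k
      using y_0[OF tT, of j] unfolding primitive_fc[OF v1(2) m1] f1 by (cases "k = 0") (auto simp: y_def)
  qed
  have p2: "primitive \<tau>xx = \<tau>x"
  proof (rule eq_if_cmp_fc_eq)
    show "continuous_on UNIV (primitive \<tau>xx)" by (rule continuous_primitive[OF v2(2) m2])
    show "per2pi (primitive \<tau>xx)" by (rule primitive_per2pi[OF v2(2) m2])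
    show "continuous_on UNIV \<tau>x" "per2pi \<tau>x" using v1 by auto
    show "cf (primitive \<tau>xx) j k = cf \<tau>x j k" for j k
    proof (cases "k = 0")
      case False
      have "- ((of_int k)\<^sup>2 *\<^sub>R y j k t) = (\<i> * of_int k * y j k t) * (\<i> * of_int k)"
        by (simp add: scaleR_conv_of_real power2_eq_square algebra_simps)
      then show ?thesis unfolding primitive_fc[OF v2(2) m2] f1 f2 using False by simp
    qed (simp add: primitive_fc[OF v2(2) m2] f1)
  qed
  have d1: "(\<tau> t has_vector_derivative \<tau>x x) (at x)" for x
    using primitive_has_derivative[OF v1(2,1), of x] by (simp add: p1)
  have d2: "(\<tau>x has_vector_derivative \<tau>xx x) (at x)" for x
    using primitive_has_derivative[OF v2(2,1), of x] by (simp add: p2)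
  have fx: "cf \<tau>x j k = cf (weak_deriv (\<tau> t)) j k" for j k
    unfolding f1 weak_deriv(2)[OF gd(2)] by (simp add: y_def)
  let ?N = "nonlinearity K (\<tau> t) \<tau>x"
  have fN: "cf ?N j k = n j k t" for j k
    unfolding n_def N_def by (rule AE_eq_nonlinearity(2)[OF gst v1(2) weak_deriv(1)[OF gd(2)] fx])
  have cF: "continuous_on UNIV (cmp (F (\<tau> t)) j)" "per2pi (cmp (F (\<tau> t)) j)" for j
    by (intro continuous_cmp per2pi_cmp bp)+
  have cT: "continuous_on UNIV (cmp (\<tau> t) j)" "per2pi (cmp (\<tau> t) j)" for j
    using H_spaceD(5,6)[OF gd(2)] by auto
  have cx: "continuous_on UNIV (cmp \<tau>x j)" "per2pi (cmp \<tau>x j)" for j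
    by (intro continuous_cmp per2pi_cmp v1)+
  have eN: "cmp ?N j = (\<lambda>x. cmp (F (\<tau> t)) j x + of_real (lambda_mult K (\<tau> t) \<tau>x $ j)
    - cmp (\<tau> t) j x * qc K (\<tau> t) \<tau>x x - (\<Sum>i\<in>UNIV. of_real (lambda_mult K (\<tau> t) \<tau>x $ i) * (cmp (\<tau> t) i x * cmp (\<tau> t) j x)))" for j
    by (rule ext) (rule nonlinearity_cmp[OF gd(4)])
  have NC: "continuous_on UNIV (cmp ?N j)" for j
    unfolding eN qc_def by (intro continuous_intros cF cT cx)
  have NP: "per2pi (cmp ?N j)" for j
    using cF(2) cT(2) cx(2) unfolding eN qc_def per2pi_def by simp
  have Nser: "cmp ?N j x = fser (\<lambda>k. n j k t) x" for j x
  proof -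
    have e: "cf ?N j = (\<lambda>k. n j k t)" by (rule ext) (rule fN)
    show ?thesis using eq_fser[OF NC NP, of j x] y'_summable(2)[OF t, of j] unfolding e by simp
  qed
  have eq: "\<tau>xx x + ?N x = \<tau>' t x" for x
  proof -
    have "cmp \<tau>xx j x + cmp ?N j x = cmp (\<tau>' t) j x" for j
    proof -
      have "cmp \<tau>xx j x + cmp ?N j x = (\<Sum>\<^sub>\<infinity>k. - ((of_int k)\<^sup>2 *\<^sub>R y j k t) * cis (of_int k * x)) + (\<Sum>\<^sub>\<infinity>k. n j k t * cis (of_int k * x))"
        unfolding Nser unfolding \<tau>xx_def cmp_vser[OF s2 r2] fser_def ..
      also have "\<dots> = (\<Sum>\<^sub>\<infinity>k. - ((of_int k)\<^sup>2 *\<^sub>R y j k t) * cis (of_int k * x) + n j k t * cis (of_int k * x))"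
        by (rule infsum_add[symmetric, OF abs_summable_summable[OF abs_summable_fser[OF s2]] abs_summable_summable[OF abs_summable_fser[OF y'_summable(2)[OF t]]]])
      also have "\<dots> = cmp (\<tau>' t) j x"
        unfolding \<tau>'_def cmp_vser[OF y'_summable(1)[OF t] y'_uminus] fser_def
        unfolding y'_def by (simp only: distrib_right)
      finally show ?thesis .
    qed
    then have "complex_of_real ((\<tau>xx x + ?N x) $ j) = complex_of_real (\<tau>' t x $ j)" for j
      by (simp add: cmp_def)
    then have "(\<tau>xx x + ?N x) $ j = \<tau>' t x $ j" for j by (simp only: of_real_eq_iff)
    then show ?thesis unfolding vec_eq_iff by blast
  qed
  show ?thesis
    unfolding classical_at_def
    by (rule exI[of _ \<tau>x], rule exI[of _ \<tau>xx]) (simp only: eq v2(1) d1 d2 time_derivative[OF t] simp_thms)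
qed

end

section \<open>From the hypotheses to uniform constants\<close>

text \<open>A vanishing chord between distinct points would make the quotient, hence the distortion, infinite.\<close>

lemma admissibleI:
  assumes "\<tau> \<in> H_space 1" "mean_zero \<tau>" "unit_speed \<tau>" and d: "distortion (curve \<tau>) \<le> ereal \<delta>" and \<delta>: "\<delta> \<ge> 0"
  shows "admissible \<delta> \<tau>"
proof -
  have "vartheta (x - y) \<le> \<delta> * norm (curve \<tau> x - curve \<tau> y)" for x y
  proof (cases "vartheta (x - y) > 0")
    case True
    have "ereal (vartheta (x - y)) / ereal (norm (curve \<tau> x - curve \<tau> y)) \<le> distortion (curve \<tau>)"
      unfolding distortion_def using True by (intro SUP_upper2[of "(x, y)"]) auto
    then have le: "ereal (vartheta (x - y)) / ereal (norm (curve \<tau> x - curve \<tau> y)) \<le> ereal \<delta>" using d by (rule order_trans)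
    have pos: "norm (curve \<tau> x - curve \<tau> y) > 0"
    proof (rule ccontr)
      assume "\<not> ?thesis"
      then have "norm (curve \<tau> x - curve \<tau> y) = 0" by simp
      with le True show False by (simp add: divide_ereal_def)
    qed
    with le show ?thesis by (simp add: pos_divide_le_eq)
  next
    case False
    then have "vartheta (x - y) \<le> 0" by simp
    also have "0 \<le> \<delta> * norm (curve \<tau> x - curve \<tau> y)" using \<delta> by simp
    finally show ?thesis .
  qed
  then show ?thesis using assms by (simp add: admissible_def)
qed

theorem theorem4p10:
  fixes K :: "real \<Rightarrow> real \<Rightarrow> real" and h :: "real \<Rightarrow> real" and p :: real
  assumes "homogeneous K h p"
    and "zero_degenerate h p \<or> (\<exists>m. m_degenerate m h p)"
  shows "\<exists>C :: real \<Rightarrow> real \<Rightarrow> real \<Rightarrow> real \<Rightarrow> real.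
    \<forall>(T::real) (\<tau>\<^sub>0 :: real \<Rightarrow> real^3) (\<tau> :: real \<Rightarrow> real \<Rightarrow> real^3).
      T > 0 \<longrightarrow>
      mild_solution K T \<tau>\<^sub>0 \<tau> \<longrightarrow>
      (\<forall>t\<in>{0..T}. mean_zero (\<tau> t) \<and> unit_speed (\<tau> t)) \<longrightarrow>
      (\<forall>t\<in>{0..T}. bilipschitz_embedding (curve (\<tau> t))) \<longrightarrow>
      A_star T \<tau> < \<infinity> \<longrightarrow> delta_star T \<tau> < \<infinity> \<longrightarrow> H_star T \<tau> < \<infinity> \<longrightarrow>
        C1_into_H 1 {0<..T} \<tau> \<and> C_into_H 3 {0<..T} \<tau> \<and>
        (\<forall>t\<in>{0<..T}. classical_at K T \<tau> t) \<and>
        (\<forall>\<epsilon>>0. \<forall>t\<in>{\<epsilon>..T}.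
           H_norm 3 (\<tau> t)
             \<le> C \<epsilon> (real_of_ereal (A_star T \<tau>)) (real_of_ereal (delta_star T \<tau>)) (real_of_ereal (H_star T \<tau>)) \<and>
           (\<forall>k::int. real_of_int \<bar>k\<bar> ^ 4 * norm (fourier (\<tau> t) k)
             \<le> C \<epsilon> (real_of_ereal (A_star T \<tau>)) (real_of_ereal (delta_star T \<tau>)) (real_of_ereal (H_star T \<tau>))))"
proof -
  obtain m where gk: "good_kernel m (g_of h) p" using good_kernel_exists[OF assms] by blast
  interpret kernel K h p m by unfold_locales (use assms(1) gk in auto)
  have "\<exists>B. \<epsilon> > 0 \<longrightarrow> (\<forall>T \<tau>\<^sub>0 \<tau>. solution K h p m A \<delta> H T \<tau>\<^sub>0 \<tau> \<longrightarrow> (\<forall>t\<in>{\<epsilon>..T}. \<forall>j k.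
     norm (cf (\<tau> t) j k) \<le> B * wt k powr (- 4)))" for \<epsilon> A \<delta> H
    using bootstrap[of \<epsilon> A \<delta> H] by blast
  then obtain B where B: "\<And>\<epsilon> A \<delta> H T \<tau>\<^sub>0 \<tau> t j k. \<epsilon> > 0 \<Longrightarrow> solution K h p m A \<delta> H T \<tau>\<^sub>0 \<tau> \<Longrightarrow> t \<in> {\<epsilon>..T} \<Longrightarrow>
     norm (cf (\<tau> t) j k) \<le> B \<epsilon> A \<delta> H * wt k powr (- 4)"
    by metis
  define C where "C \<epsilon> A \<delta> H = 3 * B \<epsilon> A \<delta> H * sqrt (W 2) + 3 * B \<epsilon> A \<delta> H" for \<epsilon> A \<delta> H
  show ?thesis
  proof (intro exI[of _ C] allI impI)
    fix T :: real and \<tau>\<^sub>0 \<tau>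
    assume T: "T > 0" and mild: "mild_solution K T \<tau>\<^sub>0 \<tau>"
      and mu: "\<forall>t\<in>{0..T}. mean_zero (\<tau> t) \<and> unit_speed (\<tau> t)"
      and "\<forall>t\<in>{0..T}. bilipschitz_embedding (curve (\<tau> t))"
      and Af: "A_star T \<tau> < \<infinity>" and df: "delta_star T \<tau> < \<infinity>" and Hf: "H_star T \<tau> < \<infinity>"
    let ?A = "real_of_ereal (A_star T \<tau>)" and ?d = "real_of_ereal (delta_star T \<tau>)" and ?H = "real_of_ereal (H_star T \<tau>)"
    have le: "f t \<le> ereal (real_of_ereal (SUP t\<in>{0..T}. f t))" if t: "t \<in> {0..T}" and fin: "(SUP t\<in>{0..T}. f t) < \<infinity>" and nn: "\<And>t. f t \<ge> 0" for f :: "real \<Rightarrow> ereal" and t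
    proof -
      have a: "f t \<le> (SUP t\<in>{0..T}. f t)" using t by (intro SUP_upper)
      then have "0 \<le> (SUP t\<in>{0..T}. f t)" using nn[of t] by (rule order_trans[rotated])
      then have "ereal (real_of_ereal (SUP t\<in>{0..T}. f t)) = (SUP t\<in>{0..T}. f t)"
        using fin by (intro ereal_real') auto
      then show ?thesis using a by simp
    qed
    have nnA: "inv_opnorm M \<ge> 0" for M
      unfolding inv_opnorm_def using onorm_pos_le[OF matrix_vector_mul_bounded_linear, of "matrix_inv M"] by auto
    have nnd: "distortion \<gamma> \<ge> 0" for \<gamma>
    proof -
      have "vartheta (1 - 0) = 1" using pi_gt3 by (subst vartheta_small) auto
      then have "ereal (vartheta (1 - 0)) / ereal (norm (\<gamma> 1 - \<gamma> 0)) \<le> distortion \<gamma>"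
        unfolding distortion_def by (intro SUP_upper2[of "(1, 0)"]) auto
      moreover have "0 \<le> ereal (vartheta (1 - 0)) / ereal (norm (\<gamma> 1 - \<gamma> 0))"
        using \<open>vartheta (1 - 0) = 1\<close> by (intro zero_le_divide_ereal) auto
      ultimately show ?thesis by (rule order_trans[rotated])
    qed
    have gs: "good_state ?A ?d ?H (\<tau> t)" if t: "t \<in> {0..T}" for t
    proof -
      have H1: "\<tau> t \<in> H_space 1" using mild t by (auto simp: mild_solution_def C_into_H_def)
      have d: "distortion (curve (\<tau> t)) \<le> ereal ?d"
        unfolding delta_star_def by (rule le[OF t df[unfolded delta_star_def] nnd])
      have "0 \<le> ereal ?d" using nnd d by (rule order_trans)
      then have adm: "admissible ?d (\<tau> t)" using H1 mu t d by (intro admissibleI) auto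
      have A: "inv_opnorm (A_mat (\<tau> t)) \<le> ereal ?A"
        unfolding A_star_def by (rule le[OF t Af[unfolded A_star_def] nnA])
      then have inv: "invertible (A_mat (\<tau> t))" by (auto simp: inv_opnorm_def split: if_splits)
      then have on: "onorm ((*v) (matrix_inv (A_mat (\<tau> t)))) \<le> ?A" using A by (simp add: inv_opnorm_def)
      have "ereal (H_norm 1 (\<tau> t)) \<le> ereal ?H"
        unfolding H_star_def by (rule le[OF t Hf[unfolded H_star_def]]) (simp add: H_norm_def)
      then show ?thesis using adm inv on by (simp add: good_state_def)
    qed
    have sol: "solution K h p m ?A ?d ?H T \<tau>\<^sub>0 \<tau>"
      by unfold_locales (use T mild gs in auto)
    then interpret solution K h p m ?A ?d ?H T \<tau>\<^sub>0 \<tau> .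
    show "C1_into_H 1 {0<..T} \<tau> \<and> C_into_H 3 {0<..T} \<tau> \<and>
        (\<forall>t\<in>{0<..T}. classical_at K T \<tau> t) \<and>
        (\<forall>\<epsilon>>0. \<forall>t\<in>{\<epsilon>..T}. H_norm 3 (\<tau> t) \<le> C \<epsilon> ?A ?d ?H \<and>
           (\<forall>k::int. real_of_int \<bar>k\<bar> ^ 4 * norm (fourier (\<tau> t) k) \<le> C \<epsilon> ?A ?d ?H))"
    proof (intro conjI C1_into_H1 C_into_H3 ballI classical allI impI)
      fix \<epsilon> t :: real assume \<epsilon>: "\<epsilon> > 0" and t: "t \<in> {\<epsilon>..T}"
      let ?B = "B \<epsilon> ?A ?d ?H"
      note b = B[OF \<epsilon> sol t]
      have B0: "?B \<ge> 0" using order_trans[OF norm_ge_zero b[of 1 0]] by (simp add: wt_def)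
      have t0: "t \<in> {0..T}" using t \<epsilon> by auto
      have z: "fourier (\<tau> t) 0 = 0" using y_0[OF t0] by (simp add: vec_eq_iff fourier_nth y_def)
      have "H_norm 3 (\<tau> t) \<le> 3 * ?B * sqrt (W (2 * 4 - 2 * 3))" by (rule H_norm_le[OF b _ _ z B0]) auto
      then show "H_norm 3 (\<tau> t) \<le> C \<epsilon> ?A ?d ?H" using B0 by (simp add: C_def)
      fix k :: int
      have "norm (fourier (\<tau> t) k) \<le> 3 * (?B * wt k powr (- 4))" by (rule norm_fourier_le[OF b])
      moreover have "real_of_int \<bar>k\<bar> ^ 4 \<le> wt k ^ 4" using abs_le_wt[of k] by (intro power_mono) auto
      ultimately have "real_of_int \<bar>k\<bar> ^ 4 * norm (fourier (\<tau> t) k) \<le> wt k ^ 4 * (3 * (?B * wt k powr (- 4)))"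
        by (intro mult_mono) auto
      also have "\<dots> = 3 * ?B * (wt k powr 4 * wt k powr (- 4))" using wt_pos[of k] by (simp add: powr_numeral)
      also have "wt k powr 4 * wt k powr (- 4) = 1" using wt_pos[of k] by (simp only: powr_add[symmetric]) simp
      also have "3 * ?B * 1 \<le> C \<epsilon> ?A ?d ?H" using B0 W_nonneg[of 2] by (simp add: C_def)
      finally show "real_of_int \<bar>k\<bar> ^ 4 * norm (fourier (\<tau> t) k) \<le> C \<epsilon> ?A ?d ?H" .
    qed
  qed
qed

end
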